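(* Let $q\ge1$ be an integer, let $\tilde g_{j;q}$, $j=1,2,\ldots$, be the normalized smoothed Hermite transforms of the needlet fields $\tilde\beta_j$ of the Gaussian isotropic field $T$ on $S^2$ under the regularity condition on $(C_\ell)$ and the variance condition on $g_{j;q}$, and let $f_{j;q}$ be the isotropic zero-mean Gaussian field on $S^2$ with the same covariance function as $\tilde g_{j;q}$ (all described in the context). Then, as $j\to\infty$, the laws of $\tilde g_{j;q}$ and $f_{j;q}$ are asymptotically proximal; that is, for every continuous and bounded $h:\mathcal C(S^2,\mathbb R)\to\mathbb R$, $$\bigl|\mathbb E\,h(\tilde g_{j;q})-\mathbb E\,h(f_{j;q})\bigr|\to0.$$
   Context: $\mathcal C(S^2,\mathbb R)$ is the space of continuous real functions on $S^2$ with the sup norm. $S^2$ is the unit sphere in $\mathbb R^3$ with surface measure $dx$ (total mass $4\pi$); $P_\ell$ is the Legendre polynomial with $P_\ell(1)=1$; $H_q$ is the (probabilists') Hermite polynomial of degree $q$. $T$ is a real zero-mean Gaussian isotropic (law invariant under rotations) random field on $S^2$ with angular power spectrum $(C_\ell)$: $T=\sum_\ell T_\ell$, $T_\ell=\sum_{m=-\ell}^{\ell}a_{\ell m}Y_{\ell m}$, where $Y_{\ell m}$ are the orthonormal spherical harmonics and $\mathbb E\,a_{\ell m}\overline{a}_{\ell' m'}=C_\ell\delta_\ell^{\ell'}\delta_m^{m'}$; thus the $T_\ell$ are independent with $\mathbb E\,T_\ell(x)T_\ell(y)=\frac{2\ell+1}{4\pi}C_\ell P_\ell(\langle x,y\rangle)$.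 Needlet fields: $B>1$ is fixed, $b:\mathbb R\to\mathbb R$ is $C^\infty$ with support in $[B^{-1},B]$ and $\sum_j b^2(\ell/B^j)=1$ for all integers $\ell>B$. Put $\beta_j(x)=\sum_\ell b(\ell/B^j)T_\ell(x)$, $\sigma_{\beta_j}^2=\mathbb E\beta_j^2(x)=\sum_\ell b^2(\ell/B^j)\frac{2\ell+1}{4\pi}C_\ell$ (assumed positive), $\tilde\beta_j=\beta_j/\sigma_{\beta_j}$. Kernel: $K(u)=\sum_{\ell=1}^{L_K}\frac{2\ell+1}{4\pi}\kappa(\ell)P_\ell(u)$, $u\in[-1,1]$, with fixed $L_K\in\mathbb N$ and real coefficients $\kappa(\ell)$. Define $g_{j;q}(x)=\int_{S^2}K(\langle x,y\rangle)H_q(\tilde\beta_j(y))\,dy$ and $\tilde g_{j;q}(x)=g_{j;q}(x)/\sqrt{\mathbb E g_{j;q}^2(x)}$. $f_{j;q}$ is taken with continuous sample paths. Standing conditions. (i) $C_\ell=G(\ell)\ell^{-\alpha}$ for $\ell=1,2,\ldots$, where $\alpha>2$ and $G:\mathbb R^+\to\mathbb R^+$ is smooth with $0<c_0\le G(u)\le d_0$ for all $u>0$, and for every $r\in\mathbb N$ there is $c_r$ with $|G^{(r)}(u)|\le c_r u^{-r}$ for all $u>0$. (ii) $\mathrm{Var}(g_{j;q}(x))=\sigma_j^2B^{-2j}$ for all $j=1,2,\ldots$, with $c_1\le\sigma_j^2\le c_2$ for some positive constants $c_1,c_2$ independent of $j$ (the variance does not depend on $x$ by isotropy). *)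

theory Defs
  imports "HOL-Probability.Probability" "HOL-Computational_Algebra.Polynomial"
begin

abbreviation S2 :: "(real^3) set" where
  "S2 \<equiv> sphere 0 1"

text \<open>
  The surface measure of a Borel set of the sphere is three times the volume of the solid cone
  over it, by integration in polar coordinates; the total mass is \<open>3 * (4 / 3) * pi = 4 * pi\<close>.
\<close>

definition surface_measure :: "(real^3) measure" where
  "surface_measure =
     scale_measure 3 (distr (restrict_space lborel (ball 0 1 - {0})) (restrict_space borel S2)
       (\<lambda>x. x /\<^sub>R norm x))"

text \<open>The space \<open>C(S2)\<close> with the sup metric; its elements are \<open>undefined\<close> off the sphere.\<close>

definition C_S2 :: "((real^3) \<Rightarrow> real) metric" where
  "C_S2 = cfunspace (top_of_set S2) euclidean_metric"

text \<open>Rodrigues' formula.\<close>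

definition legendre :: "nat \<Rightarrow> real poly" where
  "legendre l = smult (1 / (2 ^ l * fact l)) ((pderiv ^^ l) ([:-1, 0, 1:] ^ l))"

fun hermite :: "nat \<Rightarrow> real poly" where
  "hermite 0 = 1"
| "hermite (Suc 0) = [:0, 1:]"
| "hermite (Suc (Suc n)) = [:0, 1:] * hermite (Suc n) - smult (real (Suc n)) (hermite n)"

text \<open>
  For \<open>x = (sin t * cos p, sin t * sin p, cos t)\<close> the associated Legendre function (with the
  Condon-Shortley phase) is \<open>(-1) ^ m * sin t ^ m * P\<^sub>l\<^sup>(\<^sup>m\<^sup>)(cos t)\<close>; together with the factor
  \<open>exp (i * m * p)\<close> this gives the Cartesian form below. The second argument of
  \<open>sph_harm\<close> is only meaningful in the range \<open>-l, ..., l\<close>.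
\<close>

definition sph_harm_nonneg :: "nat \<Rightarrow> nat \<Rightarrow> real^3 \<Rightarrow> complex" where
  "sph_harm_nonneg l m x =
     of_real ((-1) ^ m * sqrt ((2 * real l + 1) / (4 * pi) * (fact (l - m) / fact (l + m)))
       * poly ((pderiv ^^ m) (legendre l)) (x $ 3))
     * Complex (x $ 1) (x $ 2) ^ m"

definition sph_harm :: "nat \<Rightarrow> int \<Rightarrow> real^3 \<Rightarrow> complex" where
  "sph_harm l m x =
     (if 0 \<le> m then sph_harm_nonneg l (nat m) x
      else (-1) ^ nat (- m) * cnj (sph_harm_nonneg l (nat (- m)) x))"

type_synonym 'w field = "real^3 \<Rightarrow> 'w \<Rightarrow> real"

text \<open>Degenerate (constant) Gaussian variables are included.\<close>

definition gaussian_rv :: "'w measure \<Rightarrow> ('w \<Rightarrow> real) \<Rightarrow> bool" where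
  "gaussian_rv M X \<longleftrightarrow> X \<in> borel_measurable M \<and>
     (\<exists>\<mu>. (AE \<omega> in M. X \<omega> = \<mu>) \<or> (\<exists>\<sigma>>0. distributed M lborel X (normal_density \<mu> \<sigma>)))"

definition gaussian_field :: "'w measure \<Rightarrow> 'w field \<Rightarrow> bool" where
  "gaussian_field M X \<longleftrightarrow>
     (\<forall>F c. finite F \<and> F \<subseteq> S2 \<longrightarrow> gaussian_rv M (\<lambda>\<omega>. \<Sum>x\<in>F. c x * X x \<omega>))"

definition zero_mean_field :: "'w measure \<Rightarrow> 'w field \<Rightarrow> bool" where
  "zero_mean_field M X \<longleftrightarrow>
     (\<forall>x\<in>S2. integrable M (X x) \<and> prob_space.expectation M (X x) = 0)"

definition field_law :: "'w measure \<Rightarrow> 'w field \<Rightarrow> ((real^3) \<Rightarrow> real) measure" where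
  "field_law M X = distr M (PiM S2 (\<lambda>_. borel)) (\<lambda>\<omega>. \<lambda>x\<in>S2. X x \<omega>)"

definition isotropic_field :: "'w measure \<Rightarrow> 'w field \<Rightarrow> bool" where
  "isotropic_field M X \<longleftrightarrow>
     (\<forall>x\<in>S2. X x \<in> borel_measurable M) \<and>
     (\<forall>R. rotation_matrix R \<longrightarrow> field_law M (\<lambda>x. X (R *v x)) = field_law M X)"

definition covariance :: "'w measure \<Rightarrow> ('w \<Rightarrow> real) \<Rightarrow> ('w \<Rightarrow> real) \<Rightarrow> real" where
  "covariance M X Y = prob_space.expectation M
     (\<lambda>\<omega>. (X \<omega> - prob_space.expectation M X) * (Y \<omega> - prob_space.expectation M Y))"

definition normalized_field :: "'w measure \<Rightarrow> 'w field \<Rightarrow> 'w field" where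
  "normalized_field M X x \<omega> = X x \<omega> / sqrt (prob_space.expectation M (\<lambda>\<omega>. (X x \<omega>)\<^sup>2))"

definition harmonic_component ::
    "(nat \<Rightarrow> int \<Rightarrow> 'w \<Rightarrow> complex) \<Rightarrow> nat \<Rightarrow> real^3 \<Rightarrow> 'w \<Rightarrow> complex" where
  "harmonic_component a l x \<omega> = (\<Sum>m\<in>{- int l..int l}. a l m \<omega> * sph_harm l m x)"

text \<open>The expansion of \<open>T\<close> into its harmonic components converges in mean square at each point.\<close>

definition spectral_representation ::
    "'w measure \<Rightarrow> 'w field \<Rightarrow> (nat \<Rightarrow> int \<Rightarrow> 'w \<Rightarrow> complex) \<Rightarrow> (nat \<Rightarrow> real) \<Rightarrow> bool" where
  "spectral_representation M T a C \<longleftrightarrow>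
     (\<forall>l. \<forall>m\<in>{- int l..int l}.
        a l m \<in> borel_measurable M \<and> integrable M (\<lambda>\<omega>. (cmod (a l m \<omega>))\<^sup>2)) \<and>
     (\<forall>l l'. \<forall>m\<in>{- int l..int l}. \<forall>m'\<in>{- int l'..int l'}.
        integral\<^sup>L M (\<lambda>\<omega>. a l m \<omega> * cnj (a l' m' \<omega>))
          = (if l = l' \<and> m = m' then of_real (C l) else 0)) \<and>
     (\<forall>x\<in>S2.
        (\<lambda>n. \<integral>\<^sup>+\<omega>. ennreal ((cmod (of_real (T x \<omega>) - (\<Sum>l<n. harmonic_component a l x \<omega>)))\<^sup>2) \<partial>M)
          \<longlonglongrightarrow> 0)"

text \<open>
  As \<open>T\<close> is real, its harmonic components are almost surely real; the real part below
  only turns them into real-valued functions. The series has finitely many nonzero terms.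
\<close>

definition needlet_field ::
    "(real \<Rightarrow> real) \<Rightarrow> real \<Rightarrow> (nat \<Rightarrow> int \<Rightarrow> 'w \<Rightarrow> complex) \<Rightarrow> nat \<Rightarrow> 'w field" where
  "needlet_field b B a j x \<omega> = (\<Sum>l. b (real l / B ^ j) * Re (harmonic_component a l x \<omega>))"

definition smooth_on :: "real set \<Rightarrow> (real \<Rightarrow> real) \<Rightarrow> bool" where
  "smooth_on S f \<longleftrightarrow> (\<forall>n. \<forall>x\<in>S. (deriv ^^ n) f field_differentiable at x)"

definition needlet_window :: "real \<Rightarrow> (real \<Rightarrow> real) \<Rightarrow> bool" where
  "needlet_window B b \<longleftrightarrow>
     smooth_on UNIV b \<and>
     closure {x. b x \<noteq> 0} \<subseteq> {inverse B..B} \<and>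
     (\<forall>l::nat. real l > B \<longrightarrow> (\<lambda>j. (b (real l / B ^ j))\<^sup>2) sums 1)"

definition regular_spectrum :: "(nat \<Rightarrow> real) \<Rightarrow> bool" where
  "regular_spectrum C \<longleftrightarrow>
     (\<exists>\<alpha> G. \<alpha> > 2 \<and>
        (\<forall>l\<ge>1. C l = G (real l) * real l powr (- \<alpha>)) \<and>
        smooth_on {0<..} G \<and>
        (\<exists>c\<^sub>0 d\<^sub>0. 0 < c\<^sub>0 \<and> (\<forall>u>0. c\<^sub>0 \<le> G u \<and> G u \<le> d\<^sub>0)) \<and>
        (\<forall>r. \<exists>c. \<forall>u>0. \<bar>(deriv ^^ r) G u\<bar> \<le> c * u powr (- real r)))"

definition smoothing_kernel :: "nat \<Rightarrow> (nat \<Rightarrow> real) \<Rightarrow> real \<Rightarrow> real" where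
  "smoothing_kernel L \<kappa> u =
     (\<Sum>l=1..L. (2 * real l + 1) / (4 * pi) * \<kappa> l * poly (legendre l) u)"

definition smoothed_hermite :: "nat \<Rightarrow> (nat \<Rightarrow> real) \<Rightarrow> nat \<Rightarrow> 'w field \<Rightarrow> 'w field" where
  "smoothed_hermite L \<kappa> q X x \<omega> =
     (LINT y|surface_measure. smoothing_kernel L \<kappa> (x \<bullet> y) * poly (hermite q) (X y \<omega>))"

end

theory Submission
  imports Defs "HOL-Analysis.Function_Metric"
begin

text \<open>
  The smoothing kernel is a polynomial in \<open>x \<bullet> y\<close>, so all the fields \<open>gt j\<close> live in one fixed
  finite-dimensional space of continuous functions, and the fields \<open>f j\<close> do so almost surely because
  linear relations between values pass through equality of covariances. Hence proximity reduces to
  that of the values at finitely many interpolation nodes and, as these are bounded in mean square,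
  to the convergence to zero of differences of characteristic functions.

  A linear combination of values of \<open>gt j\<close> has the form \<open>F = \<integral> \<psi> H\<^sub>q(\<beta>)\<close>. Gaussian integration by parts,
  applied \<open>q\<close> times to \<open>E (F sin (t F))\<close>, shows that \<open>t \<mapsto> E cos (t F)\<close> approximately solves the
  differential equation of the Gaussian characteristic function. The error is controlled by
  \<open>sup \<bar>\<psi>\<bar>\<close> and the norm of the covariance operator of \<open>\<beta>\<close> alone; no pointwise decay of the covariance
  of \<open>\<beta>\<close> is needed. Since the spherical harmonics diagonalize this operator, its norm is
  \<open>max b\<^sup>2 C\<^sub>l / \<sigma>\<^sup>2 = O(B\<^sup>-\<^sup>2\<^sup>j)\<close>, while the variance condition gives \<open>\<psi> = O(B\<^sup>j)\<close>. The total
  error is \<open>O((B\<^sup>j)\<^sup>3 (B\<^sup>-\<^sup>2\<^sup>j)\<^sup>7\<^sup>/\<^sup>4)\<close>, which is \<open>B\<^sup>-\<^sup>j\<^sup>/\<^sup>2\<close> up to a constant.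
\<close>

section \<open>Proximity of finite-dimensional laws\<close>

text \<open>The exponent \<open>7 / 4\<close> is forced by the three kernels in the error term,
  which cost \<open>(B^j)^3\<close>: an error of order norm to the power \<open>3 / 2\<close> would
  only stay bounded. An integration by parts that hits the trigonometric factor produces
  \<open>H W_k W_1\<close> with a Hermite factor \<open>H\<close>. In mean square \<open>W_k\<close>
  and \<open>W_1\<close> are each of the order of the norm, but \<open>H\<close> depends on the same
  point and spoils the operator bound for \<open>H W_1\<close>; a pointwise Cauchy-Schwarz bound
  gives only the square root of the norm, hence \<open>3 / 2\<close> in all. Splitting
  \<open>(H W_1)^2\<close> into \<open>W_1\<close> and \<open>H^2 W_1\<close> uses the operator
  bound once more and gains the missing \<open>1 / 4\<close>. Two obstacles shape the rest. The
  field \<open>T\<close> is not assumed to be jointly measurable, so its coefficients are reached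
  through finite cubature sums of its values and not by integrating it. And the laws of
  \<open>gt j\<close> need not converge, so all statements are about differences of
  expectations.\<close>

inductive_set trig :: "'i set \<Rightarrow> (('i \<Rightarrow> real) \<Rightarrow> real) set" for I where
  cosine: "(\<lambda>x. c * cos ((\<Sum>i\<in>I. l i * x i) + t)) \<in> trig I"
| add: "p \<in> trig I \<Longrightarrow> r \<in> trig I \<Longrightarrow> (\<lambda>x. p x + r x) \<in> trig I"

lemma trig_const: "(\<lambda>x. c) \<in> trig I"
  using trig.cosine[of c "\<lambda>_. 0" _ 0] by simp

lemma trig_sin_coord:
  assumes "finite I" "i \<in> I"
  shows "(\<lambda>x. sin (a * x i)) \<in> trig I"
proof -
  have "(\<Sum>k\<in>I. (if k = i then a else 0) * x k) = a * x i" for x :: "'a \<Rightarrow> real"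
    using assms by (subst sum.cong[OF refl, where h = "\<lambda>k. if k = i then a * x i else 0"]) auto
  then show ?thesis
    using trig.cosine[of 1 "\<lambda>k. if k = i then a else 0" I "- pi / 2"]
    by (simp add: cos_diff)
qed

text \<open>The phase in \<open>cosine\<close> brings the sines into the family; with the product
  formula for cosines it becomes an algebra with constants, which Stone-Weierstrass needs, while
  expectations of its members are read off characteristic functions.\<close>

lemma trig_mult_cos:
  assumes "p \<in> trig I"
  shows "(\<lambda>x. (c * cos ((\<Sum>i\<in>I. l i * x i) + t)) * p x) \<in> trig I"
  using assms
proof induction
  case (cosine c' l' t')
  let ?A = "\<lambda>x. (\<Sum>i\<in>I. l i * x i) + t" and ?B = "\<lambda>x. (\<Sum>i\<in>I. l' i * x i) + t'"
  have "(\<lambda>x. (c * c' / 2) * cos ((\<Sum>i\<in>I. (l i + l' i) * x i) + (t + t'))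
      + (c * c' / 2) * cos ((\<Sum>i\<in>I. (l i - l' i) * x i) + (t - t'))) \<in> trig I"
    by (intro trig.add trig.cosine)
  moreover have "(\<Sum>i\<in>I. (l i + l' i) * x i) + (t + t') = ?A x + ?B x"
    "(\<Sum>i\<in>I. (l i - l' i) * x i) + (t - t') = ?A x - ?B x" for x
    by (simp_all add: ring_distribs sum.distrib sum_subtractf)
  moreover have "(c * c' / 2) * cos (u + v) + (c * c' / 2) * cos (u - v) = c * cos u * (c' * cos v)" for u v
    by (simp add: cos_times_cos algebra_simps)
  ultimately show ?case by simp
next
  case (add p r)
  then show ?case by (simp add: ring_distribs trig.add)
qed

lemma trig_mult:
  assumes "p \<in> trig I" "r \<in> trig I"
  shows "(\<lambda>x. p x * r x) \<in> trig I"
  using assms(1)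
proof induction
  case (cosine c l t)
  then show ?case by (rule trig_mult_cos[OF assms(2)])
next
  case (add p p')
  then show ?case by (simp add: ring_distribs trig.add)
qed

text \<open>
  The substitution \<open>s = sin (pi * x / (2 * R))\<close> maps the box of radius \<open>R\<close> bijectively onto the
  cube and everything else into the cube, so that a polynomial in \<open>s\<close> that is close to \<open>h\<close> on the
  box remains bounded off the box.
\<close>
lemma trig_approximation:
  fixes h :: "('i::countable \<Rightarrow> real) \<Rightarrow> real"
  assumes I: "finite I" and h: "continuous_on UNIV h"
    and dep: "\<And>x y. (\<And>i. i \<in> I \<Longrightarrow> x i = y i) \<Longrightarrow> h x = h y"
    and H: "\<And>x. \<bar>h x\<bar> \<le> H" and R: "R > 0" and e: "e > 0"
  obtains p where "p \<in> trig I" "\<And>x. \<bar>p x\<bar> \<le> H + e"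
    "\<And>x. (\<And>i. i \<in> I \<Longrightarrow> \<bar>x i\<bar> \<le> R) \<Longrightarrow> \<bar>h x - p x\<bar> < e"
proof -
  \<comment> \<open>Coordinates outside \<open>I\<close> are pinned to 0, so that the coordinates in
    \<open>I\<close> separate the points of \<open>K\<close>, and \<open>K\<close> is compact as a
    product of compact sets.\<close>
  define K where "K = (\<Pi>\<^sub>E i\<in>(UNIV::'i set). if i \<in> I then {-1..1::real} else {0})"
  define a where "a = pi / (2 * R)"
  define s where "s x i = (if i \<in> I then sin (a * x i) else 0)" for x :: "'i \<Rightarrow> real" and i
  define k where "k u = h (\<lambda>i. arcsin (u i) / a)" for u
  have a: "a > 0" using R by (simp add: a_def)
  have sK: "s x \<in> K" for x by (auto simp: s_def K_def)
  have comp: "compact K"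
  proof -
    have "compactin (product_topology (\<lambda>i. euclidean) UNIV) K"
      unfolding K_def by (subst compactin_PiE) auto
    then show ?thesis by (simp add: euclidean_product_topology)
  qed
  have coord: "continuous_on K (\<lambda>u. u i)" for i
    by (rule continuous_on_subset[OF continuous_on_product_coordinates]) auto
  have kc: "continuous_on K k"
    unfolding k_def
  proof (rule continuous_on_compose2[OF h], rule continuous_on_coordinatewise_then_product)
    have "\<forall>x\<in>K. - 1 \<le> x i \<and> x i \<le> 1" for i
    proof
      fix x assume "x \<in> K"
      then have "x i \<in> (if i \<in> I then {-1..1} else {0})"
        unfolding K_def by (rule PiE_mem) simp
      then show "- 1 \<le> x i \<and> x i \<le> 1" by (auto split: if_splits)
    qed
    then show "continuous_on K (\<lambda>u. arcsin (u i) / a)" for i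
      using a by (intro continuous_intros coord) auto
  qed auto
  \<comment> \<open>The algebra for Stone-Weierstrass: functions on the cube whose pullback along
    \<open>s\<close> is trigonometric.\<close>
  define P where "P u \<longleftrightarrow> continuous_on K u \<and> (\<lambda>x. u (s x)) \<in> trig I" for u
  have "\<exists>g. P g \<and> (\<forall>u\<in>K. \<bar>k u - g u\<bar> < e)"
  proof (rule Stone_Weierstrass_HOL[OF comp])
    fix x y assume xy: "x \<in> K \<and> y \<in> K \<and> x \<noteq> y"
    then obtain i where i: "x i \<noteq> y i" by auto
    with xy have "i \<in> I" by (auto simp: K_def PiE_def Pi_def split: if_splits) (metis singletonD)
    then show "\<exists>f. P f \<and> f x \<noteq> f y"
      using i trig_sin_coord[OF I] by (intro exI[of _ "\<lambda>u. u i"]) (auto simp: P_def s_def coord)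
  qed (use kc e in \<open>auto simp: P_def trig_const intro!: continuous_intros trig.add trig_mult\<close>)
  then obtain g where g: "P g" "\<And>u. u \<in> K \<Longrightarrow> \<bar>k u - g u\<bar> < e" by auto
  show thesis
  proof
    show "(\<lambda>x. g (s x)) \<in> trig I" using g by (simp add: P_def)
    fix x
    show "\<bar>g (s x)\<bar> \<le> H + e"
      using g(2)[OF sK, of x] H[of "\<lambda>i. arcsin (s x i) / a"] unfolding k_def by linarith
    assume x: "\<And>i. i \<in> I \<Longrightarrow> \<bar>x i\<bar> \<le> R"
    have "arcsin (s x i) / a = x i" if "i \<in> I" for i
    proof -
      have "a * \<bar>x i\<bar> \<le> a * R" using x[OF that] a by (intro mult_left_mono) auto
      then have "\<bar>a * x i\<bar> \<le> pi / 2" using R a by (simp add: a_def abs_mult)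
      then show ?thesis using that a by (simp add: s_def arcsin_sin abs_le_iff)
    qed
    then have "k (s x) = h x" unfolding k_def by (rule dep)
    then show "\<bar>h x - g (s x)\<bar> < e" using g(2)[OF sK, of x] by simp
  qed
qed

lemma continuous_finite_dep_measurable:
  fixes h :: "('i::countable \<Rightarrow> real) \<Rightarrow> real"
  assumes "continuous_on UNIV h" and dep: "\<And>x y. (\<And>i. i \<in> I \<Longrightarrow> x i = y i) \<Longrightarrow> h x = h y"
    and X: "\<And>i. i \<in> I \<Longrightarrow> X i \<in> borel_measurable M"
  shows "(\<lambda>\<omega>. h (\<lambda>i. X i \<omega>)) \<in> borel_measurable M"
proof -
  have "(\<lambda>\<omega> i. if i \<in> I then X i \<omega> else 0) \<in> M \<rightarrow>\<^sub>M borel"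
  proof (rule measurable_coordinatewise_then_product)
    show "(\<lambda>\<omega>. if i \<in> I then X i \<omega> else 0) \<in> borel_measurable M" for i
      using X by (cases "i \<in> I") auto
  qed
  from measurable_compose[OF this borel_measurable_continuous_onI[OF assms(1)]]
  show ?thesis by (rule measurable_cong[THEN iffD1, rotated]) (rule dep, simp)
qed

lemma (in prob_space) trig_integrable:
  assumes "p \<in> trig I" "\<And>i. i \<in> I \<Longrightarrow> X i \<in> borel_measurable M"
  shows "integrable M (\<lambda>\<omega>. p (\<lambda>i. X i \<omega>))"
  using assms(1)
proof induction
  case (cosine c l t)
  have [measurable]: "(\<lambda>\<omega>. cos ((\<Sum>i\<in>I. l i * X i \<omega>) + t)) \<in> borel_measurable M"
    using assms(2) by measurable
  show ?case
    by (rule integrable_const_bound[where B = "\<bar>c\<bar>"]) (auto simp: abs_mult intro!: AE_I2 mult_left_le)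
qed auto

text \<open>Chebyshev's inequality is built into the weight \<open>(X i)\<^sup>2 / R\<^sup>2\<close>.\<close>
lemma (in prob_space) trig_expectation_approximation:
  fixes h :: "('i::countable \<Rightarrow> real) \<Rightarrow> real"
  assumes I: "finite I" and h: "continuous_on UNIV h"
    and dep: "\<And>x y. (\<And>i. i \<in> I \<Longrightarrow> x i = y i) \<Longrightarrow> h x = h y"
    and H: "\<And>x. \<bar>h x\<bar> \<le> H" and R: "R > 0" and e: "e > 0"
    and X: "\<And>i. i \<in> I \<Longrightarrow> X i \<in> borel_measurable M" "\<And>i. i \<in> I \<Longrightarrow> integrable M (\<lambda>\<omega>. (X i \<omega>)\<^sup>2)"
      "\<And>i. i \<in> I \<Longrightarrow> expectation (\<lambda>\<omega>. (X i \<omega>)\<^sup>2) \<le> (c::real)"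
    and p: "p \<in> trig I" "\<And>x. \<bar>p x\<bar> \<le> H + e"
      "\<And>x. (\<And>i. i \<in> I \<Longrightarrow> \<bar>x i\<bar> \<le> R) \<Longrightarrow> \<bar>h x - p x\<bar> < e"
  shows "\<bar>expectation (\<lambda>\<omega>. h (\<lambda>i. X i \<omega>)) - expectation (\<lambda>\<omega>. p (\<lambda>i. X i \<omega>))\<bar>
     \<le> e + (2 * H + e) * (real (card I) * c / R\<^sup>2)"
proof -
  have H0: "H \<ge> 0" using H[of undefined] by linarith
  have [measurable]: "(\<lambda>\<omega>. h (\<lambda>i. X i \<omega>)) \<in> borel_measurable M"
    by (rule continuous_finite_dep_measurable[OF h dep X(1)])
  have hi: "integrable M (\<lambda>\<omega>. h (\<lambda>i. X i \<omega>))"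
    by (rule integrable_const_bound[where B = H]) (use H in auto)
  have pi: "integrable M (\<lambda>\<omega>. p (\<lambda>i. X i \<omega>))" by (rule trig_integrable[OF p(1) X(1)])
  have "\<bar>expectation (\<lambda>\<omega>. h (\<lambda>i. X i \<omega>)) - expectation (\<lambda>\<omega>. p (\<lambda>i. X i \<omega>))\<bar>
     = \<bar>expectation (\<lambda>\<omega>. h (\<lambda>i. X i \<omega>) - p (\<lambda>i. X i \<omega>))\<bar>" using hi pi by simp
  also have "\<dots> \<le> expectation (\<lambda>\<omega>. \<bar>h (\<lambda>i. X i \<omega>) - p (\<lambda>i. X i \<omega>)\<bar>)" by (rule integral_abs_bound)
  also have "\<dots> \<le> expectation (\<lambda>\<omega>. e + (2 * H + e) * (\<Sum>i\<in>I. (X i \<omega>)\<^sup>2) / R\<^sup>2)"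
  proof (rule integral_mono)
    fix \<omega>
    show "\<bar>h (\<lambda>i. X i \<omega>) - p (\<lambda>i. X i \<omega>)\<bar> \<le> e + (2 * H + e) * (\<Sum>i\<in>I. (X i \<omega>)\<^sup>2) / R\<^sup>2"
    proof (cases "\<forall>i\<in>I. \<bar>X i \<omega>\<bar> \<le> R")
      case True
      have "0 \<le> (2 * H + e) * (\<Sum>i\<in>I. (X i \<omega>)\<^sup>2) / R\<^sup>2"
        using H0 e by (intro divide_nonneg_nonneg mult_nonneg_nonneg sum_nonneg) auto
      then show ?thesis using p(3)[of "\<lambda>i. X i \<omega>"] True by force
    next
      case False
      then obtain i where i: "i \<in> I" "R \<le> \<bar>X i \<omega>\<bar>" by force
      then have "R\<^sup>2 \<le> (X i \<omega>)\<^sup>2" using R by (metis abs_le_square_iff abs_of_pos)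
      also have "\<dots> \<le> (\<Sum>i\<in>I. (X i \<omega>)\<^sup>2)" using I i by (intro member_le_sum) auto
      finally have "1 \<le> (\<Sum>i\<in>I. (X i \<omega>)\<^sup>2) / R\<^sup>2" using R by simp
      then have "(2 * H + e) * 1 \<le> (2 * H + e) * ((\<Sum>i\<in>I. (X i \<omega>)\<^sup>2) / R\<^sup>2)"
        using H0 e by (intro mult_left_mono) auto
      then show ?thesis using H[of "\<lambda>i. X i \<omega>"] p(2)[of "\<lambda>i. X i \<omega>"] e by simp
    qed
  qed (use hi pi X(2) in auto)
  also have "\<dots> = e + (2 * H + e) * ((\<Sum>i\<in>I. expectation (\<lambda>\<omega>. (X i \<omega>)\<^sup>2)) / R\<^sup>2)"
    using X(2) by (simp add: prob_space)
  also have "(\<Sum>i\<in>I. expectation (\<lambda>\<omega>. (X i \<omega>)\<^sup>2)) \<le> card I * c"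
    using X(3) by (intro sum_bounded_above)
  finally show ?thesis using H0 e R by (simp add: divide_right_mono mult_left_mono)
qed

text \<open>The bound \<open>c\<close> is uniform in \<open>j\<close>, so one radius
  \<open>R\<close> and one trigonometric approximant, both fixed before \<open>j\<close>, serve both
  sequences. Only the difference of the laws tends to zero; neither sequence need converge.\<close>

proposition asymptotically_proximal_vectors:
  fixes h :: "('i::countable \<Rightarrow> real) \<Rightarrow> real" and X :: "nat \<Rightarrow> 'i \<Rightarrow> 'a \<Rightarrow> real"
    and Y :: "nat \<Rightarrow> 'i \<Rightarrow> 'b \<Rightarrow> real"
  assumes I: "finite I" and h: "continuous_on UNIV h"
    and dep: "\<And>x y. (\<And>i. i \<in> I \<Longrightarrow> x i = y i) \<Longrightarrow> h x = h y"
    and H: "\<And>x. \<bar>h x\<bar> \<le> H"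
    and P: "\<And>j. prob_space (P j)" and Q: "\<And>j. prob_space (Q j)"
    and X: "\<And>j i. i \<in> I \<Longrightarrow> X j i \<in> borel_measurable (P j)"
      "\<And>j i. i \<in> I \<Longrightarrow> integrable (P j) (\<lambda>\<omega>. (X j i \<omega>)\<^sup>2)"
      "\<And>j i. i \<in> I \<Longrightarrow> integral\<^sup>L (P j) (\<lambda>\<omega>. (X j i \<omega>)\<^sup>2) \<le> c"
    and Y: "\<And>j i. i \<in> I \<Longrightarrow> Y j i \<in> borel_measurable (Q j)"
      "\<And>j i. i \<in> I \<Longrightarrow> integrable (Q j) (\<lambda>\<omega>. (Y j i \<omega>)\<^sup>2)"
      "\<And>j i. i \<in> I \<Longrightarrow> integral\<^sup>L (Q j) (\<lambda>\<omega>. (Y j i \<omega>)\<^sup>2) \<le> c"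
    and lim: "\<And>l t. (\<lambda>j. integral\<^sup>L (P j) (\<lambda>\<omega>. cos ((\<Sum>i\<in>I. l i * X j i \<omega>) + t))
       - integral\<^sup>L (Q j) (\<lambda>\<omega>. cos ((\<Sum>i\<in>I. l i * Y j i \<omega>) + t))) \<longlonglongrightarrow> 0"
  shows "(\<lambda>j. integral\<^sup>L (P j) (\<lambda>\<omega>. h (\<lambda>i. X j i \<omega>))
       - integral\<^sup>L (Q j) (\<lambda>\<omega>. h (\<lambda>i. Y j i \<omega>))) \<longlonglongrightarrow> 0"
proof -
  have trig: "(\<lambda>j. integral\<^sup>L (P j) (\<lambda>\<omega>. p (\<lambda>i. X j i \<omega>))
       - integral\<^sup>L (Q j) (\<lambda>\<omega>. p (\<lambda>i. Y j i \<omega>))) \<longlonglongrightarrow> 0" if "p \<in> trig I" for p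
    using that
  proof induction
    case (cosine a l t)
    from tendsto_mult_right_zero[OF lim[of l t], of a]
    show ?case by (simp add: right_diff_distrib)
  next
    case (add p r)
    have "integral\<^sup>L (P j) (\<lambda>\<omega>. p (\<lambda>i. X j i \<omega>) + r (\<lambda>i. X j i \<omega>))
       - integral\<^sup>L (Q j) (\<lambda>\<omega>. p (\<lambda>i. Y j i \<omega>) + r (\<lambda>i. Y j i \<omega>))
       = (integral\<^sup>L (P j) (\<lambda>\<omega>. p (\<lambda>i. X j i \<omega>)) - integral\<^sup>L (Q j) (\<lambda>\<omega>. p (\<lambda>i. Y j i \<omega>)))
       + (integral\<^sup>L (P j) (\<lambda>\<omega>. r (\<lambda>i. X j i \<omega>)) - integral\<^sup>L (Q j) (\<lambda>\<omega>. r (\<lambda>i. Y j i \<omega>)))" for j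
      using prob_space.trig_integrable[OF P[of j] add.hyps(1) X(1)[of _ j]] prob_space.trig_integrable[OF P[of j] add.hyps(2) X(1)[of _ j]]
        prob_space.trig_integrable[OF Q[of j] add.hyps(1) Y(1)[of _ j]] prob_space.trig_integrable[OF Q[of j] add.hyps(2) Y(1)[of _ j]]
      by simp
    then show ?case using tendsto_add[OF add.IH] by simp
  qed
  have H0: "H \<ge> 0" using H[of undefined] by linarith
  show ?thesis
  proof (rule LIMSEQ_I)
    fix r :: real assume r: "r > 0"
    \<comment> \<open>Two approximation errors of at most \<open>2 * e\<close> and one trigonometric
      difference below \<open>e\<close> stay below \<open>8 * e = r\<close>. \<open>R\<close> makes
      \<open>A / R\<^sup>2\<close> at most \<open>e\<close>; the summand 1 keeps it
      positive.\<close>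
    define e where "e = r / 8"
    define A where "A = (2 * H + e) * (card I * c)"
    define R where "R = sqrt (\<bar>A\<bar> / e + 1)"
    have e: "e > 0" using r by (simp add: e_def)
    have R: "R > 0" using e by (auto simp: R_def intro!: add_nonneg_pos)
    have "A / R\<^sup>2 \<le> e"
    proof -
      have "R\<^sup>2 = \<bar>A\<bar> / e + 1" using e by (simp add: R_def)
      then show ?thesis using e R by (simp add: divide_le_eq field_simps)
    qed
    then have small: "e + (2 * H + e) * (card I * c / R\<^sup>2) \<le> 2 * e" by (simp add: A_def)
    obtain p where p: "p \<in> trig I" "\<And>x. \<bar>p x\<bar> \<le> H + e"
      "\<And>x. (\<And>i. i \<in> I \<Longrightarrow> \<bar>x i\<bar> \<le> R) \<Longrightarrow> \<bar>h x - p x\<bar> < e"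
      using trig_approximation[OF I h dep H R e] by blast
    from LIMSEQ_D[OF trig[OF p(1)] e] obtain n where n:
      "\<And>j. j \<ge> n \<Longrightarrow> \<bar>integral\<^sup>L (P j) (\<lambda>\<omega>. p (\<lambda>i. X j i \<omega>)) - integral\<^sup>L (Q j) (\<lambda>\<omega>. p (\<lambda>i. Y j i \<omega>))\<bar> < e"
      by auto
    show "\<exists>n. \<forall>j\<ge>n. norm (integral\<^sup>L (P j) (\<lambda>\<omega>. h (\<lambda>i. X j i \<omega>))
       - integral\<^sup>L (Q j) (\<lambda>\<omega>. h (\<lambda>i. Y j i \<omega>)) - 0) < r"
    proof (intro exI allI impI)
      fix j assume "n \<le> j"
      have "\<bar>integral\<^sup>L (P j) (\<lambda>\<omega>. h (\<lambda>i. X j i \<omega>)) - integral\<^sup>L (P j) (\<lambda>\<omega>. p (\<lambda>i. X j i \<omega>))\<bar>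
          \<le> e + (2 * H + e) * (real (card I) * c / R\<^sup>2)"
        by (rule prob_space.trig_expectation_approximation[OF P I h dep H R e X p]) auto
      moreover have "\<bar>integral\<^sup>L (Q j) (\<lambda>\<omega>. h (\<lambda>i. Y j i \<omega>)) - integral\<^sup>L (Q j) (\<lambda>\<omega>. p (\<lambda>i. Y j i \<omega>))\<bar>
          \<le> e + (2 * H + e) * (real (card I) * c / R\<^sup>2)"
        by (rule prob_space.trig_expectation_approximation[OF Q I h dep H R e Y p]) auto
      moreover note n[OF \<open>n \<le> j\<close>]
      ultimately show "norm (integral\<^sup>L (P j) (\<lambda>\<omega>. h (\<lambda>i. X j i \<omega>))
       - integral\<^sup>L (Q j) (\<lambda>\<omega>. h (\<lambda>i. Y j i \<omega>)) - 0) < r"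
        using small e unfolding real_norm_def e_def by linarith
    qed
  qed
qed

section \<open>Gaussian vectors and integration by parts\<close>

text \<open>The characteristic function in real form: the phase \<open>t = - pi / 2\<close> recovers
  the sine part. The zero variable is included, and the condition survives mean-square
  limits.\<close>

definition centered_gaussian :: "'w measure \<Rightarrow> ('w \<Rightarrow> real) \<Rightarrow> bool" where
  "centered_gaussian M X \<longleftrightarrow> X \<in> borel_measurable M \<and> integrable M (\<lambda>\<omega>. (X \<omega>)\<^sup>2) \<and>
     (\<forall>s t. (LINT \<omega>|M. cos (s * X \<omega> + t)) = cos t * exp (- (s\<^sup>2 * (LINT \<omega>|M. (X \<omega>)\<^sup>2)) / 2))"

lemma std_normal_cos:
  "(LINT x|std_normal_distribution. cos (s * x + t)) = cos t * exp (- s\<^sup>2 / 2)"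
proof -
  interpret N: real_distribution std_normal_distribution by (rule real_dist_normal_dist)
  have int: "integrable std_normal_distribution (\<lambda>x. iexp (s * x))"
    by (rule N.integrable_iexp) auto
  have eq: "(CLINT x|std_normal_distribution. iexp (s * x)) = complex_of_real (exp (- s\<^sup>2 / 2))"
    using char_std_normal_distribution by (simp add: char_def fun_eq_iff)
  have re: "(LINT x|std_normal_distribution. cos (s * x)) = exp (- s\<^sup>2 / 2)"
    using integral_bounded_linear[OF bounded_linear_Re int] by (simp only: eq) (simp add: Re_exp)
  have im: "(LINT x|std_normal_distribution. sin (s * x)) = 0"
    using integral_bounded_linear[OF bounded_linear_Im int] by (simp only: eq) (simp add: Im_exp)
  have i: "integrable std_normal_distribution (\<lambda>x. cos (s * x))"
       "integrable std_normal_distribution (\<lambda>x. sin (s * x))"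
    by (auto intro!: N.integrable_const_bound[where B = 1])
  have "(LINT x|std_normal_distribution. cos (s * x + t))
     = (LINT x|std_normal_distribution. cos (s * x) * cos t - sin (s * x) * sin t)"
    by (simp add: cos_add)
  also have "\<dots> = exp (- s\<^sup>2 / 2) * cos t"
    using i by (simp add: re im)
  finally show ?thesis by simp
qed

lemma (in prob_space) centered_gaussian_distr:
  assumes X: "centered_gaussian M X" and v: "expectation (\<lambda>\<omega>. (X \<omega>)\<^sup>2) = 1"
  shows "distr M borel X = std_normal_distribution"
proof (rule Levy_uniqueness)
  have [measurable]: "X \<in> borel_measurable M" using X by (simp add: centered_gaussian_def)
  show "real_distribution (distr M borel X)" by (rule real_distribution_distr) simp
  show "real_distribution std_normal_distribution" by (rule real_dist_normal_dist)
  show "char (distr M borel X) = char std_normal_distribution"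
  proof
    fix s
    have int: "integrable M (\<lambda>\<omega>. iexp (s * X \<omega>))" by (rule integrable_iexp) auto
    have c: "expectation (\<lambda>\<omega>. cos (s * X \<omega> + t)) = cos t * exp (- s\<^sup>2 / 2)" for t
      using X v by (simp add: centered_gaussian_def)
    have "Re (expectation (\<lambda>\<omega>. iexp (s * X \<omega>))) = exp (- s\<^sup>2 / 2)"
      using integral_bounded_linear[OF bounded_linear_Re int] c[of 0] by (simp add: Re_exp)
    moreover have "cos (s * X \<omega> + - pi / 2) = sin (s * X \<omega>)" for \<omega>
      by (simp add: cos_diff)
    then have "Im (expectation (\<lambda>\<omega>. iexp (s * X \<omega>))) = 0"
      using integral_bounded_linear[OF bounded_linear_Im int] c[of "- pi / 2"] by (simp add: Im_exp)
    ultimately show "char (distr M borel X) s = char std_normal_distribution s"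
      by (simp add: char_std_normal_distribution char_def integral_distr complex_eq_iff)
  qed
qed

lemma centered_gaussian_cmult:
  assumes "centered_gaussian M X"
  shows "centered_gaussian M (\<lambda>\<omega>. c * X \<omega>)"
  using assms unfolding centered_gaussian_def
  by (auto simp: power_mult_distrib mult.assoc[symmetric])

text \<open>Moments are read off the standard normal law after division by the standard deviation; a
  variable of variance zero vanishes almost surely and is treated apart.\<close>

lemma (in prob_space) centered_gaussian_moment:
  assumes X: "centered_gaussian M X"
  shows "integrable M (\<lambda>\<omega>. \<bar>X \<omega>\<bar> ^ k)"
proof -
  have [measurable]: "X \<in> borel_measurable M" and X2: "integrable M (\<lambda>\<omega>. (X \<omega>)\<^sup>2)"
    using X by (auto simp: centered_gaussian_def)
  define v where "v = expectation (\<lambda>\<omega>. (X \<omega>)\<^sup>2)"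
  have v0: "v \<ge> 0" by (simp add: v_def)
  show ?thesis
  proof (cases "v = 0")
    case True
    then have "AE \<omega> in M. (X \<omega>)\<^sup>2 = 0"
      using integral_nonneg_eq_0_iff_AE[OF X2] by (simp add: v_def)
    then have "AE \<omega> in M. \<bar>X \<omega>\<bar> ^ k = 0 ^ k" by eventually_elim auto
    then show ?thesis by (subst integrable_cong_AE) (auto simp: power_0_left)
  next
    case False
    define Z where "Z = (\<lambda>\<omega>. (1 / sqrt v) * X \<omega>)"
    have [measurable]: "Z \<in> borel_measurable M" by (simp add: Z_def)
    have "centered_gaussian M Z" unfolding Z_def by (rule centered_gaussian_cmult[OF X])
    moreover have "expectation (\<lambda>\<omega>. (Z \<omega>)\<^sup>2) = 1"
      using False v0 by (simp add: Z_def power_divide power_mult_distrib v_def)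
    ultimately have d: "distr M borel Z = std_normal_distribution"
      by (rule centered_gaussian_distr)
    have "integrable (distr M borel Z) (\<lambda>x. x ^ k)"
      unfolding d by (rule integrable_std_normal_distribution_moment)
    then have "integrable M (\<lambda>\<omega>. Z \<omega> ^ k)" by (subst (asm) integrable_distr_eq) auto
    then have "integrable M (\<lambda>\<omega>. sqrt v ^ k * \<bar>Z \<omega> ^ k\<bar>)" by auto
    then show ?thesis
      using False v0 by (simp add: Z_def power_abs[symmetric] abs_mult power_divide abs_divide power_mult_distrib)
  qed
qed

text \<open>\<open>f\<close> is the derivative of \<open>v\<close> times the normal density, so its
  integral is a difference of limits at the two ends, and these vanish since polynomial growth loses
  against the density.\<close>

lemma stein_one_dimensional:
  fixes v v' :: "real \<Rightarrow> real"
  assumes d: "\<And>x. (v has_real_derivative v' x) (at x)" and c: "continuous_on UNIV v'"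
    and b: "\<And>x. \<bar>v x\<bar> \<le> C * (1 + \<bar>x\<bar>) ^ K" and b': "\<And>x. \<bar>v' x\<bar> \<le> D * (1 + \<bar>x\<bar>) ^ L"
  shows "(LINT x|std_normal_distribution. x * v x) = (LINT x|std_normal_distribution. v' x)"
proof -
  interpret N: real_distribution std_normal_distribution by (rule real_dist_normal_dist)
  have mom: "integrable std_normal_distribution (\<lambda>x. \<bar>x\<bar> ^ k)" for k
    using integrable_abs[OF integrable_std_normal_distribution_moment[of k]] by (simp add: power_abs)
  have C: "C \<ge> 0" using b[of 0] by simp
  have contv: "continuous_on UNIV v" by (rule DERIV_continuous_on) (rule d)
  have [measurable]: "v \<in> borel_measurable borel" "v' \<in> borel_measurable borel"
    using c contv by (auto intro: borel_measurable_continuous_onI)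
  have pw: "(1 + \<bar>x\<bar>) ^ k \<le> 2 ^ k * (1 + \<bar>x\<bar> ^ k)" for x :: real and k
  proof -
    have "1 + \<bar>x\<bar> \<le> 2 * max 1 \<bar>x\<bar>" by (simp add: max_def)
    then have "(1 + \<bar>x\<bar>) ^ k \<le> (2 * max 1 \<bar>x\<bar>) ^ k" by (rule power_mono) simp
    also have "\<dots> = 2 ^ k * max 1 \<bar>x\<bar> ^ k" by (simp add: power_mult_distrib)
    also have "max 1 \<bar>x\<bar> ^ k \<le> 1 + \<bar>x\<bar> ^ k" by (auto simp: max_def)
    finally show ?thesis by simp
  qed
  have pint: "integrable std_normal_distribution (\<lambda>x. (1 + \<bar>x\<bar>) ^ k)" for k
    by (rule Bochner_Integration.integrable_bound[where f = "\<lambda>x. 2 ^ k * (1 + \<bar>x\<bar> ^ k)"])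
       (use pw mom in auto)
  have i1: "integrable std_normal_distribution (\<lambda>x. x * v x)"
  proof (rule Bochner_Integration.integrable_bound)
    show "integrable std_normal_distribution (\<lambda>x. C * (1 + \<bar>x\<bar>) ^ Suc K)"
      using pint[of "Suc K"] by simp
    have "\<bar>x * v x\<bar> \<le> C * (1 + \<bar>x\<bar>) ^ Suc K" for x
    proof -
      have "\<bar>x\<bar> * \<bar>v x\<bar> \<le> (1 + \<bar>x\<bar>) * (C * (1 + \<bar>x\<bar>) ^ K)" using b by (intro mult_mono) auto
      then show ?thesis by (simp add: abs_mult mult_ac)
    qed
    then show "AE x in std_normal_distribution. norm (x * v x) \<le> norm (C * (1 + \<bar>x\<bar>) ^ Suc K)"
      by (intro AE_I2) (auto intro: order_trans[OF _ abs_ge_self])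
  qed simp
  have i2: "integrable std_normal_distribution v'"
  proof (rule Bochner_Integration.integrable_bound)
    show "integrable std_normal_distribution (\<lambda>x. D * (1 + \<bar>x\<bar>) ^ L)" using pint[of L] by simp
    show "AE x in std_normal_distribution. norm (v' x) \<le> norm (D * (1 + \<bar>x\<bar>) ^ L)"
      using b' by (intro AE_I2) (auto intro: order_trans[OF _ abs_ge_self])
  qed simp
  define F where "F x = v x * std_normal_density x" for x
  define f where "f x = std_normal_density x * (v' x - x * v x)" for x
  have nd: "(std_normal_density has_real_derivative - x * std_normal_density x) (at x)" for x
    unfolding std_normal_density_def by (auto intro!: derivative_eq_intros simp: field_simps)
  have "(LBINT x=-\<infinity>..\<infinity>. f x) = 0 - 0"
  proof (rule interval_integral_FTC_integrable)
    fix x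
    have "(F has_real_derivative f x) (at x)"
      unfolding F_def f_def by (auto intro!: derivative_eq_intros d nd simp: algebra_simps)
    then show "(F has_vector_derivative f x) (at x)"
      by (simp add: has_real_derivative_iff_has_vector_derivative)
    have "isCont std_normal_density x" "isCont v x" "isCont v' x"
      using nd d c by (auto intro: DERIV_isCont simp: continuous_on_eq_continuous_at)
    then show "isCont f x" unfolding f_def by (intro continuous_intros)
  next
    have "integrable lborel f"
      using Bochner_Integration.integrable_diff[OF i2 i1] unfolding f_def
      by (subst (asm) integrable_density) auto
    then show "set_integrable lborel (einterval (-\<infinity>) \<infinity>) f" by (simp add: set_integrable_def)
  next
    have bound: "norm (F x) \<le> norm ((C * exp (3 / 2) / sqrt (2 * pi)) * ((1 + \<bar>x\<bar>) ^ K / exp (1 + \<bar>x\<bar>)))" for x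
    proof -
      \<comment> \<open>Gaussian decay is traded for exponential decay in \<open>1 + |x|\<close>, at
        the price of the factor \<open>exp (3 / 2)\<close>, so that the limit of powers against the
        exponential applies.\<close>
      have "\<bar>x\<bar> - 1 / 2 \<le> x\<^sup>2 / 2"
        using zero_le_power2[of "\<bar>x\<bar> - 1"] by (simp add: power2_eq_square algebra_simps)
      then have "exp (- x\<^sup>2 / 2) \<le> exp (3 / 2 - (1 + \<bar>x\<bar>))" by simp
      also have "\<dots> = exp (3 / 2) / exp (1 + \<bar>x\<bar>)" by (rule exp_diff)
      finally have "\<bar>v x\<bar> * exp (- x\<^sup>2 / 2) \<le> (C * (1 + \<bar>x\<bar>) ^ K) * (exp (3 / 2) / exp (1 + \<bar>x\<bar>))"
        using b[of x] C by (intro mult_mono) auto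
      then have "\<bar>v x\<bar> * exp (- x\<^sup>2 / 2) / sqrt (2 * pi) \<le> (C * (1 + \<bar>x\<bar>) ^ K) * (exp (3 / 2) / exp (1 + \<bar>x\<bar>)) / sqrt (2 * pi)"
        by (rule divide_right_mono) simp
      then show ?thesis using C by (simp add: F_def std_normal_density_def abs_mult mult_ac)
    qed
    have lim: "((\<lambda>x. (1 + \<bar>x\<bar>) ^ K / exp (1 + \<bar>x\<bar>)) \<longlongrightarrow> 0) G"
      if "filterlim (\<lambda>x::real. 1 + \<bar>x\<bar>) at_top G" for G
      using filterlim_compose[OF tendsto_power_div_exp_0[of K] that] .
    have bt: "((\<lambda>x. norm ((C * exp (3 / 2) / sqrt (2 * pi)) * ((1 + \<bar>x\<bar>) ^ K / exp (1 + \<bar>x\<bar>)))) \<longlongrightarrow> 0) G"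
      if "filterlim (\<lambda>x::real. 1 + \<bar>x\<bar>) at_top G" for G
      using tendsto_norm_zero[OF tendsto_mult_right_zero[OF lim[OF that]]] .
    have top: "filterlim (\<lambda>x::real. 1 + \<bar>x\<bar>) at_top at_top"
      by (rule filterlim_at_top_mono[OF filterlim_ident]) (intro always_eventually, auto)
    have bot: "filterlim (\<lambda>x::real. 1 + \<bar>x\<bar>) at_top at_bot"
      by (rule filterlim_at_top_mono[OF filterlim_uminus_at_top_at_bot]) (intro always_eventually, auto)
    have "(F \<longlongrightarrow> 0) at_top"
      by (rule Lim_null_comparison[OF _ bt[OF top], rotated])
         (intro always_eventually allI bound)
    then show "((F \<circ> real_of_ereal) \<longlongrightarrow> 0) (at_left \<infinity>)" by (simp add: ereal_tendsto_simps)
    have "(F \<longlongrightarrow> 0) at_bot"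
      by (rule Lim_null_comparison[OF _ bt[OF bot], rotated])
         (intro always_eventually allI bound)
    then show "((F \<circ> real_of_ereal) \<longlongrightarrow> 0) (at_right (-\<infinity>))" by (simp add: ereal_tendsto_simps)
  qed auto
  then have "(LINT x|lborel. f x) = 0"
    by (simp add: interval_lebesgue_integral_def set_lebesgue_integral_def)
  then have "(LINT x|std_normal_distribution. v' x - x * v x) = 0"
    by (subst integral_density) (auto simp: f_def)
  then show ?thesis using i1 i2 by simp
qed

section \<open>Functions of polynomial growth\<close>

definition radius :: "'i set \<Rightarrow> ('i \<Rightarrow> real) \<Rightarrow> real" where
  "radius I x = 1 + (\<Sum>i\<in>I. \<bar>x i\<bar>)"

text \<open>The summand 1 makes powers increase with the exponent, so that bounds of different
  degrees can be added.\<close>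

lemma radius_ge_1: "radius I x \<ge> 1"
  by (simp add: radius_def sum_nonneg)

lemma add_power_le: "(a + b) ^ k \<le> 2 ^ k * (a ^ k + b ^ k)" if "a \<ge> 0" "b \<ge> 0" for a b :: real
proof -
  have "(a + b) ^ k \<le> (2 * max a b) ^ k" using that by (intro power_mono) auto
  also have "\<dots> = 2 ^ k * max a b ^ k" by (simp add: power_mult_distrib)
  also have "max a b ^ k \<le> a ^ k + b ^ k" using that by (auto simp: max_def)
  finally show ?thesis by simp
qed

lemma (in prob_space) integrable_power_add:
  fixes f g :: "'a \<Rightarrow> real"
  assumes [measurable]: "f \<in> borel_measurable M" "g \<in> borel_measurable M"
    and "\<And>\<omega>. f \<omega> \<ge> 0" "\<And>\<omega>. g \<omega> \<ge> 0"
    and "integrable M (\<lambda>\<omega>. f \<omega> ^ k)" "integrable M (\<lambda>\<omega>. g \<omega> ^ k)"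
  shows "integrable M (\<lambda>\<omega>. (f \<omega> + g \<omega>) ^ k)"
  by (rule Bochner_Integration.integrable_bound[where f = "\<lambda>\<omega>. 2 ^ k * (f \<omega> ^ k + g \<omega> ^ k)"])
     (use assms add_power_le in \<open>auto simp: abs_mult intro!: AE_I2\<close>)

lemma (in prob_space) integrable_radius_power:
  assumes "finite I" and [measurable]: "\<And>i. i \<in> I \<Longrightarrow> X i \<in> borel_measurable M"
    and X: "\<And>i. i \<in> I \<Longrightarrow> integrable M (\<lambda>\<omega>. \<bar>X i \<omega>\<bar> ^ k)"
  shows "integrable M (\<lambda>\<omega>. radius I (\<lambda>i. X i \<omega>) ^ k)"
  using assms
proof (induction I rule: finite_induct)
  case (insert i I)
  have [measurable]: "X i \<in> borel_measurable M" "\<And>k. k \<in> I \<Longrightarrow> X k \<in> borel_measurable M"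
    using insert.prems by auto
  have "integrable M (\<lambda>\<omega>. (\<bar>X i \<omega>\<bar> + radius I (\<lambda>i. X i \<omega>)) ^ k)"
  proof (rule integrable_power_add)
    show "(\<lambda>\<omega>. radius I (\<lambda>i. X i \<omega>)) \<in> borel_measurable M" unfolding radius_def by measurable
    show "0 \<le> radius I (\<lambda>i. X i \<omega>)" for \<omega> using radius_ge_1[of I "\<lambda>i. X i \<omega>"] by simp
  qed (use insert in auto)
  then show ?case using insert.hyps by (simp add: radius_def algebra_simps)
qed (simp add: radius_def)

text \<open>Test functions live on the whole function space but see only the coordinates in
  \<open>I\<close>, so the dimension can vary without a change of type. The class is stable under
  the algebra used below and integrable against every vector with all moments.\<close>

definition poly_growth :: "'i set \<Rightarrow> (('i \<Rightarrow> real) \<Rightarrow> real) \<Rightarrow> bool" where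
  "poly_growth I u \<longleftrightarrow> continuous_on UNIV u \<and> (\<forall>x y. (\<forall>i\<in>I. x i = y i) \<longrightarrow> u x = u y) \<and>
     (\<exists>C K. \<forall>x. \<bar>u x\<bar> \<le> C * radius I x ^ K)"

lemma poly_growthE:
  assumes "poly_growth I u"
  obtains C K where "C \<ge> 0" "\<And>x. \<bar>u x\<bar> \<le> C * radius I x ^ K"
proof -
  obtain C K where b: "\<And>x. \<bar>u x\<bar> \<le> C * radius I x ^ K" using assms by (auto simp: poly_growth_def)
  have "C * radius I x ^ K \<le> \<bar>C\<bar> * radius I x ^ K" for x
    using radius_ge_1[of I x] by (intro mult_right_mono) auto
  with b show thesis by (intro that[of "\<bar>C\<bar>" K]) (auto intro: order_trans)
qed

lemma poly_growthI:
  assumes "continuous_on UNIV u" "\<And>x y. (\<And>i. i \<in> I \<Longrightarrow> x i = y i) \<Longrightarrow> u x = u y"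
    and "\<And>x. \<bar>u x\<bar> \<le> C * radius I x ^ K"
  shows "poly_growth I u"
  unfolding poly_growth_def using assms by blast

lemma poly_growth_continuous: "poly_growth I u \<Longrightarrow> continuous_on UNIV u"
  by (simp add: poly_growth_def)

lemma poly_growth_cong: "poly_growth I u \<Longrightarrow> (\<And>i. i \<in> I \<Longrightarrow> x i = y i) \<Longrightarrow> u x = u y"
  by (simp add: poly_growth_def)

lemma poly_growth_const: "poly_growth I (\<lambda>x. c)"
  by (rule poly_growthI[where C = "\<bar>c\<bar>" and K = 0]) auto

lemma poly_growth_coord:
  assumes "finite I" "i \<in> I" shows "poly_growth I (\<lambda>x. x i)"
proof (rule poly_growthI[where C = 1 and K = 1])
  show "\<bar>x i\<bar> \<le> 1 * radius I x ^ 1" for x :: "'a \<Rightarrow> real"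
    using member_le_sum[of i I "\<lambda>i. \<bar>x i\<bar>"] assms by (simp add: radius_def)
qed (use assms in \<open>auto intro: continuous_on_product_coordinates\<close>)

lemma poly_growth_add:
  assumes u: "poly_growth I u" and w: "poly_growth I w"
  shows "poly_growth I (\<lambda>x. u x + w x)"
proof -
  obtain C K where C: "C \<ge> 0" "\<And>x. \<bar>u x\<bar> \<le> C * radius I x ^ K" using poly_growthE[OF u] by blast
  obtain D L where D: "D \<ge> 0" "\<And>x. \<bar>w x\<bar> \<le> D * radius I x ^ L" using poly_growthE[OF w] by blast
  have "\<bar>u x + w x\<bar> \<le> (C + D) * radius I x ^ (K + L)" for x
  proof -
    have "C * radius I x ^ K \<le> C * radius I x ^ (K + L)" "D * radius I x ^ L \<le> D * radius I x ^ (K + L)"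
      using radius_ge_1[of I x] C D by (auto intro!: mult_left_mono power_increasing)
    then show ?thesis using C(2)[of x] D(2)[of x] by (simp add: ring_distribs)
  qed
  then show ?thesis
  proof (rule poly_growthI[rotated 2])
    show "u x + w x = u y + w y" if "\<And>i. i \<in> I \<Longrightarrow> x i = y i" for x y
      using poly_growth_cong[OF u that] poly_growth_cong[OF w that] by simp
  qed (intro continuous_intros poly_growth_continuous[OF u] poly_growth_continuous[OF w])
qed

lemma poly_growth_mult:
  assumes u: "poly_growth I u" and w: "poly_growth I w"
  shows "poly_growth I (\<lambda>x. u x * w x)"
proof -
  obtain C K where C: "C \<ge> 0" "\<And>x. \<bar>u x\<bar> \<le> C * radius I x ^ K" using poly_growthE[OF u] by blast
  obtain D L where D: "D \<ge> 0" "\<And>x. \<bar>w x\<bar> \<le> D * radius I x ^ L" using poly_growthE[OF w] by blast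
  have "\<bar>u x * w x\<bar> \<le> (C * D) * radius I x ^ (K + L)" for x
  proof -
    have "\<bar>u x\<bar> * \<bar>w x\<bar> \<le> (C * radius I x ^ K) * (D * radius I x ^ L)"
      using C D radius_ge_1[of I x] by (intro mult_mono) auto
    then show ?thesis by (simp add: abs_mult power_add mult_ac)
  qed
  then show ?thesis
  proof (rule poly_growthI[rotated 2])
    show "u x * w x = u y * w y" if "\<And>i. i \<in> I \<Longrightarrow> x i = y i" for x y
      using poly_growth_cong[OF u that] poly_growth_cong[OF w that] by simp
  qed (intro continuous_intros poly_growth_continuous[OF u] poly_growth_continuous[OF w])
qed

lemma poly_growth_sum:
  assumes "\<And>k. k \<in> A \<Longrightarrow> poly_growth I (u k)"
  shows "poly_growth I (\<lambda>x. \<Sum>k\<in>A. u k x)"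
  using assms by (induction A rule: infinite_finite_induct) (auto simp: poly_growth_const poly_growth_add)

lemma poly_growth_power: "poly_growth I u \<Longrightarrow> poly_growth I (\<lambda>x. u x ^ n)"
  by (induction n) (auto simp: poly_growth_const poly_growth_mult)

lemma poly_growth_cos:
  assumes "poly_growth I u" shows "poly_growth I (\<lambda>x. cos (u x))"
proof -
  have "\<bar>cos (u x)\<bar> \<le> 1 * radius I x ^ 0" for x by simp
  then show ?thesis
  proof (rule poly_growthI[rotated 2])
    show "cos (u x) = cos (u y)" if "\<And>i. i \<in> I \<Longrightarrow> x i = y i" for x y
      using poly_growth_cong[OF assms that] by simp
  qed (rule continuous_on_compose2[OF continuous_on_cos[OF continuous_on_id[of UNIV]] poly_growth_continuous[OF assms]], simp)
qed

lemma poly_growth_abs: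
  assumes "poly_growth I u" shows "poly_growth I (\<lambda>x. \<bar>u x\<bar>)"
proof -
  obtain C K where "\<And>x. \<bar>u x\<bar> \<le> C * radius I x ^ K" using poly_growthE[OF assms] by blast
  then have "\<bar>\<bar>u x\<bar>\<bar> \<le> C * radius I x ^ K" for x by simp
  then show ?thesis
  proof (rule poly_growthI[rotated 2])
    show "\<bar>u x\<bar> = \<bar>u y\<bar>" if "\<And>i. i \<in> I \<Longrightarrow> x i = y i" for x y
      using poly_growth_cong[OF assms that] by simp
  qed (intro continuous_on_rabs poly_growth_continuous[OF assms])
qed

lemma poly_growth_sin:
  assumes "poly_growth I u" shows "poly_growth I (\<lambda>x. sin (u x))"
proof -
  have "\<bar>sin (u x)\<bar> \<le> 1 * radius I x ^ 0" for x by simp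
  then show ?thesis
  proof (rule poly_growthI[rotated 2])
    show "sin (u x) = sin (u y)" if "\<And>i. i \<in> I \<Longrightarrow> x i = y i" for x y
      using poly_growth_cong[OF assms that] by simp
  qed (rule continuous_on_compose2[OF continuous_on_sin[OF continuous_on_id[of UNIV]] poly_growth_continuous[OF assms]], simp)
qed

lemma poly_growth_poly:
  assumes "poly_growth I u" shows "poly_growth I (\<lambda>x. poly p (u x))"
  using assms unfolding poly_altdef
  by (intro poly_growth_sum poly_growth_mult poly_growth_const poly_growth_power)

lemma poly_growth_linear:
  assumes "finite I" shows "poly_growth I (\<lambda>x. \<Sum>i\<in>I. l i * x i)"
  using assms by (intro poly_growth_sum poly_growth_mult poly_growth_const poly_growth_coord)

lemma (in prob_space) poly_growth_measurable:
  fixes u :: "('i::countable \<Rightarrow> real) \<Rightarrow> real"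
  assumes "poly_growth I u" "\<And>i. i \<in> I \<Longrightarrow> X i \<in> borel_measurable M"
  shows "(\<lambda>\<omega>. u (\<lambda>i. X i \<omega>)) \<in> borel_measurable M"
  by (rule continuous_finite_dep_measurable[where I = I]) (use assms in \<open>auto simp: poly_growth_def\<close>)

lemma (in prob_space) poly_growth_integrable:
  fixes u :: "('i::countable \<Rightarrow> real) \<Rightarrow> real"
  assumes u: "poly_growth I u" and X: "\<And>i. i \<in> I \<Longrightarrow> X i \<in> borel_measurable M"
    and r: "\<And>k. integrable M (\<lambda>\<omega>. radius I (\<lambda>i. X i \<omega>) ^ k)"
  shows "integrable M (\<lambda>\<omega>. u (\<lambda>i. X i \<omega>))"
proof -
  obtain C K where C: "C \<ge> 0" "\<And>x. \<bar>u x\<bar> \<le> C * radius I x ^ K" using poly_growthE[OF u] by blast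
  show ?thesis
  proof (rule Bochner_Integration.integrable_bound)
    show "integrable M (\<lambda>\<omega>. C * radius I (\<lambda>i. X i \<omega>) ^ K)" using r by simp
    show "AE \<omega> in M. norm (u (\<lambda>i. X i \<omega>)) \<le> norm (C * radius I (\<lambda>i. X i \<omega>) ^ K)"
      using C(2) by (intro AE_I2) (auto intro: order_trans[OF _ abs_ge_self])
  qed (rule poly_growth_measurable[OF u X])
qed

text \<open>For unbounded \<open>g\<close> one passes to the limit in the clamped functions.\<close>
proposition expectation_eq_of_characteristic_functions:
  fixes g :: "('i::countable \<Rightarrow> real) \<Rightarrow> real"
  assumes "prob_space P" "prob_space Q" and I: "finite I" and g: "poly_growth I g"
    and X: "\<And>i. i \<in> I \<Longrightarrow> X i \<in> borel_measurable P" "\<And>k. integrable P (\<lambda>\<omega>. radius I (\<lambda>i. X i \<omega>) ^ k)"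
    and Y: "\<And>i. i \<in> I \<Longrightarrow> Y i \<in> borel_measurable Q" "\<And>k. integrable Q (\<lambda>\<omega>. radius I (\<lambda>i. Y i \<omega>) ^ k)"
    and eq: "\<And>l t. (LINT \<omega>|P. cos ((\<Sum>i\<in>I. l i * X i \<omega>) + t)) = (LINT \<omega>|Q. cos ((\<Sum>i\<in>I. l i * Y i \<omega>) + t))"
  shows "(LINT \<omega>|P. g (\<lambda>i. X i \<omega>)) = (LINT \<omega>|Q. g (\<lambda>i. Y i \<omega>))"
proof -
  interpret P: prob_space P by fact
  interpret Q: prob_space Q by fact
  define s where "s n x = max (- real n) (min (real n) (g x))" for n x
  have gc: "continuous_on UNIV g" and gd: "\<And>x y. (\<And>i. i \<in> I \<Longrightarrow> x i = y i) \<Longrightarrow> g x = g y"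
    using g by (auto simp: poly_growth_def)
  define c where "c = (\<Sum>i\<in>I. (LINT \<omega>|P. (X i \<omega>)\<^sup>2) + (LINT \<omega>|Q. (Y i \<omega>)\<^sup>2))"
  have sq: "poly_growth I (\<lambda>x. (x i)\<^sup>2)" if "i \<in> I" for i
    using that I by (intro poly_growth_power poly_growth_coord)
  have eqn: "(LINT \<omega>|P. s n (\<lambda>i. X i \<omega>)) = (LINT \<omega>|Q. s n (\<lambda>i. Y i \<omega>))" for n
  proof -
    \<comment> \<open>The two vectors enter as constant sequences: a constant difference that tends
      to zero is zero.\<close>
    have "(\<lambda>j::nat. (LINT \<omega>|P. s n (\<lambda>i. X i \<omega>)) - (LINT \<omega>|Q. s n (\<lambda>i. Y i \<omega>))) \<longlonglongrightarrow> 0"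
    proof (rule asymptotically_proximal_vectors[OF I, where h = "s n" and X = "\<lambda>_. X" and Y = "\<lambda>_. Y" and P = "\<lambda>_. P" and Q = "\<lambda>_. Q" and c = c])
      show "continuous_on UNIV (s n)" unfolding s_def using gc by (intro continuous_intros)
      show "s n x = s n y" if "\<And>i. i \<in> I \<Longrightarrow> x i = y i" for x y
        using gd[of x y] that by (simp add: s_def)
      show "\<bar>s n x\<bar> \<le> real n" for x by (auto simp: s_def)
      fix i assume i: "i \<in> I"
      show "integrable P (\<lambda>\<omega>. (X i \<omega>)\<^sup>2)" by (rule P.poly_growth_integrable[OF sq[OF i] X])
      show "integrable Q (\<lambda>\<omega>. (Y i \<omega>)\<^sup>2)" by (rule Q.poly_growth_integrable[OF sq[OF i] Y])
      have "(LINT \<omega>|P. (X i \<omega>)\<^sup>2) + (LINT \<omega>|Q. (Y i \<omega>)\<^sup>2) \<le> c"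
        unfolding c_def using I i by (intro member_le_sum) auto
      moreover have "0 \<le> (LINT \<omega>|P. (X i \<omega>)\<^sup>2)" "0 \<le> (LINT \<omega>|Q. (Y i \<omega>)\<^sup>2)" by simp_all
      ultimately show "(LINT \<omega>|P. (X i \<omega>)\<^sup>2) \<le> c" "(LINT \<omega>|Q. (Y i \<omega>)\<^sup>2) \<le> c" by linarith+
    qed (use X Y eq assms in auto)
    then show ?thesis using LIMSEQ_unique[OF tendsto_const] by fastforce
  qed
  have sg: "(\<lambda>n. s n x) \<longlonglongrightarrow> g x" for x
  proof (rule tendsto_eventually)
    obtain m where "\<bar>g x\<bar> \<le> real m" using real_arch_simple by blast
    then show "\<forall>\<^sub>F n in sequentially. s n x = g x"
      by (auto simp: s_def eventually_sequentially intro!: exI[of _ m])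
  qed
  have sb: "norm (s n x) \<le> \<bar>g x\<bar>" for n x by (auto simp: s_def)
  have sm: "poly_growth I (s n)" for n
  proof -
    obtain C K where C: "C \<ge> 0" "\<And>x. \<bar>g x\<bar> \<le> C * radius I x ^ K" using poly_growthE[OF g] by blast
    have "\<bar>s n x\<bar> \<le> C * radius I x ^ K" for x using sb[of n x] C(2)[of x] by simp
    then show ?thesis
    proof (rule poly_growthI[rotated 2])
      show "continuous_on UNIV (s n)" unfolding s_def using gc by (intro continuous_intros)
      show "s n x = s n y" if "\<And>i. i \<in> I \<Longrightarrow> x i = y i" for x y
        using gd[of x y] that by (simp add: s_def)
    qed
  qed
  have "(\<lambda>n. LINT \<omega>|P. s n (\<lambda>i. X i \<omega>)) \<longlonglongrightarrow> (LINT \<omega>|P. g (\<lambda>i. X i \<omega>))"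
  proof (rule integral_dominated_convergence[where w = "\<lambda>\<omega>. \<bar>g (\<lambda>i. X i \<omega>)\<bar>"])
    show "integrable P (\<lambda>\<omega>. \<bar>g (\<lambda>i. X i \<omega>)\<bar>)"
      by (intro integrable_abs P.poly_growth_integrable[OF g X])
    show "(\<lambda>\<omega>. s n (\<lambda>i. X i \<omega>)) \<in> borel_measurable P" for n
      by (rule P.poly_growth_measurable[OF sm X(1)])
  qed (use sg sb in \<open>auto intro!: P.poly_growth_measurable[OF g X(1)]\<close>)
  moreover have "(\<lambda>n. LINT \<omega>|Q. s n (\<lambda>i. Y i \<omega>)) \<longlonglongrightarrow> (LINT \<omega>|Q. g (\<lambda>i. Y i \<omega>))"
  proof (rule integral_dominated_convergence[where w = "\<lambda>\<omega>. \<bar>g (\<lambda>i. Y i \<omega>)\<bar>"])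
    show "integrable Q (\<lambda>\<omega>. \<bar>g (\<lambda>i. Y i \<omega>)\<bar>)"
      by (intro integrable_abs Q.poly_growth_integrable[OF g Y])
    show "(\<lambda>\<omega>. s n (\<lambda>i. Y i \<omega>)) \<in> borel_measurable Q" for n
      by (rule Q.poly_growth_measurable[OF sm Y(1)])
  qed (use sg sb in \<open>auto intro!: Q.poly_growth_measurable[OF g Y(1)]\<close>)
  ultimately show ?thesis unfolding eqn by (rule LIMSEQ_unique)
qed

section \<open>Resampling and Stein's identity for Gaussian vectors\<close>

lemma integrable_pair_mult:
  fixes f :: "'a \<Rightarrow> real" and g :: "'b \<Rightarrow> real"
  assumes "sigma_finite_measure M" "sigma_finite_measure N"
    and f: "integrable M f" and g: "integrable N g"
  shows "integrable (M \<Otimes>\<^sub>M N) (\<lambda>z. f (fst z) * g (snd z))"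
proof -
  interpret M: sigma_finite_measure M by fact
  interpret N: sigma_finite_measure N by fact
  interpret pair_sigma_finite M N ..
  have [measurable]: "f \<in> borel_measurable M" "g \<in> borel_measurable N" using f g by auto
  show ?thesis
    by (rule Fubini_integrable) (use f g in \<open>auto simp: abs_mult\<close>)
qed

text \<open>Neither independence nor an invertible covariance can be asked for: the coordinates will
  be real and imaginary parts of the random coefficients, which are linearly related because
  \<open>T\<close> is real.\<close>

locale gaussian_vector = prob_space M for M :: "'w measure" +
  fixes I :: "'i::countable set" and \<xi> :: "'i \<Rightarrow> 'w \<Rightarrow> real"
  assumes finite_I: "finite I"
    and gaussian: "\<And>l. centered_gaussian M (\<lambda>\<omega>. \<Sum>i\<in>I. l i * \<xi> i \<omega>)"
begin

lemma gaussian_coord: "i \<in> I \<Longrightarrow> centered_gaussian M (\<xi> i)"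
proof -
  assume i: "i \<in> I"
  have "(\<Sum>k\<in>I. (if k = i then 1 else 0) * \<xi> k \<omega>) = \<xi> i \<omega>" for \<omega>
    using i finite_I by (simp add: if_distrib[of "\<lambda>a. a * _"] cong: if_cong)
  then show ?thesis using gaussian[of "\<lambda>k. if k = i then 1 else 0"] by simp
qed

lemma \<xi>_measurable: "i \<in> I \<Longrightarrow> \<xi> i \<in> borel_measurable M"
  using gaussian_coord by (auto simp: centered_gaussian_def)

lemma \<xi>_radius: "integrable M (\<lambda>\<omega>. radius I (\<lambda>i. \<xi> i \<omega>) ^ k)"
  by (intro integrable_radius_power finite_I \<xi>_measurable centered_gaussian_moment gaussian_coord)

lemma pg_integrable: "poly_growth I u \<Longrightarrow> integrable M (\<lambda>\<omega>. u (\<lambda>i. \<xi> i \<omega>))"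
  by (rule poly_growth_integrable[OF _ \<xi>_measurable \<xi>_radius])

lemma pg_measurable: "poly_growth I u \<Longrightarrow> (\<lambda>\<omega>. u (\<lambda>i. \<xi> i \<omega>)) \<in> borel_measurable M"
  using pg_integrable by blast

context
  fixes c :: "'i \<Rightarrow> real" and X :: "'w \<Rightarrow> real" and \<gamma> :: "'i \<Rightarrow> real"
  assumes X: "X = (\<lambda>\<omega>. \<Sum>i\<in>I. c i * \<xi> i \<omega>)"
    and \<gamma>: "\<And>i. i \<in> I \<Longrightarrow> \<gamma> i = expectation (\<lambda>\<omega>. \<xi> i \<omega> * X \<omega>)"
    and unit: "expectation (\<lambda>\<omega>. (X \<omega>)\<^sup>2) = 1"
begin

lemma sum_\<gamma>: "(\<Sum>i\<in>I. l i * \<gamma> i) = expectation (\<lambda>\<omega>. (\<Sum>i\<in>I. l i * \<xi> i \<omega>) * X \<omega>)"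
proof -
  have "integrable M (\<lambda>\<omega>. l i * (\<xi> i \<omega> * X \<omega>))" if "i \<in> I" for i
    using that unfolding X
    by (intro pg_integrable[where u = "\<lambda>y. l i * (y i * (\<Sum>i\<in>I. c i * y i))"]
        poly_growth_mult poly_growth_const poly_growth_coord poly_growth_linear finite_I)
  then have "expectation (\<lambda>\<omega>. \<Sum>i\<in>I. l i * (\<xi> i \<omega> * X \<omega>)) = (\<Sum>i\<in>I. l i * \<gamma> i)"
    by (subst Bochner_Integration.integral_sum) (auto simp: \<gamma>)
  then show ?thesis by (simp add: sum_distrib_right mult.assoc)
qed

lemma sum_c\<gamma>: "(\<Sum>i\<in>I. c i * \<gamma> i) = 1"
  using unit by (simp add: sum_\<gamma> X power2_eq_square)

text \<open>The bound separates \<open>x\<close> from the data \<open>y\<close> and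
  \<open>r\<close>: its powers are integrable over a product space, and for fixed data it is a
  growth bound in the single variable \<open>x\<close>.\<close>

lemma radius_shift:
  "radius I (\<lambda>i. y i + (x - r) * \<gamma> i) \<le> (1 + \<bar>x\<bar>) * (radius I y + (1 + \<bar>r\<bar>) * (\<Sum>i\<in>I. \<bar>\<gamma> i\<bar>))"
proof -
  have "(\<Sum>i\<in>I. \<bar>y i + (x - r) * \<gamma> i\<bar>) \<le> (\<Sum>i\<in>I. \<bar>y i\<bar> + \<bar>x - r\<bar> * \<bar>\<gamma> i\<bar>)"
    by (intro sum_mono) (auto simp: abs_mult[symmetric])
  also have "\<dots> = (\<Sum>i\<in>I. \<bar>y i\<bar>) + \<bar>x - r\<bar> * (\<Sum>i\<in>I. \<bar>\<gamma> i\<bar>)"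
    by (simp add: sum.distrib sum_distrib_left)
  finally have "radius I (\<lambda>i. y i + (x - r) * \<gamma> i) \<le> radius I y + \<bar>x - r\<bar> * (\<Sum>i\<in>I. \<bar>\<gamma> i\<bar>)"
    by (simp add: radius_def)
  moreover have "radius I y \<le> (1 + \<bar>x\<bar>) * radius I y"
    using radius_ge_1[of I y] by (simp add: ring_distribs)
  moreover have "\<bar>x - r\<bar> \<le> (1 + \<bar>x\<bar>) * (1 + \<bar>r\<bar>)"
  proof -
    have "0 \<le> \<bar>x\<bar> * \<bar>r\<bar>" by simp
    with abs_triangle_ineq4[of x r] show ?thesis unfolding ring_distribs by linarith
  qed
  then have "\<bar>x - r\<bar> * (\<Sum>i\<in>I. \<bar>\<gamma> i\<bar>) \<le> (1 + \<bar>x\<bar>) * (1 + \<bar>r\<bar>) * (\<Sum>i\<in>I. \<bar>\<gamma> i\<bar>)"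
    by (intro mult_right_mono sum_nonneg) auto
  ultimately show ?thesis by (simp add: ring_distribs)
qed

text \<open>
  The vector \<open>\<xi> - X \<gamma>\<close> is uncorrelated with the standard Gaussian variable \<open>X\<close>, so replacing \<open>X\<close>
  by an independent copy \<open>x\<close> does not change the law of \<open>\<xi>\<close>.
\<close>
lemma resample:
  assumes g: "poly_growth I g"
  shows "expectation (\<lambda>\<omega>. g (\<lambda>i. \<xi> i \<omega>)) =
     expectation (\<lambda>\<omega>. LINT x|std_normal_distribution. g (\<lambda>i. \<xi> i \<omega> + (x - X \<omega>) * \<gamma> i))"
proof -
  interpret N: real_distribution std_normal_distribution by (rule real_dist_normal_dist)
  interpret MN: pair_prob_space M std_normal_distribution ..
  let ?P = "M \<Otimes>\<^sub>M std_normal_distribution"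
  have [measurable]: "\<And>i. i \<in> I \<Longrightarrow> \<xi> i \<in> borel_measurable M" by (rule \<xi>_measurable)
  have [measurable]: "X \<in> borel_measurable M" unfolding X by measurable
  define Y where "Y i = (\<lambda>z. \<xi> i (fst z) + (snd z - X (fst z)) * \<gamma> i)" for i
  have Y: "Y i \<in> borel_measurable ?P" if "i \<in> I" for i
    using that unfolding Y_def by measurable
  have rad: "integrable ?P (\<lambda>z. radius I (\<lambda>i. Y i z) ^ k)" for k
  proof (rule Bochner_Integration.integrable_bound)
    define A where "A y = radius I y + (1 + \<bar>\<Sum>i\<in>I. c i * y i\<bar>) * (\<Sum>i\<in>I. \<bar>\<gamma> i\<bar>)" for y
    have "poly_growth I A" unfolding A_def radius_def
      by (intro poly_growth_add poly_growth_mult poly_growth_const poly_growth_abs poly_growth_linear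
          poly_growth_sum poly_growth_coord finite_I)
    then have "integrable M (\<lambda>\<omega>. A (\<lambda>i. \<xi> i \<omega>) ^ k)"
      by (intro pg_integrable[where u = "\<lambda>y. A y ^ k"] poly_growth_power)
    moreover have "integrable std_normal_distribution (\<lambda>x. (1 + \<bar>x\<bar>) ^ k)"
    proof (rule N.integrable_power_add)
      show "integrable std_normal_distribution (\<lambda>x. \<bar>x\<bar> ^ k)"
        using integrable_abs[OF integrable_std_normal_distribution_moment[of k]] by (simp add: power_abs)
    qed auto
    ultimately show "integrable ?P (\<lambda>z. A (\<lambda>i. \<xi> i (fst z)) ^ k * (1 + \<bar>snd z\<bar>) ^ k)"
      by (intro integrable_pair_mult) unfold_locales
    show "AE z in ?P. norm (radius I (\<lambda>i. Y i z) ^ k) \<le> norm (A (\<lambda>i. \<xi> i (fst z)) ^ k * (1 + \<bar>snd z\<bar>) ^ k)"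
    proof (intro AE_I2)
      fix z
      have le: "radius I (\<lambda>i. Y i z) \<le> (1 + \<bar>snd z\<bar>) * A (\<lambda>i. \<xi> i (fst z))"
        unfolding Y_def A_def X by (rule radius_shift)
      have "0 \<le> radius I (\<lambda>i. Y i z)" using radius_ge_1[of I "\<lambda>i. Y i z"] by simp
      with power_mono[OF le this, of k]
      show "norm (radius I (\<lambda>i. Y i z) ^ k) \<le> norm (A (\<lambda>i. \<xi> i (fst z)) ^ k * (1 + \<bar>snd z\<bar>) ^ k)"
        by (simp add: power_mult_distrib mult_ac)
    qed
    show "(\<lambda>z. radius I (\<lambda>i. Y i z) ^ k) \<in> borel_measurable ?P"
      unfolding radius_def using Y by measurable
  qed
  have char: "expectation (\<lambda>\<omega>. cos ((\<Sum>i\<in>I. l i * \<xi> i \<omega>) + t)) = (LINT z|?P. cos ((\<Sum>i\<in>I. l i * Y i z) + t))" for l t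
  proof -
    \<comment> \<open>\<open>s\<close> is the regression coefficient of \<open>W\<close> on
      \<open>X\<close>, and \<open>V\<close> is the residual. \<open>V\<close> and \<open>X\<close>
      are uncorrelated, so the variances add, which is all that the characteristic functions
      see.\<close>
    define s where "s = (\<Sum>i\<in>I. l i * \<gamma> i)"
    define V where "V = (\<lambda>\<omega>. \<Sum>i\<in>I. (l i - s * c i) * \<xi> i \<omega>)"
    define W where "W = (\<lambda>\<omega>. \<Sum>i\<in>I. l i * \<xi> i \<omega>)"
    have VW: "W \<omega> = V \<omega> + s * X \<omega>" for \<omega>
      unfolding V_def W_def X by (simp add: algebra_simps sum_subtractf sum_distrib_left)
    have pgV: "poly_growth I (\<lambda>y. \<Sum>i\<in>I. (l i - s * c i) * y i)"
      and pgX: "poly_growth I (\<lambda>y. \<Sum>i\<in>I. c i * y i)" by (intro poly_growth_linear finite_I)+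
    have int: "integrable M (\<lambda>\<omega>. (V \<omega>)\<^sup>2)" "integrable M (\<lambda>\<omega>. V \<omega> * X \<omega>)" "integrable M (\<lambda>\<omega>. (X \<omega>)\<^sup>2)"
      using pg_integrable[OF poly_growth_power[OF pgV, of 2]] pg_integrable[OF poly_growth_power[OF pgX, of 2]]
        pg_integrable[OF poly_growth_mult[OF pgV pgX]] by (simp_all add: V_def X)
    have gV: "centered_gaussian M V" unfolding V_def by (rule gaussian)
    have gW: "centered_gaussian M W" unfolding W_def by (rule gaussian)
    have [measurable]: "V \<in> borel_measurable M" using gV by (simp add: centered_gaussian_def)
    have "expectation (\<lambda>\<omega>. V \<omega> * X \<omega>) = (\<Sum>i\<in>I. (l i - s * c i) * \<gamma> i)"
      unfolding V_def by (rule sum_\<gamma>[symmetric])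
    also have "\<dots> = (\<Sum>i\<in>I. l i * \<gamma> i) - s * (\<Sum>i\<in>I. c i * \<gamma> i)"
      by (simp add: left_diff_distrib sum_subtractf sum_distrib_left mult.assoc)
    also have "\<dots> = s - s * (\<Sum>i\<in>I. c i * \<gamma> i)" by (simp add: s_def)
    finally have VX: "expectation (\<lambda>\<omega>. V \<omega> * X \<omega>) = 0" by (simp add: sum_c\<gamma>)
    have "expectation (\<lambda>\<omega>. (W \<omega>)\<^sup>2) = expectation (\<lambda>\<omega>. (V \<omega>)\<^sup>2 + 2 * s * (V \<omega> * X \<omega>) + s\<^sup>2 * (X \<omega>)\<^sup>2)"
      by (simp add: VW power2_eq_square algebra_simps)
    also have "\<dots> = expectation (\<lambda>\<omega>. (V \<omega>)\<^sup>2) + s\<^sup>2"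
      using int by (simp add: VX unit)
    finally have var: "expectation (\<lambda>\<omega>. (W \<omega>)\<^sup>2) = expectation (\<lambda>\<omega>. (V \<omega>)\<^sup>2) + s\<^sup>2" .
    have lin: "(\<Sum>i\<in>I. l i * Y i z) = s * snd z + V (fst z)" for z
    proof -
      have "(\<Sum>i\<in>I. l i * Y i z) = W (fst z) + (snd z - X (fst z)) * s"
        by (simp add: Y_def W_def s_def algebra_simps sum.distrib sum_subtractf sum_distrib_left)
      then show ?thesis by (simp add: VW algebra_simps)
    qed
    have "integrable ?P (\<lambda>z. cos (s * snd z + V (fst z) + t))"
      by (rule MN.integrable_const_bound[where B = 1]) auto
    from MN.integral_fst'[OF this]
    have "(LINT z|?P. cos (s * snd z + V (fst z) + t))
       = expectation (\<lambda>\<omega>. LINT x|std_normal_distribution. cos (s * x + (V \<omega> + t)))"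
      by (simp add: add.assoc)
    also have "\<dots> = exp (- s\<^sup>2 / 2) * expectation (\<lambda>\<omega>. cos (V \<omega> + t))"
      by (simp only: std_normal_cos) simp
    also have "expectation (\<lambda>\<omega>. cos (V \<omega> + t)) = cos t * exp (- expectation (\<lambda>\<omega>. (V \<omega>)\<^sup>2) / 2)"
      using gV unfolding centered_gaussian_def by (metis (no_types, lifting) mult_1 one_power2 Bochner_Integration.integral_cong)
    also have "exp (- s\<^sup>2 / 2) * (cos t * exp (- expectation (\<lambda>\<omega>. (V \<omega>)\<^sup>2) / 2))
       = cos t * exp (- expectation (\<lambda>\<omega>. (W \<omega>)\<^sup>2) / 2)"
      by (simp add: var exp_add[symmetric] add_divide_distrib diff_divide_distrib)
    also have "\<dots> = expectation (\<lambda>\<omega>. cos (W \<omega> + t))"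
      using gW unfolding centered_gaussian_def by (metis (no_types, lifting) mult_1 one_power2 Bochner_Integration.integral_cong)
    finally show ?thesis by (simp add: lin W_def)
  qed
  have "expectation (\<lambda>\<omega>. g (\<lambda>i. \<xi> i \<omega>)) = (LINT z|?P. g (\<lambda>i. Y i z))"
    by (rule expectation_eq_of_characteristic_functions[OF prob_space_axioms MN.prob_space_axioms finite_I g
          \<xi>_measurable \<xi>_radius Y rad char])
  also have "\<dots> = expectation (\<lambda>\<omega>. LINT x|std_normal_distribution. g (\<lambda>i. Y i (\<omega>, x)))"
    by (rule MN.integral_fst'[symmetric], rule MN.poly_growth_integrable[OF g Y rad])
  finally show ?thesis by (simp add: Y_def)
qed

text \<open>After resampling, \<open>\<xi>\<close> runs along a line in the direction
  \<open>\<gamma>\<close> with a standard normal parameter, so for each outcome the one-dimensional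
  identity applies; resampling backwards removes the parameter again.\<close>

lemma stein:
  assumes u: "poly_growth I u" and u': "poly_growth I u'"
    and d: "\<And>y. ((\<lambda>s. u (\<lambda>i. y i + s * \<gamma> i)) has_real_derivative u' y) (at 0)"
  shows "expectation (\<lambda>\<omega>. X \<omega> * u (\<lambda>i. \<xi> i \<omega>)) = expectation (\<lambda>\<omega>. u' (\<lambda>i. \<xi> i \<omega>))"
proof -
  have pgX: "poly_growth I (\<lambda>y. (\<Sum>i\<in>I. c i * y i) * u y)"
    by (intro poly_growth_mult poly_growth_linear finite_I u)
  have "expectation (\<lambda>\<omega>. X \<omega> * u (\<lambda>i. \<xi> i \<omega>)) = expectation (\<lambda>\<omega>. LINT x|std_normal_distribution.
      (\<Sum>i\<in>I. c i * (\<xi> i \<omega> + (x - X \<omega>) * \<gamma> i)) * u (\<lambda>i. \<xi> i \<omega> + (x - X \<omega>) * \<gamma> i))"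
    using resample[OF pgX] by (simp add: X)
  also have "\<dots> = expectation (\<lambda>\<omega>. LINT x|std_normal_distribution. u' (\<lambda>i. \<xi> i \<omega> + (x - X \<omega>) * \<gamma> i))"
  proof (rule Bochner_Integration.integral_cong[OF refl])
    fix \<omega>
    define v where "v x = u (\<lambda>i. \<xi> i \<omega> + (x - X \<omega>) * \<gamma> i)" for x
    define v' where "v' x = u' (\<lambda>i. \<xi> i \<omega> + (x - X \<omega>) * \<gamma> i)" for x
    define A where "A = radius I (\<lambda>i. \<xi> i \<omega>) + (1 + \<bar>X \<omega>\<bar>) * (\<Sum>i\<in>I. \<bar>\<gamma> i\<bar>)"
    have bound: "\<exists>C K. \<forall>x. \<bar>w (\<lambda>i. \<xi> i \<omega> + (x - X \<omega>) * \<gamma> i)\<bar> \<le> C * (1 + \<bar>x\<bar>) ^ K" if w: "poly_growth I w" for w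
    proof -
      obtain C K where C: "C \<ge> 0" "\<And>y. \<bar>w y\<bar> \<le> C * radius I y ^ K" using poly_growthE[OF w] by blast
      have "\<bar>w (\<lambda>i. \<xi> i \<omega> + (x - X \<omega>) * \<gamma> i)\<bar> \<le> (C * A ^ K) * (1 + \<bar>x\<bar>) ^ K" for x
      proof -
        have "radius I (\<lambda>i. \<xi> i \<omega> + (x - X \<omega>) * \<gamma> i) ^ K \<le> ((1 + \<bar>x\<bar>) * A) ^ K"
          unfolding A_def using radius_ge_1[of I "\<lambda>i. \<xi> i \<omega> + (x - X \<omega>) * \<gamma> i"]
          by (intro power_mono radius_shift) auto
        then have "C * radius I (\<lambda>i. \<xi> i \<omega> + (x - X \<omega>) * \<gamma> i) ^ K \<le> C * ((1 + \<bar>x\<bar>) * A) ^ K"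
          using C(1) by (rule mult_left_mono)
        then show ?thesis using C(2)[of "\<lambda>i. \<xi> i \<omega> + (x - X \<omega>) * \<gamma> i"] by (simp add: power_mult_distrib mult_ac)
      qed
      then show ?thesis by blast
    qed
    obtain C K where C: "\<And>x. \<bar>v x\<bar> \<le> C * (1 + \<bar>x\<bar>) ^ K" using bound[OF u] unfolding v_def by blast
    obtain D L where D: "\<And>x. \<bar>v' x\<bar> \<le> D * (1 + \<bar>x\<bar>) ^ L" using bound[OF u'] unfolding v'_def by blast
    \<comment> \<open>On this line the functional \<open>X\<close> takes the value of the parameter,
      because its variance is 1.\<close>
    have "(\<Sum>i\<in>I. c i * (\<xi> i \<omega> + a * \<gamma> i)) = X \<omega> + a * (\<Sum>i\<in>I. c i * \<gamma> i)" for a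
      by (simp add: X ring_distribs sum.distrib sum_distrib_left mult.left_commute)
    then have x: "(\<Sum>i\<in>I. c i * (\<xi> i \<omega> + (x - X \<omega>) * \<gamma> i)) = x" for x by (simp add: sum_c\<gamma>)
    have "(LINT x|std_normal_distribution. x * v x) = (LINT x|std_normal_distribution. v' x)"
    proof (rule stein_one_dimensional[OF _ _ C D])
      fix x
      have "((\<lambda>s. v (x + s)) has_real_derivative v' x) (at 0)"
        using d[of "\<lambda>i. \<xi> i \<omega> + (x - X \<omega>) * \<gamma> i"] by (simp add: v_def v'_def algebra_simps)
      then show "(v has_real_derivative v' x) (at x)" using DERIV_shift[of v "v' x" 0 x] by (simp add: add.commute)
    next
      show "continuous_on UNIV v'" unfolding v'_def
        by (rule continuous_on_compose2[OF poly_growth_continuous[OF u']],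
            rule continuous_on_coordinatewise_then_product) (auto intro!: continuous_intros)
    qed
    then show "(LINT x|std_normal_distribution. (\<Sum>i\<in>I. c i * (\<xi> i \<omega> + (x - X \<omega>) * \<gamma> i)) *
        u (\<lambda>i. \<xi> i \<omega> + (x - X \<omega>) * \<gamma> i)) =
      (LINT x|std_normal_distribution. u' (\<lambda>i. \<xi> i \<omega> + (x - X \<omega>) * \<gamma> i))"
      by (simp add: x v_def v'_def)
  qed
  also have "\<dots> = expectation (\<lambda>\<omega>. u' (\<lambda>i. \<xi> i \<omega>))" by (rule resample[OF u', symmetric])
  finally show ?thesis .
qed

end

end

section \<open>Hermite polynomials\<close>

lemma pderiv_hermite: "pderiv (hermite (Suc n)) = smult (of_nat (Suc n)) (hermite n)"
proof (induction n rule: less_induct)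
  case (less n)
  show ?case
  proof (cases n)
    case 0 then show ?thesis by (simp add: pderiv_pCons)
  next
    case (Suc m)
    \<comment> \<open>For \<open>m = 0\<close> the truncated index \<open>m - 1\<close> is harmless,
      its coefficient being 0.\<close>
    have h: "hermite (Suc m) = [:0, 1:] * hermite m - smult (real m) (hermite (m - 1))"
      by (cases m) auto
    have m: "smult (real (Suc m)) (pderiv (hermite m)) = smult (real (Suc m)) (smult (real m) (hermite (m - 1)))"
      using less[of "m - 1"] Suc by (cases m) (auto simp: pderiv_1)
    have "pderiv (hermite (Suc n)) = hermite (Suc m) + [:0, 1:] * pderiv (hermite (Suc m))
        - smult (real (Suc m)) (pderiv (hermite m))"
      by (simp add: Suc pderiv_diff pderiv_mult pderiv_smult pderiv_pCons del: of_nat_Suc)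
    also have "\<dots> = hermite (Suc m) + smult (real (Suc m)) ([:0, 1:] * hermite m - smult (real m) (hermite (m - 1)))"
      unfolding m using less[of m] Suc by (simp add: smult_diff_right del: of_nat_Suc)
    also have "\<dots> = smult (real (Suc n)) (hermite n)"
    proof -
      have *: "p + smult (real k) p = smult (real (Suc k)) p" for k and p :: "real poly"
        by (simp add: smult_add_left)
      show ?thesis unfolding h[symmetric] Suc by (rule *)
    qed
    finally show ?thesis by simp
  qed
qed

text \<open>Multiplication by the variable minus differentiation is the adjoint of differentiation
  for the normal law; this form of the recurrence feeds \<open>hermite_ibp\<close>.\<close>

lemma hermite_Suc: "hermite (Suc n) = [:0, 1:] * hermite n - pderiv (hermite n)"
  by (cases n) (auto simp: pderiv_1 pderiv_hermite simp del: of_nat_Suc)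

section \<open>Bounded weights and derivatives of integrals\<close>

lemma poly_abs_bound:
  fixes p :: "real poly"
  obtains C where "C \<ge> 0" "\<And>x. \<bar>poly p x\<bar> \<le> C * (1 + \<bar>x\<bar>) ^ degree p"
proof
  show "(\<Sum>i\<le>degree p. \<bar>coeff p i\<bar>) \<ge> 0" by (simp add: sum_nonneg)
  fix x
  have "\<bar>poly p x\<bar> \<le> (\<Sum>i\<le>degree p. \<bar>coeff p i * x ^ i\<bar>)"
    unfolding poly_altdef by (rule sum_abs)
  also have "\<dots> \<le> (\<Sum>i\<le>degree p. \<bar>coeff p i\<bar> * (1 + \<bar>x\<bar>) ^ degree p)"
  proof (rule sum_mono)
    fix i assume "i \<in> {..degree p}"
    then have "(1 + \<bar>x\<bar>) ^ i \<le> (1 + \<bar>x\<bar>) ^ degree p" by (intro power_increasing) auto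
    moreover have "\<bar>x\<bar> ^ i \<le> (1 + \<bar>x\<bar>) ^ i" by (rule power_mono) auto
    ultimately show "\<bar>coeff p i * x ^ i\<bar> \<le> \<bar>coeff p i\<bar> * (1 + \<bar>x\<bar>) ^ degree p"
      by (simp add: abs_mult power_abs mult_left_mono)
  qed
  finally show "\<bar>poly p x\<bar> \<le> (\<Sum>i\<le>degree p. \<bar>coeff p i\<bar>) * (1 + \<bar>x\<bar>) ^ degree p"
    by (simp add: sum_distrib_right)
qed

text \<open>The bound is imposed on the space of the measure only: functions on the sphere are
  functions on the ambient space, where polynomials are unbounded.\<close>

definition bounded_measurable :: "'y measure \<Rightarrow> ('y \<Rightarrow> real) \<Rightarrow> bool" where
  "bounded_measurable \<mu> f \<longleftrightarrow> f \<in> borel_measurable \<mu> \<and> (\<exists>B. \<forall>y\<in>space \<mu>. \<bar>f y\<bar> \<le> B)"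

lemma bounded_measurableD: "bounded_measurable \<mu> f \<Longrightarrow> f \<in> borel_measurable \<mu>"
  by (simp add: bounded_measurable_def)

lemma bounded_measurableI:
  "f \<in> borel_measurable \<mu> \<Longrightarrow> (\<And>y. y \<in> space \<mu> \<Longrightarrow> \<bar>f y\<bar> \<le> B) \<Longrightarrow> bounded_measurable \<mu> f"
  by (auto simp: bounded_measurable_def)

lemma bounded_measurable_const: "bounded_measurable \<mu> (\<lambda>_. c)"
  by (rule bounded_measurableI[where B = "\<bar>c\<bar>"]) auto

lemma bounded_measurable_add:
  assumes "bounded_measurable \<mu> f" "bounded_measurable \<mu> g"
  shows "bounded_measurable \<mu> (\<lambda>y. f y + g y)"
proof -
  obtain A B where "\<And>y. y \<in> space \<mu> \<Longrightarrow> \<bar>f y\<bar> \<le> A" "\<And>y. y \<in> space \<mu> \<Longrightarrow> \<bar>g y\<bar> \<le> B"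
    using assms unfolding bounded_measurable_def by blast
  then have "\<bar>f y + g y\<bar> \<le> A + B" if "y \<in> space \<mu>" for y
    using that by (meson abs_triangle_ineq add_mono order_trans)
  then show ?thesis using assms[THEN bounded_measurableD] by (intro bounded_measurableI) auto
qed

lemma bounded_measurable_mult:
  assumes "bounded_measurable \<mu> f" "bounded_measurable \<mu> g"
  shows "bounded_measurable \<mu> (\<lambda>y. f y * g y)"
proof -
  obtain A B where "\<And>y. y \<in> space \<mu> \<Longrightarrow> \<bar>f y\<bar> \<le> A" "\<And>y. y \<in> space \<mu> \<Longrightarrow> \<bar>g y\<bar> \<le> B"
    using assms unfolding bounded_measurable_def by blast
  then have "\<bar>f y * g y\<bar> \<le> \<bar>A\<bar> * \<bar>B\<bar>" if "y \<in> space \<mu>" for y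
    unfolding abs_mult using that by (intro mult_mono) (auto intro: order_trans[OF _ abs_ge_self])
  then show ?thesis using assms[THEN bounded_measurableD] by (intro bounded_measurableI) auto
qed

lemma bounded_measurable_sum:
  "(\<And>k. k \<in> A \<Longrightarrow> bounded_measurable \<mu> (f k)) \<Longrightarrow> bounded_measurable \<mu> (\<lambda>y. \<Sum>k\<in>A. f k y)"
  by (induction A rule: infinite_finite_induct) (auto simp: bounded_measurable_const bounded_measurable_add)

lemma bounded_measurable_power: "bounded_measurable \<mu> f \<Longrightarrow> bounded_measurable \<mu> (\<lambda>y. f y ^ n)"
  by (induction n) (auto simp: bounded_measurable_const bounded_measurable_mult)

lemma bounded_measurable_poly: "bounded_measurable \<mu> f \<Longrightarrow> bounded_measurable \<mu> (\<lambda>y. poly p (f y))"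
  unfolding poly_altdef
  by (intro bounded_measurable_sum bounded_measurable_mult bounded_measurable_const bounded_measurable_power)

lemmas bounded_measurable_intros =
  bounded_measurable_const bounded_measurable_add bounded_measurable_mult bounded_measurable_sum
  bounded_measurable_power bounded_measurable_poly

lemma (in finite_measure) integrable_bounded_measurable:
  assumes "bounded_measurable M f" shows "integrable M f"
proof -
  obtain B where "\<And>y. y \<in> space M \<Longrightarrow> \<bar>f y\<bar> \<le> B" using assms by (auto simp: bounded_measurable_def)
  then show ?thesis
    by (intro integrable_const_bound[where B = B]) (use assms in \<open>auto simp: bounded_measurable_def\<close>)
qed

text \<open>Induction on the polynomial with the weight generalized: each factor of the variable is
  absorbed into the weight, which leaves only the sum and product rules.\<close>

lemma (in finite_measure) DERIV_integral_poly:
  assumes "bounded_measurable M A" "bounded_measurable M G" "bounded_measurable M \<theta>"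
  shows "((\<lambda>s. LINT z|M. \<theta> z * poly p (A z + s * G z)) has_real_derivative
     (LINT z|M. \<theta> z * G z * poly (pderiv p) (A z))) (at 0)"
  using assms(3)
proof (induction p arbitrary: \<theta>)
  case 0
  then show ?case by simp
next
  case (pCons a p)
  note bm = bounded_measurable_intros assms(1,2) pCons.prems
  have eq: "(LINT z|M. \<theta> z * poly (pCons a p) (A z + s * G z))
     = a * (LINT z|M. \<theta> z) + (LINT z|M. (\<theta> z * A z) * poly p (A z + s * G z))
       + s * (LINT z|M. (\<theta> z * G z) * poly p (A z + s * G z))" for s
  proof -
    have "(LINT z|M. \<theta> z * poly (pCons a p) (A z + s * G z))
      = (LINT z|M. a * \<theta> z + (\<theta> z * A z) * poly p (A z + s * G z) + s * ((\<theta> z * G z) * poly p (A z + s * G z)))"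
      by (simp add: algebra_simps)
    also have "\<dots> = (LINT z|M. a * \<theta> z) + (LINT z|M. (\<theta> z * A z) * poly p (A z + s * G z))
       + (LINT z|M. s * ((\<theta> z * G z) * poly p (A z + s * G z)))"
      by (subst Bochner_Integration.integral_add, (intro integrable_bounded_measurable bm)+)+ simp
    finally show ?thesis by simp
  qed
  have d: "((\<lambda>s. a * (LINT z|M. \<theta> z) + (LINT z|M. (\<theta> z * A z) * poly p (A z + s * G z))
       + s * (LINT z|M. (\<theta> z * G z) * poly p (A z + s * G z))) has_real_derivative
     (0 + (LINT z|M. (\<theta> z * A z) * G z * poly (pderiv p) (A z)))
      + (1 * (LINT z|M. (\<theta> z * G z) * poly p (A z + 0 * G z))
         + (LINT z|M. (\<theta> z * G z) * G z * poly (pderiv p) (A z)) * 0)) (at 0)"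
    by (intro DERIV_add DERIV_const DERIV_mult DERIV_ident pCons.IH bm)
  have "(LINT z|M. \<theta> z * G z * poly (pderiv (pCons a p)) (A z))
     = (LINT z|M. (\<theta> z * A z) * G z * poly (pderiv p) (A z) + (\<theta> z * G z) * poly p (A z))"
    by (simp add: pderiv_pCons algebra_simps)
  also have "\<dots> = (LINT z|M. (\<theta> z * A z) * G z * poly (pderiv p) (A z)) + (LINT z|M. (\<theta> z * G z) * poly p (A z))"
    by (intro Bochner_Integration.integral_add integrable_bounded_measurable bm)
  finally show ?case unfolding eq using d by simp
qed

text \<open>The real part of a Taylor remainder of the exponential on the imaginary axis, turned by
  the phase \<open>x\<close>.\<close>

lemma cos_first_order: "\<bar>cos (x + h) - cos x + h * sin x\<bar> \<le> h\<^sup>2 / 2" for x h :: real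
proof -
  define Z where "Z = iexp x * (iexp h - (\<Sum>k\<le>1. (\<i> * complex_of_real h) ^ k / fact k))"
  have "cmod Z \<le> \<bar>h\<bar> ^ 2 / 2"
    using iexp_approx1[of h 1] by (simp add: Z_def norm_mult numeral_2_eq_2)
  moreover have "Re Z = cos (x + h) - cos x + h * sin x"
    by (simp add: Z_def Re_exp Im_exp cos_add algebra_simps)
  ultimately show ?thesis using abs_Re_le_cmod[of Z] by simp
qed

text \<open>The remainder has expectation of order \<open>h\<^sup>2\<close> because \<open>F\<close>
  is square integrable, so the difference quotient is off by at most a multiple of
  \<open>|h|\<close>.\<close>

lemma (in prob_space) DERIV_expectation_cos:
  assumes F: "integrable M F" and F2: "integrable M (\<lambda>\<omega>. (F \<omega>)\<^sup>2)"
  shows "((\<lambda>t. expectation (\<lambda>\<omega>. cos (t * F \<omega> + \<theta>))) has_real_derivative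
     - expectation (\<lambda>\<omega>. F \<omega> * sin (t * F \<omega> + \<theta>))) (at t)"
proof -
  have [measurable]: "F \<in> borel_measurable M" using F by auto
  let ?c = "\<lambda>t. expectation (\<lambda>\<omega>. cos (t * F \<omega> + \<theta>))" and ?d = "- expectation (\<lambda>\<omega>. F \<omega> * sin (t * F \<omega> + \<theta>))"
  let ?v = "expectation (\<lambda>\<omega>. (F \<omega>)\<^sup>2)"
  have ic: "integrable M (\<lambda>\<omega>. cos (t * F \<omega> + \<theta>))" for t
    by (rule integrable_const_bound[where B = 1]) auto
  have sinint: "integrable M (\<lambda>\<omega>. F \<omega> * sin (t * F \<omega> + \<theta>))"
    by (rule Bochner_Integration.integrable_bound[OF F]) (auto simp: abs_mult intro!: AE_I2 mult_left_le)
  have ang: "t * F \<omega> + \<theta> + h * F \<omega> = (t + h) * F \<omega> + \<theta>" for \<omega> h by (simp add: ring_distribs)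
  have "\<bar>(?c (t + h) - ?c t) / h - ?d\<bar> \<le> \<bar>h\<bar> * ?v" if "h \<noteq> 0" for h
  proof -
    have ic': "integrable M (\<lambda>\<omega>. cos (t * F \<omega> + \<theta> + h * F \<omega>))" unfolding ang by (rule ic)
    have is': "integrable M (\<lambda>\<omega>. h * F \<omega> * sin (t * F \<omega> + \<theta>))"
      unfolding mult.assoc by (intro integrable_mult_right sinint)
    define D where "D = (\<lambda>\<omega>. cos (t * F \<omega> + \<theta> + h * F \<omega>) - cos (t * F \<omega> + \<theta>) + h * F \<omega> * sin (t * F \<omega> + \<theta>))"
    have iD: "integrable M D"
      unfolding D_def
      by (intro Bochner_Integration.integrable_add Bochner_Integration.integrable_diff ic ic' is')
    have "expectation D = expectation (\<lambda>\<omega>. cos (t * F \<omega> + \<theta> + h * F \<omega>)) - ?c t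
        + expectation (\<lambda>\<omega>. h * F \<omega> * sin (t * F \<omega> + \<theta>))"
      unfolding D_def using ic[of t] ic' is' by simp
    then have eD: "?c (t + h) - ?c t - h * ?d = expectation D"
      unfolding ang by (simp add: mult.assoc)
    have "\<bar>expectation D\<bar> \<le> expectation (\<lambda>\<omega>. \<bar>D \<omega>\<bar>)" by (rule integral_abs_bound)
    also have "\<dots> \<le> expectation (\<lambda>\<omega>. h\<^sup>2 * (F \<omega>)\<^sup>2)"
    proof (rule integral_mono)
      show "integrable M (\<lambda>\<omega>. \<bar>D \<omega>\<bar>)" using iD by simp
      fix \<omega>
      have "0 \<le> (h * F \<omega>)\<^sup>2" by simp
      then show "\<bar>D \<omega>\<bar> \<le> h\<^sup>2 * (F \<omega>)\<^sup>2"
        using cos_first_order[of "t * F \<omega> + \<theta>" "h * F \<omega>"]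
        unfolding D_def power_mult_distrib by linarith
    qed (use F2 in simp)
    finally have "\<bar>?c (t + h) - ?c t - h * ?d\<bar> \<le> h\<^sup>2 * ?v" unfolding eD by simp
    then have "\<bar>?c (t + h) - ?c t - h * ?d\<bar> / \<bar>h\<bar> \<le> h\<^sup>2 * ?v / \<bar>h\<bar>" by (rule divide_right_mono) simp
    also have "h\<^sup>2 * ?v / \<bar>h\<bar> = \<bar>h\<bar> * ?v" using that by (simp add: power2_eq_square abs_if)
    also have "\<bar>?c (t + h) - ?c t - h * ?d\<bar> / \<bar>h\<bar> = \<bar>(?c (t + h) - ?c t) / h - ?d\<bar>"
    proof -
      have "(a - h * d) / h = a / h - d" for a d :: real using that by (simp add: diff_divide_distrib)
      then show ?thesis by (simp only: abs_divide[symmetric])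
    qed
    finally show ?thesis .
  qed
  then have "\<forall>\<^sub>F h in at 0. norm ((?c (t + h) - ?c t) / h - ?d) \<le> \<bar>h\<bar> * ?v"
    by (auto simp: eventually_at intro!: exI[of _ 1])
  moreover have "((\<lambda>h. \<bar>h\<bar> * ?v) \<longlongrightarrow> 0) (at 0)" by (auto intro!: tendsto_eq_intros)
  ultimately have "((\<lambda>h. (?c (t + h) - ?c t) / h - ?d) \<longlongrightarrow> 0) (at 0)"
    by (rule Lim_null_comparison)
  then show ?thesis unfolding DERIV_def using LIM_zero_iff by blast
qed

lemma integral_cauchy_schwarz:
  fixes f g :: "'a \<Rightarrow> real"
  assumes f: "integrable M (\<lambda>x. (f x)\<^sup>2)" and g: "integrable M (\<lambda>x. (g x)\<^sup>2)"
    and fg: "integrable M (\<lambda>x. f x * g x)"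
  shows "(LINT x|M. f x * g x)\<^sup>2 \<le> (LINT x|M. (f x)\<^sup>2) * (LINT x|M. (g x)\<^sup>2)"
proof -
  let ?A = "LINT x|M. (f x)\<^sup>2" and ?B = "LINT x|M. (g x)\<^sup>2" and ?C = "LINT x|M. f x * g x"
  have nn: "0 \<le> a\<^sup>2 * ?A - 2 * a * b * ?C + b\<^sup>2 * ?B" for a b
  proof -
    have "0 \<le> (LINT x|M. (a * f x - b * g x)\<^sup>2)" by simp
    also have "\<dots> = (LINT x|M. a\<^sup>2 * (f x)\<^sup>2 - 2 * a * b * (f x * g x) + b\<^sup>2 * (g x)\<^sup>2)"
      by (simp add: power2_eq_square algebra_simps)
    also have "\<dots> = a\<^sup>2 * ?A - 2 * a * b * ?C + b\<^sup>2 * ?B" using f g fg by simp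
    finally show ?thesis .
  qed
  show ?thesis
  proof (cases "?B = 0")
    case True
    have "?C = 0"
    proof (rule ccontr)
      assume "?C \<noteq> 0"
      \<comment> \<open>With \<open>?B = 0\<close> the quadratic form is affine in \<open>b\<close>,
        and this value makes it equal to -1.\<close>
      then show False using nn[of 1 "(?A + 1) / (2 * ?C)"] True by simp
    qed
    then show ?thesis using True by simp
  next
    case False
    then have "?B > 0" by (simp add: less_le)
    moreover have "0 \<le> ?B * (?A * ?B - ?C\<^sup>2)"
      using nn[of ?B ?C] by (simp add: power2_eq_square algebra_simps)
    ultimately show ?thesis by (simp add: zero_le_mult_iff)
  qed
qed

text \<open>Finite sums of products split the dependence on the point from that on the vector.
  Integrating over the point then gives a finite combination of test functions, with no separate
  argument for continuity in the vector.\<close>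

inductive separated :: "'y measure \<Rightarrow> 'i::countable set \<Rightarrow> ('y \<Rightarrow> ('i \<Rightarrow> real) \<Rightarrow> real) \<Rightarrow> bool" for \<mu> I where
  product: "bounded_measurable \<mu> c \<Longrightarrow> poly_growth I m \<Longrightarrow> separated \<mu> I (\<lambda>z x. c z * m x)"
| add: "separated \<mu> I k \<Longrightarrow> separated \<mu> I l \<Longrightarrow> separated \<mu> I (\<lambda>z x. k z x + l z x)"

lemma separated_const: "separated \<mu> I (\<lambda>z x. c)"
  using separated.product[OF bounded_measurable_const[of \<mu> 1] poly_growth_const[of I c]] by simp

lemma separated_sum:
  "(\<And>r. r \<in> A \<Longrightarrow> separated \<mu> I (k r)) \<Longrightarrow> separated \<mu> I (\<lambda>z x. \<Sum>r\<in>A. k r z x)"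
  by (induction A rule: infinite_finite_induct) (auto simp: separated_const separated.add)

lemma separated_mult_product:
  assumes "separated \<mu> I l" "bounded_measurable \<mu> c" "poly_growth I m"
  shows "separated \<mu> I (\<lambda>z x. c z * m x * l z x)"
  using assms(1)
proof induction
  case (product c' m')
  have "separated \<mu> I (\<lambda>z x. (c z * c' z) * (m x * m' x))"
    by (intro separated.product bounded_measurable_mult poly_growth_mult assms product)
  then show ?case by (simp add: mult_ac)
next
  case (add k l)
  then show ?case by (simp add: ring_distribs separated.add)
qed

lemma separated_mult:
  assumes "separated \<mu> I k" "separated \<mu> I l"
  shows "separated \<mu> I (\<lambda>z x. k z x * l z x)"
  using assms(1)
proof induction
  case (product c m)
  then show ?case by (rule separated_mult_product[OF assms(2)])
next
  case (add k k')
  then show ?case by (simp add: ring_distribs separated.add)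
qed

lemma separated_power: "separated \<mu> I k \<Longrightarrow> separated \<mu> I (\<lambda>z x. k z x ^ n)"
  by (induction n) (auto simp: separated_const separated_mult)

lemma separated_poly: "separated \<mu> I k \<Longrightarrow> separated \<mu> I (\<lambda>z x. poly p (k z x))"
  unfolding poly_altdef by (intro separated_sum separated_mult separated_const separated_power)

lemma separated_bounded_measurable: "separated \<mu> I k \<Longrightarrow> bounded_measurable \<mu> (\<lambda>z. k z x)"
  by (induction rule: separated.induct) (auto intro: bounded_measurable_intros)

lemma (in finite_measure) poly_growth_integral_separated:
  assumes "separated M I k" shows "poly_growth I (\<lambda>x. LINT z|M. k z x)"
  using assms
proof induction
  case (product c m)
  have "poly_growth I (\<lambda>x. (LINT z|M. c z) * m x)" by (intro poly_growth_mult poly_growth_const product)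
  then show ?case by simp
next
  case (add k l)
  have "(LINT z|M. k z x + l z x) = (LINT z|M. k z x) + (LINT z|M. l z x)" for x
    by (intro Bochner_Integration.integral_add integrable_bounded_measurable separated_bounded_measurable[OF add.hyps(1)]
        separated_bounded_measurable[OF add.hyps(2)])
  then show ?case using poly_growth_add[OF add.IH] by simp
qed

section \<open>Hermite functionals of a Gaussian field\<close>

text \<open>A finite-dimensional setting for Malliavin calculus: the derivative at \<open>y\<close>
  becomes the derivative in the coordinates along \<open>\<gamma> y\<close>, the vector of
  covariances of the coordinates with \<open>\<beta> y\<close>.\<close>

locale gaussian_expansion = gaussian_vector M I \<xi> + Y: finite_measure \<mu>
  for M :: "'w measure" and I :: "'i::countable set" and \<xi> and \<mu> :: "'y measure" +
  fixes e :: "'y \<Rightarrow> 'i \<Rightarrow> real"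
  assumes e: "\<And>i. i \<in> I \<Longrightarrow> bounded_measurable \<mu> (\<lambda>y. e y i)"
    and unit: "\<And>y. y \<in> space \<mu> \<Longrightarrow> expectation (\<lambda>\<omega>. (\<Sum>i\<in>I. e y i * \<xi> i \<omega>)\<^sup>2) = 1"
begin

definition \<beta> where "\<beta> y \<omega> = (\<Sum>i\<in>I. e y i * \<xi> i \<omega>)"
definition R where "R i k = expectation (\<lambda>\<omega>. \<xi> i \<omega> * \<xi> k \<omega>)"
definition \<gamma> where "\<gamma> y i = (\<Sum>k\<in>I. e y k * R i k)"
definition \<rho> where "\<rho> z y = (\<Sum>i\<in>I. e z i * \<gamma> y i)"
definition r where "r \<omega> = radius I (\<lambda>i. \<xi> i \<omega>)"

lemma r_ge_1: "r \<omega> \<ge> 1" by (simp add: r_def radius_ge_1)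

lemma r_integrable: "integrable M (\<lambda>\<omega>. r \<omega> ^ k)" unfolding r_def by (rule \<xi>_radius)

lemma sq_unit: "y \<in> space \<mu> \<Longrightarrow> expectation (\<lambda>\<omega>. (\<beta> y \<omega>)\<^sup>2) = 1"
  unfolding \<beta>_def by (rule unit)

lemma linear_product:
  "integrable M (\<lambda>\<omega>. (\<Sum>i\<in>I. a i * \<xi> i \<omega>) * (\<Sum>k\<in>I. b k * \<xi> k \<omega>))"
  "expectation (\<lambda>\<omega>. (\<Sum>i\<in>I. a i * \<xi> i \<omega>) * (\<Sum>k\<in>I. b k * \<xi> k \<omega>)) = (\<Sum>i\<in>I. a i * (\<Sum>k\<in>I. b k * R i k))"
proof -
  show "integrable M (\<lambda>\<omega>. (\<Sum>i\<in>I. a i * \<xi> i \<omega>) * (\<Sum>k\<in>I. b k * \<xi> k \<omega>))"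
    by (intro pg_integrable[where u = "\<lambda>x. (\<Sum>i\<in>I. a i * x i) * (\<Sum>k\<in>I. b k * x k)"]
        poly_growth_mult poly_growth_linear finite_I)
  have int: "integrable M (\<lambda>\<omega>. \<xi> i \<omega> * \<xi> k \<omega>)" if "i \<in> I" "k \<in> I" for i k
    using that by (intro pg_integrable[where u = "\<lambda>x. x i * x k"] poly_growth_mult poly_growth_coord finite_I)
  have "(\<Sum>i\<in>I. a i * \<xi> i \<omega>) * (\<Sum>k\<in>I. b k * \<xi> k \<omega>) = (\<Sum>i\<in>I. \<Sum>k\<in>I. a i * (b k * (\<xi> i \<omega> * \<xi> k \<omega>)))" for \<omega>
    by (simp add: sum_product mult_ac)
  then show "expectation (\<lambda>\<omega>. (\<Sum>i\<in>I. a i * \<xi> i \<omega>) * (\<Sum>k\<in>I. b k * \<xi> k \<omega>)) = (\<Sum>i\<in>I. a i * (\<Sum>k\<in>I. b k * R i k))"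
    using int by (simp add: Bochner_Integration.integral_sum R_def sum_distrib_left)
qed

lemma \<rho>_eq: "\<rho> z y = expectation (\<lambda>\<omega>. \<beta> z \<omega> * \<beta> y \<omega>)"
  unfolding \<rho>_def \<gamma>_def \<beta>_def linear_product(2) ..

lemma \<rho>_sym: "\<rho> z y = \<rho> y z"
  by (simp add: \<rho>_eq mult.commute)

lemma \<gamma>_eq: "i \<in> I \<Longrightarrow> \<gamma> y i = expectation (\<lambda>\<omega>. \<xi> i \<omega> * \<beta> y \<omega>)"
proof -
  assume i: "i \<in> I"
  have s: "(\<Sum>k\<in>I. (if k = i then 1 else 0) * f k) = f i" for f :: "'i \<Rightarrow> real"
    using i finite_I by (simp add: if_distrib[of "\<lambda>a. a * _"] cong: if_cong)
  show ?thesis using linear_product(2)[of "\<lambda>k. if k = i then 1 else 0" "e y"]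
    by (simp only: s \<gamma>_def \<beta>_def)
qed

lemma \<rho>_bound: "\<bar>\<rho> z y\<bar> \<le> 1" if "z \<in> space \<mu>" "y \<in> space \<mu>"
proof -
  have int: "integrable M (\<lambda>\<omega>. \<beta> z \<omega> * \<beta> y \<omega>)" for z y
    unfolding \<beta>_def by (rule linear_product)
  have "\<bar>\<rho> z y\<bar> \<le> expectation (\<lambda>\<omega>. \<bar>\<beta> z \<omega> * \<beta> y \<omega>\<bar>)"
    unfolding \<rho>_eq by (rule integral_abs_bound)
  also have "\<dots> \<le> expectation (\<lambda>\<omega>. (\<beta> z \<omega> * \<beta> z \<omega> + \<beta> y \<omega> * \<beta> y \<omega>) / 2)"
  proof (rule integral_mono)
    show "\<bar>\<beta> z \<omega> * \<beta> y \<omega>\<bar> \<le> (\<beta> z \<omega> * \<beta> z \<omega> + \<beta> y \<omega> * \<beta> y \<omega>) / 2" for \<omega>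
      using zero_le_power2[of "\<bar>\<beta> z \<omega>\<bar> - \<bar>\<beta> y \<omega>\<bar>"] by (simp add: power2_eq_square abs_mult algebra_simps)
  qed (use int in auto)
  also have "\<dots> = (expectation (\<lambda>\<omega>. (\<beta> z \<omega>)\<^sup>2) + expectation (\<lambda>\<omega>. (\<beta> y \<omega>)\<^sup>2)) / 2"
    using int by (simp add: power2_eq_square)
  finally show ?thesis using that by (simp add: sq_unit)
qed

lemma e_measurable [measurable]: "i \<in> I \<Longrightarrow> (\<lambda>y. e y i) \<in> borel_measurable \<mu>"
  using e by (rule bounded_measurableD)

lemma \<xi>_meas [measurable]: "i \<in> I \<Longrightarrow> \<xi> i \<in> borel_measurable M"
  by (rule \<xi>_measurable)

lemma \<gamma>_measurable [measurable]: "i \<in> I \<Longrightarrow> (\<lambda>y. \<gamma> y i) \<in> borel_measurable \<mu>"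
  unfolding \<gamma>_def by measurable

lemma \<rho>_measurable [measurable]:
  assumes [measurable]: "f \<in> N \<rightarrow>\<^sub>M \<mu>" "g \<in> N \<rightarrow>\<^sub>M \<mu>"
  shows "(\<lambda>w. \<rho> (f w) (g w)) \<in> borel_measurable N"
  unfolding \<rho>_def
  by (intro borel_measurable_sum borel_measurable_times measurable_compose[OF assms(1) e_measurable]
      measurable_compose[OF assms(2) \<gamma>_measurable])

lemma \<beta>_measurable [measurable]:
  assumes [measurable]: "f \<in> N \<rightarrow>\<^sub>M \<mu>" "g \<in> N \<rightarrow>\<^sub>M M"
  shows "(\<lambda>w. \<beta> (f w) (g w)) \<in> borel_measurable N"
  unfolding \<beta>_def
  by (intro borel_measurable_sum borel_measurable_times measurable_compose[OF assms(1) e_measurable]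
      measurable_compose[OF assms(2) \<xi>_measurable])

lemma \<beta>_bound: obtains E where "E \<ge> 0" "\<And>y \<omega>. y \<in> space \<mu> \<Longrightarrow> \<bar>\<beta> y \<omega>\<bar> \<le> E * r \<omega>"
proof -
  have "\<forall>i\<in>I. \<exists>B. \<forall>y\<in>space \<mu>. \<bar>e y i\<bar> \<le> B" using e by (auto simp: bounded_measurable_def)
  then obtain B where B: "\<And>i y. i \<in> I \<Longrightarrow> y \<in> space \<mu> \<Longrightarrow> \<bar>e y i\<bar> \<le> B i" by metis
  define E where "E = (\<Sum>i\<in>I. \<bar>B i\<bar>)"
  show thesis
  proof
    show "E \<ge> 0" by (simp add: E_def sum_nonneg)
    fix y \<omega> assume y: "y \<in> space \<mu>"
    have "\<bar>\<beta> y \<omega>\<bar> \<le> (\<Sum>i\<in>I. \<bar>e y i * \<xi> i \<omega>\<bar>)" unfolding \<beta>_def by (rule sum_abs)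
    also have "\<dots> \<le> (\<Sum>i\<in>I. E * \<bar>\<xi> i \<omega>\<bar>)"
    proof (rule sum_mono)
      fix i assume i: "i \<in> I"
      have "\<bar>e y i\<bar> \<le> \<bar>B i\<bar>" using B[OF i y] by linarith
      also have "\<dots> \<le> E" unfolding E_def using i finite_I by (intro member_le_sum) auto
      finally show "\<bar>e y i * \<xi> i \<omega>\<bar> \<le> E * \<bar>\<xi> i \<omega>\<bar>" by (simp add: abs_mult mult_right_mono)
    qed
    also have "\<dots> \<le> E * r \<omega>"
      using \<open>E \<ge> 0\<close> by (simp add: r_def radius_def sum_distrib_left[symmetric] mult_left_mono)
    finally show "\<bar>\<beta> y \<omega>\<bar> \<le> E * r \<omega>" .
  qed
qed

lemma \<beta>_moment:
  assumes "y \<in> space \<mu>"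
  shows "expectation (\<lambda>\<omega>. poly p (\<beta> y \<omega>)) = (LINT x|std_normal_distribution. poly p x)"
proof -
  have "centered_gaussian M (\<beta> y)" unfolding \<beta>_def by (rule gaussian)
  then have "distr M borel (\<beta> y) = std_normal_distribution"
    by (rule centered_gaussian_distr) (rule sq_unit[OF assms])
  then have "(LINT x|std_normal_distribution. poly p x) = (LINT x|distr M borel (\<beta> y). poly p x)" by simp
  also have "\<dots> = expectation (\<lambda>\<omega>. poly p (\<beta> y \<omega>))"
    using assms by (intro integral_distr) (auto simp: poly_altdef)
  finally show ?thesis ..
qed

subsubsection \<open>Functionals\<close>

definition \<Phi> where "\<Phi> p \<theta> x = (LINT z|\<mu>. \<theta> z * poly p (\<Sum>i\<in>I. e z i * x i))"

lemma \<Phi>_\<xi>: "\<Phi> p \<theta> (\<lambda>i. \<xi> i \<omega>) = (LINT z|\<mu>. \<theta> z * poly p (\<beta> z \<omega>))"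
  by (simp add: \<Phi>_def \<beta>_def)

lemma \<Phi>_poly_growth: "bounded_measurable \<mu> \<theta> \<Longrightarrow> poly_growth I (\<Phi> p \<theta>)"
proof -
  assume \<theta>: "bounded_measurable \<mu> \<theta>"
  have "separated \<mu> I (\<lambda>z x. \<Sum>i\<in>I. e z i * x i)"
    by (intro separated_sum separated.product e poly_growth_coord finite_I)
  then have "separated \<mu> I (\<lambda>z x. poly p (\<Sum>i\<in>I. e z i * x i))"
    by (rule separated_poly)
  moreover have "separated \<mu> I (\<lambda>z x. \<theta> z * 1)"
    by (intro separated.product \<theta> poly_growth_const)
  ultimately show ?thesis
    unfolding \<Phi>_def by (intro Y.poly_growth_integral_separated separated_mult) auto
qed

text \<open>A step \<open>s\<close> in the direction \<open>\<gamma> y\<close> shifts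
  \<open>\<beta> z\<close> by \<open>s * \<rho> z y\<close>, so the derivative acts on the
  polynomial and multiplies the weight by a covariance.\<close>

lemma \<Phi>_deriv:
  assumes \<theta>: "bounded_measurable \<mu> \<theta>"
  shows "((\<lambda>s. \<Phi> p \<theta> (\<lambda>i. x i + s * \<gamma> y i)) has_real_derivative \<Phi> (pderiv p) (\<lambda>z. \<theta> z * \<rho> z y) x) (at 0)"
proof -
  have lin: "(\<Sum>i\<in>I. e z i * (x i + s * \<gamma> y i)) = (\<Sum>i\<in>I. e z i * x i) + s * \<rho> z y" for z s
    by (simp add: \<rho>_def ring_distribs sum.distrib sum_distrib_left mult.left_commute)
  have "((\<lambda>s. LINT z|\<mu>. \<theta> z * poly p ((\<Sum>i\<in>I. e z i * x i) + s * \<rho> z y)) has_real_derivative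
     (LINT z|\<mu>. \<theta> z * \<rho> z y * poly (pderiv p) (\<Sum>i\<in>I. e z i * x i))) (at 0)"
    unfolding \<rho>_def by (intro Y.DERIV_integral_poly \<theta> bounded_measurable_intros e)
  then show ?thesis by (simp add: \<Phi>_def lin)
qed

text \<open>Since \<open>\<rho> y y = 1\<close>, the value \<open>\<beta> y\<close> grows at unit
  rate in the direction \<open>\<gamma> y\<close>. The term in which Stein's identity differentiates
  the Hermite factor therefore cancels the derivative in \<open>hermite_Suc\<close>, and only the
  derivative of \<open>P\<close> is left.\<close>

lemma hermite_ibp:
  assumes y: "y \<in> space \<mu>" and P: "poly_growth I P" and P': "poly_growth I P'"
    and d: "\<And>x. ((\<lambda>s. P (\<lambda>i. x i + s * \<gamma> y i)) has_real_derivative P' x) (at 0)"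
  shows "expectation (\<lambda>\<omega>. poly (hermite (Suc m)) (\<beta> y \<omega>) * P (\<lambda>i. \<xi> i \<omega>)) =
     expectation (\<lambda>\<omega>. poly (hermite m) (\<beta> y \<omega>) * P' (\<lambda>i. \<xi> i \<omega>))"
proof -
  let ?h = "hermite m" and ?h' = "pderiv (hermite m)"
  let ?l = "\<lambda>x. \<Sum>i\<in>I. e y i * x i"
  have pg: "poly_growth I (\<lambda>x. poly p (?l x))" for p
    by (intro poly_growth_poly poly_growth_linear finite_I)
  have int: "integrable M (\<lambda>\<omega>. poly p (\<beta> y \<omega>) * Q (\<lambda>i. \<xi> i \<omega>))" if "poly_growth I Q" for p Q
    unfolding \<beta>_def by (rule pg_integrable[OF poly_growth_mult[OF pg that]])
  have "\<rho> y y = 1" using y by (simp add: \<rho>_eq sq_unit flip: power2_eq_square)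
  then have l: "?l (\<lambda>i. x i + s * \<gamma> y i) = ?l x + s" for x s
    by (simp add: \<rho>_def ring_distribs sum.distrib sum_distrib_left[symmetric] mult.left_commute)
  have "expectation (\<lambda>\<omega>. \<beta> y \<omega> * (poly ?h (?l (\<lambda>i. \<xi> i \<omega>)) * P (\<lambda>i. \<xi> i \<omega>))) =
     expectation (\<lambda>\<omega>. poly ?h' (?l (\<lambda>i. \<xi> i \<omega>)) * P (\<lambda>i. \<xi> i \<omega>) + P' (\<lambda>i. \<xi> i \<omega>) * poly ?h (?l (\<lambda>i. \<xi> i \<omega>)))"
  proof (rule stein[where c = "e y" and \<gamma> = "\<gamma> y"])
    fix x
    have "((\<lambda>s. poly ?h (?l x + s)) has_real_derivative poly ?h' (?l x + 0) * (0 + 1)) (at 0)"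
      by (rule DERIV_chain2[OF poly_DERIV]) (auto intro!: derivative_eq_intros)
    then have "((\<lambda>s. poly ?h (?l x + s)) has_real_derivative poly ?h' (?l x)) (at 0)" by simp
    from DERIV_mult[OF this d[of x]]
    show "((\<lambda>s. poly ?h (?l (\<lambda>i. x i + s * \<gamma> y i)) * P (\<lambda>i. x i + s * \<gamma> y i)) has_real_derivative
        poly ?h' (?l x) * P x + P' x * poly ?h (?l x)) (at 0)"
      unfolding l by simp
  qed (use y in \<open>auto simp: \<beta>_def fun_eq_iff \<gamma>_eq unit intro!: poly_growth_add poly_growth_mult pg P P'\<close>)
  then have st: "expectation (\<lambda>\<omega>. \<beta> y \<omega> * (poly ?h (\<beta> y \<omega>) * P (\<lambda>i. \<xi> i \<omega>))) =
     expectation (\<lambda>\<omega>. poly ?h' (\<beta> y \<omega>) * P (\<lambda>i. \<xi> i \<omega>) + poly ?h (\<beta> y \<omega>) * P' (\<lambda>i. \<xi> i \<omega>))"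
    by (simp add: \<beta>_def mult.commute)
  have "expectation (\<lambda>\<omega>. poly (hermite (Suc m)) (\<beta> y \<omega>) * P (\<lambda>i. \<xi> i \<omega>)) =
    expectation (\<lambda>\<omega>. \<beta> y \<omega> * (poly ?h (\<beta> y \<omega>) * P (\<lambda>i. \<xi> i \<omega>)) - poly ?h' (\<beta> y \<omega>) * P (\<lambda>i. \<xi> i \<omega>))"
    by (simp add: hermite_Suc algebra_simps)
  also have "\<dots> = expectation (\<lambda>\<omega>. \<beta> y \<omega> * (poly ?h (\<beta> y \<omega>) * P (\<lambda>i. \<xi> i \<omega>)))
      - expectation (\<lambda>\<omega>. poly ?h' (\<beta> y \<omega>) * P (\<lambda>i. \<xi> i \<omega>))"
    using int[OF P, of "[:0, 1:] * ?h"] int[OF P, of ?h'] by (intro Bochner_Integration.integral_diff) (simp_all add: mult.assoc)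
  also have "\<dots> = expectation (\<lambda>\<omega>. poly ?h (\<beta> y \<omega>) * P' (\<lambda>i. \<xi> i \<omega>))"
    unfolding st using int[OF P, of ?h'] int[OF P', of ?h] by simp
  finally show ?thesis .
qed

subsubsection \<open>Functions on the product space\<close>

text \<open>A bound by a power of \<open>r\<close> that is uniform in the point serves twice: for
  Fubini over the product space, and for bounded functions of the point at each fixed
  outcome.\<close>

definition nice :: "('y \<Rightarrow> 'w \<Rightarrow> real) \<Rightarrow> bool" where
  "nice k \<longleftrightarrow> (\<lambda>z. k (fst z) (snd z)) \<in> borel_measurable (\<mu> \<Otimes>\<^sub>M M) \<and>
     (\<exists>C K. C \<ge> 0 \<and> (\<forall>y\<in>space \<mu>. \<forall>\<omega>\<in>space M. \<bar>k y \<omega>\<bar> \<le> C * r \<omega> ^ K))"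

lemma nice_measurable: "nice k \<Longrightarrow> (\<lambda>z. k (fst z) (snd z)) \<in> borel_measurable (\<mu> \<Otimes>\<^sub>M M)"
  by (simp add: nice_def)

lemma nice_section: "nice k \<Longrightarrow> y \<in> space \<mu> \<Longrightarrow> k y \<in> borel_measurable M"
  using measurable_compose[OF measurable_Pair1'[of y \<mu> M] nice_measurable[of k]] by simp

lemma nice_section2: "nice k \<Longrightarrow> \<omega> \<in> space M \<Longrightarrow> (\<lambda>y. k y \<omega>) \<in> borel_measurable \<mu>"
  using measurable_compose[OF measurable_Pair2'[of \<omega> M \<mu>] nice_measurable[of k]] by simp

lemma niceI:
  assumes "(\<lambda>z. k (fst z) (snd z)) \<in> borel_measurable (\<mu> \<Otimes>\<^sub>M M)" "C \<ge> 0"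
    "\<And>y \<omega>. y \<in> space \<mu> \<Longrightarrow> \<omega> \<in> space M \<Longrightarrow> \<bar>k y \<omega>\<bar> \<le> C * r \<omega> ^ K"
  shows "nice k"
  using assms unfolding nice_def by blast

lemma nice_mult:
  assumes "nice k" "nice l" shows "nice (\<lambda>y \<omega>. k y \<omega> * l y \<omega>)"
proof -
  obtain C K where C: "C \<ge> 0" "\<And>y \<omega>. y \<in> space \<mu> \<Longrightarrow> \<omega> \<in> space M \<Longrightarrow> \<bar>k y \<omega>\<bar> \<le> C * r \<omega> ^ K"
    using assms(1) unfolding nice_def by blast
  obtain D L where D: "D \<ge> 0" "\<And>y \<omega>. y \<in> space \<mu> \<Longrightarrow> \<omega> \<in> space M \<Longrightarrow> \<bar>l y \<omega>\<bar> \<le> D * r \<omega> ^ L"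
    using assms(2) unfolding nice_def by blast
  show ?thesis
  proof (rule niceI[where C = "C * D" and K = "K + L"])
    fix y \<omega> assume "y \<in> space \<mu>" "\<omega> \<in> space M"
    then have "\<bar>k y \<omega>\<bar> * \<bar>l y \<omega>\<bar> \<le> (C * r \<omega> ^ K) * (D * r \<omega> ^ L)"
      using C D r_ge_1[of \<omega>] by (intro mult_mono) auto
    then show "\<bar>k y \<omega> * l y \<omega>\<bar> \<le> C * D * r \<omega> ^ (K + L)" by (simp add: abs_mult power_add mult_ac)
  qed (use C D assms[THEN nice_measurable] in auto)
qed

lemma nice_power: "nice k \<Longrightarrow> nice (\<lambda>y \<omega>. k y \<omega> ^ n)"
proof (induction n)
  case 0 show ?case by (rule niceI[where C = 1 and K = 0]) auto
next
  case (Suc n) then show ?case using nice_mult[of k "\<lambda>y \<omega>. k y \<omega> ^ n"] by simp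
qed

lemma nice_bounded:
  assumes "bounded_measurable \<mu> f" shows "nice (\<lambda>y \<omega>. f y)"
proof -
  obtain B where B: "\<And>y. y \<in> space \<mu> \<Longrightarrow> \<bar>f y\<bar> \<le> B" using assms by (auto simp: bounded_measurable_def)
  have [measurable]: "f \<in> borel_measurable \<mu>" using assms by (rule bounded_measurableD)
  show ?thesis
  proof (rule niceI[where C = "\<bar>B\<bar>" and K = 0])
    show "\<bar>f y\<bar> \<le> \<bar>B\<bar> * r \<omega> ^ 0" if "y \<in> space \<mu>" for y \<omega> using B[OF that] by simp
  qed auto
qed

lemma nice_poly_growth:
  assumes "poly_growth I u" shows "nice (\<lambda>y \<omega>. u (\<lambda>i. \<xi> i \<omega>))"
proof -
  obtain C K where C: "C \<ge> 0" "\<And>x. \<bar>u x\<bar> \<le> C * radius I x ^ K" using poly_growthE[OF assms] by blast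
  have [measurable]: "(\<lambda>\<omega>. u (\<lambda>i. \<xi> i \<omega>)) \<in> borel_measurable M" by (rule pg_measurable[OF assms])
  show ?thesis by (rule niceI[where C = C and K = K]) (use C in \<open>auto simp: r_def\<close>)
qed

lemma poly_\<beta>_bound: "\<exists>C\<ge>0. \<exists>K. \<forall>y\<in>space \<mu>. \<forall>\<omega>. \<bar>poly p (\<beta> y \<omega>)\<bar> \<le> C * r \<omega> ^ K"
proof -
  obtain E where E: "E \<ge> 0" "\<And>y \<omega>. y \<in> space \<mu> \<Longrightarrow> \<bar>\<beta> y \<omega>\<bar> \<le> E * r \<omega>" using \<beta>_bound by blast
  obtain C where C: "C \<ge> 0" "\<And>x. \<bar>poly p x\<bar> \<le> C * (1 + \<bar>x\<bar>) ^ degree p" using poly_abs_bound[of p] by blast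
  have "\<bar>poly p (\<beta> y \<omega>)\<bar> \<le> (C * (1 + E) ^ degree p) * r \<omega> ^ degree p" if y: "y \<in> space \<mu>" for y \<omega>
  proof -
    have "1 + \<bar>\<beta> y \<omega>\<bar> \<le> (1 + E) * r \<omega>" using E(2)[OF y, of \<omega>] r_ge_1[of \<omega>] by (simp add: ring_distribs)
    then have "(1 + \<bar>\<beta> y \<omega>\<bar>) ^ degree p \<le> ((1 + E) * r \<omega>) ^ degree p" by (intro power_mono) auto
    then have "C * (1 + \<bar>\<beta> y \<omega>\<bar>) ^ degree p \<le> C * ((1 + E) * r \<omega>) ^ degree p"
      using C(1) by (rule mult_left_mono)
    then show ?thesis using C(2)[of "\<beta> y \<omega>"] by (simp add: power_mult_distrib mult_ac)
  qed
  then show ?thesis using C(1) E(1) by (intro exI[of _ "C * (1 + E) ^ degree p"] conjI exI[of _ "degree p"]) auto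
qed

lemma nice_poly: "nice (\<lambda>y \<omega>. poly p (\<beta> y \<omega>))"
proof -
  obtain C K where "C \<ge> 0" "\<And>y \<omega>. y \<in> space \<mu> \<Longrightarrow> \<bar>poly p (\<beta> y \<omega>)\<bar> \<le> C * r \<omega> ^ K"
    using poly_\<beta>_bound[of p] by blast
  moreover have "(\<lambda>z. poly p (\<beta> (fst z) (snd z))) \<in> borel_measurable (\<mu> \<Otimes>\<^sub>M M)"
    unfolding poly_altdef by measurable
  ultimately show ?thesis by (intro niceI)
qed

sublocale YM: pair_sigma_finite \<mu> M ..

lemma nice_integrable:
  assumes "nice k" shows "integrable (\<mu> \<Otimes>\<^sub>M M) (\<lambda>z. k (fst z) (snd z))"
proof -
  obtain C K where C: "C \<ge> 0" "\<And>y \<omega>. y \<in> space \<mu> \<Longrightarrow> \<omega> \<in> space M \<Longrightarrow> \<bar>k y \<omega>\<bar> \<le> C * r \<omega> ^ K"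
    using assms unfolding nice_def by blast
  show ?thesis
  proof (rule Bochner_Integration.integrable_bound)
    show "integrable (\<mu> \<Otimes>\<^sub>M M) (\<lambda>z. C * r (snd z) ^ K)"
      using integrable_pair_mult[of \<mu> M "\<lambda>_. C" "\<lambda>\<omega>. r \<omega> ^ K"] r_integrable
      by (simp add: Y.sigma_finite_measure_axioms sigma_finite_measure_axioms)
    show "AE z in \<mu> \<Otimes>\<^sub>M M. norm (k (fst z) (snd z)) \<le> norm (C * r (snd z) ^ K)"
      using C(2) by (intro AE_I2) (auto simp: space_pair_measure intro: order_trans[OF _ abs_ge_self])
  qed (rule nice_measurable[OF assms])
qed

lemma nice_section_integrable:
  assumes "nice k" "y \<in> space \<mu>" shows "integrable M (k y)"
proof -
  obtain C K where C: "C \<ge> 0" "\<And>y \<omega>. y \<in> space \<mu> \<Longrightarrow> \<omega> \<in> space M \<Longrightarrow> \<bar>k y \<omega>\<bar> \<le> C * r \<omega> ^ K"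
    using assms(1) unfolding nice_def by blast
  show ?thesis
    by (rule Bochner_Integration.integrable_bound[where f = "\<lambda>\<omega>. C * r \<omega> ^ K"])
       (use C(2) assms(2) r_integrable nice_section[OF assms] in \<open>auto intro!: AE_I2 intro: order_trans[OF _ abs_ge_self]\<close>)
qed

lemma nice_bounded_section:
  assumes "nice k" "\<omega> \<in> space M" shows "bounded_measurable \<mu> (\<lambda>y. k y \<omega>)"
proof -
  obtain C K where "\<And>y \<omega>. y \<in> space \<mu> \<Longrightarrow> \<omega> \<in> space M \<Longrightarrow> \<bar>k y \<omega>\<bar> \<le> C * r \<omega> ^ K"
    using assms(1) unfolding nice_def by blast
  then show ?thesis using assms by (intro bounded_measurableI[where B = "C * r \<omega> ^ K"] nice_section2)
qed

lemma nice_fubini: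
  assumes "nice k"
  shows "(LINT y|\<mu>. expectation (k y)) = expectation (\<lambda>\<omega>. LINT y|\<mu>. k y \<omega>)"
  using YM.Fubini_integral[of "\<lambda>y \<omega>. k y \<omega>"] nice_integrable[OF assms] by (simp add: case_prod_beta')

lemma nice_outer_integrable:
  assumes "nice k" shows "integrable \<mu> (\<lambda>y. expectation (k y))"
  using YM.integrable_fst'[OF nice_integrable[OF assms]] by simp

lemma nice_inner_integrable:
  assumes "nice k" shows "integrable M (\<lambda>\<omega>. LINT y|\<mu>. k y \<omega>)"
  using YM.integrable_snd[of "\<lambda>y \<omega>. k y \<omega>"] nice_integrable[OF assms] by (simp add: case_prod_beta')

end

section \<open>Derivatives of Hermite functionals and their mean-square size\<close>

definition hermite_moment :: "nat \<Rightarrow> nat \<Rightarrow> real" where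
  "hermite_moment m k = (LINT x|std_normal_distribution. poly (hermite m ^ k) x)"

text \<open>Second moments enter in \<open>W_square_le\<close>, fourth and eighth ones in
  \<open>W_1_weighted\<close>; summing over \<open>m\<close> gives one constant for all degrees that
  occur.\<close>

definition moment_sum :: "nat \<Rightarrow> real" where
  "moment_sum q = (\<Sum>m\<le>q. hermite_moment m 2 + hermite_moment m 4 + hermite_moment m 8)"

lemma hermite_moment_nonneg: "even k \<Longrightarrow> 0 \<le> hermite_moment m k"
  unfolding hermite_moment_def by (simp add: poly_power zero_le_power_eq)

lemma hermite_moment_le:
  assumes "m \<le> q" shows "hermite_moment m 2 \<le> moment_sum q" "hermite_moment m 4 \<le> moment_sum q"
    "hermite_moment m 8 \<le> moment_sum q"
proof -
  have "hermite_moment m 2 + hermite_moment m 4 + hermite_moment m 8 \<le> moment_sum q"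
    unfolding moment_sum_def using assms hermite_moment_nonneg by (intro member_le_sum) auto
  then show "hermite_moment m 2 \<le> moment_sum q" "hermite_moment m 4 \<le> moment_sum q"
    "hermite_moment m 8 \<le> moment_sum q"
    using hermite_moment_nonneg[of 2 m] hermite_moment_nonneg[of 4 m] hermite_moment_nonneg[of 8 m] by auto
qed

lemma moment_sum_nonneg: "0 \<le> moment_sum q"
  unfolding moment_sum_def by (intro sum_nonneg add_nonneg_nonneg hermite_moment_nonneg) auto

text \<open>At each step of \<open>A_approx\<close> the accumulated error is multiplied by the
  Hermite factor of that step and one new error term is added.\<close>

fun recursion_error :: "nat \<Rightarrow> real" where
  "recursion_error 0 = 0"
| "recursion_error (Suc n) = real (Suc n) * recursion_error n + 1"

lemma recursion_error_nonneg: "0 \<le> recursion_error n" by (induction n) auto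

text \<open>
  \<open>d\<close> is the fourth root of a bound for the covariance operator of the field, so that the error
  exponent \<open>7 / 4\<close> of the operator norm needs no fractional powers.
\<close>
locale gaussian_functional = gaussian_expansion M I \<xi> \<mu> e
  for M :: "'w measure" and I :: "'i::countable set" and \<xi> and \<mu> :: "'y measure" and e +
  fixes d \<Psi> :: real and \<psi> :: "'y \<Rightarrow> real" and q :: nat
  assumes d: "d > 0"
    and spectral: "\<And>f. bounded_measurable \<mu> f \<Longrightarrow>
       expectation (\<lambda>\<omega>. (LINT y|\<mu>. f y * (\<Sum>i\<in>I. e y i * \<xi> i \<omega>))\<^sup>2) \<le> d ^ 4 * (LINT y|\<mu>. (f y)\<^sup>2)"
    and \<psi>_measurable [measurable]: "\<psi> \<in> borel_measurable \<mu>"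
    and \<psi>_bound: "\<And>y. y \<in> space \<mu> \<Longrightarrow> \<bar>\<psi> y\<bar> \<le> \<Psi>"
    and \<Psi>: "\<Psi> \<ge> 0" and q: "q \<ge> 1"
begin

lemma \<psi>: "bounded_measurable \<mu> \<psi>"
  by (rule bounded_measurableI[OF \<psi>_measurable \<psi>_bound])

lemma bm_\<rho>: "y \<in> space \<mu> \<Longrightarrow> bounded_measurable \<mu> (\<lambda>z. \<rho> z y)"
  by (rule bounded_measurableI[where B = 1]) (auto intro: \<rho>_bound)

text \<open>The variance of \<open>U f\<close> is the quadratic form of the covariance operator at
  \<open>f\<close>, which is what \<open>spectral\<close> bounds.\<close>

definition U where "U f \<omega> = (LINT y|\<mu>. f y * \<beta> y \<omega>)"
definition cov_op where "cov_op f y = (LINT z|\<mu>. \<rho> y z * f z)"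

lemma U_eq:
  assumes "bounded_measurable \<mu> f"
  shows "U f \<omega> = (\<Sum>i\<in>I. (LINT y|\<mu>. f y * e y i) * \<xi> i \<omega>)"
proof -
  have "integrable \<mu> (\<lambda>y. f y * e y i * \<xi> i \<omega>)" if "i \<in> I" for i
    using that by (intro Y.integrable_bounded_measurable bounded_measurable_intros assms e)
  then have "(LINT y|\<mu>. (\<Sum>i\<in>I. f y * e y i * \<xi> i \<omega>)) = (\<Sum>i\<in>I. (LINT y|\<mu>. f y * e y i * \<xi> i \<omega>))"
    by (intro Bochner_Integration.integral_sum)
  also have "\<dots> = (\<Sum>i\<in>I. (LINT y|\<mu>. f y * e y i) * \<xi> i \<omega>)" by simp
  finally show ?thesis by (simp add: U_def \<beta>_def sum_distrib_left mult.assoc)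
qed

lemma cov_op_eq:
  assumes "bounded_measurable \<mu> f"
  shows "cov_op f y = (\<Sum>i\<in>I. e y i * (\<Sum>k\<in>I. (LINT z|\<mu>. f z * e z k) * R i k))"
proof -
  have i: "integrable \<mu> (\<lambda>z. e y i * (f z * e z k * R i k))" if "k \<in> I" for i k
    using that by (intro Y.integrable_bounded_measurable bounded_measurable_intros assms e)
  have "\<rho> y z * f z = (\<Sum>i\<in>I. \<Sum>k\<in>I. e y i * (f z * e z k * R i k))" for z
    by (simp add: \<rho>_def \<gamma>_def sum_distrib_left sum_distrib_right mult_ac)
  then have "cov_op f y = (\<Sum>i\<in>I. \<Sum>k\<in>I. (LINT z|\<mu>. e y i * (f z * e z k * R i k)))"
    unfolding cov_op_def using i by (simp add: Bochner_Integration.integral_sum)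
  then show ?thesis by (simp add: sum_distrib_left)
qed

lemma bm_cov_op:
  assumes "bounded_measurable \<mu> f" shows "bounded_measurable \<mu> (cov_op f)"
proof -
  have "cov_op f = (\<lambda>y. \<Sum>i\<in>I. e y i * (\<Sum>k\<in>I. (LINT z|\<mu>. f z * e z k) * R i k))"
    using cov_op_eq[OF assms] by (intro ext)
  then show ?thesis by (simp only:) (intro bounded_measurable_intros e)
qed

lemma U_square:
  assumes "bounded_measurable \<mu> f"
  shows "integrable M (\<lambda>\<omega>. (U f \<omega>)\<^sup>2)" "expectation (\<lambda>\<omega>. (U f \<omega>)\<^sup>2) \<le> d ^ 4 * (LINT y|\<mu>. (f y)\<^sup>2)"
  using linear_product(1) spectral[OF assms] by (simp_all add: U_eq[OF assms] power2_eq_square) (simp add: U_eq[OF assms, symmetric] U_def \<beta>_def)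

lemma U_product:
  assumes f: "bounded_measurable \<mu> f" and g: "bounded_measurable \<mu> g"
  shows "expectation (\<lambda>\<omega>. U f \<omega> * U g \<omega>) = (LINT y|\<mu>. f y * cov_op g y)"
proof -
  define G where "G i = (\<Sum>k\<in>I. (LINT z|\<mu>. g z * e z k) * R i k)" for i
  have "integrable \<mu> (\<lambda>y. f y * e y i * G i)" if "i \<in> I" for i
    using that by (intro Y.integrable_bounded_measurable bounded_measurable_intros f e)
  then have "(LINT y|\<mu>. (\<Sum>i\<in>I. f y * e y i * G i)) = (\<Sum>i\<in>I. (LINT y|\<mu>. f y * e y i * G i))"
    by (intro Bochner_Integration.integral_sum)
  also have "\<dots> = (\<Sum>i\<in>I. (LINT y|\<mu>. f y * e y i) * G i)" by simp
  also have "\<dots> = expectation (\<lambda>\<omega>. U f \<omega> * U g \<omega>)"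
    unfolding U_eq[OF f] U_eq[OF g] linear_product(2) G_def ..
  finally show ?thesis unfolding cov_op_eq[OF g] G_def[symmetric] by (simp add: sum_distrib_left mult.assoc)
qed

lemma \<beta>_U_product:
  assumes g: "bounded_measurable \<mu> g"
  shows "integrable M (\<lambda>\<omega>. \<beta> y \<omega> * U g \<omega>)" "expectation (\<lambda>\<omega>. \<beta> y \<omega> * U g \<omega>) = cov_op g y"
  unfolding \<beta>_def U_eq[OF g] cov_op_eq[OF g] by (rule linear_product)+

lemma weighted_am_gm: "a * b \<le> (a\<^sup>2 / c + c * b\<^sup>2) / 2" if "c > 0" for a b c :: real
proof -
  have "0 \<le> (a - c * b)\<^sup>2 / c" using that by simp
  also have "\<dots> = a\<^sup>2 / c + c * b\<^sup>2 - 2 * (a * b)"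
    using that by (simp add: power2_eq_square field_simps)
  finally show ?thesis by simp
qed

text \<open>The squared norm is the covariance of \<open>U (cov_op f)\<close> and
  \<open>U f\<close>; the weight \<open>d ^ 4\<close> in the arithmetic-geometric mean lets half of
  the left side be absorbed. Thus a bound on the quadratic form becomes one on the operator without
  spectral theory.\<close>

lemma cov_op_norm:
  assumes f: "bounded_measurable \<mu> f"
  shows "(LINT y|\<mu>. (cov_op f y)\<^sup>2) \<le> d ^ 8 * (LINT y|\<mu>. (f y)\<^sup>2)"
proof -
  let ?g = "cov_op f"
  have g: "bounded_measurable \<mu> ?g" by (rule bm_cov_op[OF f])
  have d4: "d ^ 4 > 0" using d by simp
  have "(LINT y|\<mu>. (?g y)\<^sup>2) = expectation (\<lambda>\<omega>. U ?g \<omega> * U f \<omega>)"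
    by (simp add: U_product[OF g f] power2_eq_square)
  also have "\<dots> \<le> expectation (\<lambda>\<omega>. ((U ?g \<omega>)\<^sup>2 / d ^ 4 + d ^ 4 * (U f \<omega>)\<^sup>2) / 2)"
    using linear_product(1) U_square(1)[OF f] U_square(1)[OF g]
    by (intro integral_mono weighted_am_gm d4) (simp_all add: U_eq[OF f] U_eq[OF g])
  also have "\<dots> = (expectation (\<lambda>\<omega>. (U ?g \<omega>)\<^sup>2) / d ^ 4 + d ^ 4 * expectation (\<lambda>\<omega>. (U f \<omega>)\<^sup>2)) / 2"
    using U_square(1)[OF f] U_square(1)[OF g] by simp
  also have "\<dots> \<le> ((LINT y|\<mu>. (?g y)\<^sup>2) + d ^ 4 * (d ^ 4 * (LINT y|\<mu>. (f y)\<^sup>2))) / 2"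
    using U_square(2)[OF f] U_square(2)[OF g] d4
    by (intro divide_right_mono add_mono mult_left_mono) (simp_all add: divide_le_eq mult.commute)
  finally show ?thesis by (simp flip: mult.assoc power_add)
qed

text \<open>The same absorption, with the unit-variance variable \<open>\<beta> y\<close> in place
  of \<open>U f\<close>. It replaces pointwise decay of the covariance.\<close>

lemma \<rho>_square:
  assumes y: "y \<in> space \<mu>"
  shows "(LINT z|\<mu>. (\<rho> z y)\<^sup>2) \<le> d ^ 4"
proof -
  let ?g = "\<lambda>z. \<rho> z y"
  have g: "bounded_measurable \<mu> ?g" by (rule bm_\<rho>[OF y])
  have d4: "d ^ 4 > 0" using d by simp
  have iy: "integrable M (\<lambda>\<omega>. (\<beta> y \<omega>)\<^sup>2)" using linear_product(1)[of "e y" "e y"] by (simp add: \<beta>_def power2_eq_square)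
  have "(LINT z|\<mu>. (?g z)\<^sup>2) = expectation (\<lambda>\<omega>. \<beta> y \<omega> * U ?g \<omega>)"
    by (simp add: \<beta>_U_product(2)[OF g] cov_op_def power2_eq_square \<rho>_sym[of y])
  also have "\<dots> \<le> expectation (\<lambda>\<omega>. (U ?g \<omega>)\<^sup>2 / d ^ 4 / 2 + d ^ 4 * (\<beta> y \<omega>)\<^sup>2 / 2)"
  proof (rule integral_mono)
    show "\<beta> y \<omega> * U ?g \<omega> \<le> (U ?g \<omega>)\<^sup>2 / d ^ 4 / 2 + d ^ 4 * (\<beta> y \<omega>)\<^sup>2 / 2" for \<omega>
      using weighted_am_gm[OF d4, of "U ?g \<omega>" "\<beta> y \<omega>"] by (simp add: mult.commute add_divide_distrib)
  qed (use \<beta>_U_product(1)[OF g] U_square(1)[OF g] iy in auto)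
  also have "\<dots> = expectation (\<lambda>\<omega>. (U ?g \<omega>)\<^sup>2) / d ^ 4 / 2 + d ^ 4 / 2"
    using U_square(1)[OF g] iy sq_unit[OF y] by simp
  also have "\<dots> \<le> (LINT z|\<mu>. (?g z)\<^sup>2) / 2 + d ^ 4 / 2"
    using U_square(2)[OF g] d4
    by (intro divide_right_mono add_mono) (simp_all add: divide_le_eq mult.commute)
  finally show ?thesis by simp
qed

text \<open>Up to a constant, \<open>W k y\<close> is the \<open>k\<close>-th derivative of
  \<open>F\<close> in the direction \<open>\<gamma> y\<close>. For \<open>k = q\<close> it is
  deterministic.\<close>

definition W where "W k y \<omega> = (LINT z|\<mu>. \<psi> z * \<rho> z y ^ k * poly (hermite (q - k)) (\<beta> z \<omega>))"

definition F where "F \<omega> = (LINT z|\<mu>. \<psi> z * poly (hermite q) (\<beta> z \<omega>))"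

lemma W_0: "W 0 y = F" by (simp add: W_def F_def fun_eq_iff)

lemma nice_W: "nice (W k)"
proof -
  obtain C K where C: "C \<ge> 0" "\<And>y \<omega>. y \<in> space \<mu> \<Longrightarrow> \<bar>poly (hermite (q - k)) (\<beta> y \<omega>)\<bar> \<le> C * r \<omega> ^ K"
    using poly_\<beta>_bound[of "hermite (q - k)"] by blast
  show ?thesis
  proof (rule niceI[where C = "\<Psi> * C * measure \<mu> (space \<mu>)" and K = K])
    show "(\<lambda>z. W k (fst z) (snd z)) \<in> borel_measurable (\<mu> \<Otimes>\<^sub>M M)"
      unfolding W_def poly_altdef by measurable
    show "0 \<le> \<Psi> * C * measure \<mu> (space \<mu>)" using \<Psi> C by simp
    fix y \<omega> assume y: "y \<in> space \<mu>" "\<omega> \<in> space M"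
    have "bounded_measurable \<mu> (\<lambda>z. \<psi> z * \<rho> z y ^ k * poly (hermite (q - k)) (\<beta> z \<omega>))"
      by (intro bounded_measurable_intros \<psi> bm_\<rho> y nice_bounded_section[OF nice_poly])
    then have int: "integrable \<mu> (\<lambda>z. \<psi> z * \<rho> z y ^ k * poly (hermite (q - k)) (\<beta> z \<omega>))"
      by (rule Y.integrable_bounded_measurable)
    have "\<bar>W k y \<omega>\<bar> \<le> (LINT z|\<mu>. \<bar>\<psi> z * \<rho> z y ^ k * poly (hermite (q - k)) (\<beta> z \<omega>)\<bar>)"
      unfolding W_def by (rule integral_abs_bound)
    also have "\<dots> \<le> (LINT z|\<mu>. \<Psi> * 1 * (C * r \<omega> ^ K))"
    proof (rule integral_mono_AE)
      show "AE z in \<mu>. \<bar>\<psi> z * \<rho> z y ^ k * poly (hermite (q - k)) (\<beta> z \<omega>)\<bar> \<le> \<Psi> * 1 * (C * r \<omega> ^ K)"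
        unfolding abs_mult power_abs using y C(2) \<psi>_bound \<rho>_bound \<Psi>
        by (intro AE_I2 mult_mono power_le_one) auto
    qed (use int in auto)
    finally show "\<bar>W k y \<omega>\<bar> \<le> \<Psi> * C * measure \<mu> (space \<mu>) * r \<omega> ^ K" by (simp add: mult_ac)
  qed
qed

definition mass where "mass = measure \<mu> (space \<mu>)"

lemma mass_nonneg: "0 \<le> mass" by (simp add: mass_def)

lemma integral_hermite_moment:
  "expectation (\<lambda>\<omega>. LINT y|\<mu>. poly (hermite m) (\<beta> y \<omega>) ^ k) = mass * hermite_moment m k"
proof -
  have "expectation (\<lambda>\<omega>. LINT y|\<mu>. poly (hermite m) (\<beta> y \<omega>) ^ k) = (LINT y|\<mu>. expectation (\<lambda>\<omega>. poly (hermite m) (\<beta> y \<omega>) ^ k))"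
    by (rule nice_fubini[symmetric, OF nice_power[OF nice_poly]])
  also have "\<dots> = (LINT y|\<mu>. hermite_moment m k)"
    by (rule Bochner_Integration.integral_cong[OF refl])
       (use \<beta>_moment[where p = "hermite m ^ k"] in \<open>simp add: hermite_moment_def poly_power\<close>)
  finally show ?thesis by (simp add: mass_def)
qed

text \<open>Cauchy-Schwarz spends one covariance factor on \<open>\<rho>_square\<close> and keeps
  the other \<open>k\<close> for a later integration over \<open>y\<close>.\<close>

lemma W_pointwise:
  assumes y: "y \<in> space \<mu>" and \<omega>: "\<omega> \<in> space M"
  shows "(W (Suc k) y \<omega>)\<^sup>2 \<le> d ^ 4 * \<Psi>\<^sup>2 * (LINT z|\<mu>. \<rho> z y ^ (2 * k) * (poly (hermite (q - Suc k)) (\<beta> z \<omega>))\<^sup>2)"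
proof -
  let ?H = "\<lambda>z. poly (hermite (q - Suc k)) (\<beta> z \<omega>)"
  have H: "bounded_measurable \<mu> ?H" by (rule nice_bounded_section[OF nice_poly \<omega>])
  note bm = bounded_measurable_intros H \<psi> bm_\<rho>[OF y]
  have "W (Suc k) y \<omega> = (LINT z|\<mu>. \<rho> z y * (\<psi> z * \<rho> z y ^ k * ?H z))"
    by (simp add: W_def mult_ac)
  then have "(W (Suc k) y \<omega>)\<^sup>2 \<le> (LINT z|\<mu>. (\<rho> z y)\<^sup>2) * (LINT z|\<mu>. (\<psi> z * \<rho> z y ^ k * ?H z)\<^sup>2)"
    by (simp only:) (intro integral_cauchy_schwarz Y.integrable_bounded_measurable bm)
  also have "\<dots> \<le> d ^ 4 * (LINT z|\<mu>. \<Psi>\<^sup>2 * (\<rho> z y ^ (2 * k) * (?H z)\<^sup>2))"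
  proof (intro mult_mono \<rho>_square y)
    show "(LINT z|\<mu>. (\<psi> z * \<rho> z y ^ k * ?H z)\<^sup>2) \<le> (LINT z|\<mu>. \<Psi>\<^sup>2 * (\<rho> z y ^ (2 * k) * (?H z)\<^sup>2))"
    proof (rule integral_mono_AE)
      show "AE z in \<mu>. (\<psi> z * \<rho> z y ^ k * ?H z)\<^sup>2 \<le> \<Psi>\<^sup>2 * (\<rho> z y ^ (2 * k) * (?H z)\<^sup>2)"
      proof (intro AE_I2)
        fix z assume "z \<in> space \<mu>"
        then have "(\<psi> z)\<^sup>2 \<le> \<Psi>\<^sup>2" using \<psi>_bound by (simp add: abs_le_square_iff[symmetric] \<Psi>)
        then show "(\<psi> z * \<rho> z y ^ k * ?H z)\<^sup>2 \<le> \<Psi>\<^sup>2 * (\<rho> z y ^ (2 * k) * (?H z)\<^sup>2)"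
          unfolding power_mult_distrib power_mult[symmetric] mult.assoc mult.commute[of k 2]
          by (intro mult_right_mono mult_nonneg_nonneg) simp_all
      qed
    qed (intro Y.integrable_bounded_measurable bm)+
  qed simp_all
  finally show ?thesis by (simp add: mult.assoc)
qed

text \<open>For \<open>k = 1\<close> the pointwise bound has no covariance left to integrate over
  \<open>y\<close>, but \<open>W 1\<close> is the covariance operator applied to a function, so
  \<open>cov_op_norm\<close> applies. For \<open>k \<ge> 2\<close> the surplus powers are reduced to
  \<open>\<rho>\<^sup>2\<close>, whose integral over \<open>y\<close> gives the second factor
  \<open>d ^ 4\<close>.\<close>

lemma W_square_le:
  assumes k: "1 \<le> k" "k \<le> q"
  shows "(LINT y|\<mu>. expectation (\<lambda>\<omega>. (W k y \<omega>)\<^sup>2)) \<le> d ^ 8 * \<Psi>\<^sup>2 * (mass * moment_sum q)"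
proof -
  let ?H = "\<lambda>z \<omega>. poly (hermite (q - k)) (\<beta> z \<omega>)"
  have "(LINT y|\<mu>. (W k y \<omega>)\<^sup>2) \<le> d ^ 8 * \<Psi>\<^sup>2 * (LINT z|\<mu>. (?H z \<omega>)\<^sup>2)" if \<omega>: "\<omega> \<in> space M" for \<omega>
  proof -
    have H: "bounded_measurable \<mu> (\<lambda>z. ?H z \<omega>)" by (rule nice_bounded_section[OF nice_poly \<omega>])
    note bm = bounded_measurable_intros H \<psi>
    show ?thesis
    proof (cases "k = 1")
      case True
      have "W k y \<omega> = cov_op (\<lambda>z. \<psi> z * ?H z \<omega>) y" for y
        by (simp add: W_def cov_op_def True \<rho>_sym[of y] mult_ac)
      then have "(LINT y|\<mu>. (W k y \<omega>)\<^sup>2) \<le> d ^ 8 * (LINT y|\<mu>. (\<psi> y * ?H y \<omega>)\<^sup>2)"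
        by (simp only:) (intro cov_op_norm bm)
      also have "(LINT y|\<mu>. (\<psi> y * ?H y \<omega>)\<^sup>2) \<le> (LINT y|\<mu>. \<Psi>\<^sup>2 * (?H y \<omega>)\<^sup>2)"
      proof (rule integral_mono_AE)
        show "AE z in \<mu>. (\<psi> z * ?H z \<omega>)\<^sup>2 \<le> \<Psi>\<^sup>2 * (?H z \<omega>)\<^sup>2"
          using \<psi>_bound \<Psi> by (intro AE_I2) (auto simp: power_mult_distrib abs_le_square_iff[symmetric] intro!: mult_right_mono)
      qed (intro Y.integrable_bounded_measurable bm)+
      finally show ?thesis using d by (simp add: mult.assoc)
    next
      case False
      with k obtain l where l: "k = Suc (Suc l)" by (metis One_nat_def Suc_le_D le_SucE le_zero_eq not0_implies_Suc)
      interpret YY: pair_sigma_finite \<mu> \<mu> ..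
      have H': "bounded_measurable (\<mu> \<Otimes>\<^sub>M \<mu>) (\<lambda>w. (\<rho> (snd w) (fst w))\<^sup>2 * (?H (snd w) \<omega>)\<^sup>2)"
      proof -
        have [measurable]: "(\<lambda>z. ?H z \<omega>) \<in> borel_measurable \<mu>" by (rule bounded_measurableD[OF H])
        obtain B where B: "\<And>z. z \<in> space \<mu> \<Longrightarrow> \<bar>?H z \<omega>\<bar> \<le> B" using H by (auto simp: bounded_measurable_def)
        have "bounded_measurable (\<mu> \<Otimes>\<^sub>M \<mu>) (\<lambda>w. ?H (snd w) \<omega>)"
          by (rule bounded_measurableI[where B = B]) (use B in \<open>auto simp: space_pair_measure\<close>)
        moreover have "bounded_measurable (\<mu> \<Otimes>\<^sub>M \<mu>) (\<lambda>w. \<rho> (snd w) (fst w))"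
          by (rule bounded_measurableI[where B = 1]) (use \<rho>_bound in \<open>auto simp: space_pair_measure\<close>)
        ultimately show ?thesis by (intro bounded_measurable_mult bounded_measurable_power)
      qed
      interpret P: finite_measure "\<mu> \<Otimes>\<^sub>M \<mu>"
        by (rule finite_measure_pair_measure) unfold_locales
      have int: "integrable (\<mu> \<Otimes>\<^sub>M \<mu>) (\<lambda>(y, z). (\<rho> z y)\<^sup>2 * (?H z \<omega>)\<^sup>2)"
        using P.integrable_bounded_measurable[OF H'] by (simp add: case_prod_beta')
      have "(LINT y|\<mu>. (W k y \<omega>)\<^sup>2) \<le> (LINT y|\<mu>. d ^ 4 * \<Psi>\<^sup>2 * (LINT z|\<mu>. (\<rho> z y)\<^sup>2 * (?H z \<omega>)\<^sup>2))"
      proof (rule integral_mono_AE)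
        show "AE y in \<mu>. (W k y \<omega>)\<^sup>2 \<le> d ^ 4 * \<Psi>\<^sup>2 * (LINT z|\<mu>. (\<rho> z y)\<^sup>2 * (?H z \<omega>)\<^sup>2)"
        proof (intro AE_I2)
          fix y assume y: "y \<in> space \<mu>"
          have "(LINT z|\<mu>. \<rho> z y ^ (2 * Suc l) * (?H z \<omega>)\<^sup>2) \<le> (LINT z|\<mu>. (\<rho> z y)\<^sup>2 * (?H z \<omega>)\<^sup>2)"
          proof (rule integral_mono_AE)
            show "AE z in \<mu>. \<rho> z y ^ (2 * Suc l) * (?H z \<omega>)\<^sup>2 \<le> (\<rho> z y)\<^sup>2 * (?H z \<omega>)\<^sup>2"
            proof (intro AE_I2 mult_right_mono)
              fix z assume "z \<in> space \<mu>"
              then have "(\<rho> z y)\<^sup>2 \<le> 1" using \<rho>_bound[OF _ y] by (simp add: abs_square_le_1)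
              then have "((\<rho> z y)\<^sup>2) ^ Suc l \<le> (\<rho> z y)\<^sup>2" using power_decreasing[of 1 "Suc l" "(\<rho> z y)\<^sup>2"] by simp
              then show "\<rho> z y ^ (2 * Suc l) \<le> (\<rho> z y)\<^sup>2" by (simp only: power_mult)
            qed simp
          qed (intro Y.integrable_bounded_measurable bm bm_\<rho>[OF y])+
          then show "(W k y \<omega>)\<^sup>2 \<le> d ^ 4 * \<Psi>\<^sup>2 * (LINT z|\<mu>. (\<rho> z y)\<^sup>2 * (?H z \<omega>)\<^sup>2)"
            using W_pointwise[OF y \<omega>, of "Suc l"] d mult_left_mono[of _ _ "d ^ 4 * \<Psi>\<^sup>2"]
            unfolding l by (smt (verit) zero_le_power2 mult_nonneg_nonneg zero_le_power)
        qed
      next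
        show "integrable \<mu> (\<lambda>y. (W k y \<omega>)\<^sup>2)"
          by (rule Y.integrable_bounded_measurable[OF nice_bounded_section[OF nice_power[OF nice_W] \<omega>]])
        show "integrable \<mu> (\<lambda>y. d ^ 4 * \<Psi>\<^sup>2 * (LINT z|\<mu>. (\<rho> z y)\<^sup>2 * (?H z \<omega>)\<^sup>2))"
          by (intro integrable_mult_right YY.integrable_fst[OF int])
      qed
      also have "\<dots> = d ^ 4 * \<Psi>\<^sup>2 * (LINT y|\<mu>. LINT z|\<mu>. (\<rho> z y)\<^sup>2 * (?H z \<omega>)\<^sup>2)" by simp
      also have "(LINT y|\<mu>. LINT z|\<mu>. (\<rho> z y)\<^sup>2 * (?H z \<omega>)\<^sup>2) = (LINT z|\<mu>. LINT y|\<mu>. (\<rho> z y)\<^sup>2 * (?H z \<omega>)\<^sup>2)"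
        by (rule YY.Fubini_integral[OF int, symmetric])
      also have "\<dots> \<le> (LINT z|\<mu>. d ^ 4 * (?H z \<omega>)\<^sup>2)"
      proof (rule integral_mono_AE)
        show "integrable \<mu> (\<lambda>z. LINT y|\<mu>. (\<rho> z y)\<^sup>2 * (?H z \<omega>)\<^sup>2)" by (rule YY.integrable_snd[OF int])
        show "AE z in \<mu>. (LINT y|\<mu>. (\<rho> z y)\<^sup>2 * (?H z \<omega>)\<^sup>2) \<le> d ^ 4 * (?H z \<omega>)\<^sup>2"
          using \<rho>_square by (intro AE_I2) (auto simp: \<rho>_sym intro!: mult_right_mono)
      qed (intro Y.integrable_bounded_measurable bm)
      finally show ?thesis using d by (simp add: mult_ac mult_left_mono mult_right_mono flip: power_add)
    qed
  qed
  then have "expectation (\<lambda>\<omega>. LINT y|\<mu>. (W k y \<omega>)\<^sup>2) \<le> expectation (\<lambda>\<omega>. d ^ 8 * \<Psi>\<^sup>2 * (LINT z|\<mu>. (?H z \<omega>)\<^sup>2))"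
    by (intro integral_mono_AE AE_I2 integrable_mult_right nice_inner_integrable nice_power nice_W nice_poly)
  also have "\<dots> = d ^ 8 * \<Psi>\<^sup>2 * (mass * hermite_moment (q - k) 2)" by (simp add: integral_hermite_moment)
  also have "\<dots> \<le> d ^ 8 * \<Psi>\<^sup>2 * (mass * moment_sum q)"
    using hermite_moment_le(1)[of "q - k" q] mass_nonneg by (intro mult_left_mono) auto
  finally show ?thesis by (subst nice_fubini[OF nice_power[OF nice_W]])
qed

end

section \<open>Error terms and the differential equation of the characteristic function\<close>

context gaussian_functional
begin

definition product_integral :: "('y \<Rightarrow> 'w \<Rightarrow> real) \<Rightarrow> real" where
  "product_integral k = (LINT z|(\<mu> \<Otimes>\<^sub>M M). k (fst z) (snd z))"

lemma product_integral_eq: "nice k \<Longrightarrow> (LINT y|\<mu>. expectation (k y)) = product_integral k"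
  unfolding product_integral_def using YM.integral_fst'[OF nice_integrable[of k]] by simp

text \<open>The random weight depends on \<open>y\<close>, which rules out the operator bound; the
  pointwise bound yields only \<open>d ^ 4\<close>, half the exponent of
  \<open>W_square_le\<close>.\<close>

lemma W_1_weighted:
  assumes m: "m \<le> q"
  shows "(LINT y|\<mu>. expectation (\<lambda>\<omega>. poly (hermite m) (\<beta> y \<omega>) ^ 4 * (W 1 y \<omega>)\<^sup>2))
     \<le> d ^ 4 * \<Psi>\<^sup>2 * ((mass + mass ^ 3) * moment_sum q)"
proof -
  let ?h = "\<lambda>z \<omega>. poly (hermite m) (\<beta> z \<omega>)" and ?H = "\<lambda>z \<omega>. poly (hermite (q - 1)) (\<beta> z \<omega>)"
  let ?k = "\<lambda>y \<omega>. ?h y \<omega> ^ 4 * (W 1 y \<omega>)\<^sup>2"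
  have nk: "nice ?k" by (intro nice_mult nice_power nice_poly nice_W)
  have "(LINT y|\<mu>. ?k y \<omega>) \<le> d ^ 4 * \<Psi>\<^sup>2 / 2 * ((LINT y|\<mu>. ?h y \<omega> ^ 8) + mass\<^sup>2 * (LINT y|\<mu>. ?H y \<omega> ^ 4))"
    if \<omega>: "\<omega> \<in> space M" for \<omega>
  proof -
    have h: "bounded_measurable \<mu> (\<lambda>z. ?h z \<omega>)" and H: "bounded_measurable \<mu> (\<lambda>z. ?H z \<omega>)"
      by (rule nice_bounded_section[OF nice_poly \<omega>])+
    note bm = bounded_measurable_intros h H
    define S where "S = (LINT z|\<mu>. (?H z \<omega>)\<^sup>2)"
    have S: "S\<^sup>2 \<le> mass * (LINT z|\<mu>. ?H z \<omega> ^ 4)"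
    proof -
      have "(LINT z|\<mu>. 1 * (?H z \<omega>)\<^sup>2)\<^sup>2 \<le> (LINT z|\<mu>. 1\<^sup>2) * (LINT z|\<mu>. ((?H z \<omega>)\<^sup>2)\<^sup>2)"
        by (intro integral_cauchy_schwarz Y.integrable_bounded_measurable bm)
      then show ?thesis by (simp add: S_def mass_def)
    qed
    have "(LINT y|\<mu>. ?k y \<omega>) \<le> (LINT y|\<mu>. d ^ 4 * \<Psi>\<^sup>2 / 2 * (?h y \<omega> ^ 8 + S\<^sup>2))"
    proof (rule integral_mono_AE)
      show "AE y in \<mu>. ?k y \<omega> \<le> d ^ 4 * \<Psi>\<^sup>2 / 2 * (?h y \<omega> ^ 8 + S\<^sup>2)"
      proof (intro AE_I2)
        fix y assume y: "y \<in> space \<mu>"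
        have "(W 1 y \<omega>)\<^sup>2 \<le> d ^ 4 * \<Psi>\<^sup>2 * S"
          using W_pointwise[OF y \<omega>, of 0] by (simp add: S_def)
        then have "?k y \<omega> \<le> ?h y \<omega> ^ 4 * (d ^ 4 * \<Psi>\<^sup>2 * S)"
          by (intro mult_left_mono) simp_all
        also have "\<dots> = d ^ 4 * \<Psi>\<^sup>2 * (?h y \<omega> ^ 4 * S)" by simp
        also have "\<dots> \<le> d ^ 4 * \<Psi>\<^sup>2 * (((?h y \<omega> ^ 4)\<^sup>2 / 1 + 1 * S\<^sup>2) / 2)"
          by (intro mult_left_mono weighted_am_gm) simp_all
        finally show "?k y \<omega> \<le> d ^ 4 * \<Psi>\<^sup>2 / 2 * (?h y \<omega> ^ 8 + S\<^sup>2)" by (simp flip: power_mult)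
      qed
    qed (intro Y.integrable_bounded_measurable bm nice_bounded_section[OF nk \<omega>])+
    also have "\<dots> = d ^ 4 * \<Psi>\<^sup>2 / 2 * ((LINT y|\<mu>. ?h y \<omega> ^ 8) + mass * S\<^sup>2)"
      using Y.integrable_bounded_measurable[OF bounded_measurable_power[OF h]] by (simp add: mass_def)
    also have "\<dots> \<le> d ^ 4 * \<Psi>\<^sup>2 / 2 * ((LINT y|\<mu>. ?h y \<omega> ^ 8) + mass * (mass * (LINT y|\<mu>. ?H y \<omega> ^ 4)))"
      using S mass_nonneg by (intro mult_left_mono add_left_mono) auto
    finally show ?thesis by (simp add: power2_eq_square mult.assoc)
  qed
  then have "expectation (\<lambda>\<omega>. LINT y|\<mu>. ?k y \<omega>) \<le> expectation (\<lambda>\<omega>.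
      d ^ 4 * \<Psi>\<^sup>2 / 2 * ((LINT y|\<mu>. ?h y \<omega> ^ 8) + mass\<^sup>2 * (LINT y|\<mu>. ?H y \<omega> ^ 4)))"
    by (intro integral_mono_AE AE_I2 integrable_mult_right Bochner_Integration.integrable_add
        nice_inner_integrable nk nice_power nice_poly)
  also have "\<dots> = d ^ 4 * \<Psi>\<^sup>2 / 2 * (mass * hermite_moment m 8 + mass\<^sup>2 * (mass * hermite_moment (q - 1) 4))"
    using nice_inner_integrable[OF nice_power[OF nice_poly]] by (simp add: integral_hermite_moment)
  also have "\<dots> \<le> d ^ 4 * \<Psi>\<^sup>2 / 2 * (mass * moment_sum q + mass\<^sup>2 * (mass * moment_sum q))"
    using hermite_moment_le(3)[OF m] hermite_moment_le(2)[of "q - 1" q] mass_nonneg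
    by (intro mult_left_mono add_mono) auto
  also have "\<dots> \<le> d ^ 4 * \<Psi>\<^sup>2 * (mass * moment_sum q + mass\<^sup>2 * (mass * moment_sum q))"
    using mass_nonneg moment_sum_nonneg[of q] by (intro mult_right_mono) auto
  finally show ?thesis
    unfolding nice_fubini[OF nk]
    by (rule order_trans) (simp add: power2_eq_square power3_eq_cube algebra_simps)
qed

text \<open>One factor \<open>\<Psi>\<close> comes from the outer integral and one from each of the
  two \<open>W\<close> in the error term; the power of \<open>d\<close> is balanced in
  \<open>err_bound\<close>.\<close>

definition error_bound where "error_bound = \<Psi> ^ 3 * d ^ 7 * ((mass + mass ^ 3) * moment_sum q)"

lemma error_bound_nonneg: "0 \<le> error_bound"
  unfolding error_bound_def using \<Psi> d mass_nonneg moment_sum_nonneg by simp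

text \<open>\<open>f\<close> and \<open>w\<close> are \<open>F\<close> and \<open>W\<close> as
  functions of the coordinates, so that they can be differentiated in the direction
  \<open>\<gamma> y\<close>.\<close>

definition f where "f = \<Phi> (hermite q) \<psi>"
definition w where "w k y = \<Phi> (hermite (q - k)) (\<lambda>z. \<psi> z * \<rho> z y ^ k)"

lemma f_\<xi>: "f (\<lambda>i. \<xi> i \<omega>) = F \<omega>" by (simp add: f_def \<Phi>_\<xi> F_def)

lemma w_\<xi>: "w k y (\<lambda>i. \<xi> i \<omega>) = W k y \<omega>" by (simp add: w_def \<Phi>_\<xi> W_def)

lemma f_poly_growth: "poly_growth I f"
  unfolding f_def by (rule \<Phi>_poly_growth[OF \<psi>])

lemma w_poly_growth: "y \<in> space \<mu> \<Longrightarrow> poly_growth I (w k y)"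
  unfolding w_def by (intro \<Phi>_poly_growth bounded_measurable_intros \<psi> bm_\<rho>)

lemma \<Phi>_smult: "\<Phi> (smult c p) \<theta> x = c * \<Phi> p \<theta> x"
  by (simp add: \<Phi>_def mult.left_commute)

lemma w_deriv:
  assumes y: "y \<in> space \<mu>" and k: "k < q"
  shows "((\<lambda>s. w k y (\<lambda>i. x i + s * \<gamma> y i)) has_real_derivative real (q - k) * w (Suc k) y x) (at 0)"
proof -
  have s: "q - k = Suc (q - Suc k)" using k by simp
  have "bounded_measurable \<mu> (\<lambda>z. \<psi> z * \<rho> z y ^ k)" by (intro bounded_measurable_intros \<psi> bm_\<rho> y)
  from \<Phi>_deriv[OF this, of "hermite (Suc (q - Suc k))" x y]
  have "((\<lambda>s. \<Phi> (hermite (Suc (q - Suc k))) (\<lambda>z. \<psi> z * \<rho> z y ^ k) (\<lambda>i. x i + s * \<gamma> y i)) has_real_derivative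
      real (Suc (q - Suc k)) * \<Phi> (hermite (q - Suc k)) (\<lambda>z. \<psi> z * \<rho> z y ^ Suc k) x) (at 0)"
    by (simp only: pderiv_hermite \<Phi>_smult power_Suc2 mult.assoc)
  then show ?thesis unfolding w_def s[symmetric] .
qed

lemma f_deriv:
  assumes y: "y \<in> space \<mu>"
  shows "((\<lambda>s. f (\<lambda>i. x i + s * \<gamma> y i)) has_real_derivative real q * w 1 y x) (at 0)"
proof -
  have "w 0 y = f" by (simp add: w_def f_def)
  then show ?thesis using w_deriv[OF y, of 0 x] q by simp
qed

lemma trig_deriv:
  assumes y: "y \<in> space \<mu>"
  shows "((\<lambda>s. cos (t * f (\<lambda>i. x i + s * \<gamma> y i) + \<theta>)) has_real_derivative - sin (t * f x + \<theta>) * (t * (real q * w 1 y x))) (at 0)"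
    and "((\<lambda>s. sin (t * f (\<lambda>i. x i + s * \<gamma> y i) + \<theta>)) has_real_derivative cos (t * f x + \<theta>) * (t * (real q * w 1 y x))) (at 0)"
proof -
  have d: "((\<lambda>s. t * f (\<lambda>i. x i + s * \<gamma> y i) + \<theta>) has_real_derivative t * (real q * w 1 y x)) (at 0)"
    using DERIV_add[OF DERIV_cmult[OF f_deriv[OF y, of x], of t] DERIV_const[of \<theta>]] by simp
  show "((\<lambda>s. cos (t * f (\<lambda>i. x i + s * \<gamma> y i) + \<theta>)) has_real_derivative - sin (t * f x + \<theta>) * (t * (real q * w 1 y x))) (at 0)"
    using DERIV_chain2[OF DERIV_cos d] by simp
  show "((\<lambda>s. sin (t * f (\<lambda>i. x i + s * \<gamma> y i) + \<theta>)) has_real_derivative cos (t * f x + \<theta>) * (t * (real q * w 1 y x))) (at 0)"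
    using DERIV_chain2[OF DERIV_sin d] by simp
qed

lemma trig_poly_growth: "poly_growth I (\<lambda>x. cos (t * f x + \<theta>))" "poly_growth I (\<lambda>x. sin (t * f x + \<theta>))"
  by (intro poly_growth_cos poly_growth_sin poly_growth_add poly_growth_mult poly_growth_const f_poly_growth)+

lemma nice_trig: "nice (\<lambda>y \<omega>. cos (t * F \<omega> + \<theta>))" "nice (\<lambda>y \<omega>. sin (t * F \<omega> + \<theta>))"
  using nice_poly_growth[OF trig_poly_growth(1)] nice_poly_growth[OF trig_poly_growth(2)] by (simp_all add: f_\<xi>)

text \<open>\<open>A k\<close> is the main term after \<open>k\<close> integrations by parts;
  \<open>err k\<close> collects the contribution in which the derivative meets the trigonometric
  factor.\<close>

definition A where
  "A k t \<theta> = (LINT y|\<mu>. \<psi> y * expectation (\<lambda>\<omega>. poly (hermite (q - k)) (\<beta> y \<omega>) * (W k y \<omega> * cos (t * F \<omega> + \<theta>))))"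

definition err where
  "err k t \<theta> = (LINT y|\<mu>. \<psi> y * expectation (\<lambda>\<omega>. poly (hermite (q - Suc k)) (\<beta> y \<omega>) * (W k y \<omega> * (W 1 y \<omega> * sin (t * F \<omega> + \<theta>)))))"

lemma weighted_integrable:
  assumes "nice k" shows "integrable \<mu> (\<lambda>y. \<psi> y * expectation (k y))"
  using nice_outer_integrable[OF nice_mult[OF nice_bounded[OF \<psi>] assms]] by simp

lemma err_bound:
  assumes k: "1 \<le> k" "k < q"
  shows "\<bar>err k t \<theta>\<bar> \<le> error_bound"
proof -
  let ?h = "\<lambda>y \<omega>. poly (hermite (q - Suc k)) (\<beta> y \<omega>)"
  define l where "l = (\<lambda>y \<omega>. ?h y \<omega> * (W k y \<omega> * (W 1 y \<omega> * sin (t * F \<omega> + \<theta>))))"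
  \<comment> \<open>Two weighted means, with weights \<open>d\<close> and \<open>d\<^sup>2\<close>,
    turn the available bounds \<open>d ^ 8\<close>, \<open>d ^ 8\<close> and \<open>d ^ 4\<close>
    into the shares 1/2, 1/4 and 1/4 of \<open>d ^ 7\<close>.\<close>
  define u where "u = (\<lambda>y \<omega>. (1 / (2 * d)) * (W k y \<omega>)\<^sup>2 + ((1 / (4 * d)) * (W 1 y \<omega>)\<^sup>2 + (d ^ 3 / 4) * (?h y \<omega> ^ 4 * (W 1 y \<omega>)\<^sup>2)))"
  have nl: "nice l" unfolding l_def by (intro nice_mult nice_poly nice_W nice_trig)
  have n1: "nice (\<lambda>y \<omega>. (W k y \<omega>)\<^sup>2)" and n2: "nice (\<lambda>y \<omega>. (W 1 y \<omega>)\<^sup>2)" and n3: "nice (\<lambda>y \<omega>. ?h y \<omega> ^ 4 * (W 1 y \<omega>)\<^sup>2)"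
    by (intro nice_mult nice_power nice_poly nice_W)+
  have lu: "\<bar>l y \<omega>\<bar> \<le> u y \<omega>" for y \<omega>
  proof -
    have "\<bar>l y \<omega>\<bar> \<le> \<bar>W k y \<omega>\<bar> * \<bar>?h y \<omega> * W 1 y \<omega>\<bar>"
    proof -
      have "\<bar>l y \<omega>\<bar> = (\<bar>W k y \<omega>\<bar> * \<bar>?h y \<omega> * W 1 y \<omega>\<bar>) * \<bar>sin (t * F \<omega> + \<theta>)\<bar>" by (simp add: l_def abs_mult)
      also have "\<dots> \<le> (\<bar>W k y \<omega>\<bar> * \<bar>?h y \<omega> * W 1 y \<omega>\<bar>) * 1" by (intro mult_left_mono) auto
      finally show ?thesis by simp
    qed
    also have "\<dots> \<le> ((W k y \<omega>)\<^sup>2 / d + d * (?h y \<omega> * W 1 y \<omega>)\<^sup>2) / 2"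
      using weighted_am_gm[OF d, of "\<bar>W k y \<omega>\<bar>" "\<bar>?h y \<omega> * W 1 y \<omega>\<bar>"] by simp
    also have "\<dots> \<le> ((W k y \<omega>)\<^sup>2 / d + d * (((W 1 y \<omega>)\<^sup>2 / d\<^sup>2 + d\<^sup>2 * ((?h y \<omega>)\<^sup>2 * W 1 y \<omega>)\<^sup>2) / 2)) / 2"
    proof -
      have "(?h y \<omega> * W 1 y \<omega>)\<^sup>2 = W 1 y \<omega> * ((?h y \<omega>)\<^sup>2 * W 1 y \<omega>)" by (simp add: power2_eq_square)
      also have "\<dots> \<le> ((W 1 y \<omega>)\<^sup>2 / d\<^sup>2 + d\<^sup>2 * ((?h y \<omega>)\<^sup>2 * W 1 y \<omega>)\<^sup>2) / 2"
        using d by (intro weighted_am_gm) simp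
      finally show ?thesis using d by (intro divide_right_mono add_left_mono mult_left_mono) auto
    qed
    also have "((?h y \<omega>)\<^sup>2 * W 1 y \<omega>)\<^sup>2 = ?h y \<omega> ^ 4 * (W 1 y \<omega>)\<^sup>2"
      by (simp add: power_mult_distrib flip: power_mult)
    also have "(a / d + d * ((b / d\<^sup>2 + d\<^sup>2 * e) / 2)) / 2 = (1 / (2 * d)) * a + ((1 / (4 * d)) * b + (d ^ 3 / 4) * e)" for a b e
      using d by (simp add: field_simps power2_eq_square power3_eq_cube)
    finally show ?thesis by (simp only: u_def)
  qed
  have "\<bar>err k t \<theta>\<bar> \<le> (LINT y|\<mu>. \<bar>\<psi> y * expectation (l y)\<bar>)"
    unfolding err_def l_def by (rule integral_abs_bound)
  also have "\<dots> \<le> (LINT y|\<mu>. \<Psi> * expectation (\<lambda>\<omega>. \<bar>l y \<omega>\<bar>))"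
  proof (rule integral_mono_AE)
    show "integrable \<mu> (\<lambda>y. \<bar>\<psi> y * expectation (l y)\<bar>)" using weighted_integrable[OF nl] by simp
    have "integrable (\<mu> \<Otimes>\<^sub>M M) (\<lambda>z. \<bar>l (fst z) (snd z)\<bar>)" using nice_integrable[OF nl] by simp
    from YM.integrable_fst'[OF this]
    show "integrable \<mu> (\<lambda>y. \<Psi> * expectation (\<lambda>\<omega>. \<bar>l y \<omega>\<bar>))" by simp
    show "AE y in \<mu>. \<bar>\<psi> y * expectation (l y)\<bar> \<le> \<Psi> * expectation (\<lambda>\<omega>. \<bar>l y \<omega>\<bar>)"
      unfolding abs_mult using \<psi>_bound \<Psi> by (intro AE_I2 mult_mono integral_abs_bound) auto
  qed
  also have "\<dots> = \<Psi> * (LINT z|(\<mu> \<Otimes>\<^sub>M M). \<bar>l (fst z) (snd z)\<bar>)"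
    using YM.integral_fst'[of "\<lambda>z. \<bar>l (fst z) (snd z)\<bar>"] nice_integrable[OF nl] by simp
  also have "\<dots> \<le> \<Psi> * (LINT z|(\<mu> \<Otimes>\<^sub>M M). u (fst z) (snd z))"
    using lu nice_integrable[OF nl] nice_integrable[OF n1] nice_integrable[OF n2] nice_integrable[OF n3] \<Psi>
    by (intro mult_left_mono integral_mono) (auto simp: u_def)
  also have "(LINT z|(\<mu> \<Otimes>\<^sub>M M). u (fst z) (snd z)) = 1 / (2 * d) * product_integral (\<lambda>y \<omega>. (W k y \<omega>)\<^sup>2)
      + (1 / (4 * d) * product_integral (\<lambda>y \<omega>. (W 1 y \<omega>)\<^sup>2) + d ^ 3 / 4 * product_integral (\<lambda>y \<omega>. ?h y \<omega> ^ 4 * (W 1 y \<omega>)\<^sup>2))"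
    unfolding u_def product_integral_def
    using nice_integrable[OF n1] nice_integrable[OF n2] nice_integrable[OF n3] by simp
  also have "\<dots> \<le> 1 / (2 * d) * (d ^ 8 * \<Psi>\<^sup>2 * ((mass + mass ^ 3) * moment_sum q))
      + (1 / (4 * d) * (d ^ 8 * \<Psi>\<^sup>2 * ((mass + mass ^ 3) * moment_sum q))
        + d ^ 3 / 4 * (d ^ 4 * \<Psi>\<^sup>2 * ((mass + mass ^ 3) * moment_sum q)))"
  proof -
    have le: "product_integral (\<lambda>y \<omega>. (W j y \<omega>)\<^sup>2) \<le> d ^ 8 * \<Psi>\<^sup>2 * ((mass + mass ^ 3) * moment_sum q)" if "1 \<le> j" "j \<le> q" for j
    proof -
      have "product_integral (\<lambda>y \<omega>. (W j y \<omega>)\<^sup>2) \<le> d ^ 8 * \<Psi>\<^sup>2 * (mass * moment_sum q)"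
        using W_square_le[OF that] by (simp add: product_integral_eq[OF nice_power[OF nice_W]])
      also have "\<dots> \<le> d ^ 8 * \<Psi>\<^sup>2 * ((mass + mass ^ 3) * moment_sum q)"
        using d mass_nonneg moment_sum_nonneg by (intro mult_left_mono mult_right_mono) auto
      finally show ?thesis .
    qed
    have "product_integral (\<lambda>y \<omega>. ?h y \<omega> ^ 4 * (W 1 y \<omega>)\<^sup>2) \<le> d ^ 4 * \<Psi>\<^sup>2 * ((mass + mass ^ 3) * moment_sum q)"
      by (subst product_integral_eq[OF n3, symmetric]) (rule W_1_weighted, simp)
    then show ?thesis
      using le[of k] le[of 1] k d by (intro add_mono mult_left_mono) auto
  qed
  also have "\<dots> = d ^ 7 * \<Psi>\<^sup>2 * ((mass + mass ^ 3) * moment_sum q)"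
  proof -
    have "d ^ 8 = d * d ^ 7" "d ^ 3 / 4 * (d ^ 4 * x * y) = d ^ 7 * x * y / 4" for x y
      by (simp_all flip: power_Suc power_add)
    then show ?thesis using d by (simp add: field_simps)
  qed
  finally show ?thesis
    using \<Psi> unfolding error_bound_def by (simp add: power3_eq_cube power2_eq_square mult_ac mult_left_mono mult_right_mono)
qed

text \<open>The derivative falls either on \<open>W k\<close>, which yields \<open>W (Suc k)\<close>
  with the Hermite factor \<open>q - k\<close>, or on the cosine, which yields
  \<open>err k\<close>.\<close>

lemma A_step:
  assumes k: "k < q"
  shows "A k t \<theta> = real (q - k) * A (Suc k) t \<theta> - t * real q * err k t \<theta>"
proof -
  let ?h = "\<lambda>y \<omega>. poly (hermite (q - Suc k)) (\<beta> y \<omega>)"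
  let ?a = "\<lambda>y \<omega>. ?h y \<omega> * (W (Suc k) y \<omega> * cos (t * F \<omega> + \<theta>))"
  let ?b = "\<lambda>y \<omega>. ?h y \<omega> * (W k y \<omega> * (W 1 y \<omega> * sin (t * F \<omega> + \<theta>)))"
  have na: "nice ?a" and nb: "nice ?b" by (intro nice_mult nice_poly nice_W nice_trig)+
  have s: "q - k = Suc (q - Suc k)" using k by simp
  have key: "expectation (\<lambda>\<omega>. poly (hermite (q - k)) (\<beta> y \<omega>) * (W k y \<omega> * cos (t * F \<omega> + \<theta>)))
     = real (q - k) * expectation (?a y) - t * real q * expectation (?b y)" if y: "y \<in> space \<mu>" for y
  proof -
    have "expectation (\<lambda>\<omega>. poly (hermite (Suc (q - Suc k))) (\<beta> y \<omega>) * (w k y (\<lambda>i. \<xi> i \<omega>) * cos (t * f (\<lambda>i. \<xi> i \<omega>) + \<theta>)))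
      = expectation (\<lambda>\<omega>. ?h y \<omega> * (real (q - k) * w (Suc k) y (\<lambda>i. \<xi> i \<omega>) * cos (t * f (\<lambda>i. \<xi> i \<omega>) + \<theta>)
          + (- sin (t * f (\<lambda>i. \<xi> i \<omega>) + \<theta>) * (t * (real q * w 1 y (\<lambda>i. \<xi> i \<omega>)))) * w k y (\<lambda>i. \<xi> i \<omega>)))"
    proof (rule hermite_ibp[OF y, where P = "\<lambda>x. w k y x * cos (t * f x + \<theta>)"])
      show "poly_growth I (\<lambda>x. w k y x * cos (t * f x + \<theta>))"
        by (intro poly_growth_mult w_poly_growth y trig_poly_growth)
      have "poly_growth I (\<lambda>x. real (q - k) * w (Suc k) y x * cos (t * f x + \<theta>) + (- 1 * sin (t * f x + \<theta>) * (t * (real q * w 1 y x))) * w k y x)"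
        by (intro poly_growth_add poly_growth_mult w_poly_growth y trig_poly_growth poly_growth_const)
      then show "poly_growth I (\<lambda>x. real (q - k) * w (Suc k) y x * cos (t * f x + \<theta>) + (- sin (t * f x + \<theta>) * (t * (real q * w 1 y x))) * w k y x)"
        by simp
      show "((\<lambda>s. w k y (\<lambda>i. x i + s * \<gamma> y i) * cos (t * f (\<lambda>i. x i + s * \<gamma> y i) + \<theta>)) has_real_derivative
        real (q - k) * w (Suc k) y x * cos (t * f x + \<theta>) + (- sin (t * f x + \<theta>) * (t * (real q * w 1 y x))) * w k y x) (at 0)" for x
        using DERIV_mult[OF w_deriv[OF y k, of x] trig_deriv(1)[OF y, of t x \<theta>]] by simp
    qed
    also have "\<dots> = expectation (\<lambda>\<omega>. real (q - k) * ?a y \<omega> - t * real q * ?b y \<omega>)"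
      by (simp only: w_\<xi> f_\<xi>) (rule Bochner_Integration.integral_cong[OF refl], simp add: algebra_simps)
    also have "\<dots> = real (q - k) * expectation (?a y) - t * real q * expectation (?b y)"
      using nice_section_integrable[OF na y] nice_section_integrable[OF nb y] by simp
    finally show ?thesis by (simp only: w_\<xi> f_\<xi> s)
  qed
  have "A k t \<theta> = (LINT y|\<mu>. real (q - k) * (\<psi> y * expectation (?a y)) - t * real q * (\<psi> y * expectation (?b y)))"
    unfolding A_def
    by (intro Bochner_Integration.integral_cong[OF refl], simp only: key) (simp add: right_diff_distrib mult.left_commute)
  also have "\<dots> = real (q - k) * A (Suc k) t \<theta> - t * real q * err k t \<theta>"
    using weighted_integrable[OF na] weighted_integrable[OF nb] by (simp add: A_def err_def)
  finally show ?thesis .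
qed

text \<open>The variance of \<open>F\<close> divided by \<open>fact q\<close>, see
  \<open>F_variance\<close>.\<close>

definition V where "V = (LINT y|\<mu>. \<psi> y * (LINT z|\<mu>. \<psi> z * \<rho> z y ^ q))"

definition c where "c t \<theta> = expectation (\<lambda>\<omega>. cos (t * F \<omega> + \<theta>))"

text \<open>After \<open>q\<close> steps the Hermite factor is 1 and \<open>W q\<close> is not
  random, so only the expectation of the cosine remains.\<close>

lemma A_q: "A q t \<theta> = V * c t \<theta>"
proof -
  have *: "\<psi> y * expectation (\<lambda>\<omega>. poly (hermite (q - q)) (\<beta> y \<omega>) * (W q y \<omega> * cos (t * F \<omega> + \<theta>)))
      = \<psi> y * (LINT z|\<mu>. \<psi> z * \<rho> z y ^ q) * c t \<theta>" for y
    by (simp add: W_def c_def mult.assoc)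
  show ?thesis unfolding A_def * V_def by simp
qed

text \<open>The induction runs from \<open>A q\<close> down to \<open>A 1\<close> and stops there:
  \<open>err 0\<close> contains \<open>W 0 = F\<close>, which has no covariance factor and is not
  small.\<close>

lemma A_approx:
  assumes "n < q"
  shows "\<bar>A (q - n) t \<theta> - fact n * V * c t \<theta>\<bar> \<le> \<bar>t\<bar> * real q * error_bound * recursion_error n"
  using assms
proof (induction n)
  case 0
  then show ?case by (simp add: A_q)
next
  case (Suc n)
  have s: "Suc (q - Suc n) = q - n" "q - (q - Suc n) = Suc n" using Suc.prems by auto
  have "A (q - Suc n) t \<theta> = real (Suc n) * A (q - n) t \<theta> - t * real q * err (q - Suc n) t \<theta>"
    using A_step[of "q - Suc n" t \<theta>] Suc.prems by (simp add: s del: of_nat_Suc)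
  then have eq: "A (q - Suc n) t \<theta> - fact (Suc n) * V * c t \<theta>
     = real (Suc n) * (A (q - n) t \<theta> - fact n * V * c t \<theta>) - t * real q * err (q - Suc n) t \<theta>"
    by (simp add: algebra_simps)
  have ih: "real (Suc n) * \<bar>A (q - n) t \<theta> - fact n * V * c t \<theta>\<bar>
      \<le> real (Suc n) * (\<bar>t\<bar> * real q * error_bound * recursion_error n)"
    using Suc.prems by (intro mult_left_mono Suc.IH) simp_all
  have eb: "\<bar>t\<bar> * real q * \<bar>err (q - Suc n) t \<theta>\<bar> \<le> \<bar>t\<bar> * real q * error_bound"
    using Suc.prems by (intro mult_left_mono err_bound) auto
  have "\<bar>A (q - Suc n) t \<theta> - fact (Suc n) * V * c t \<theta>\<bar>
      \<le> real (Suc n) * \<bar>A (q - n) t \<theta> - fact n * V * c t \<theta>\<bar> + \<bar>t\<bar> * real q * \<bar>err (q - Suc n) t \<theta>\<bar>"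
    unfolding eq by (rule order_trans[OF abs_triangle_ineq4]) (simp add: abs_mult)
  also have "\<dots> \<le> real (Suc n) * (\<bar>t\<bar> * real q * error_bound * recursion_error n) + \<bar>t\<bar> * real q * error_bound"
    by (rule add_mono[OF ih eb])
  finally show ?case by (simp add: algebra_simps)
qed

lemma F_integrable: "integrable M F" "integrable M (\<lambda>\<omega>. (F \<omega>)\<^sup>2)"
  using pg_integrable[OF f_poly_growth] pg_integrable[OF poly_growth_power[OF f_poly_growth, of 2]] by (simp_all add: f_\<xi>)

text \<open>\<open>F\<close> itself supplies the Hermite factor, so the first integration by parts
  differentiates only the sine and produces a single term.\<close>

lemma F_sin: "expectation (\<lambda>\<omega>. F \<omega> * sin (t * F \<omega> + \<theta>)) = t * real q * A 1 t \<theta>"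
proof -
  let ?s = "\<lambda>\<omega>. sin (t * F \<omega> + \<theta>)"
  have n: "nice (\<lambda>y \<omega>. \<psi> y * (poly (hermite q) (\<beta> y \<omega>) * ?s \<omega>))"
    by (intro nice_mult nice_bounded[OF \<psi>] nice_poly nice_trig)
  have "expectation (\<lambda>\<omega>. F \<omega> * ?s \<omega>) = expectation (\<lambda>\<omega>. LINT y|\<mu>. \<psi> y * (poly (hermite q) (\<beta> y \<omega>) * ?s \<omega>))"
    by (simp add: F_def mult.assoc[symmetric])
  also have "\<dots> = (LINT y|\<mu>. \<psi> y * expectation (\<lambda>\<omega>. poly (hermite q) (\<beta> y \<omega>) * ?s \<omega>))"
    using nice_fubini[OF n] by simp
  also have "\<dots> = (LINT y|\<mu>. t * real q * (\<psi> y * expectation (\<lambda>\<omega>. poly (hermite (q - 1)) (\<beta> y \<omega>) * (W 1 y \<omega> * cos (t * F \<omega> + \<theta>)))))"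
  proof (rule Bochner_Integration.integral_cong[OF refl])
    fix y assume y: "y \<in> space \<mu>"
    have "expectation (\<lambda>\<omega>. poly (hermite (Suc (q - 1))) (\<beta> y \<omega>) * sin (t * f (\<lambda>i. \<xi> i \<omega>) + \<theta>))
      = expectation (\<lambda>\<omega>. poly (hermite (q - 1)) (\<beta> y \<omega>) * (cos (t * f (\<lambda>i. \<xi> i \<omega>) + \<theta>) * (t * (real q * w 1 y (\<lambda>i. \<xi> i \<omega>)))))"
      by (intro hermite_ibp[OF y, where P = "\<lambda>x. sin (t * f x + \<theta>)"] trig_deriv y trig_poly_growth
          poly_growth_mult w_poly_growth poly_growth_const)
    also have "\<dots> = expectation (\<lambda>\<omega>. t * real q * (poly (hermite (q - 1)) (\<beta> y \<omega>) * (W 1 y \<omega> * cos (t * F \<omega> + \<theta>))))"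
      by (simp only: w_\<xi> f_\<xi>) (rule Bochner_Integration.integral_cong[OF refl], simp add: algebra_simps)
    finally show "\<psi> y * expectation (\<lambda>\<omega>. poly (hermite q) (\<beta> y \<omega>) * ?s \<omega>)
      = t * real q * (\<psi> y * expectation (\<lambda>\<omega>. poly (hermite (q - 1)) (\<beta> y \<omega>) * (W 1 y \<omega> * cos (t * F \<omega> + \<theta>))))"
      using q by (simp add: f_\<xi>)
  qed
  finally show ?thesis by (simp add: A_def)
qed

text \<open>At \<open>t = 0\<close> and this phase the sine is 1, while the right-hand side of
  \<open>F_sin\<close> carries the factor \<open>t\<close>.\<close>

lemma F_mean: "expectation F = 0"
  using F_sin[of 0 "pi / 2"] by simp

text \<open>All error terms carry the factor \<open>t\<close>, so at \<open>t = 0\<close> the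
  recursion for \<open>A\<close> is exact.\<close>

lemma F_variance: "expectation (\<lambda>\<omega>. (F \<omega>)\<^sup>2) = fact q * V"
proof -
  have n: "nice (\<lambda>y \<omega>. \<psi> y * (poly (hermite q) (\<beta> y \<omega>) * F \<omega>))"
  proof -
    have "W 0 = (\<lambda>y. F)" using W_0 by auto
    then have "nice (\<lambda>y. F)" using nice_W[of 0] by simp
    then show ?thesis by (intro nice_mult nice_bounded[OF \<psi>] nice_poly)
  qed
  have "expectation (\<lambda>\<omega>. (F \<omega>)\<^sup>2) = expectation (\<lambda>\<omega>. LINT y|\<mu>. \<psi> y * (poly (hermite q) (\<beta> y \<omega>) * F \<omega>))"
    by (simp add: mult.assoc[symmetric] power2_eq_square) (simp add: F_def)
  also have "\<dots> = (LINT y|\<mu>. \<psi> y * expectation (\<lambda>\<omega>. poly (hermite q) (\<beta> y \<omega>) * F \<omega>))"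
    using nice_fubini[OF n] by simp
  also have "\<dots> = A 0 0 0" by (simp add: A_def W_0)
  also have "\<dots> = real q * A 1 0 0" using A_step[of 0 0 0] q by simp
  also have "A 1 0 0 = fact (q - 1) * V"
    using A_approx[of "q - 1" 0 0] q by (simp add: c_def prob_space)
  finally show ?thesis using q by (simp add: fact_reduce)
qed

text \<open>The Stein-Tikhomirov argument: \<open>c\<close> satisfies
  \<open>c' = - t * v * c\<close> up to \<open>K\<close>. The integrating factor
  \<open>exp (t\<^sup>2 * v / 2)\<close> turns this into a small derivative on the unit interval,
  and the mean value theorem compares \<open>t = 1\<close> with \<open>t = 0\<close>. Other scales
  are covered by rescaling \<open>\<psi>\<close>.\<close>

theorem cos_approximation:
  "\<bar>expectation (\<lambda>\<omega>. cos (F \<omega> + \<theta>)) - cos \<theta> * exp (- expectation (\<lambda>\<omega>. (F \<omega>)\<^sup>2) / 2)\<bar>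
     \<le> (real q)\<^sup>2 * recursion_error (q - 1) * error_bound"
proof -
  define v where "v = expectation (\<lambda>\<omega>. (F \<omega>)\<^sup>2)"
  define K where "K = (real q)\<^sup>2 * recursion_error (q - 1) * error_bound"
  have K0: "K \<ge> 0" unfolding K_def using error_bound_nonneg recursion_error_nonneg by simp
  have v0: "v \<ge> 0" by (simp add: v_def)
  have cd: "((\<lambda>t. c t \<theta>) has_real_derivative - (t * real q * A 1 t \<theta>)) (at t)" for t
    using DERIV_expectation_cos[OF F_integrable, of \<theta> t] by (simp add: F_sin c_def)
  have vq: "v = real q * (fact (q - 1) * V)"
    unfolding v_def F_variance using q by (simp add: fact_reduce)
  have ap: "\<bar>- (t * real q * A 1 t \<theta>) + t * v * c t \<theta>\<bar> \<le> K" if t: "0 < t" "t < 1" for t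
  proof -
    have "- (t * real q * A 1 t \<theta>) + t * v * c t \<theta> = - (t * real q) * (A 1 t \<theta> - fact (q - 1) * V * c t \<theta>)"
      by (simp add: vq algebra_simps)
    then have "\<bar>- (t * real q * A 1 t \<theta>) + t * v * c t \<theta>\<bar> = t * real q * \<bar>A 1 t \<theta> - fact (q - 1) * V * c t \<theta>\<bar>"
      using t by (simp add: abs_mult)
    also have "\<dots> \<le> t * real q * (\<bar>t\<bar> * real q * error_bound * recursion_error (q - 1))"
      using A_approx[of "q - 1" t \<theta>] q t by (intro mult_left_mono) auto
    also have "\<dots> = t\<^sup>2 * K" using t by (simp add: K_def power2_eq_square mult_ac)
    also have "\<dots> \<le> 1 * K" using t K0 by (intro mult_right_mono) (auto simp: power_le_one)
    finally show ?thesis by simp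
  qed
  define G where "G t = c t \<theta> * exp (t\<^sup>2 * v / 2)" for t
  define G' where "G' t = (- (t * real q * A 1 t \<theta>) + t * v * c t \<theta>) * exp (t\<^sup>2 * v / 2)" for t
  have Gd: "(G has_real_derivative G' t) (at t)" for t
    unfolding G_def G'_def by (auto intro!: derivative_eq_intros cd simp: algebra_simps)
  have "\<exists>z>0. z < 1 \<and> G 1 - G 0 = (1 - 0) * G' z"
    by (rule MVT2) (auto intro: Gd)
  then obtain z where z: "0 < z" "z < 1" "G 1 - G 0 = G' z" by auto
  have "\<bar>G' z\<bar> \<le> K * exp (v / 2)"
    unfolding G'_def abs_mult using ap[OF z(1,2)] z v0
    by (intro mult_mono) (auto simp: power_le_one mult_left_le_one_le)
  then have "\<bar>G 1 - G 0\<bar> * exp (- v / 2) \<le> K * exp (v / 2) * exp (- v / 2)"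
    unfolding z(3) by (intro mult_right_mono) auto
  also have "K * exp (v / 2) * exp (- v / 2) = K" by (simp add: mult.assoc flip: exp_add)
  also have "\<bar>G 1 - G 0\<bar> * exp (- v / 2) = \<bar>(G 1 - G 0) * exp (- v / 2)\<bar>" by (simp add: abs_mult)
  also have "(G 1 - G 0) * exp (- v / 2) = c 1 \<theta> - cos \<theta> * exp (- v / 2)"
    by (simp add: G_def c_def prob_space left_diff_distrib mult.assoc flip: exp_add)
  finally show ?thesis by (simp add: c_def v_def K_def)
qed

end

section \<open>Surface measure\<close>

lemma lborel_distr_orthogonal:
  fixes f :: "real ^ 3 \<Rightarrow> real ^ 3"
  assumes f: "orthogonal_transformation f"
  shows "distr lborel borel f = lborel"
proof (rule lborel_eqI[symmetric])
  fix l u :: "real ^ 3" assume le: "\<And>b. b \<in> Basis \<Longrightarrow> l \<bullet> b \<le> u \<bullet> b"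
  obtain g where g: "orthogonal_transformation g" "\<And>x. g (f x) = x" "\<And>x. f (g x) = x"
    using orthogonal_transformation_inv[OF f] orthogonal_transformation_bij[OF f]
    by (metis bij_inv_eq_iff)
  have [measurable]: "f \<in> borel_measurable borel"
    using f by (intro borel_measurable_continuous_onI linear_continuous_on)
       (simp add: orthogonal_transformation_def linear_conv_bounded_linear)
  have pre: "f -` box l u = g ` box l u"
    using g by (auto simp: image_iff) metis
  have "emeasure (distr lborel borel f) (box l u) = emeasure lborel (f -` box l u)"
    by (simp add: emeasure_distr)
  also have "\<dots> = emeasure lebesgue (f -` box l u)"
  proof -
    have "f -` box l u \<in> sets borel" by (rule measurable_sets_borel[of f borel]) auto
    then show ?thesis by simp
  qed
  also have "\<dots> = ennreal (measure lebesgue (g ` box l u))"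
  proof -
    have "g ` box l u \<in> lmeasurable" by (rule measurable_orthogonal_image[OF g(1)]) auto
    then show ?thesis unfolding pre by (intro emeasure_eq_ennreal_measure fmeasurableD2)
  qed
  also have "measure lebesgue (g ` box l u) = measure lebesgue (box l u)"
    by (rule measure_orthogonal_image[OF g(1)]) auto
  also have "\<dots> = (\<Prod>b\<in>Basis. (u - l) \<bullet> b)"
    using le by (simp add: measure_lborel_box_eq inner_diff_left)
  finally show "emeasure (distr lborel borel f) (box l u) = (\<Prod>b\<in>Basis. (u - l) \<bullet> b)"
    by simp
qed simp

abbreviation unit_ball3 :: "(real ^ 3) set" where "unit_ball3 \<equiv> ball 0 1 - {0}"

lemma normalize_measurable [measurable]:
  "(\<lambda>x. x /\<^sub>R norm x) \<in> restrict_space lborel unit_ball3 \<rightarrow>\<^sub>M restrict_space borel S2"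
  by (rule measurable_restrict_space2) (auto simp: space_restrict_space intro!: measurable_restrict_space1)

lemma space_surface_measure [simp]: "space surface_measure = S2"
  by (simp add: surface_measure_def space_scale_measure space_restrict_space)

lemma sets_surface_measure [measurable_cong]: "sets surface_measure = sets (restrict_space borel S2)"
  by (simp add: surface_measure_def)

text \<open>Scaling by a constant is rewritten as a density, so that the integration rules for
  densities apply.\<close>

lemma surface_measure_density:
  "surface_measure = density (distr (restrict_space lborel unit_ball3) (restrict_space borel S2)
     (\<lambda>x. x /\<^sub>R norm x)) (\<lambda>_. ennreal 3)"
  unfolding surface_measure_def
  by (rule measure_eqI) (auto simp: emeasure_density_const)

lemma borel_measurable_surface: "f \<in> borel_measurable borel \<Longrightarrow> f \<in> borel_measurable surface_measure"
  by (subst measurable_cong_sets[OF sets_surface_measure refl]) (rule measurable_restrict_space1)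

lemma surface_integral:
  fixes f :: "real ^ 3 \<Rightarrow> 'a::{banach, second_countable_topology}"
  assumes [measurable]: "f \<in> borel_measurable borel"
  shows "(LINT x|surface_measure. f x) =
     3 *\<^sub>R (LINT x|lborel. indicator unit_ball3 x *\<^sub>R f (x /\<^sub>R norm x))"
proof -
  have [measurable]: "f \<in> borel_measurable (restrict_space borel S2)" by (simp add: measurable_restrict_space1)
  have "(LINT x|surface_measure. f x) = (LINT x|distr (restrict_space lborel unit_ball3) (restrict_space borel S2)
     (\<lambda>x. x /\<^sub>R norm x). 3 *\<^sub>R f x)"
    unfolding surface_measure_density by (subst integral_density) auto
  also have "\<dots> = (LINT x|restrict_space lborel unit_ball3. 3 *\<^sub>R f (x /\<^sub>R norm x))"
    by (rule integral_distr) measurable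
  also have "\<dots> = 3 *\<^sub>R (LINT x|restrict_space lborel unit_ball3. f (x /\<^sub>R norm x))" by simp
  also have "(LINT x|restrict_space lborel unit_ball3. f (x /\<^sub>R norm x))
     = (LINT x|lborel. indicator unit_ball3 x *\<^sub>R f (x /\<^sub>R norm x))"
    by (rule integral_restrict_space) auto
  finally show ?thesis .
qed

lemma emeasure_surface_measure: "emeasure surface_measure S2 = ennreal (4 * pi)"
proof -
  have "emeasure surface_measure S2 = 3 * emeasure (restrict_space lborel unit_ball3)
      ((\<lambda>x. x /\<^sub>R norm x) -` S2 \<inter> unit_ball3)"
    unfolding surface_measure_def
    by (simp add: emeasure_distr space_restrict_space sets_restrict_space_iff)
  also have "(\<lambda>x. x /\<^sub>R norm x) -` S2 \<inter> unit_ball3 = unit_ball3" by auto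
  also have "emeasure (restrict_space lborel unit_ball3) unit_ball3 = emeasure lborel unit_ball3"
    by (rule emeasure_restrict_space) auto
  also have "\<dots> = emeasure lborel (ball 0 1 :: (real ^ 3) set)"
    by (rule emeasure_Diff_null_set) auto
  also have "\<dots> = ennreal (4 / 3 * pi)" by (simp add: emeasure_ball unit_ball_vol_3)
  finally show ?thesis by (simp flip: ennreal_numeral ennreal_mult'')
qed

interpretation surface: finite_measure surface_measure
  by standard (simp add: emeasure_surface_measure)

lemma surface_mass: "measure surface_measure S2 = 4 * pi"
  by (simp add: measure_def emeasure_surface_measure)

text \<open>In the cone representation the map acts on the solid ball, where it preserves volume and
  commutes with radial projection.\<close>

lemma surface_integral_orthogonal:
  fixes g :: "real ^ 3 \<Rightarrow> 'a::{banach, second_countable_topology}"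
  assumes f: "orthogonal_transformation f" and [measurable]: "g \<in> borel_measurable borel"
  shows "(LINT x|surface_measure. g (f x)) = (LINT x|surface_measure. g x)"
proof -
  have lf: "linear f" using f by (simp add: orthogonal_transformation_def)
  have [measurable]: "f \<in> borel_measurable borel"
    using lf by (intro borel_measurable_continuous_onI linear_continuous_on) (simp add: linear_conv_bounded_linear)
  have nf: "norm (f x) = norm x" for x using f by (simp add: orthogonal_transformation)
  have "(LINT x|lborel. indicator unit_ball3 x *\<^sub>R g (x /\<^sub>R norm x))
     = (LINT x|distr lborel borel f. indicator unit_ball3 x *\<^sub>R g (x /\<^sub>R norm x))"
    by (simp add: lborel_distr_orthogonal[OF f])
  also have "\<dots> = (LINT x|lborel. indicator unit_ball3 (f x) *\<^sub>R g (f x /\<^sub>R norm (f x)))"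
  proof (rule integral_distr)
    have "(\<lambda>x::real^3. x /\<^sub>R norm x) \<in> borel_measurable borel" by simp
    then have "(\<lambda>x::real^3. g (x /\<^sub>R norm x)) \<in> borel_measurable borel"
      by (rule measurable_compose[OF _ assms(2)])
    then show "(\<lambda>x. indicator unit_ball3 x *\<^sub>R g (x /\<^sub>R norm x)) \<in> borel_measurable borel"
      by (intro borel_measurable_scaleR borel_measurable_indicator) auto
  qed simp
  also have "\<dots> = (LINT x|lborel. indicator unit_ball3 x *\<^sub>R g (f (x /\<^sub>R norm x)))"
  proof (rule Bochner_Integration.integral_cong[OF refl])
    fix x
    have "f x = 0 \<longleftrightarrow> x = 0" by (metis nf norm_eq_zero)
    then have "f x \<in> unit_ball3 \<longleftrightarrow> x \<in> unit_ball3" by (simp add: nf)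
    then show "indicator unit_ball3 (f x) *\<^sub>R g (f x /\<^sub>R norm (f x)) = indicator unit_ball3 x *\<^sub>R g (f (x /\<^sub>R norm x))"
      by (simp add: nf linear_scale[OF lf] indicator_def)
  qed
  finally show ?thesis by (simp add: surface_integral)
qed

lemma continuous_surface_measurable:
  fixes f :: "real ^ 3 \<Rightarrow> 'a::{real_normed_vector, second_countable_topology}"
  shows "continuous_on UNIV f \<Longrightarrow> f \<in> borel_measurable surface_measure"
  by (intro borel_measurable_surface borel_measurable_continuous_onI)

lemma continuous_surface_integrable:
  fixes f :: "real ^ 3 \<Rightarrow> 'a::{banach, second_countable_topology}"
  assumes "continuous_on UNIV f" shows "integrable surface_measure f"
proof -
  have "compact (f ` S2)"
    by (intro compact_continuous_image continuous_on_subset[OF assms]) auto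
  then obtain B where "\<And>x. x \<in> S2 \<Longrightarrow> norm (f x) \<le> B"
    using compact_imp_bounded bounded_iff by (metis imageI)
  then show ?thesis
    by (intro surface.integrable_const_bound[where B = B] AE_I2 continuous_surface_measurable assms) auto
qed

text \<open>The parameters are a point of the unit circle and not an angle, so that
  \<open>moment3_mixed\<close> can work with polynomials in \<open>t\<close>.\<close>

definition rot13 :: "real \<Rightarrow> real \<Rightarrow> real ^ 3 \<Rightarrow> real ^ 3" where
  "rot13 c s x = vector [c * x $ 1 - s * x $ 3, x $ 2, s * x $ 1 + c * x $ 3]"

definition rot12 :: "real \<Rightarrow> real \<Rightarrow> real ^ 3 \<Rightarrow> real ^ 3" where
  "rot12 c s x = vector [c * x $ 1 - s * x $ 2, s * x $ 1 + c * x $ 2, x $ 3]"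

lemma orthogonal_rot13:
  assumes "c\<^sup>2 + s\<^sup>2 = 1" shows "orthogonal_transformation (rot13 c s)"
proof -
  have "linear (rot13 c s)"
    by (rule linearI) (simp_all add: rot13_def vec_eq_iff forall_3 algebra_simps)
  moreover have "rot13 c s v \<bullet> rot13 c s w = v \<bullet> w" for v w
  proof -
    have "rot13 c s v \<bullet> rot13 c s w = (c\<^sup>2 + s\<^sup>2) * (v $ 1 * w $ 1 + v $ 3 * w $ 3) + v $ 2 * w $ 2"
      by (simp add: rot13_def inner_vec_def sum_3 power2_eq_square algebra_simps)
    then show ?thesis by (simp add: assms inner_vec_def sum_3)
  qed
  ultimately show ?thesis by (simp add: orthogonal_transformation_def)
qed

lemma orthogonal_rot12:
  assumes "c\<^sup>2 + s\<^sup>2 = 1" shows "orthogonal_transformation (rot12 c s)"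
proof -
  have "linear (rot12 c s)"
    by (rule linearI) (simp_all add: rot12_def vec_eq_iff forall_3 algebra_simps)
  moreover have "rot12 c s v \<bullet> rot12 c s w = v \<bullet> w" for v w
  proof -
    have "rot12 c s v \<bullet> rot12 c s w = (c\<^sup>2 + s\<^sup>2) * (v $ 1 * w $ 1 + v $ 2 * w $ 2) + v $ 3 * w $ 3"
      by (simp add: rot12_def inner_vec_def sum_3 power2_eq_square algebra_simps)
    then show ?thesis by (simp add: assms inner_vec_def sum_3)
  qed
  ultimately show ?thesis by (simp add: orthogonal_transformation_def)
qed

lemma rot12_component [simp]: "rot12 c s x $ 3 = x $ 3" "rot12 c s x $ 1 = c * x $ 1 - s * x $ 2"
    "rot12 c s x $ 2 = s * x $ 1 + c * x $ 2"
  by (simp_all add: rot12_def)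

lemma rot13_component [simp]: "rot13 c s x $ 3 = s * x $ 1 + c * x $ 3"
  by (simp add: rot13_def)

lemma S2_sum_squares: "x \<in> S2 \<Longrightarrow> (x $ 1)\<^sup>2 + (x $ 2)\<^sup>2 + (x $ 3)\<^sup>2 = (1::real)"
  using dot_square_norm[of x] by (simp add: inner_vec_def sum_3 power2_eq_square)

lemma coeff_one_plus_square_power:
  "coeff ([:1, 0, 1:] ^ n :: real poly) 0 = 1 \<and> coeff ([:1, 0, 1:] ^ n :: real poly) 1 = 0 \<and>
   coeff ([:1, 0, 1:] ^ n :: real poly) 2 = real n"
  by (induction n) (auto simp: numeral_2_eq_2 coeff_pCons)

definition moment3 :: "nat \<Rightarrow> real" where
  "moment3 k = (LINT x|surface_measure. (x $ 3) ^ k)"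

lemma surface_integrable_monomial: "integrable surface_measure (\<lambda>x. (x $ 3) ^ k * (x $ 1) ^ i * (x $ 2) ^ j)"
  by (intro continuous_surface_integrable continuous_intros)

text \<open>
  The moments in the directions \<open>(t, 0, 1) / sqrt (1 + t\<^sup>2)\<close> agree; the recursion is the
  coefficient of \<open>t\<^sup>2\<close> in this polynomial identity.
\<close>
lemma moment3_mixed:
  "real (2 * n + 1) * (LINT x|surface_measure. (x $ 3) ^ (2 * n) * (x $ 1)\<^sup>2) = moment3 (2 * n + 2)"
proof -
  let ?N = "2 * n + 2"
  define M where "M r = (LINT x|surface_measure. (x $ 3) ^ (?N - r) * (x $ 1) ^ r)" for r
  have int: "integrable surface_measure (\<lambda>x. (x $ 3) ^ (?N - r) * (x $ 1) ^ r)" for r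
    using surface_integrable_monomial[of "?N - r" r 0] by simp
  define p where "p = (\<Sum>r\<le>?N. monom (real (?N choose r) * M r) r)"
  define q where "q = smult (moment3 ?N) ([:1, 0, 1:] ^ (n + 1))"
  have "poly p t = poly q t" for t
  proof -
    define s where "s = sqrt (1 + t\<^sup>2)"
    have s: "s > 0" "s\<^sup>2 = 1 + t\<^sup>2" unfolding s_def by (auto simp: add_pos_nonneg)
    have "(1 / s)\<^sup>2 + (t / s)\<^sup>2 = (1 + t\<^sup>2) / s\<^sup>2" by (simp add: power_divide add_divide_distrib)
    then have "(1 / s)\<^sup>2 + (t / s)\<^sup>2 = 1" unfolding s(2)[symmetric] using s(1) by simp
    then have "orthogonal_transformation (rot13 (1 / s) (t / s))" by (rule orthogonal_rot13)
    from surface_integral_orthogonal[OF this, of "\<lambda>x. (x $ 3) ^ ?N"]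
    have "moment3 ?N = (LINT x|surface_measure. ((t * x $ 1 + x $ 3) / s) ^ ?N)"
      by (simp add: moment3_def add_divide_distrib)
    also have "\<dots> = (LINT x|surface_measure. (t * x $ 1 + x $ 3) ^ ?N) / s ^ ?N"
      by (simp add: power_divide del: power_add)
    also have "(LINT x|surface_measure. (t * x $ 1 + x $ 3) ^ ?N)
       = (LINT x|surface_measure. (\<Sum>r\<le>?N. (real (?N choose r) * t ^ r) * ((x $ 3) ^ (?N - r) * (x $ 1) ^ r)))"
      by (subst binomial_ring) (simp add: power_mult_distrib mult_ac)
    also have "\<dots> = (\<Sum>r\<le>?N. (real (?N choose r) * t ^ r) * M r)"
      unfolding M_def using int by (subst Bochner_Integration.integral_sum) auto
    also have "\<dots> = poly p t" by (simp add: p_def poly_sum poly_monom mult_ac)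
    finally have "poly p t = moment3 ?N * s ^ ?N" using s by (simp add: field_simps)
    also have "s ^ ?N = (s\<^sup>2) ^ (n + 1)" unfolding power_mult[symmetric] by simp
    also have "\<dots> = (1 + t\<^sup>2) ^ (n + 1)" by (simp add: s)
    also have "moment3 ?N * (1 + t\<^sup>2) ^ (n + 1) = poly q t"
    proof -
      have "poly [:1, 0, 1:] t = 1 + t\<^sup>2" by (simp add: power2_eq_square)
      then show ?thesis by (simp only: q_def poly_smult poly_power)
    qed
    finally show ?thesis .
  qed
  then have "p = q" by (rule poly_ext)
  then have "coeff p 2 = coeff q 2" by simp
  also have "coeff q 2 = moment3 ?N * real (n + 1)"
    using coeff_one_plus_square_power[of "n + 1"] by (simp add: q_def del: power_Suc power_add)
  also have "coeff p 2 = real (?N choose 2) * M 2"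
  proof -
    have "coeff p 2 = (\<Sum>r\<le>?N. if r = 2 then real (?N choose r) * M r else 0)"
      unfolding p_def coeff_sum coeff_monom ..
    then show ?thesis by (subst (asm) sum.delta) auto
  qed
  also have "real (?N choose 2) = real (n + 1) * real (2 * n + 1)"
    by (simp add: choose_two algebra_simps)
  finally have "real (n + 1) * (real (2 * n + 1) * M 2) = real (n + 1) * moment3 ?N" by (simp only: mult_ac)
  then have "real (2 * n + 1) * M 2 = moment3 ?N" by (simp del: of_nat_add of_nat_Suc)
  then show ?thesis by (simp add: M_def)
qed

text \<open>The constant 1 is written as the sum of the squared coordinates: a quarter turn about
  the third axis identifies the two mixed moments, and \<open>moment3_mixed\<close> reduces them to
  pure ones.\<close>

lemma moment3_step: "real (2 * n + 3) * moment3 (2 * n + 2) = real (2 * n + 1) * moment3 (2 * n)"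
proof -
  let ?m = "\<lambda>f. LINT x|surface_measure. (x $ 3) ^ (2 * n) * f x"
  have i1: "integrable surface_measure (\<lambda>x. (x $ 3) ^ (2 * n) * (x $ 1)\<^sup>2)"
    and i2: "integrable surface_measure (\<lambda>x. (x $ 3) ^ (2 * n) * (x $ 2)\<^sup>2)"
    and i3: "integrable surface_measure (\<lambda>x. (x $ 3) ^ (2 * n + 2))"
    using surface_integrable_monomial[of "2 * n" 2 0] surface_integrable_monomial[of "2 * n" 0 2]
      surface_integrable_monomial[of "2 * n + 2" 0 0] by simp_all
  have "orthogonal_transformation (rot12 0 1)" by (rule orthogonal_rot12) simp
  from surface_integral_orthogonal[OF this, of "\<lambda>x. (x $ 3) ^ (2 * n) * (x $ 1)\<^sup>2"]
  have sym: "?m (\<lambda>x. (x $ 2)\<^sup>2) = ?m (\<lambda>x. (x $ 1)\<^sup>2)" by simp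
  have "moment3 (2 * n) = (LINT x|surface_measure. (x $ 3) ^ (2 * n) * (x $ 1)\<^sup>2 + (x $ 3) ^ (2 * n) * (x $ 2)\<^sup>2 + (x $ 3) ^ (2 * n + 2))"
    unfolding moment3_def
  proof (rule Bochner_Integration.integral_cong[OF refl])
    fix x assume "x \<in> space surface_measure"
    then have "(x $ 1)\<^sup>2 + (x $ 2)\<^sup>2 + (x $ 3)\<^sup>2 = 1" by (simp add: S2_sum_squares del: mem_sphere mem_sphere_0)
    then have "(x $ 3) ^ (2 * n) = (x $ 3) ^ (2 * n) * ((x $ 1)\<^sup>2 + (x $ 2)\<^sup>2 + (x $ 3)\<^sup>2)" by simp
    then show "(x $ 3) ^ (2 * n) = (x $ 3) ^ (2 * n) * (x $ 1)\<^sup>2 + (x $ 3) ^ (2 * n) * (x $ 2)\<^sup>2 + (x $ 3) ^ (2 * n + 2)"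
      by (simp only: ring_distribs power_add)
  qed
  also have "\<dots> = 2 * ?m (\<lambda>x. (x $ 1)\<^sup>2) + moment3 (2 * n + 2)"
    unfolding moment3_def using i1 i2 i3 sym by simp
  finally have "real (2 * n + 1) * moment3 (2 * n) = 2 * (real (2 * n + 1) * ?m (\<lambda>x. (x $ 1)\<^sup>2)) + real (2 * n + 1) * moment3 (2 * n + 2)"
    by (simp add: algebra_simps)
  also have "\<dots> = real (2 * n + 3) * moment3 (2 * n + 2)"
    unfolding moment3_mixed by (simp add: algebra_simps)
  finally show ?thesis ..
qed

lemma moment3_even: "real (2 * n + 1) * moment3 (2 * n) = 4 * pi"
proof (induction n)
  case 0 show ?case by (simp add: moment3_def surface_mass)
next
  case (Suc n) then show ?case using moment3_step[of n] by (simp add: numeral_3_eq_3)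
qed

lemma moment3_odd: "odd k \<Longrightarrow> moment3 k = 0"
proof -
  assume k: "odd k"
  have "orthogonal_transformation (\<lambda>x::real^3. - x)"
    unfolding orthogonal_transformation_def by (intro conjI linearI) auto
  from surface_integral_orthogonal[OF this, of "\<lambda>x. (x $ 3) ^ k"] k
  show ?thesis by (simp add: moment3_def)
qed

text \<open>Not normalized: by Archimedes this is \<open>2 * pi\<close> times the integral of
  \<open>p\<close> from -1 to 1.\<close>

definition sphere_mean :: "real poly \<Rightarrow> real" where
  "sphere_mean p = (LINT x|surface_measure. poly p (x $ 3))"

lemma surface_integrable_poly: "integrable surface_measure (\<lambda>x. poly p (x $ 3))"
  by (intro continuous_surface_integrable continuous_intros)

lemma sphere_mean_add: "sphere_mean (p + q) = sphere_mean p + sphere_mean q"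
  by (simp add: sphere_mean_def surface_integrable_poly)

lemma sphere_mean_smult: "sphere_mean (smult c p) = c * sphere_mean p"
  by (simp add: sphere_mean_def)

lemma sphere_mean_0: "sphere_mean 0 = 0"
  by (simp add: sphere_mean_def)

lemma sphere_mean_sum: "sphere_mean (\<Sum>i\<in>A. f i) = (\<Sum>i\<in>A. sphere_mean (f i))"
  by (induction A rule: infinite_finite_induct) (simp_all add: sphere_mean_add sphere_mean_0)

text \<open>Archimedes' theorem on the height coordinate in the guise of the fundamental theorem of
  calculus; on monomials it is the computation of \<open>moment3\<close>.\<close>

lemma sphere_mean_pderiv: "sphere_mean (pderiv p) = 2 * pi * (poly p 1 - poly p (- 1))"
proof -
  have m: "sphere_mean (pderiv (monom c n)) = 2 * pi * (poly (monom c n) 1 - poly (monom c n) (- 1))" for c n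
  proof (cases n)
    case 0 show ?thesis unfolding 0 monom_0 pderiv_singleton sphere_mean_0 by simp
  next
    case (Suc k)
    have "pderiv (monom c n) = smult (real (Suc k) * c) (monom 1 k)"
      by (simp add: Suc pderiv_monom smult_monom)
    then have "sphere_mean (pderiv (monom c n)) = real (Suc k) * c * moment3 k"
      by (simp only: sphere_mean_smult) (simp add: sphere_mean_def moment3_def poly_monom)
    also have "\<dots> = 2 * pi * (c - c * (- 1) ^ Suc k)"
    proof (cases "even k")
      case True
      then obtain j where "k = 2 * j" by (rule evenE)
      then show ?thesis using moment3_even[of j] by (simp add: mult.commute mult.left_commute)
    qed (simp add: moment3_odd)
    finally show ?thesis by (simp add: poly_monom Suc)
  qed
  have ps: "pderiv (sum f A) = (\<Sum>x\<in>A. pderiv (f x))" for f :: "nat \<Rightarrow> real poly" and A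
    using higher_pderiv_sum[of 1 f A] by simp
  have "sphere_mean (pderiv (\<Sum>i\<le>degree p. monom (coeff p i) i)) =
     2 * pi * (poly (\<Sum>i\<le>degree p. monom (coeff p i) i) 1 - poly (\<Sum>i\<le>degree p. monom (coeff p i) i) (- 1))"
    by (simp add: ps sphere_mean_sum m poly_sum sum_distrib_left sum_subtractf right_diff_distrib)
  then show ?thesis by (simp only: poly_as_sum_of_monoms)
qed

section \<open>Legendre polynomials and spherical harmonics\<close>

definition pQ :: "real poly" where "pQ = [:-1, 0, 1:]"
definition pS :: "real poly" where "pS = [:1, 0, -1:]"
definition pX :: "real poly" where "pX = [:0, 1:]"

lemma poly_pQ [simp]: "poly pQ t = t\<^sup>2 - 1"
  and poly_pS [simp]: "poly pS t = 1 - t\<^sup>2"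
  and poly_pX [simp]: "poly pX t = t"
  by (simp_all add: pQ_def pS_def pX_def power2_eq_square)

lemma pderiv_pS: "pderiv pS = smult (- 2) pX"
  by (simp add: pderiv_pCons pS_def pX_def)

definition rod :: "nat \<Rightarrow> nat \<Rightarrow> real poly" where
  "rod l n = (pderiv ^^ n) (pQ ^ l)"

lemma rod_Suc: "pderiv (rod l n) = rod l (Suc n)"
  by (simp add: rod_def)

lemma pderiv_pQ: "pderiv pQ = smult 2 pX"
  by (simp add: pderiv_pCons pQ_def pX_def)

lemma pderiv_pX: "pderiv pX = 1"
  by (simp add: pderiv_pCons pX_def)

text \<open>For \<open>n = 0\<close> this is the first-order equation of \<open>pQ ^ l\<close>, and
  each differentiation is one step of the induction. The truncated \<open>n - 1\<close> at
  \<open>n = 0\<close> has coefficient 0.\<close>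

lemma rod_ode:
  "pQ * rod l (Suc n) = smult (2 * (real l - real n)) (pX * rod l n)
     + smult (real n * (2 * real l - real n + 1)) (rod l (n - 1))"
proof (induction n)
  case 0
  show ?case
  proof (cases l)
    case 0 then show ?thesis by (simp add: rod_def)
  next
    case (Suc k)
    have "pderiv (pQ ^ Suc k) = smult (real (Suc k)) (pQ ^ k) * pderiv pQ"
      by (rule pderiv_power_Suc)
    then have "pQ * pderiv (pQ ^ Suc k) = smult (2 * real (Suc k)) (pX * pQ ^ Suc k)"
      by (simp only: pderiv_pQ) (simp add: mult_ac)
    then show ?thesis by (simp add: Suc rod_def del: of_nat_Suc power_Suc)
  qed
next
  case (Suc n)
  have n: "smult (real n * (2 * real l - real n + 1)) (pderiv (rod l (n - 1)))
      = smult (real n * (2 * real l - real n + 1)) (rod l n)"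
    by (cases n) (simp_all add: rod_Suc)
  have "pderiv (pQ * rod l (Suc n)) = pderiv (smult (2 * (real l - real n)) (pX * rod l n)
     + smult (real n * (2 * real l - real n + 1)) (rod l (n - 1)))"
    by (simp only: Suc)
  then have eq: "smult 2 pX * rod l (Suc n) + pQ * rod l (Suc (Suc n))
     = smult (2 * (real l - real n)) (rod l n + pX * rod l (Suc n)) + smult (real n * (2 * real l - real n + 1)) (rod l n)"
    unfolding pderiv_mult pderiv_add pderiv_smult pderiv_pQ pderiv_pX n
    unfolding rod_Suc by (simp only: mult_1 mult_1_right mult.commute add.commute)
  show ?case
  proof (rule poly_ext)
    fix t
    have "poly (smult 2 pX * rod l (Suc n) + pQ * rod l (Suc (Suc n))) t
      = poly (smult (2 * (real l - real n)) (rod l n + pX * rod l (Suc n)) + smult (real n * (2 * real l - real n + 1)) (rod l n)) t"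
      by (simp only: eq)
    then show "poly (pQ * rod l (Suc (Suc n))) t = poly (smult (2 * (real l - real (Suc n))) (pX * rod l (Suc n))
     + smult (real (Suc n) * (2 * real l - real (Suc n) + 1)) (rod l (Suc n - 1))) t"
      by (simp add: algebra_simps)
  qed
qed

lemma rod_dvd: "n \<le> l \<Longrightarrow> pQ ^ (l - n) dvd rod l n"
proof (induction n)
  case 0 show ?case by (simp add: rod_def)
next
  case (Suc n)
  then obtain p where p: "rod l n = pQ ^ Suc (l - Suc n) * p"
    by (auto simp: dvd_def Suc_diff_Suc)
  have "rod l (Suc n) = pQ ^ Suc (l - Suc n) * pderiv p + p * (smult (real (Suc (l - Suc n))) (pQ ^ (l - Suc n)) * pderiv pQ)"
    unfolding rod_Suc[symmetric] p pderiv_mult pderiv_power_Suc by (simp add: mult_ac)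
  also have "\<dots> = pQ ^ (l - Suc n) * (pQ * pderiv p + smult (real (Suc (l - Suc n))) (p * pderiv pQ))"
    by (simp add: ring_distribs mult_ac del: of_nat_Suc)
  finally show ?case by simp
qed

lemma rod_ends: "n < l \<Longrightarrow> poly (rod l n) 1 = 0 \<and> poly (rod l n) (- 1) = 0"
proof -
  assume n: "n < l"
  then obtain p where "rod l n = pQ ^ (l - n) * p" using rod_dvd[of n l] by (auto simp: dvd_def)
  then show ?thesis using n by (simp add: poly_power)
qed

lemma degree_Q_power: "degree (pQ ^ l) = 2 * l"
  by (simp add: degree_power_eq pQ_def)

lemma higher_pderiv_top:
  fixes p :: "real poly"
  assumes "degree p \<le> n" shows "(pderiv ^^ n) p = [:fact n * coeff p n:]"
proof (rule poly_eqI)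
  fix k
  show "coeff ((pderiv ^^ n) p) k = coeff [:fact n * coeff p n:] k"
  proof (cases k)
    case 0
    then show ?thesis by (simp add: coeff_higher_pderiv pochhammer_fact)
  next
    case (Suc m)
    then have "coeff p (k + n) = 0" using assms by (intro coeff_eq_0) simp
    then show ?thesis by (simp add: coeff_higher_pderiv Suc)
  qed
qed

lemma higher_pderiv_zero:
  fixes p :: "real poly"
  assumes "degree p < n" shows "(pderiv ^^ n) p = 0"
  using higher_pderiv_top[of p n] assms coeff_eq_0[of p n] by simp

lemma sphere_mean_by_parts:
  "sphere_mean (p * pderiv q) = 2 * pi * (poly p 1 * poly q 1 - poly p (- 1) * poly q (- 1)) - sphere_mean (pderiv p * q)"
proof -
  have "sphere_mean (pderiv (p * q)) = sphere_mean (p * pderiv q) + sphere_mean (pderiv p * q)"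
    by (simp add: pderiv_mult sphere_mean_add mult.commute)
  then show ?thesis by (simp add: sphere_mean_pderiv)
qed

text \<open>Repeated integration by parts; by \<open>rod_ends\<close> the boundary terms vanish as
  long as fewer than \<open>l\<close> derivatives remain on the second factor.\<close>

lemma sphere_mean_rod:
  "n \<le> l \<Longrightarrow> sphere_mean (p * rod l l) = (- 1) ^ n * sphere_mean ((pderiv ^^ n) p * rod l (l - n))"
proof (induction n)
  case (Suc n)
  have s: "l - n = Suc (l - Suc n)" using Suc.prems by simp
  have "sphere_mean ((pderiv ^^ n) p * rod l (l - n)) = - sphere_mean (pderiv ((pderiv ^^ n) p) * rod l (l - Suc n))"
    unfolding s rod_Suc[symmetric] sphere_mean_by_parts using rod_ends[of "l - Suc n" l] Suc.prems by simp
  then show ?case using Suc by simp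
qed simp

lemma sphere_mean_S_power: "sphere_mean (pS ^ l) = 4 * pi * 4 ^ l * (fact l)\<^sup>2 / fact (2 * l + 1)"
proof (induction l)
  case 0
  show ?case by (simp add: sphere_mean_def surface_mass)
next
  case (Suc l)
  \<comment> \<open>The differentiated polynomial vanishes at both ends, so the mean of its
    derivative is zero; this is the recursion in \<open>l\<close>.\<close>
  have d: "pderiv (pX * pS ^ Suc l) = smult (2 * real l + 3) (pS ^ Suc l) + smult (- (2 * real l + 2)) (pS ^ l)"
  proof (rule poly_ext)
    fix t
    show "poly (pderiv (pX * pS ^ Suc l)) t = poly (smult (2 * real l + 3) (pS ^ Suc l) + smult (- (2 * real l + 2)) (pS ^ l)) t"
      unfolding pderiv_mult pderiv_power_Suc pderiv_pX pderiv_pS by (simp add: power2_eq_square algebra_simps)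
  qed
  then have "sphere_mean (smult (2 * real l + 3) (pS ^ Suc l) + smult (- (2 * real l + 2)) (pS ^ l)) = 0"
    using sphere_mean_pderiv[of "pX * pS ^ Suc l"] unfolding d by simp
  then have "(2 * real l + 3) * sphere_mean (pS ^ Suc l) = (2 * real l + 2) * sphere_mean (pS ^ l)"
    unfolding sphere_mean_add sphere_mean_smult mult_minus_left by linarith
  then have "sphere_mean (pS ^ Suc l) = (2 * real l + 2) * sphere_mean (pS ^ l) / (2 * real l + 3)"
    by (simp add: field_simps)
  also have "\<dots> = 4 * pi * 4 ^ Suc l * (fact (Suc l))\<^sup>2 / fact (2 * Suc l + 1)"
  proof -
    define x F where "x = real l + 1" and "F = (fact (2 * l + 1) :: real)"
    have x: "x > 0" "F > 0" by (simp_all add: x_def F_def)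
    have f: "(fact (2 * Suc l + 1) :: real) = (2 * real l + 3) * (2 * x) * F"
      by (simp add: x_def F_def algebra_simps)
    have g: "(fact (Suc l) :: real) = x * fact l" by (simp add: x_def algebra_simps)
    have "2 * x * (A / F) / y = A * 4 * x\<^sup>2 / (y * (2 * x) * F)" if "y > 0" for A y
      using x that by (simp add: field_simps power2_eq_square)
    from this[of "2 * real l + 3" "4 * pi * 4 ^ l * (fact l)\<^sup>2"] show ?thesis
      unfolding Suc f g F_def[symmetric] by (simp add: x_def power_mult_distrib mult_ac)
  qed
  finally show ?case .
qed

lemma legendre_rod: "legendre l = smult (1 / (2 ^ l * fact l)) (rod l l)"
  by (simp add: legendre_def rod_def pQ_def)

lemma degree_legendre: "degree (legendre l) = l"
  by (simp add: legendre_rod rod_def degree_higher_pderiv degree_Q_power)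

text \<open>Moving all \<open>k\<close> derivatives onto the polynomial of lower degree annihilates
  it.\<close>

lemma legendre_orthogonal_less:
  assumes "l < k" shows "sphere_mean (legendre l * legendre k) = 0"
  using sphere_mean_rod[of k k "legendre l"] higher_pderiv_zero[of "legendre l" k] assms
  by (simp add: legendre_rod[of k] sphere_mean_smult degree_legendre sphere_mean_0)

text \<open>Moving all \<open>l\<close> derivatives over leaves a constant, the top derivative of
  the Legendre polynomial, times the mean of \<open>pS ^ l\<close>; the two signs cancel.\<close>

lemma legendre_norm: "sphere_mean (legendre l * legendre l) = 4 * pi / (2 * real l + 1)"
proof -
  have lead: "coeff (pQ ^ l) (2 * l) = 1"
    using lead_coeff_power[of pQ l] by (simp add: degree_Q_power) (simp add: pQ_def)
  have top: "(pderiv ^^ l) (legendre l) = [:fact (2 * l) / (2 ^ l * fact l):]"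
  proof -
    have "(pderiv ^^ l) (rod l l) = (pderiv ^^ (2 * l)) (pQ ^ l)"
      by (simp add: rod_def mult_2 funpow_add)
    also have "\<dots> = [:fact (2 * l):]" by (subst higher_pderiv_top) (simp_all add: degree_Q_power lead)
    finally show ?thesis by (simp add: legendre_rod higher_pderiv_smult)
  qed
  have QS: "pQ ^ l = smult ((- 1) ^ l) (pS ^ l)"
  proof -
    have "pQ = smult (- 1) pS" by (simp add: pQ_def pS_def)
    then show ?thesis by (metis smult_power)
  qed
  have "sphere_mean (legendre l * legendre l) = 1 / (2 ^ l * fact l) * sphere_mean (legendre l * rod l l)"
    by (subst (2) legendre_rod) (simp add: sphere_mean_smult)
  also have "sphere_mean (legendre l * rod l l) = (- 1) ^ l * sphere_mean ((pderiv ^^ l) (legendre l) * pQ ^ l)"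
    using sphere_mean_rod[of l l "legendre l"] by (simp add: rod_def)
  also have "sphere_mean ((pderiv ^^ l) (legendre l) * pQ ^ l) = fact (2 * l) / (2 ^ l * fact l) * ((- 1) ^ l * sphere_mean (pS ^ l))"
    unfolding top QS by (simp add: sphere_mean_smult)
  finally have "sphere_mean (legendre l * legendre l) = ((- 1) ^ l * (- 1) ^ l) * (fact (2 * l) / (2 ^ l * fact l * (2 ^ l * fact l)) * sphere_mean (pS ^ l))"
    by (simp add: mult_ac)
  also have "(- 1) ^ l * (- 1) ^ l = (1::real)" by (simp flip: power_mult_distrib)
  also have "(2 ^ l * fact l * (2 ^ l * fact l) :: real) = 4 ^ l * (fact l)\<^sup>2"
    by (simp add: power2_eq_square flip: power_mult_distrib)
  finally show ?thesis unfolding sphere_mean_S_power by simp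
qed

lemma legendre_orthogonal:
  "sphere_mean (legendre l * legendre k) = (if l = k then 4 * pi / (2 * real l + 1) else 0)"
  using legendre_orthogonal_less[of l k] legendre_orthogonal_less[of k l] legendre_norm[of l]
  by (cases l k rule: linorder_cases) (auto simp: mult.commute)

text \<open>The associated Legendre function without its power of the sine; up to a constant an
  ultraspherical (Gegenbauer) polynomial.\<close>

definition ultra :: "nat \<Rightarrow> nat \<Rightarrow> real poly" where
  "ultra l m = (pderiv ^^ m) (legendre l)"

lemma ultra_Suc: "ultra l (Suc m) = pderiv (ultra l m)"
  by (simp add: ultra_def)

lemma ultra_rod: "ultra l m = smult (1 / (2 ^ l * fact l)) (rod l (l + m))"
  by (simp add: ultra_def legendre_rod higher_pderiv_smult rod_def funpow_add add.commute[of l m])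

text \<open>\<open>rod_ode\<close> with index \<open>l + m\<close>, brought into divergence form:
  the second-order equation becomes a step that lowers \<open>m\<close>.\<close>

lemma pderiv_S_ultra:
  assumes "m \<ge> 1"
  shows "pderiv (pS ^ m * ultra l m) = smult (- (real (l + m) * (real l - real m + 1))) (pS ^ (m - 1) * ultra l (m - 1))"
proof (rule poly_ext)
  fix t
  obtain k where k: "m = Suc k" using assms by (cases m) auto
  have "pQ * rod l (Suc (l + m)) = smult (- (2 * real m)) (pX * rod l (l + m)) + smult (real (l + m) * (real l - real m + 1)) (rod l (l + m - 1))"
    using rod_ode[of l "l + m"] by (simp add: algebra_simps)
  then have "smult (1 / (2 ^ l * fact l)) (pQ * rod l (Suc (l + m))) = smult (1 / (2 ^ l * fact l))
     (smult (- (2 * real m)) (pX * rod l (l + m)) + smult (real (l + m) * (real l - real m + 1)) (rod l (l + m - 1)))"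
    by simp
  then have "pQ * ultra l (Suc m) = smult (- (2 * real m)) (pX * ultra l m) + smult (real (l + m) * (real l - real m + 1)) (ultra l (m - 1))"
    by (simp add: ultra_rod k smult_add_right mult.commute)
  then have "poly (pQ * ultra l (Suc m)) t = poly (smult (- (2 * real m)) (pX * ultra l m) + smult (real (l + m) * (real l - real m + 1)) (ultra l (m - 1))) t"
    by simp
  then have ode: "(1 - t\<^sup>2) * poly (ultra l (Suc m)) t = 2 * real m * (t * poly (ultra l m) t) - real (l + m) * (real l - real m + 1) * poly (ultra l (m - 1)) t"
    by (simp add: power2_eq_square algebra_simps)
  have "poly (pderiv (pS ^ m * ultra l m)) t = (1 - t\<^sup>2) ^ k * ((1 - t\<^sup>2) * poly (ultra l (Suc m)) t - 2 * real m * (t * poly (ultra l m) t))"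
    unfolding pderiv_mult k pderiv_power_Suc ultra_Suc[symmetric]
    by (simp add: pderiv_pS power2_eq_square algebra_simps)
  then show "poly (pderiv (pS ^ m * ultra l m)) t = poly (smult (- (real (l + m) * (real l - real m + 1))) (pS ^ (m - 1) * ultra l (m - 1))) t"
    unfolding ode by (simp add: k power2_eq_square poly_power)
qed

text \<open>For \<open>m \<ge> 1\<close> the power of \<open>pS\<close> vanishes at both ends, so
  integration by parts has no boundary term and \<open>pderiv_S_ultra\<close> lowers
  \<open>m\<close>.\<close>

lemma ultra_orthogonal_step:
  assumes "m \<ge> 1"
  shows "sphere_mean (pS ^ m * ultra l m * ultra k m)
     = real (l + m) * (real l - real m + 1) * sphere_mean (pS ^ (m - 1) * ultra l (m - 1) * ultra k (m - 1))"
proof -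
  have k: "ultra k m = pderiv (ultra k (m - 1))" using assms by (simp flip: ultra_Suc)
  have e: "poly (pS ^ m * ultra l m) 1 = 0" "poly (pS ^ m * ultra l m) (- 1) = 0"
    using assms by (simp_all add: poly_power)
  have "sphere_mean (pS ^ m * ultra l m * ultra k m) = - sphere_mean (pderiv (pS ^ m * ultra l m) * ultra k (m - 1))"
    unfolding k sphere_mean_by_parts[of "pS ^ m * ultra l m"] e by simp
  also have "\<dots> = - (- (real (l + m) * (real l - real m + 1)) * sphere_mean (pS ^ (m - 1) * ultra l (m - 1) * ultra k (m - 1)))"
    unfolding pderiv_S_ultra[OF assms] mult_smult_left sphere_mean_smult ..
  finally show ?thesis by simp
qed

lemma ultra_orthogonal:
  assumes "m \<le> l"
  shows "sphere_mean (pS ^ m * ultra l m * ultra k m) = (if l = k then 4 * pi / (2 * real l + 1) * (fact (l + m) / fact (l - m)) else 0)"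
  using assms
proof (induction m)
  case 0
  then show ?case by (simp add: ultra_def legendre_orthogonal)
next
  case (Suc m)
  have "fact (l + Suc m) / fact (l - Suc m) = real (l + Suc m) * (real l - real (Suc m) + 1) * (fact (l + m) / fact (l - m))"
  proof -
    have "l - m = Suc (l - Suc m)" using Suc.prems by simp
    then have 1: "(fact (l - m) :: real) = (real l - real (Suc m) + 1) * fact (l - Suc m)"
      using Suc.prems by (simp add: of_nat_diff)
    have 2: "(fact (l + Suc m) :: real) = real (l + Suc m) * fact (l + m)" by simp
    have "b * F / x = b * c * (F / (c * x))" if "c \<noteq> 0" for b c F x :: real using that by simp
    moreover have "real l - real (Suc m) + 1 \<noteq> 0" using Suc.prems by linarith
    ultimately show ?thesis unfolding 1 2 by blast
  qed
  note f = this
  have "sphere_mean (pS ^ Suc m * ultra l (Suc m) * ultra k (Suc m))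
      = real (l + Suc m) * (real l - real (Suc m) + 1) * sphere_mean (pS ^ m * ultra l m * ultra k m)"
    using ultra_orthogonal_step[of "Suc m" l k] by (simp only: diff_Suc_1)
  also have "sphere_mean (pS ^ m * ultra l m * ultra k m)
      = (if l = k then 4 * pi / (2 * real l + 1) * (fact (l + m) / fact (l - m)) else 0)"
    using Suc.prems by (intro Suc.IH) simp
  finally show ?case unfolding f by (simp only: mult.left_commute if_distrib mult_zero_right split: if_split)
qed

text \<open>Up to a factor that depends on \<open>l\<close> alone, the squared modulus of a
  spherical harmonic as a polynomial in the height. The differences of \<open>unsold_flux\<close> in
  \<open>m\<close> are the derivatives of these terms.\<close>

definition unsold :: "nat \<Rightarrow> nat \<Rightarrow> real poly" where
  "unsold l m = smult (fact (l - m) / fact (l + m)) (pS ^ m * ultra l m * ultra l m)"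

definition unsold_flux :: "nat \<Rightarrow> nat \<Rightarrow> real poly" where
  "unsold_flux l m = smult (fact (l - m) / fact (l + m)) (pS ^ m * ultra l m * ultra l (Suc m))"

lemma pderiv_unsold:
  assumes m: "1 \<le> m" "m \<le> l"
  shows "pderiv (unsold l m) = unsold_flux l m - unsold_flux l (m - 1)"
proof -
  obtain k where k: "m = Suc k" using m by (cases m) auto
  have f: "fact (l - m) / fact (l + m) * (real (l + m) * (real l - real m + 1)) = (fact (l - k) / fact (l + k) :: real)"
  proof -
    have "l - k = Suc (l - m)" using m k by simp
    then have 1: "(fact (l - k) :: real) = (real l - real m + 1) * fact (l - m)"
      using m by (simp add: of_nat_diff)
    have 2: "(fact (l + m) :: real) = real (l + m) * fact (l + k)" using k by simp
    have "x / (b * F) * (b * c) = c * x / F" if "b \<noteq> 0" for b c F x :: real using that by simp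
    moreover have "real (l + m) \<noteq> 0" using m by simp
    ultimately show ?thesis unfolding 1 2 by blast
  qed
  have "pderiv (unsold l m) = smult (fact (l - m) / fact (l + m)) (pS ^ m * ultra l m * ultra l (Suc m)
     + pderiv (pS ^ m * ultra l m) * ultra l m)"
    unfolding unsold_def pderiv_smult pderiv_mult[of "pS ^ m * ultra l m"] ultra_Suc by (simp add: mult.commute)
  also have "\<dots> = unsold_flux l m - smult (fact (l - m) / fact (l + m) * (real (l + m) * (real l - real m + 1))) (pS ^ k * ultra l k * ultra l (Suc k))"
  proof -
    have "smult a (A + smult (- b) B * C) = smult a A - smult (a * b) (B * C)" for a b and A B C :: "real poly"
      by (simp add: smult_diff_right)
    then show ?thesis unfolding pderiv_S_ultra[OF m(1)] unsold_flux_def by (simp only: k diff_Suc_1)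
  qed
  finally show ?thesis unfolding f by (simp add: unsold_flux_def k)
qed

text \<open>The derivative telescopes: the flux at \<open>l\<close> contains a derivative of the
  Legendre polynomial beyond its degree, and the flux at 0 cancels against the derivative of the
  unpaired term \<open>m = 0\<close>.\<close>

lemma unsold_constant:
  "\<exists>c. unsold l 0 + smult 2 (\<Sum>m=1..l. unsold l m) = [:c:]"
proof -
  have "pderiv (unsold l 0 + smult 2 (\<Sum>m=1..l. unsold l m)) = pderiv (unsold l 0) + smult 2 (\<Sum>m=1..l. pderiv (unsold l m))"
    using higher_pderiv_sum[of 1 "unsold l" "{1..l}"] by (simp add: pderiv_add pderiv_smult)
  also have "(\<Sum>m=1..l. pderiv (unsold l m)) = (\<Sum>m=1..l. unsold_flux l m - unsold_flux l (m - 1))"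
    by (intro sum.cong pderiv_unsold) auto
  also have "\<dots> = unsold_flux l l - unsold_flux l 0"
    using sum_telescope''[of 0 l "unsold_flux l"] by (simp add: sum.atLeast_Suc_atMost)
  also have "unsold_flux l l = 0"
    using higher_pderiv_zero[of "legendre l" "Suc l"] by (simp add: unsold_flux_def ultra_def degree_legendre)
  also have "pderiv (unsold l 0) = smult 2 (unsold_flux l 0)"
    unfolding unsold_def unsold_flux_def power_0 mult_1 pderiv_smult pderiv_mult ultra_Suc
    by (rule poly_ext) simp
  finally have "pderiv (unsold l 0 + smult 2 (\<Sum>m=1..l. unsold l m)) = 0" by simp
  then show ?thesis by (auto simp: pderiv_eq_0_iff intro: degree_eq_zeroE)
qed

section \<open>Spherical harmonics\<close>

definition norm_coeff :: "nat \<Rightarrow> nat \<Rightarrow> real" where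
  "norm_coeff l m = (-1) ^ m * sqrt ((2 * real l + 1) / (4 * pi) * (fact (l - m) / fact (l + m)))"

lemma sph_harm_nonneg_eq:
  "sph_harm_nonneg l m x = of_real (norm_coeff l m * poly (ultra l m) (x $ 3)) * Complex (x $ 1) (x $ 2) ^ m"
  by (simp add: sph_harm_nonneg_def norm_coeff_def ultra_def)

lemma norm_coeff_square: "(norm_coeff l m)\<^sup>2 = (2 * real l + 1) / (4 * pi) * (fact (l - m) / fact (l + m))"
  by (simp add: norm_coeff_def power_mult_distrib flip: power_mult)

lemma continuous_sph_harm_nonneg: "continuous_on UNIV (sph_harm_nonneg l m)"
proof -
  have "continuous_on UNIV (\<lambda>x. of_real (norm_coeff l m * poly (ultra l m) (x $ 3))
      * (complex_of_real (x $ 1) + \<i> * complex_of_real (x $ 2)) ^ m :: complex)"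
    by (intro continuous_intros)
  then show ?thesis
    by (rule continuous_on_eq) (simp add: sph_harm_nonneg_eq Complex_eq)
qed

lemma continuous_sph_harm: "continuous_on UNIV (sph_harm l m)"
proof (cases "0 \<le> m")
  case True
  then show ?thesis using continuous_sph_harm_nonneg by (simp add: sph_harm_def[abs_def])
next
  case False
  then show ?thesis
    using continuous_sph_harm_nonneg by (simp add: sph_harm_def[abs_def] continuous_intros)
qed

lemma sph_harm_uminus: "sph_harm l (- m) x = (-1) ^ nat \<bar>m\<bar> * cnj (sph_harm l m x)"
proof -
  have pm: "(- 1) ^ n * ((- 1) ^ n * z) = z" for n and z :: complex
    by (simp add: mult.assoc[symmetric] flip: power_mult_distrib)
  consider "m = 0" | "m > 0" | "m < 0" by linarith
  then show ?thesis
  proof cases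
    case 1
    then show ?thesis by (simp add: sph_harm_def sph_harm_nonneg_eq)
  next
    case 2
    then show ?thesis by (simp add: sph_harm_def)
  next
    case 3
    then show ?thesis by (simp add: sph_harm_def pm)
  qed
qed

lemma sph_harm_rotate:
  "sph_harm l m (rot12 (cos \<theta>) (sin \<theta>) x) = cis (real_of_int m * \<theta>) * sph_harm l m x"
proof -
  have rot: "Complex (cos \<theta> * x $ 1 - sin \<theta> * x $ 2) (sin \<theta> * x $ 1 + cos \<theta> * x $ 2) = cis \<theta> * Complex (x $ 1) (x $ 2)"
    by (simp add: complex_eq_iff)
  have nn: "sph_harm_nonneg l n (rot12 (cos \<theta>) (sin \<theta>) x) = cis (real n * \<theta>) * sph_harm_nonneg l n x" for n
  proof -
    have d: "cis (real n * \<theta>) = cis \<theta> ^ n" by (simp add: Complex.DeMoivre)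
    show ?thesis unfolding sph_harm_nonneg_eq rot12_component rot power_mult_distrib d by (simp only: mult_ac)
  qed
  show ?thesis
  proof (cases "0 \<le> m")
    case True
    then show ?thesis by (simp add: sph_harm_def nn)
  next
    case False
    then show ?thesis by (simp add: sph_harm_def nn cis_cnj mult_ac)
  qed
qed

lemma sph_harm_product_integrable: "integrable surface_measure (\<lambda>x. sph_harm l m x * cnj (sph_harm k n x))"
  by (intro continuous_surface_integrable continuous_intros continuous_sph_harm)

text \<open>A rotation about the third axis by \<open>pi / (m - n)\<close> preserves the measure and
  multiplies the integrand by -1.\<close>

lemma sph_harm_orthogonal_order:
  assumes "m \<noteq> n"
  shows "(LINT x|surface_measure. sph_harm l m x * cnj (sph_harm k n x)) = 0"
proof -
  let ?f = "\<lambda>x. sph_harm l m x * cnj (sph_harm k n x)"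
  define \<theta> where "\<theta> = pi / (real_of_int m - real_of_int n)"
  have \<theta>: "real_of_int m * \<theta> - real_of_int n * \<theta> = pi"
    unfolding left_diff_distrib[symmetric] \<theta>_def using assms by simp
  have "orthogonal_transformation (rot12 (cos \<theta>) (sin \<theta>))" by (rule orthogonal_rot12) simp
  moreover have "?f \<in> borel_measurable borel"
    by (intro borel_measurable_continuous_onI continuous_intros continuous_sph_harm)
  ultimately have "(LINT x|surface_measure. ?f x) = (LINT x|surface_measure. ?f (rot12 (cos \<theta>) (sin \<theta>) x))"
    by (rule surface_integral_orthogonal[symmetric])
  also have "\<dots> = (LINT x|surface_measure. cis pi * ?f x)"
  proof (rule Bochner_Integration.integral_cong[OF refl])
    fix x
    have "cis (real_of_int m * \<theta>) * cnj (cis (real_of_int n * \<theta>)) = cis pi"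
      by (simp only: cis_cnj cis_mult) (simp add: \<theta>)
    then show "?f (rot12 (cos \<theta>) (sin \<theta>) x) = cis pi * ?f x"
      unfolding sph_harm_rotate complex_cnj_mult by (simp only: mult_ac)
  qed
  also have "\<dots> = - (LINT x|surface_measure. ?f x)" by simp
  finally show ?thesis by simp
qed

text \<open>On the sphere the squared modulus of the complex number formed by the first two
  coordinates is \<open>pS\<close> at the height, so the azimuth drops out of products of equal
  order.\<close>

lemma sph_harm_nonneg_product:
  assumes x: "x \<in> S2"
  shows "sph_harm_nonneg l m x * cnj (sph_harm_nonneg k m x)
     = of_real (norm_coeff l m * norm_coeff k m * poly (pS ^ m * ultra l m * ultra k m) (x $ 3))"
proof -
  define z where "z = Complex (x $ 1) (x $ 2)"
  have "(x $ 1)\<^sup>2 + (x $ 2)\<^sup>2 = 1 - (x $ 3)\<^sup>2" using S2_sum_squares[OF x] by simp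
  then have "z * cnj z = of_real (1 - (x $ 3)\<^sup>2)"
    by (simp add: z_def complex_mult_cnj)
  then have "z ^ m * cnj z ^ m = of_real ((1 - (x $ 3)\<^sup>2) ^ m)"
    by (simp only: power_mult_distrib[symmetric] of_real_power)
  note zz = this
  have "sph_harm_nonneg l m x * cnj (sph_harm_nonneg k m x)
     = of_real (norm_coeff l m * poly (ultra l m) (x $ 3)) * of_real (norm_coeff k m * poly (ultra k m) (x $ 3)) * (z ^ m * cnj z ^ m)"
    unfolding sph_harm_nonneg_eq z_def[symmetric] complex_cnj_mult complex_cnj_power complex_cnj_complex_of_real
    by (simp only: mult_ac)
  also have "\<dots> = of_real (norm_coeff l m * norm_coeff k m * poly (pS ^ m * ultra l m * ultra k m) (x $ 3))"
    unfolding zz by (simp add: poly_power mult_ac flip: of_real_mult of_real_power)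
  finally show ?thesis .
qed

lemma sph_harm_product_same_order:
  assumes "x \<in> S2"
  shows "sph_harm l m x * cnj (sph_harm k m x)
     = of_real (norm_coeff l (nat \<bar>m\<bar>) * norm_coeff k (nat \<bar>m\<bar>) * poly (pS ^ nat \<bar>m\<bar> * ultra l (nat \<bar>m\<bar>) * ultra k (nat \<bar>m\<bar>)) (x $ 3))"
proof (cases "0 \<le> m")
  case True
  then show ?thesis using sph_harm_nonneg_product[OF assms, of l "nat m" k] by (simp add: sph_harm_def)
next
  case False
  let ?n = "nat (- m)"
  have "sph_harm l m x * cnj (sph_harm k m x) = ((-1) ^ ?n * (-1) ^ ?n) * cnj (sph_harm_nonneg l ?n x * cnj (sph_harm_nonneg k ?n x))"
    using False by (simp add: sph_harm_def)
  also have "(-1) ^ ?n * (-1) ^ ?n = (1::complex)" by (simp flip: power_mult_distrib)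
  finally show ?thesis
    using False unfolding sph_harm_nonneg_product[OF assms] by simp
qed

lemma sph_harm_orthonormal:
  assumes "m \<in> {- int l..int l}"
  shows "(LINT x|surface_measure. sph_harm l m x * cnj (sph_harm k n x)) = (if l = k \<and> m = n then 1 else 0)"
proof (cases "m = n")
  case False
  then show ?thesis using sph_harm_orthogonal_order by auto
next
  case True
  let ?n = "nat \<bar>m\<bar>"
  have n: "?n \<le> l" using assms by auto
  have "(LINT x|surface_measure. sph_harm l m x * cnj (sph_harm k m x))
     = (LINT x|surface_measure. complex_of_real (norm_coeff l ?n * norm_coeff k ?n * poly (pS ^ ?n * ultra l ?n * ultra k ?n) (x $ 3)))"
    by (rule Bochner_Integration.integral_cong[OF refl]) (simp only: space_surface_measure sph_harm_product_same_order)
  also have "\<dots> = of_real (norm_coeff l ?n * norm_coeff k ?n * sphere_mean (pS ^ ?n * ultra l ?n * ultra k ?n))"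
    by (simp only: integral_complex_of_real sphere_mean_def integral_mult_right_zero)
  also have "\<dots> = (if l = k then 1 else 0)"
  proof (cases "l = k")
    case True
    have "norm_coeff l ?n * norm_coeff l ?n = (2 * real l + 1) / (4 * pi) * (fact (l - ?n) / fact (l + ?n))"
      by (simp flip: power2_eq_square add: norm_coeff_square)
    then have "norm_coeff l ?n * norm_coeff l ?n * sphere_mean (pS ^ ?n * ultra l ?n * ultra l ?n) = 1"
      by (simp add: ultra_orthogonal[OF n])
    then show ?thesis using True by simp
  qed (simp add: ultra_orthogonal[OF n])
  finally show ?thesis using True by simp
qed

lemma sum_symmetric_int:
  fixes f :: "nat \<Rightarrow> 'a::real_vector"
  shows "(\<Sum>m\<in>{- int l..int l}. f (nat \<bar>m\<bar>)) = f 0 + 2 *\<^sub>R (\<Sum>m=1..l. f m)"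
proof (induction l)
  case (Suc l)
  have "{- int (Suc l)..int (Suc l)} = insert (- int (Suc l)) (insert (int (Suc l)) {- int l..int l})" by auto
  then have "(\<Sum>m\<in>{- int (Suc l)..int (Suc l)}. f (nat \<bar>m\<bar>)) = f (Suc l) + (f (Suc l) + (\<Sum>m\<in>{- int l..int l}. f (nat \<bar>m\<bar>)))"
    by (simp del: of_nat_Suc)
  then show ?case using Suc by (simp add: scaleR_2 algebra_simps)
qed simp

lemma unsold_sum:
  "\<exists>c. \<forall>x\<in>S2. (\<Sum>m\<in>{- int l..int l}. (cmod (sph_harm l m x))\<^sup>2) = c"
proof -
  obtain c where c: "unsold l 0 + smult 2 (\<Sum>m=1..l. unsold l m) = [:c:]" using unsold_constant by blast
  have "(\<Sum>m\<in>{- int l..int l}. (cmod (sph_harm l m x))\<^sup>2) = (2 * real l + 1) / (4 * pi) * c" if x: "x \<in> S2" for x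
  proof -
    have "(cmod (sph_harm l m x))\<^sup>2 = (2 * real l + 1) / (4 * pi) * poly (unsold l (nat \<bar>m\<bar>)) (x $ 3)" for m
    proof -
      let ?n = "nat \<bar>m\<bar>"
      have "complex_of_real ((cmod (sph_harm l m x))\<^sup>2) = sph_harm l m x * cnj (sph_harm l m x)"
        by (simp add: complex_norm_square del: of_real_power)
      also have "\<dots> = of_real (norm_coeff l ?n * norm_coeff l ?n * poly (pS ^ ?n * ultra l ?n * ultra l ?n) (x $ 3))"
        by (rule sph_harm_product_same_order[OF x])
      finally have "(cmod (sph_harm l m x))\<^sup>2 = (norm_coeff l ?n)\<^sup>2 * poly (pS ^ ?n * ultra l ?n * ultra l ?n) (x $ 3)"
        unfolding of_real_eq_iff by (simp only: power2_eq_square)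
      then show ?thesis unfolding norm_coeff_square unsold_def poly_smult by (simp only: mult.assoc)
    qed
    then have "(\<Sum>m\<in>{- int l..int l}. (cmod (sph_harm l m x))\<^sup>2)
       = (\<Sum>m\<in>{- int l..int l}. (2 * real l + 1) / (4 * pi) * poly (unsold l (nat \<bar>m\<bar>)) (x $ 3))" by simp
    also have "\<dots> = (2 * real l + 1) / (4 * pi) * poly (unsold l 0 + smult 2 (\<Sum>m=1..l. unsold l m)) (x $ 3)"
      unfolding sum_distrib_left[symmetric] sum_symmetric_int[of "\<lambda>n. poly (unsold l n) (x $ 3)" l]
      by (simp add: poly_sum)
    finally show ?thesis unfolding c by simp
  qed
  then show ?thesis by blast
qed

text \<open>Unsoeld's theorem; the constant is found by integrating over the sphere.\<close>
theorem sum_sph_harm_square: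
  assumes x: "x \<in> S2"
  shows "(\<Sum>m\<in>{- int l..int l}. (cmod (sph_harm l m x))\<^sup>2) = (2 * real l + 1) / (4 * pi)"
proof -
  obtain c where c: "\<And>x. x \<in> S2 \<Longrightarrow> (\<Sum>m\<in>{- int l..int l}. (cmod (sph_harm l m x))\<^sup>2) = c"
    using unsold_sum[of l] by blast
  have int: "integrable surface_measure (\<lambda>x. (cmod (sph_harm l m x))\<^sup>2)" for m
    by (intro continuous_surface_integrable continuous_intros continuous_sph_harm)
  have one: "(LINT x|surface_measure. (cmod (sph_harm l m x))\<^sup>2) = 1" if "m \<in> {- int l..int l}" for m
  proof -
    have "complex_of_real (LINT x|surface_measure. (cmod (sph_harm l m x))\<^sup>2) = (LINT x|surface_measure. sph_harm l m x * cnj (sph_harm l m x))"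
      unfolding complex_norm_square[symmetric] by (rule integral_complex_of_real[symmetric])
    then show ?thesis using sph_harm_orthonormal[OF that, of l m] by simp
  qed
  have "2 * real l + 1 = (\<Sum>m\<in>{- int l..int l}. 1)" by (simp add: nat_add_distrib)
  also have "\<dots> = (\<Sum>m\<in>{- int l..int l}. (LINT x|surface_measure. (cmod (sph_harm l m x))\<^sup>2))"
    by (intro sum.cong refl one[symmetric])
  also have "\<dots> = (LINT x|surface_measure. (\<Sum>m\<in>{- int l..int l}. (cmod (sph_harm l m x))\<^sup>2))"
    by (rule Bochner_Integration.integral_sum[symmetric]) (rule int)
  also have "\<dots> = (LINT x|surface_measure. c)"
    by (rule Bochner_Integration.integral_cong[OF refl]) (simp only: space_surface_measure c)
  also have "\<dots> = 4 * pi * c" by (simp add: surface_mass)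
  finally have "c = (2 * real l + 1) / (4 * pi)" by (simp add: field_simps)
  then show ?thesis using c[OF x] by simp
qed

section \<open>Bessel's inequality and mean-square limits of Gaussian variables\<close>

lemma bessel_inequality:
  fixes \<phi> :: "'k \<Rightarrow> real ^ 3 \<Rightarrow> complex"
  assumes K: "finite K" and cont: "\<And>k. k \<in> K \<Longrightarrow> continuous_on UNIV (\<phi> k)"
    and orth: "\<And>j k. j \<in> K \<Longrightarrow> k \<in> K \<Longrightarrow> (LINT x|surface_measure. \<phi> j x * cnj (\<phi> k x)) = (if j = k then 1 else 0)"
    and f: "bounded_measurable surface_measure f"
  shows "(\<Sum>k\<in>K. (cmod (LINT x|surface_measure. f x *\<^sub>R \<phi> k x))\<^sup>2) \<le> (LINT x|surface_measure. (f x)\<^sup>2)"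
proof -
  \<comment> \<open>As \<open>f\<close> is real, the conjugate makes these the coefficients of its
    orthogonal projection \<open>g\<close>.\<close>
  define a where "a k = cnj (LINT x|surface_measure. f x *\<^sub>R \<phi> k x)" for k
  define g where "g x = (\<Sum>k\<in>K. a k * \<phi> k x)" for x
  have \<phi>m: "\<phi> k \<in> borel_measurable surface_measure" if "k \<in> K" for k
    by (rule continuous_surface_measurable[OF cont[OF that]])
  have gc: "continuous_on UNIV g" unfolding g_def by (intro continuous_intros cont)
  have "\<exists>B. \<forall>x\<in>S2. \<bar>f x\<bar> \<le> B" using f unfolding bounded_measurable_def space_surface_measure by blast
  then obtain B where B: "\<And>x. x \<in> S2 \<Longrightarrow> \<bar>f x\<bar> \<le> B" by blast
  have f\<phi>: "integrable surface_measure (\<lambda>x. f x *\<^sub>R u x)" if "continuous_on UNIV u" for u :: "real^3 \<Rightarrow> complex"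
  proof (rule Bochner_Integration.integrable_bound)
    show "integrable surface_measure (\<lambda>x. B * cmod (u x))"
      by (intro continuous_surface_integrable continuous_intros that)
    show "AE x in surface_measure. norm (f x *\<^sub>R u x) \<le> norm (B * cmod (u x))"
      using B by (intro AE_I2) (auto simp: abs_mult intro!: mult_right_mono intro: order_trans[OF _ abs_ge_self])
    show "(\<lambda>x. f x *\<^sub>R u x) \<in> borel_measurable surface_measure"
      using f continuous_surface_measurable[OF that] by (auto simp: bounded_measurable_def)
  qed
  have fcg: "(LINT x|surface_measure. f x *\<^sub>R cnj (g x)) = of_real (\<Sum>k\<in>K. (cmod (a k))\<^sup>2)"
  proof -
    have "(LINT x|surface_measure. f x *\<^sub>R cnj (g x)) = (LINT x|surface_measure. (\<Sum>k\<in>K. cnj (a k) * (f x *\<^sub>R cnj (\<phi> k x))))"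
      by (simp add: g_def scaleR_sum_right)
    also have "\<dots> = (\<Sum>k\<in>K. cnj (a k) * (LINT x|surface_measure. f x *\<^sub>R cnj (\<phi> k x)))"
    proof -
      have "integrable surface_measure (\<lambda>x. cnj (a k) * (f x *\<^sub>R cnj (\<phi> k x)))" if "k \<in> K" for k
        by (intro integrable_mult_right f\<phi> continuous_on_cnj cont that)
      then show ?thesis by (simp only: Bochner_Integration.integral_sum integral_mult_right_zero)
    qed
    also have "\<dots> = (\<Sum>k\<in>K. cnj (a k) * a k)"
    proof (intro sum.cong refl)
      fix k assume "k \<in> K"
      have "(LINT x|surface_measure. f x *\<^sub>R cnj (\<phi> k x)) = (LINT x|surface_measure. cnj (f x *\<^sub>R \<phi> k x))" by simp
      also have "\<dots> = a k" unfolding a_def by (rule integral_bounded_linear[OF bounded_linear_cnj f\<phi>[OF cont]]) fact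
      finally show "cnj (a k) * (LINT x|surface_measure. f x *\<^sub>R cnj (\<phi> k x)) = cnj (a k) * a k" by simp
    qed
    also have "\<dots> = of_real (\<Sum>k\<in>K. (cmod (a k))\<^sup>2)" by (simp add: complex_norm_square mult.commute del: of_real_power)
    finally show ?thesis .
  qed
  have gg: "(LINT x|surface_measure. g x * cnj (g x)) = of_real (\<Sum>k\<in>K. (cmod (a k))\<^sup>2)"
  proof -
    have "(LINT x|surface_measure. g x * cnj (g x)) = (LINT x|surface_measure. (\<Sum>j\<in>K. \<Sum>k\<in>K. (a j * cnj (a k)) * (\<phi> j x * cnj (\<phi> k x))))"
      by (simp add: g_def sum_product mult_ac)
    also have "\<dots> = (\<Sum>j\<in>K. \<Sum>k\<in>K. (a j * cnj (a k)) * (LINT x|surface_measure. \<phi> j x * cnj (\<phi> k x)))"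
    proof -
      have "integrable surface_measure (\<lambda>x. (a j * cnj (a k)) * (\<phi> j x * cnj (\<phi> k x)))" if "j \<in> K" "k \<in> K" for j k
        by (intro continuous_surface_integrable continuous_intros cont that)
      then show ?thesis
        by (simp add: Bochner_Integration.integral_sum Bochner_Integration.integrable_sum)
    qed
    also have "\<dots> = (\<Sum>j\<in>K. \<Sum>k\<in>K. if k = j then a j * cnj (a k) else 0)"
      by (intro sum.cong refl) (simp add: orth)
    also have "\<dots> = of_real (\<Sum>k\<in>K. (cmod (a k))\<^sup>2)" using K by (simp add: complex_norm_square del: of_real_power)
    finally show ?thesis .
  qed
  have ff: "integrable surface_measure (\<lambda>x. (f x)\<^sup>2)"
    by (intro surface.integrable_bounded_measurable bounded_measurable_power f)
  have i1: "integrable surface_measure (\<lambda>x. f x *\<^sub>R cnj (g x))" by (intro f\<phi> continuous_intros gc)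
  have i2: "integrable surface_measure (\<lambda>x. g x * cnj (g x))" by (intro continuous_surface_integrable continuous_intros gc)
  have "0 \<le> (LINT x|surface_measure. (cmod (of_real (f x) - g x))\<^sup>2)" by simp
  also have "\<dots> = (LINT x|surface_measure. (f x)\<^sup>2 - 2 * Re (f x *\<^sub>R cnj (g x)) + Re (g x * cnj (g x)))"
  proof -
    have "(cmod (of_real u - v))\<^sup>2 = u\<^sup>2 - 2 * Re (u *\<^sub>R cnj v) + Re (v * cnj v)" for u v
      unfolding cmod_power2 by (simp add: power2_eq_square algebra_simps)
    then show ?thesis by (simp only:)
  qed
  also have "\<dots> = (LINT x|surface_measure. (f x)\<^sup>2) - 2 * (LINT x|surface_measure. Re (f x *\<^sub>R cnj (g x))) + (LINT x|surface_measure. Re (g x * cnj (g x)))"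
    using ff integrable_Re[OF i1] integrable_Re[OF i2] by simp
  also have "\<dots> = (LINT x|surface_measure. (f x)\<^sup>2) - (\<Sum>k\<in>K. (cmod (a k))\<^sup>2)"
    unfolding integral_Re[OF i1] integral_Re[OF i2] fcg gg by simp
  finally show ?thesis by (simp add: a_def)
qed

lemma (in prob_space) gaussian_rv_centered:
  assumes X: "gaussian_rv M X" and int: "integrable M X" and mean: "expectation X = 0"
  shows "centered_gaussian M X"
proof -
  have [measurable]: "X \<in> borel_measurable M" using X by (simp add: gaussian_rv_def)
  from X obtain \<mu> where "(AE \<omega> in M. X \<omega> = \<mu>) \<or> (\<exists>\<sigma>>0. distributed M lborel X (normal_density \<mu> \<sigma>))"
    by (auto simp: gaussian_rv_def)
  then show ?thesis
  proof (elim disjE exE conjE)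
    assume ae: "AE \<omega> in M. X \<omega> = \<mu>"
    then have "expectation X = expectation (\<lambda>_. \<mu>)" by (intro integral_cong_AE) auto
    then have "\<mu> = 0" using mean by (simp add: prob_space)
    with ae have ae: "AE \<omega> in M. X \<omega> = 0" by simp
    have "expectation (\<lambda>\<omega>. (X \<omega>)\<^sup>2) = expectation (\<lambda>_. 0)"
      by (intro integral_cong_AE) (use ae in auto)
    moreover have "integrable M (\<lambda>\<omega>. (X \<omega>)\<^sup>2)"
      by (subst integrable_cong_AE[where g = "\<lambda>_. 0"]) (use ae in auto)
    moreover have "expectation (\<lambda>\<omega>. cos (s * X \<omega> + t)) = expectation (\<lambda>_. cos t)" for s t
      by (intro integral_cong_AE) (use ae in auto)
    ultimately show ?thesis by (simp add: centered_gaussian_def prob_space)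
  next
    fix \<sigma> :: real assume \<sigma>: "\<sigma> > 0" and d: "distributed M lborel X (normal_density \<mu> \<sigma>)"
    have "\<mu> = 0" using normal_distributed_expectation[OF \<sigma> d] mean by simp
    then have "distributed M lborel (\<lambda>\<omega>. X \<omega> / \<sigma>) std_normal_density"
      using d normal_standard_normal_convert[OF \<sigma>, of X \<mu>] by simp
    then have D: "distr M lborel (\<lambda>\<omega>. X \<omega> / \<sigma>) = std_normal_distribution"
      by (simp add: distributed_distr_eq_density)
    have "integrable (distr M lborel (\<lambda>\<omega>. X \<omega> / \<sigma>)) (\<lambda>x. x ^ 2)"
      unfolding D by (rule integrable_std_normal_distribution_moment)
    then have "integrable M (\<lambda>\<omega>. (X \<omega> / \<sigma>)\<^sup>2)" by (subst (asm) integrable_distr_eq) auto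
    then have i2: "integrable M (\<lambda>\<omega>. \<sigma>\<^sup>2 * (X \<omega> / \<sigma>)\<^sup>2)" by simp
    have v: "expectation (\<lambda>\<omega>. (X \<omega>)\<^sup>2) = \<sigma>\<^sup>2"
      using normal_distributed_variance[OF \<sigma> d] mean by simp
    have "expectation (\<lambda>\<omega>. cos (s * X \<omega> + t)) = cos t * exp (- (s\<^sup>2 * \<sigma>\<^sup>2) / 2)" for s t
    proof -
      have "(LINT x|distr M lborel (\<lambda>\<omega>. X \<omega> / \<sigma>). cos ((s * \<sigma>) * x + t)) = expectation (\<lambda>\<omega>. cos ((s * \<sigma>) * (X \<omega> / \<sigma>) + t))"
        by (rule integral_distr) auto
      then show ?thesis unfolding D std_normal_cos using \<sigma> by (simp add: power_mult_distrib)
    qed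
    then show ?thesis using i2 \<sigma> by (simp add: centered_gaussian_def v power_divide)
  qed
qed

lemma (in prob_space) expectation_abs_le_sqrt:
  assumes [measurable]: "X \<in> borel_measurable M" and X: "integrable M (\<lambda>\<omega>. (X \<omega>)\<^sup>2)"
  shows "integrable M X" "expectation (\<lambda>\<omega>. \<bar>X \<omega>\<bar>) \<le> sqrt (expectation (\<lambda>\<omega>. (X \<omega>)\<^sup>2))"
proof -
  show i: "integrable M X" by (rule square_integrable_imp_integrable[OF _ X]) simp
  have "(expectation (\<lambda>\<omega>. \<bar>X \<omega>\<bar> * 1))\<^sup>2 \<le> expectation (\<lambda>\<omega>. \<bar>X \<omega>\<bar>\<^sup>2) * expectation (\<lambda>\<omega>. 1\<^sup>2)"
    by (rule integral_cauchy_schwarz) (use X i in auto)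
  then show "expectation (\<lambda>\<omega>. \<bar>X \<omega>\<bar>) \<le> sqrt (expectation (\<lambda>\<omega>. (X \<omega>)\<^sup>2))"
    by (intro real_le_rsqrt) (simp add: prob_space)
qed

text \<open>Both sides of the defining identity are continuous in mean square: the cosine is
  1-Lipschitz, and the second moments converge by Cauchy-Schwarz.\<close>

lemma (in prob_space) centered_gaussian_limit:
  assumes Xn: "\<And>n. centered_gaussian M (X n)" and [measurable]: "Y \<in> borel_measurable M"
    and Y2: "integrable M (\<lambda>\<omega>. (Y \<omega>)\<^sup>2)"
    and lim: "(\<lambda>n. expectation (\<lambda>\<omega>. (X n \<omega> - Y \<omega>)\<^sup>2)) \<longlonglongrightarrow> 0"
  shows "centered_gaussian M Y"
proof -
  define e where "e n = expectation (\<lambda>\<omega>. (X n \<omega> - Y \<omega>)\<^sup>2)" for n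
  have [measurable]: "X n \<in> borel_measurable M" and X2: "integrable M (\<lambda>\<omega>. (X n \<omega>)\<^sup>2)" for n
    using Xn by (auto simp: centered_gaussian_def)
  have D2: "integrable M (\<lambda>\<omega>. (X n \<omega> - Y \<omega>)\<^sup>2)" for n
  proof (rule Bochner_Integration.integrable_bound)
    show "integrable M (\<lambda>\<omega>. 2 * (X n \<omega>)\<^sup>2 + 2 * (Y \<omega>)\<^sup>2)" using X2 Y2 by simp
    have "(x - y)\<^sup>2 \<le> 2 * x\<^sup>2 + 2 * y\<^sup>2" for x y :: real
      using zero_le_power2[of "x + y"] by (simp add: power2_eq_square algebra_simps)
    then show "AE \<omega> in M. norm ((X n \<omega> - Y \<omega>)\<^sup>2) \<le> norm (2 * (X n \<omega>)\<^sup>2 + 2 * (Y \<omega>)\<^sup>2)"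
      by (intro AE_I2) simp
  qed simp
  have se: "(\<lambda>n. sqrt (e n)) \<longlonglongrightarrow> 0" using tendsto_real_sqrt[OF lim] by (simp add: e_def)
  have int: "integrable M (\<lambda>\<omega>. cos (s * Z \<omega> + t))" if "Z \<in> borel_measurable M" for Z :: "'a \<Rightarrow> real" and s t :: real
  proof -
    have [measurable]: "Z \<in> borel_measurable M" by (rule that)
    show ?thesis by (rule integrable_const_bound[where B = 1]) auto
  qed
  have c: "(\<lambda>n. expectation (\<lambda>\<omega>. cos (s * X n \<omega> + t))) \<longlonglongrightarrow> expectation (\<lambda>\<omega>. cos (s * Y \<omega> + t))" for s t
  proof (rule LIM_zero_cancel)
    show "(\<lambda>n. expectation (\<lambda>\<omega>. cos (s * X n \<omega> + t)) - expectation (\<lambda>\<omega>. cos (s * Y \<omega> + t))) \<longlonglongrightarrow> 0"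
    proof (rule Lim_null_comparison)
      show "(\<lambda>n. \<bar>s\<bar> * sqrt (e n)) \<longlonglongrightarrow> 0" using tendsto_mult_right_zero[OF se] .
      show "\<forall>\<^sub>F n in sequentially. norm (expectation (\<lambda>\<omega>. cos (s * X n \<omega> + t)) - expectation (\<lambda>\<omega>. cos (s * Y \<omega> + t))) \<le> \<bar>s\<bar> * sqrt (e n)"
      proof (intro always_eventually allI)
        fix n
        have lip: "\<bar>cos a - cos b\<bar> \<le> \<bar>a - b\<bar>" for a b :: real
        proof -
          have "\<bar>cos a - cos b\<bar> = 2 * \<bar>sin ((a + b) / 2)\<bar> * \<bar>sin ((b - a) / 2)\<bar>"
            by (simp add: cos_diff_cos abs_mult)
          also have "\<dots> \<le> 2 * 1 * \<bar>(b - a) / 2\<bar>"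
            by (intro mult_mono abs_sin_x_le_abs_x) auto
          finally show ?thesis by simp
        qed
        have "norm (expectation (\<lambda>\<omega>. cos (s * X n \<omega> + t)) - expectation (\<lambda>\<omega>. cos (s * Y \<omega> + t)))
           = \<bar>expectation (\<lambda>\<omega>. cos (s * X n \<omega> + t) - cos (s * Y \<omega> + t))\<bar>" by (simp add: int)
        also have "\<bar>expectation (\<lambda>\<omega>. cos (s * X n \<omega> + t) - cos (s * Y \<omega> + t))\<bar>
           \<le> expectation (\<lambda>\<omega>. \<bar>cos (s * X n \<omega> + t) - cos (s * Y \<omega> + t)\<bar>)" by (rule integral_abs_bound)
        also have "\<dots> \<le> expectation (\<lambda>\<omega>. \<bar>s\<bar> * \<bar>X n \<omega> - Y \<omega>\<bar>)"
        proof (rule integral_mono)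
          show "\<bar>cos (s * X n \<omega> + t) - cos (s * Y \<omega> + t)\<bar> \<le> \<bar>s\<bar> * \<bar>X n \<omega> - Y \<omega>\<bar>" for \<omega>
            using lip[of "s * X n \<omega> + t" "s * Y \<omega> + t"] by (simp add: abs_mult[symmetric] right_diff_distrib)
        qed (use int expectation_abs_le_sqrt(1)[OF _ D2[of n]] in auto)
        also have "\<dots> \<le> \<bar>s\<bar> * sqrt (e n)"
          using expectation_abs_le_sqrt(2)[OF _ D2[of n]] by (simp add: e_def mult_left_mono)
        finally show "norm (expectation (\<lambda>\<omega>. cos (s * X n \<omega> + t)) - expectation (\<lambda>\<omega>. cos (s * Y \<omega> + t))) \<le> \<bar>s\<bar> * sqrt (e n)" .
      qed
    qed
  qed
  have v: "(\<lambda>n. expectation (\<lambda>\<omega>. (X n \<omega>)\<^sup>2)) \<longlonglongrightarrow> expectation (\<lambda>\<omega>. (Y \<omega>)\<^sup>2)"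
  proof (rule LIM_zero_cancel, rule Lim_null_comparison)
    show "(\<lambda>n. e n + 2 * sqrt (expectation (\<lambda>\<omega>. (Y \<omega>)\<^sup>2)) * sqrt (e n)) \<longlonglongrightarrow> 0"
      using tendsto_add[OF lim tendsto_mult_right_zero[OF se]] by (simp add: e_def)
    show "\<forall>\<^sub>F n in sequentially. norm (expectation (\<lambda>\<omega>. (X n \<omega>)\<^sup>2) - expectation (\<lambda>\<omega>. (Y \<omega>)\<^sup>2))
        \<le> e n + 2 * sqrt (expectation (\<lambda>\<omega>. (Y \<omega>)\<^sup>2)) * sqrt (e n)"
    proof (intro always_eventually allI)
      fix n
      have p: "integrable M (\<lambda>\<omega>. Y \<omega> * (X n \<omega> - Y \<omega>))"
      proof (rule Bochner_Integration.integrable_bound)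
        show "integrable M (\<lambda>\<omega>. ((Y \<omega>)\<^sup>2 + (X n \<omega> - Y \<omega>)\<^sup>2) / 2)" using Y2 D2 by simp
        have "\<bar>x * y\<bar> \<le> (x\<^sup>2 + y\<^sup>2) / 2" for x y :: real
          using zero_le_power2[of "\<bar>x\<bar> - \<bar>y\<bar>"] by (simp add: power2_eq_square abs_mult algebra_simps)
        then show "AE \<omega> in M. norm (Y \<omega> * (X n \<omega> - Y \<omega>)) \<le> norm (((Y \<omega>)\<^sup>2 + (X n \<omega> - Y \<omega>)\<^sup>2) / 2)"
          by (intro AE_I2) (simp only: real_norm_def, simp)
      qed simp
      have "expectation (\<lambda>\<omega>. (X n \<omega>)\<^sup>2) = expectation (\<lambda>\<omega>. (Y \<omega>)\<^sup>2 + 2 * (Y \<omega> * (X n \<omega> - Y \<omega>)) + (X n \<omega> - Y \<omega>)\<^sup>2)"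
        by (simp add: power2_eq_square algebra_simps)
      also have "\<dots> = expectation (\<lambda>\<omega>. (Y \<omega>)\<^sup>2) + 2 * expectation (\<lambda>\<omega>. Y \<omega> * (X n \<omega> - Y \<omega>)) + e n"
        using Y2 p D2 by (simp add: e_def)
      finally have eq: "expectation (\<lambda>\<omega>. (X n \<omega>)\<^sup>2) - expectation (\<lambda>\<omega>. (Y \<omega>)\<^sup>2) = e n + 2 * expectation (\<lambda>\<omega>. Y \<omega> * (X n \<omega> - Y \<omega>))"
        by simp
      have "(expectation (\<lambda>\<omega>. Y \<omega> * (X n \<omega> - Y \<omega>)))\<^sup>2 \<le> expectation (\<lambda>\<omega>. (Y \<omega>)\<^sup>2) * e n"
        unfolding e_def by (rule integral_cauchy_schwarz[OF Y2 D2 p])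
      then have "\<bar>expectation (\<lambda>\<omega>. Y \<omega> * (X n \<omega> - Y \<omega>))\<bar> \<le> sqrt (expectation (\<lambda>\<omega>. (Y \<omega>)\<^sup>2)) * sqrt (e n)"
        unfolding real_sqrt_mult[symmetric] by (metis real_sqrt_abs real_sqrt_le_iff)
      moreover have "e n \<ge> 0" by (simp add: e_def)
      ultimately show "norm (expectation (\<lambda>\<omega>. (X n \<omega>)\<^sup>2) - expectation (\<lambda>\<omega>. (Y \<omega>)\<^sup>2))
        \<le> e n + 2 * sqrt (expectation (\<lambda>\<omega>. (Y \<omega>)\<^sup>2)) * sqrt (e n)"
        unfolding eq real_norm_def by linarith
    qed
  qed
  have "expectation (\<lambda>\<omega>. cos (s * Y \<omega> + t)) = cos t * exp (- (s\<^sup>2 * expectation (\<lambda>\<omega>. (Y \<omega>)\<^sup>2)) / 2)" for s t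
  proof (rule LIMSEQ_unique[OF c])
    have "expectation (\<lambda>\<omega>. cos (s * X n \<omega> + t)) = cos t * exp (- (s\<^sup>2 * expectation (\<lambda>\<omega>. (X n \<omega>)\<^sup>2)) / 2)" for n
      using Xn[of n] by (simp add: centered_gaussian_def)
    then show "(\<lambda>n. expectation (\<lambda>\<omega>. cos (s * X n \<omega> + t))) \<longlonglongrightarrow> cos t * exp (- (s\<^sup>2 * expectation (\<lambda>\<omega>. (Y \<omega>)\<^sup>2)) / 2)"
      by (auto intro!: tendsto_intros v)
  qed
  then show ?thesis using Y2 by (simp add: centered_gaussian_def)
qed

section \<open>Cubature on the sphere\<close>

lemma sphere_partition:
  assumes "\<epsilon> > 0"
  obtains F B where "finite F" "F \<subseteq> S2" "\<And>x. x \<in> F \<Longrightarrow> B x \<in> sets surface_measure"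
    "disjoint_family_on B F" "(\<Union>x\<in>F. B x) = S2" "\<And>x y. x \<in> F \<Longrightarrow> y \<in> B x \<Longrightarrow> dist x y < \<epsilon>"
proof -
  have "compact S2" by simp
  then obtain F where F: "finite F" "F \<subseteq> S2" "S2 \<subseteq> (\<Union>x\<in>F. ball x \<epsilon>)"
    using compactE_image[of S2 S2 "\<lambda>x. ball x \<epsilon>"] assms by (metis (no_types, lifting) UN_iff centre_in_ball open_ball subsetI)
  obtain h where h: "bij_betw h {..<card F} F" using ex_bij_betw_nat_finite[OF F(1)] by (auto simp: atLeast0LessThan)
  define g where "g = the_inv_into {..<card F} h"
  have hg: "g x < card F" "h (g x) = x" if "x \<in> F" for x
    using that h bij_betw_the_inv_into[OF h] f_the_inv_into_f_bij_betw[OF h, of x]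
    unfolding g_def by (auto simp: bij_betw_def)
  \<comment> \<open>Each ball of a finite cover loses the balls of smaller index, so every point
    lies exactly in the cell of the first ball that contains it.\<close>
  define B where "B x = S2 \<inter> ball x \<epsilon> - (\<Union>i<g x. ball (h i) \<epsilon>)" for x
  show thesis
  proof
    show "B x \<in> sets surface_measure" if "x \<in> F" for x
      unfolding sets_surface_measure sets_restrict_space B_def
      by (rule image_eqI[where x = "ball x \<epsilon> - (\<Union>i<g x. ball (h i) \<epsilon>)"]) auto
    show "disjoint_family_on B F"
    proof (unfold disjoint_family_on_def, intro ballI impI)
      fix x y assume xy: "x \<in> F" "y \<in> F" "x \<noteq> y"
      then have "g x \<noteq> g y" using hg by metis
      then consider "g x < g y" | "g y < g x" by linarith
      then show "B x \<inter> B y = {}"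
        using hg(2)[OF xy(1)] hg(2)[OF xy(2)] unfolding B_def by cases (force+)
    qed
    show "(\<Union>x\<in>F. B x) = S2"
    proof (intro equalityI subsetI)
      fix y assume y: "y \<in> S2"
      define P where "P i \<longleftrightarrow> i < card F \<and> y \<in> ball (h i) \<epsilon>" for i
      obtain x where "x \<in> F" "y \<in> ball x \<epsilon>" using F(3) y by auto
      then have "P (g x)" using hg by (simp add: P_def)
      define i where "i = (LEAST i. P i)"
      have i: "P i" unfolding i_def by (rule LeastI) fact
      have less: "\<not> P j" if "j < i" for j using that unfolding i_def by (rule not_less_Least)
      have hi: "h i \<in> F" using i h by (auto simp: P_def bij_betw_def)
      have "g (h i) = i" using i h unfolding g_def P_def by (simp add: bij_betw_def the_inv_into_f_f)
      then have "y \<in> B (h i)" using i less y unfolding B_def P_def by (auto dest: less_trans)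
      then show "y \<in> (\<Union>x\<in>F. B x)" using hi by auto
    qed (auto simp: B_def)
  qed (use F in \<open>auto simp: B_def\<close>)
qed

lemma cubature_error:
  fixes f :: "real ^ 3 \<Rightarrow> complex"
  assumes F: "finite F" and B: "\<And>x. x \<in> F \<Longrightarrow> B x \<in> sets surface_measure"
    "disjoint_family_on B F" "(\<Union>x\<in>F. B x) = S2"
    and \<delta>: "\<And>x y. x \<in> F \<Longrightarrow> y \<in> B x \<Longrightarrow> cmod (f y - f x) \<le> \<delta>" and f: "continuous_on UNIV f"
  shows "cmod ((\<Sum>x\<in>F. measure surface_measure (B x) *\<^sub>R f x) - (LINT x|surface_measure. f x)) \<le> 4 * pi * \<delta>"
proof -
  define s where "s y = (\<Sum>x\<in>F. indicator (B x) y *\<^sub>R f x)" for y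
  have si: "integrable surface_measure (\<lambda>y. indicator (B x) y *\<^sub>R f x)" if "x \<in> F" for x
    using B(1)[OF that] by (intro integrable_scaleR_left) (auto simp: surface.emeasure_eq_measure)
  have fi: "integrable surface_measure f" by (rule continuous_surface_integrable[OF f])
  have sint: "integrable surface_measure s" unfolding s_def using si by (rule Bochner_Integration.integrable_sum)
  have "(LINT y|surface_measure. s y) = (\<Sum>x\<in>F. (LINT y|surface_measure. indicator (B x) y *\<^sub>R f x))"
    unfolding s_def using si by (rule Bochner_Integration.integral_sum)
  also have "\<dots> = (\<Sum>x\<in>F. measure surface_measure (B x) *\<^sub>R f x)"
  proof (intro sum.cong refl)
    fix x assume x: "x \<in> F"
    have "(LINT y|surface_measure. indicator (B x) y *\<^sub>R f x) = (LINT y|surface_measure. indicat_real (B x) y) *\<^sub>R f x"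
      using B(1)[OF x] by (intro integral_scaleR_left) (auto simp: surface.emeasure_eq_measure)
    then show "(LINT y|surface_measure. indicator (B x) y *\<^sub>R f x) = measure surface_measure (B x) *\<^sub>R f x"
      using sets.sets_into_space[OF B(1)[OF x]] by (simp add: Int_absorb2)
  qed
  finally have "cmod ((\<Sum>x\<in>F. measure surface_measure (B x) *\<^sub>R f x) - (LINT x|surface_measure. f x))
      = cmod (LINT y|surface_measure. s y - f y)" using sint fi by simp
  also have "\<dots> \<le> (LINT y|surface_measure. cmod (s y - f y))" by (rule integral_norm_bound)
  also have "\<dots> \<le> (LINT y|surface_measure. \<delta>)"
  proof (rule integral_mono_AE)
    show "AE y in surface_measure. cmod (s y - f y) \<le> \<delta>"
    proof (intro AE_I2)
      fix y assume "y \<in> space surface_measure"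
      then have "y \<in> (\<Union>x\<in>F. B x)" by (simp only: B(3) space_surface_measure)
      then obtain x where x: "x \<in> F" "y \<in> B x" by blast
      have "indicator (B z) y *\<^sub>R f z = (if z = x then f x else 0)" if "z \<in> F" for z
        using x that B(2) by (auto simp: disjoint_family_on_def indicator_def)
      then have "s y = (\<Sum>z\<in>F. if z = x then f x else 0)" unfolding s_def by (intro sum.cong) auto
      then have "s y = f x" using x F by simp
      then show "cmod (s y - f y) \<le> \<delta>" using \<delta>[OF x] by (simp add: norm_minus_commute)
    qed
  qed (use sint fi in auto)
  finally show ?thesis by (simp add: surface_mass)
qed

text \<open>\<open>gaussian_field\<close> speaks of finite combinations of values only, and cubature
  sums approximate integrals within that class. The weights are the areas of the cells of finer and
  finer partitions.\<close>

lemma cubature: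
  obtains F :: "nat \<Rightarrow> (real ^ 3) set" and w :: "nat \<Rightarrow> real ^ 3 \<Rightarrow> real" where
    "\<And>n. finite (F n)" "\<And>n. F n \<subseteq> S2" "\<And>n x. w n x \<ge> 0" "\<And>n. (\<Sum>x\<in>F n. w n x) = 4 * pi"
    "\<And>f::real ^ 3 \<Rightarrow> complex. continuous_on UNIV f \<Longrightarrow>
       (\<lambda>n. \<Sum>x\<in>F n. w n x *\<^sub>R f x) \<longlonglongrightarrow> (LINT x|surface_measure. f x)"
proof -
  have "\<forall>n. \<exists>F B. finite F \<and> F \<subseteq> S2 \<and> (\<forall>x\<in>F. B x \<in> sets surface_measure) \<and>
    disjoint_family_on B F \<and> (\<Union>x\<in>F. B x) = S2 \<and> (\<forall>x\<in>F. \<forall>y\<in>B x. dist x y < 1 / real (Suc n))"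
  proof
    fix n
    have "1 / real (Suc n) > 0" by simp
    from sphere_partition[OF this] show "\<exists>F B. finite F \<and> F \<subseteq> S2 \<and> (\<forall>x\<in>F. B x \<in> sets surface_measure) \<and>
      disjoint_family_on B F \<and> (\<Union>x\<in>F. B x) = S2 \<and> (\<forall>x\<in>F. \<forall>y\<in>B x. dist x y < 1 / real (Suc n))"
      by (metis (no_types, lifting))
  qed
  then obtain F B where FB: "\<And>n. finite (F n)" "\<And>n. F n \<subseteq> S2" "\<And>n x. x \<in> F n \<Longrightarrow> B n x \<in> sets surface_measure"
    "\<And>n. disjoint_family_on (B n) (F n)" "\<And>n. (\<Union>x\<in>F n. B n x) = S2"
    "\<And>n x y. x \<in> F n \<Longrightarrow> y \<in> B n x \<Longrightarrow> dist x y < 1 / real (Suc n)"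
    by metis
  define w where "w n x = measure surface_measure (B n x)" for n x
  show thesis
  proof
    show "(\<Sum>x\<in>F n. w n x) = 4 * pi" for n
    proof -
      have "(\<Sum>x\<in>F n. w n x) = measure surface_measure (\<Union>x\<in>F n. B n x)"
        unfolding w_def using FB by (intro surface.finite_measure_finite_Union[symmetric]) auto
      then show ?thesis using FB(5) surface_mass by simp
    qed
    show "(\<lambda>n. \<Sum>x\<in>F n. w n x *\<^sub>R f x) \<longlonglongrightarrow> (LINT x|surface_measure. f x)" if f: "continuous_on UNIV f"
      for f :: "real ^ 3 \<Rightarrow> complex"
    proof (rule LIMSEQ_I)
      fix r :: real assume r: "r > 0"
      define \<delta> where "\<delta> = r / (8 * pi)"
      have \<delta>: "\<delta> > 0" using r by (simp add: \<delta>_def)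
      have "uniformly_continuous_on S2 f"
        by (rule compact_uniformly_continuous[OF continuous_on_subset[OF f]]) auto
      then obtain d where d: "d > 0" "\<And>x y. x \<in> S2 \<Longrightarrow> y \<in> S2 \<Longrightarrow> dist y x < d \<Longrightarrow> dist (f y) (f x) < \<delta>"
        using \<delta> unfolding uniformly_continuous_on_def by metis
      obtain m where m: "1 / real (Suc m) < d" using d(1) nat_approx_posE by blast
      show "\<exists>no. \<forall>n\<ge>no. norm ((\<Sum>x\<in>F n. w n x *\<^sub>R f x) - (LINT x|surface_measure. f x)) < r"
      proof (intro exI allI impI)
        fix n assume n: "m \<le> n"
        have "norm ((\<Sum>x\<in>F n. w n x *\<^sub>R f x) - (LINT x|surface_measure. f x)) \<le> 4 * pi * \<delta>"
          unfolding w_def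
        proof (rule cubature_error[OF FB(1,3,4,5) _ f])
          fix x y assume xy: "x \<in> F n" "y \<in> B n x"
          have "1 / real (Suc n) \<le> 1 / real (Suc m)" using n by (simp add: frac_le)
          then have "dist y x < d" using FB(6)[OF xy] m by (simp add: dist_commute)
          moreover have "x \<in> S2" "y \<in> S2" using FB(2,5) xy by blast+
          ultimately show "cmod (f y - f x) \<le> \<delta>" using d(2)[of x y] by (simp add: dist_norm)
        qed
        then show "norm ((\<Sum>x\<in>F n. w n x *\<^sub>R f x) - (LINT x|surface_measure. f x)) < r"
          using r by (simp add: \<delta>_def)
      qed
    qed
  qed (use FB in \<open>auto simp: w_def\<close>)
qed

section \<open>The spectral coefficients\<close>

lemma (in prob_space) gaussian_field_centered_set:
  assumes "gaussian_field M f" "zero_mean_field M f" and F: "finite F" "F \<subseteq> S2"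
  shows "centered_gaussian M (\<lambda>\<omega>. \<Sum>x\<in>F. c x * f x \<omega>)"
proof (rule gaussian_rv_centered)
  have i: "integrable M (f x)" "expectation (f x) = 0" if "x \<in> F" for x
    using assms(2) F that by (auto simp: zero_mean_field_def)
  show "gaussian_rv M (\<lambda>\<omega>. \<Sum>x\<in>F. c x * f x \<omega>)" using assms(1) F by (simp add: gaussian_field_def)
  show "integrable M (\<lambda>\<omega>. \<Sum>x\<in>F. c x * f x \<omega>)" using i by (intro Bochner_Integration.integrable_sum integrable_mult_right)
  show "expectation (\<lambda>\<omega>. \<Sum>x\<in>F. c x * f x \<omega>) = 0"
    using i by (subst Bochner_Integration.integral_sum) auto
qed

abbreviation harmonics :: "nat set \<Rightarrow> (nat \<times> int) set" where
  "harmonics A \<equiv> (SIGMA l:A. {- int l..int l})"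

text \<open>Summability makes the truncation error \<open>tail\<close> small uniformly over the
  sphere.\<close>

locale spectral_field = prob_space M for M :: "'w measure" +
  fixes T :: "real ^ 3 \<Rightarrow> 'w \<Rightarrow> real" and a :: "nat \<Rightarrow> int \<Rightarrow> 'w \<Rightarrow> complex" and C :: "nat \<Rightarrow> real"
  assumes gaussian_T: "gaussian_field M T" and zero_mean_T: "zero_mean_field M T"
    and spectral_T: "spectral_representation M T a C"
    and summable_C: "summable (\<lambda>l. C l * (2 * real l + 1))"
begin

lemma a_measurable: "m \<in> {- int l..int l} \<Longrightarrow> a l m \<in> borel_measurable M"
  and a_square: "m \<in> {- int l..int l} \<Longrightarrow> integrable M (\<lambda>\<omega>. (cmod (a l m \<omega>))\<^sup>2)"
  and a_orth: "m \<in> {- int l..int l} \<Longrightarrow> m' \<in> {- int l'..int l'} \<Longrightarrow>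
     expectation (\<lambda>\<omega>. a l m \<omega> * cnj (a l' m' \<omega>)) = (if l = l' \<and> m = m' then of_real (C l) else 0)"
  using spectral_T by (auto simp: spectral_representation_def)

lemma a_product_integrable:
  assumes "m \<in> {- int l..int l}" "m' \<in> {- int l'..int l'}"
  shows "integrable M (\<lambda>\<omega>. a l m \<omega> * cnj (a l' m' \<omega>))"
proof (rule Bochner_Integration.integrable_bound)
  show "integrable M (\<lambda>\<omega>. ((cmod (a l m \<omega>))\<^sup>2 + (cmod (a l' m' \<omega>))\<^sup>2) / 2)"
    using a_square[OF assms(1)] a_square[OF assms(2)] by simp
  have "x * y \<le> (x\<^sup>2 + y\<^sup>2) / 2" for x y :: real
    using zero_le_power2[of "x - y"] by (simp add: power2_eq_square algebra_simps)
  then show "AE \<omega> in M. norm (a l m \<omega> * cnj (a l' m' \<omega>)) \<le> norm (((cmod (a l m \<omega>))\<^sup>2 + (cmod (a l' m' \<omega>))\<^sup>2) / 2)"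
    by (intro AE_I2) (simp add: norm_mult)
  have [measurable]: "cnj \<in> borel_measurable borel" by (intro borel_measurable_continuous_onI continuous_intros)
  have [measurable]: "a l m \<in> borel_measurable M" "a l' m' \<in> borel_measurable M" using assms a_measurable by blast+
  show "(\<lambda>\<omega>. a l m \<omega> * cnj (a l' m' \<omega>)) \<in> borel_measurable M" by measurable
qed

lemma linear_square:
  assumes K: "finite K" "K \<subseteq> harmonics UNIV"
  shows "integrable M (\<lambda>\<omega>. (cmod (\<Sum>k\<in>K. z k * a (fst k) (snd k) \<omega>))\<^sup>2)"
    and "expectation (\<lambda>\<omega>. (cmod (\<Sum>k\<in>K. z k * a (fst k) (snd k) \<omega>))\<^sup>2) = (\<Sum>k\<in>K. (cmod (z k))\<^sup>2 * C (fst k))"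
proof -
  let ?A = "\<lambda>k \<omega>. a (fst k) (snd k) \<omega>"
  have k: "snd k \<in> {- int (fst k)..int (fst k)}" if "k \<in> K" for k using K that by auto
  have sq: "complex_of_real ((cmod (\<Sum>k\<in>K. z k * ?A k \<omega>))\<^sup>2) = (\<Sum>j\<in>K. \<Sum>k\<in>K. (z j * cnj (z k)) * (?A j \<omega> * cnj (?A k \<omega>)))" for \<omega>
    by (simp only: complex_norm_square) (simp add: sum_product mult_ac)
  have ci: "integrable M (\<lambda>\<omega>. \<Sum>j\<in>K. \<Sum>k\<in>K. (z j * cnj (z k)) * (?A j \<omega> * cnj (?A k \<omega>)))"
    using k by (intro Bochner_Integration.integrable_sum integrable_mult_right a_product_integrable) auto
  then have cr: "integrable M (\<lambda>\<omega>. complex_of_real ((cmod (\<Sum>k\<in>K. z k * ?A k \<omega>))\<^sup>2))" by (simp only: sq)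
  then show "integrable M (\<lambda>\<omega>. (cmod (\<Sum>k\<in>K. z k * ?A k \<omega>))\<^sup>2)"
    using complex_of_real_integrable_eq by blast
  have "complex_of_real (expectation (\<lambda>\<omega>. (cmod (\<Sum>k\<in>K. z k * ?A k \<omega>))\<^sup>2))
     = expectation (\<lambda>\<omega>. complex_of_real ((cmod (\<Sum>k\<in>K. z k * ?A k \<omega>))\<^sup>2))"
    by (rule integral_complex_of_real[symmetric])
  also have "\<dots> = (\<Sum>j\<in>K. \<Sum>k\<in>K. (z j * cnj (z k)) * expectation (\<lambda>\<omega>. ?A j \<omega> * cnj (?A k \<omega>)))"
  proof -
    have "integrable M (\<lambda>\<omega>. (z j * cnj (z k)) * (?A j \<omega> * cnj (?A k \<omega>)))" if "j \<in> K" "k \<in> K" for j k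
      using k that by (intro integrable_mult_right a_product_integrable) auto
    then show ?thesis
      by (simp only: sq) (simp add: Bochner_Integration.integral_sum Bochner_Integration.integrable_sum)
  qed
  also have "\<dots> = (\<Sum>j\<in>K. \<Sum>k\<in>K. if k = j then (z j * cnj (z k)) * of_real (C (fst k)) else 0)"
  proof -
    have "expectation (\<lambda>\<omega>. ?A j \<omega> * cnj (?A k \<omega>)) = (if k = j then of_real (C (fst k)) else 0)" if "j \<in> K" "k \<in> K" for j k
      using a_orth[OF k[OF that(1)] k[OF that(2)]] by (auto simp: prod_eq_iff)
    then show ?thesis by (intro sum.cong refl) simp
  qed
  also have "\<dots> = of_real (\<Sum>k\<in>K. (cmod (z k))\<^sup>2 * C (fst k))"
    using K(1) by (simp add: complex_norm_square del: of_real_power)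
  finally show "expectation (\<lambda>\<omega>. (cmod (\<Sum>k\<in>K. z k * ?A k \<omega>))\<^sup>2) = (\<Sum>k\<in>K. (cmod (z k))\<^sup>2 * C (fst k))"
    unfolding of_real_eq_iff .
qed

lemma C_nonneg: "C l \<ge> 0"
proof -
  have "expectation (\<lambda>\<omega>. (cmod (\<Sum>k\<in>{(l, 0)}. 1 * a (fst k) (snd k) \<omega>))\<^sup>2) = (\<Sum>k\<in>{(l, 0::int)}. (cmod 1)\<^sup>2 * C (fst k))"
    by (rule linear_square) auto
  then have "C l = expectation (\<lambda>\<omega>. (cmod (a l 0 \<omega>))\<^sup>2)" by simp
  then show ?thesis by simp
qed

definition partial_T where "partial_T A x \<omega> = (\<Sum>k\<in>harmonics A. sph_harm (fst k) (snd k) x * a (fst k) (snd k) \<omega>)"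

lemma partial_T_eq: "finite A \<Longrightarrow> partial_T A x \<omega> = (\<Sum>l\<in>A. harmonic_component a l x \<omega>)"
  unfolding partial_T_def harmonic_component_def
  by (subst sum.Sigma) (auto intro!: sum.cong simp: mult.commute)

lemma partial_T_square:
  assumes A: "finite A" and x: "x \<in> S2"
  shows "integrable M (\<lambda>\<omega>. (cmod (partial_T A x \<omega>))\<^sup>2)"
    and "expectation (\<lambda>\<omega>. (cmod (partial_T A x \<omega>))\<^sup>2) = (\<Sum>l\<in>A. C l * ((2 * real l + 1) / (4 * pi)))"
proof -
  have K: "finite (harmonics A)" "harmonics A \<subseteq> harmonics UNIV" using A by auto
  show "integrable M (\<lambda>\<omega>. (cmod (partial_T A x \<omega>))\<^sup>2)"
    unfolding partial_T_def by (rule linear_square[OF K])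
  have "expectation (\<lambda>\<omega>. (cmod (partial_T A x \<omega>))\<^sup>2) = (\<Sum>k\<in>harmonics A. (cmod (sph_harm (fst k) (snd k) x))\<^sup>2 * C (fst k))"
    unfolding partial_T_def by (rule linear_square[OF K])
  also have "\<dots> = (\<Sum>l\<in>A. \<Sum>m\<in>{- int l..int l}. (cmod (sph_harm l m x))\<^sup>2 * C l)"
    using A by (subst sum.Sigma) (auto intro!: sum.cong)
  also have "\<dots> = (\<Sum>l\<in>A. C l * ((2 * real l + 1) / (4 * pi)))"
    unfolding sum_distrib_right[symmetric] sum_sph_harm_square[OF x] by (simp add: mult.commute)
  finally show "expectation (\<lambda>\<omega>. (cmod (partial_T A x \<omega>))\<^sup>2) = (\<Sum>l\<in>A. C l * ((2 * real l + 1) / (4 * pi)))" .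
qed

lemma T_centered:
  assumes "finite F" "F \<subseteq> S2" shows "centered_gaussian M (\<lambda>\<omega>. \<Sum>x\<in>F. c x * T x \<omega>)"
  by (rule gaussian_field_centered_set[OF gaussian_T zero_mean_T assms])

lemma T_measurable: "x \<in> S2 \<Longrightarrow> T x \<in> borel_measurable M"
  and T_square: "x \<in> S2 \<Longrightarrow> integrable M (\<lambda>\<omega>. (T x \<omega>)\<^sup>2)"
  using T_centered[of "{x}" "\<lambda>_. 1"] by (auto simp: centered_gaussian_def)

definition tail where "tail N = (\<Sum>l. C (l + N) * ((2 * real (l + N) + 1) / (4 * pi)))"

lemma summable_C': "summable (\<lambda>l. C l * ((2 * real l + 1) / (4 * pi)))"
  using summable_divide[OF summable_C, of "4 * pi"] by simp

lemma tail_tendsto: "tail \<longlonglongrightarrow> 0"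
  unfolding tail_def by (rule suminf_exist_split2[OF summable_C'])

lemma tail_bound: "(\<Sum>l\<in>{N..<n}. C l * ((2 * real l + 1) / (4 * pi))) \<le> tail N"
proof (cases "N \<le> n")
  case True
  have "(\<Sum>l\<in>{N..<n}. C l * ((2 * real l + 1) / (4 * pi))) = (\<Sum>l<n - N. C (l + N) * ((2 * real (l + N) + 1) / (4 * pi)))"
    using sum.shift_bounds_nat_ivl[of "\<lambda>l. C l * ((2 * real l + 1) / (4 * pi))" 0 N "n - N"] True
    by (simp add: atLeast0LessThan)
  also have "\<dots> \<le> tail N"
    unfolding tail_def using C_nonneg by (intro sum_le_suminf summable_ignore_initial_segment[OF summable_C']) auto
  finally show ?thesis .
next
  case False
  have "0 \<le> tail N"
    unfolding tail_def using C_nonneg by (intro suminf_nonneg summable_ignore_initial_segment[OF summable_C']) auto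
  then show ?thesis using False by simp
qed

lemma cmod_square_add: "(cmod (u + v))\<^sup>2 \<le> 2 * (cmod u)\<^sup>2 + 2 * (cmod v)\<^sup>2"
proof -
  have "(cmod (u + v))\<^sup>2 \<le> (cmod u + cmod v)\<^sup>2" by (intro power_mono norm_triangle_ineq) simp
  also have "\<dots> \<le> 2 * (cmod u)\<^sup>2 + 2 * (cmod v)\<^sup>2"
    using zero_le_power2[of "cmod u - cmod v"] by (simp add: power2_eq_square algebra_simps)
  finally show ?thesis .
qed

lemma partial_T_measurable: "finite A \<Longrightarrow> partial_T A x \<in> borel_measurable M"
  unfolding partial_T_def using a_measurable by (intro borel_measurable_sum borel_measurable_times) auto

text \<open>The spectral representation gives convergence without a rate. Comparison with a much
  later partial sum, whose own error is negligible, leaves the variance of the block in between,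
  which does not depend on \<open>x\<close> by Unsoeld's theorem; the factor 2 comes from splitting
  a square.\<close>

lemma approximation_error:
  assumes x: "x \<in> S2"
  shows "integrable M (\<lambda>\<omega>. (cmod (of_real (T x \<omega>) - partial_T {..<N} x \<omega>))\<^sup>2)"
    and "expectation (\<lambda>\<omega>. (cmod (of_real (T x \<omega>) - partial_T {..<N} x \<omega>))\<^sup>2) \<le> 2 * tail N"
proof -
  have [measurable]: "T x \<in> borel_measurable M" "partial_T {..<n} x \<in> borel_measurable M" "partial_T {N..<n} x \<in> borel_measurable M" for n
    using T_measurable[OF x] partial_T_measurable by auto
  let ?D = "\<lambda>n \<omega>. of_real (T x \<omega>) - partial_T {..<n} x \<omega>"
  show int: "integrable M (\<lambda>\<omega>. (cmod (?D N \<omega>))\<^sup>2)"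
  proof (rule Bochner_Integration.integrable_bound)
    show "integrable M (\<lambda>\<omega>. 2 * (T x \<omega>)\<^sup>2 + 2 * (cmod (partial_T {..<N} x \<omega>))\<^sup>2)"
      using T_square[OF x] partial_T_square(1)[OF _ x, of "{..<N}"] by simp
    show "AE \<omega> in M. norm ((cmod (?D N \<omega>))\<^sup>2) \<le> norm (2 * (T x \<omega>)\<^sup>2 + 2 * (cmod (partial_T {..<N} x \<omega>))\<^sup>2)"
      using cmod_square_add[of "of_real (T x _)" "- partial_T {..<N} x _"] by (intro AE_I2) simp
  qed measurable
  have lim: "(\<lambda>n. \<integral>\<^sup>+\<omega>. ennreal ((cmod (?D n \<omega>))\<^sup>2) \<partial>M) \<longlonglongrightarrow> 0"
    using spectral_T x by (simp add: spectral_representation_def partial_T_eq)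
  have "(\<integral>\<^sup>+\<omega>. ennreal ((cmod (?D N \<omega>))\<^sup>2) \<partial>M) \<le> ennreal (2 * tail N)"
  proof (rule ennreal_le_epsilon)
    fix \<epsilon> :: real assume \<epsilon>: "0 < \<epsilon>"
    have "\<forall>\<^sub>F n in sequentially. (\<integral>\<^sup>+\<omega>. ennreal ((cmod (?D n \<omega>))\<^sup>2) \<partial>M) < ennreal (\<epsilon> / 2)"
      by (rule order_tendstoD(2)[OF lim]) (use \<epsilon> in simp)
    then obtain n where n: "N \<le> n" "(\<integral>\<^sup>+\<omega>. ennreal ((cmod (?D n \<omega>))\<^sup>2) \<partial>M) < ennreal (\<epsilon> / 2)"
      unfolding eventually_sequentially by (metis nle_le)
    have split: "?D N \<omega> = ?D n \<omega> + partial_T {N..<n} x \<omega>" for \<omega>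
    proof -
      have un: "{..<n} = {..<N} \<union> {N..<n}" using n(1) by auto
      have "(\<Sum>l<n. harmonic_component a l x \<omega>) = (\<Sum>l<N. harmonic_component a l x \<omega>) + (\<Sum>l\<in>{N..<n}. harmonic_component a l x \<omega>)"
        unfolding un by (rule sum.union_disjoint) auto
      then have "partial_T {..<n} x \<omega> = partial_T {..<N} x \<omega> + partial_T {N..<n} x \<omega>"
        by (simp only: partial_T_eq finite_lessThan finite_atLeastLessThan)
      then show ?thesis by simp
    qed
    have "(\<integral>\<^sup>+\<omega>. ennreal ((cmod (?D N \<omega>))\<^sup>2) \<partial>M) \<le> (\<integral>\<^sup>+\<omega>. 2 * ennreal ((cmod (?D n \<omega>))\<^sup>2) + 2 * ennreal ((cmod (partial_T {N..<n} x \<omega>))\<^sup>2) \<partial>M)"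
    proof (rule nn_integral_mono)
      fix \<omega>
      have "ennreal ((cmod (?D N \<omega>))\<^sup>2) \<le> ennreal (2 * (cmod (?D n \<omega>))\<^sup>2 + 2 * (cmod (partial_T {N..<n} x \<omega>))\<^sup>2)"
        unfolding split[of \<omega>] by (intro ennreal_leI cmod_square_add)
      then show "ennreal ((cmod (?D N \<omega>))\<^sup>2) \<le> 2 * ennreal ((cmod (?D n \<omega>))\<^sup>2) + 2 * ennreal ((cmod (partial_T {N..<n} x \<omega>))\<^sup>2)"
        by (simp add: ennreal_mult')
    qed
    also have "\<dots> = 2 * (\<integral>\<^sup>+\<omega>. ennreal ((cmod (?D n \<omega>))\<^sup>2) \<partial>M) + 2 * (\<integral>\<^sup>+\<omega>. ennreal ((cmod (partial_T {N..<n} x \<omega>))\<^sup>2) \<partial>M)"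
      by (simp add: nn_integral_add nn_integral_cmult)
    also have "(\<integral>\<^sup>+\<omega>. ennreal ((cmod (partial_T {N..<n} x \<omega>))\<^sup>2) \<partial>M) = ennreal (expectation (\<lambda>\<omega>. (cmod (partial_T {N..<n} x \<omega>))\<^sup>2))"
      by (rule nn_integral_eq_integral[OF partial_T_square(1)[OF _ x]]) auto
    also have "2 * (\<integral>\<^sup>+\<omega>. ennreal ((cmod (?D n \<omega>))\<^sup>2) \<partial>M) + 2 * ennreal (expectation (\<lambda>\<omega>. (cmod (partial_T {N..<n} x \<omega>))\<^sup>2))
       \<le> 2 * ennreal (\<epsilon> / 2) + 2 * ennreal (tail N)"
      using n(2) tail_bound[of N n] partial_T_square(2)[OF _ x, of "{N..<n}"]
      by (intro add_mono mult_left_mono ennreal_leI) auto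
    also have "\<dots> = ennreal (2 * tail N) + ennreal \<epsilon>"
    proof -
      have "2 * ennreal (\<epsilon> / 2) = ennreal (2 * (\<epsilon> / 2))" using \<epsilon> by (subst ennreal_mult') auto
      moreover have "2 * ennreal (tail N) = ennreal (2 * tail N)" by (subst ennreal_mult') auto
      ultimately show ?thesis by (simp add: add.commute)
    qed
    finally show "(\<integral>\<^sup>+\<omega>. ennreal ((cmod (?D N \<omega>))\<^sup>2) \<partial>M) \<le> ennreal (2 * tail N) + ennreal \<epsilon>" .
  qed
  then have "ennreal (expectation (\<lambda>\<omega>. (cmod (?D N \<omega>))\<^sup>2)) \<le> ennreal (2 * tail N)"
    by (subst (asm) nn_integral_eq_integral[OF int]) auto
  moreover have "0 \<le> tail N" using tail_bound[of N N] by simp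
  ultimately show "expectation (\<lambda>\<omega>. (cmod (?D N \<omega>))\<^sup>2) \<le> 2 * tail N"
    by (subst (asm) ennreal_le_iff) auto
qed

lemma weighted_sum_square:
  fixes u :: "'x \<Rightarrow> complex"
  assumes "finite F" "\<And>x. x \<in> F \<Longrightarrow> w x \<ge> 0"
  shows "(cmod (\<Sum>x\<in>F. w x *\<^sub>R u x))\<^sup>2 \<le> (\<Sum>x\<in>F. w x) * (\<Sum>x\<in>F. w x * (cmod (u x))\<^sup>2)"
proof -
  have "cmod (\<Sum>x\<in>F. w x *\<^sub>R u x) \<le> (\<Sum>x\<in>F. sqrt (w x) * (sqrt (w x) * cmod (u x)))"
    using assms by (intro sum_norm_le) (auto simp flip: mult.assoc)
  also have "\<dots> \<le> L2_set (\<lambda>x. sqrt (w x)) F * L2_set (\<lambda>x. sqrt (w x) * cmod (u x)) F"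
    using L2_set_mult_ineq[of "\<lambda>x. sqrt (w x)" "\<lambda>x. sqrt (w x) * cmod (u x)" F] assms by (simp add: abs_mult)
  finally have "(cmod (\<Sum>x\<in>F. w x *\<^sub>R u x))\<^sup>2 \<le> (L2_set (\<lambda>x. sqrt (w x)) F * L2_set (\<lambda>x. sqrt (w x) * cmod (u x)) F)\<^sup>2"
    by (rule power_mono) simp
  also have "\<dots> = (\<Sum>x\<in>F. w x) * (\<Sum>x\<in>F. w x * (cmod (u x))\<^sup>2)"
    using assms by (simp add: L2_set_def power_mult_distrib sum_nonneg)
  finally show ?thesis .
qed

text \<open>
  The coefficients are mean-square limits of linear combinations of values of the field:
  cubature formulas discretize the projection integral of \<open>T\<close> against the spherical harmonics.
\<close>
lemma projection_limit:
  fixes K :: "(nat \<times> int) set" and z :: "nat \<times> int \<Rightarrow> complex"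
    and F :: "nat \<Rightarrow> (real ^ 3) set" and w :: "nat \<Rightarrow> real ^ 3 \<Rightarrow> real"
  assumes K: "finite K" "K \<subseteq> harmonics UNIV"
    and F: "\<And>n. finite (F n)" "\<And>n. F n \<subseteq> S2" "\<And>n x. w n x \<ge> 0" "\<And>n. (\<Sum>x\<in>F n. w n x) = 4 * pi"
      "\<And>f::real ^ 3 \<Rightarrow> complex. continuous_on UNIV f \<Longrightarrow>
       (\<lambda>n. \<Sum>x\<in>F n. w n x *\<^sub>R f x) \<longlonglongrightarrow> (LINT x|surface_measure. f x)"
  defines "\<Theta> \<equiv> \<lambda>x. \<Sum>k\<in>K. z k * cnj (sph_harm (fst k) (snd k) x)"
  defines "E \<equiv> \<lambda>n \<omega>. (\<Sum>x\<in>F n. w n x *\<^sub>R (\<Theta> x * of_real (T x \<omega>))) - (\<Sum>k\<in>K. z k * a (fst k) (snd k) \<omega>)"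
  shows "integrable M (\<lambda>\<omega>. (cmod (E n \<omega>))\<^sup>2)"
    and "(\<lambda>n. expectation (\<lambda>\<omega>. (cmod (E n \<omega>))\<^sup>2)) \<longlonglongrightarrow> 0"
proof -
  have \<Theta>c: "continuous_on UNIV \<Theta>" unfolding \<Theta>_def by (intro continuous_intros continuous_sph_harm)
  have "compact (\<Theta> ` S2)" by (intro compact_continuous_image continuous_on_subset[OF \<Theta>c]) auto
  then obtain B where B: "\<And>x. x \<in> S2 \<Longrightarrow> cmod (\<Theta> x) \<le> B"
    using compact_imp_bounded bounded_iff by (metis imageI)
  have \<Theta>B: "cmod (\<Theta> x) \<le> B" if "x \<in> F n" for x n using B F(2) that by blast
  define L where "L N = harmonics {..<N}" for N
  have Lf: "finite (L N)" "L N \<subseteq> harmonics UNIV" for N by (auto simp: L_def)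
  define q where "q n k = (\<Sum>x\<in>F n. w n x *\<^sub>R (\<Theta> x * sph_harm (fst k) (snd k) x))" for n k
  define zz where "zz k = (if k \<in> K then z k else 0)" for k
  have qlim: "(\<lambda>n. q n k) \<longlonglongrightarrow> zz k" if k: "k \<in> harmonics UNIV" for k
  proof -
    have "(\<lambda>n. q n k) \<longlonglongrightarrow> (LINT x|surface_measure. \<Theta> x * sph_harm (fst k) (snd k) x)"
      unfolding q_def by (intro F(5) continuous_intros \<Theta>c continuous_sph_harm)
    also have "(LINT x|surface_measure. \<Theta> x * sph_harm (fst k) (snd k) x)
       = (LINT x|surface_measure. (\<Sum>j\<in>K. z j * (sph_harm (fst k) (snd k) x * cnj (sph_harm (fst j) (snd j) x))))"
      by (simp add: \<Theta>_def sum_distrib_left sum_distrib_right mult_ac)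
    also have "\<dots> = (\<Sum>j\<in>K. z j * (LINT x|surface_measure. sph_harm (fst k) (snd k) x * cnj (sph_harm (fst j) (snd j) x)))"
    proof -
      have "integrable surface_measure (\<lambda>x. z j * (sph_harm (fst k) (snd k) x * cnj (sph_harm (fst j) (snd j) x)))" for j
        by (intro integrable_mult_right sph_harm_product_integrable)
      then show ?thesis by (simp only: Bochner_Integration.integral_sum integral_mult_right_zero)
    qed
    also have "\<dots> = (\<Sum>j\<in>K. if j = k then z j else 0)"
      using k by (intro sum.cong refl) (auto simp: sph_harm_orthonormal prod_eq_iff)
    also have "\<dots> = zz k" using K(1) by (simp add: zz_def)
    finally show ?thesis .
  qed
  obtain N0 where N0: "K \<subseteq> L N0"
  proof -
    have "finite (fst ` K)" using K by simp
    then obtain b where "\<forall>l\<in>fst ` K. l \<le> b" using finite_nat_set_iff_bounded_le by blast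
    then have "K \<subseteq> L (Suc b)" using K(2) by (fastforce simp: L_def)
    then show thesis by (rule that)
  qed
  \<comment> \<open>\<open>E1\<close> is the truncation error of the field, small for large
    \<open>N\<close> uniformly in \<open>n\<close>; \<open>E2\<close> is the cubature error of
    finitely many coefficients and tends to zero in \<open>n\<close> for fixed
    \<open>N\<close>.\<close>
  define E1 where "E1 N n \<omega> = (\<Sum>x\<in>F n. w n x *\<^sub>R (\<Theta> x * (of_real (T x \<omega>) - partial_T {..<N} x \<omega>)))" for N n \<omega>
  define E2 where "E2 N n \<omega> = (\<Sum>k\<in>L N. (q n k - zz k) * a (fst k) (snd k) \<omega>)" for N n \<omega>
  have split: "E n \<omega> = E1 N n \<omega> + E2 N n \<omega>" if "N0 \<le> N" for N n \<omega>
  proof -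
    have KL: "K \<subseteq> L N" using N0 that by (auto simp: L_def)
    have "(\<Sum>k\<in>L N. zz k * a (fst k) (snd k) \<omega>) = (\<Sum>k\<in>K. z k * a (fst k) (snd k) \<omega>)"
      by (rule sum.mono_neutral_cong_right) (use KL Lf in \<open>auto simp: zz_def\<close>)
    moreover have "(\<Sum>k\<in>L N. q n k * a (fst k) (snd k) \<omega>) = (\<Sum>x\<in>F n. w n x *\<^sub>R (\<Theta> x * partial_T {..<N} x \<omega>))"
      unfolding q_def partial_T_def L_def sum_distrib_right sum_distrib_left scaleR_sum_right
      by (subst sum.swap) (simp add: mult.assoc)
    ultimately show ?thesis
      by (simp add: E_def E1_def E2_def left_diff_distrib right_diff_distrib scaleR_diff_right sum_subtractf)
  qed
  have [measurable]: "T x \<in> borel_measurable M" if "x \<in> F n" for x n using T_measurable F(2) that by blast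
  have [measurable]: "partial_T {..<n} x \<in> borel_measurable M" for n x by (rule partial_T_measurable) simp
  have e2: "integrable M (\<lambda>\<omega>. (cmod (E2 N n \<omega>))\<^sup>2)"
    "expectation (\<lambda>\<omega>. (cmod (E2 N n \<omega>))\<^sup>2) = (\<Sum>k\<in>L N. (cmod (q n k - zz k))\<^sup>2 * C (fst k))" for N n
    unfolding E2_def by (rule linear_square[OF Lf])+
  have E1_pt: "(cmod (E1 N n \<omega>))\<^sup>2 \<le> 4 * pi * B\<^sup>2 * (\<Sum>x\<in>F n. w n x * (cmod (of_real (T x \<omega>) - partial_T {..<N} x \<omega>))\<^sup>2)" for N n \<omega>
  proof -
    have "(cmod (E1 N n \<omega>))\<^sup>2 \<le> (\<Sum>x\<in>F n. w n x) * (\<Sum>x\<in>F n. w n x * (cmod (\<Theta> x * (of_real (T x \<omega>) - partial_T {..<N} x \<omega>)))\<^sup>2)"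
      unfolding E1_def by (rule weighted_sum_square) (use F in auto)
    also have "\<dots> \<le> (4 * pi) * (\<Sum>x\<in>F n. w n x * (B\<^sup>2 * (cmod (of_real (T x \<omega>) - partial_T {..<N} x \<omega>))\<^sup>2))"
      unfolding F(4) norm_mult power_mult_distrib
      using \<Theta>B F(3) by (intro mult_left_mono sum_mono mult_right_mono power_mono) auto
    finally show ?thesis by (simp add: sum_distrib_left mult_ac)
  qed
  have i1: "integrable M (\<lambda>\<omega>. 4 * pi * B\<^sup>2 * (\<Sum>x\<in>F n. w n x * (cmod (of_real (T x \<omega>) - partial_T {..<N} x \<omega>))\<^sup>2))" for N n
    using approximation_error(1) F(2) by (intro integrable_mult_right Bochner_Integration.integrable_sum) blast
  have e1: "integrable M (\<lambda>\<omega>. (cmod (E1 N n \<omega>))\<^sup>2)" for N n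
  proof (rule Bochner_Integration.integrable_bound[OF i1[of n N]])
    show "AE \<omega> in M. norm ((cmod (E1 N n \<omega>))\<^sup>2) \<le> norm (4 * pi * B\<^sup>2 * (\<Sum>x\<in>F n. w n x * (cmod (of_real (T x \<omega>) - partial_T {..<N} x \<omega>))\<^sup>2))"
      using E1_pt by (intro AE_I2) (auto intro: order_trans[OF _ abs_ge_self])
    show "(\<lambda>\<omega>. (cmod (E1 N n \<omega>))\<^sup>2) \<in> borel_measurable M"
      unfolding E1_def by measurable
  qed
  have e1b: "expectation (\<lambda>\<omega>. (cmod (E1 N n \<omega>))\<^sup>2) \<le> 32 * pi\<^sup>2 * B\<^sup>2 * tail N" for N n
  proof -
    have "expectation (\<lambda>\<omega>. (cmod (E1 N n \<omega>))\<^sup>2) \<le> expectation (\<lambda>\<omega>. 4 * pi * B\<^sup>2 * (\<Sum>x\<in>F n. w n x * (cmod (of_real (T x \<omega>) - partial_T {..<N} x \<omega>))\<^sup>2))"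
      by (intro integral_mono e1 i1 E1_pt)
    also have "\<dots> = 4 * pi * B\<^sup>2 * (\<Sum>x\<in>F n. w n x * expectation (\<lambda>\<omega>. (cmod (of_real (T x \<omega>) - partial_T {..<N} x \<omega>))\<^sup>2))"
    proof -
      have "integrable M (\<lambda>\<omega>. w n x * (cmod (of_real (T x \<omega>) - partial_T {..<N} x \<omega>))\<^sup>2)" if "x \<in> F n" for x
        using that F(2) by (intro integrable_mult_right approximation_error(1)) blast
      then show ?thesis by (simp add: Bochner_Integration.integral_sum)
    qed
    also have "\<dots> \<le> 4 * pi * B\<^sup>2 * (\<Sum>x\<in>F n. w n x * (2 * tail N))"
    proof -
      have "expectation (\<lambda>\<omega>. (cmod (of_real (T x \<omega>) - partial_T {..<N} x \<omega>))\<^sup>2) \<le> 2 * tail N" if "x \<in> F n" for x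
        using that F(2) by (intro approximation_error(2)) blast
      then show ?thesis using F(3) by (intro mult_left_mono sum_mono) auto
    qed
    \<comment> \<open>A factor \<open>4 * pi\<close> stems from Cauchy-Schwarz, another from the
      total weight, and 2 from \<open>approximation_error\<close>.\<close>
    also have "\<dots> = 32 * pi\<^sup>2 * B\<^sup>2 * tail N"
      unfolding sum_distrib_right[symmetric] F(4) by (simp add: power2_eq_square)
    finally show ?thesis .
  qed
  have le: "(cmod (E n \<omega>))\<^sup>2 \<le> 2 * (cmod (E1 N n \<omega>))\<^sup>2 + 2 * (cmod (E2 N n \<omega>))\<^sup>2" if "N0 \<le> N" for N n \<omega>
    unfolding split[OF that] by (rule cmod_square_add)
  show int: "integrable M (\<lambda>\<omega>. (cmod (E n \<omega>))\<^sup>2)" for n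
  proof (rule Bochner_Integration.integrable_bound)
    show "integrable M (\<lambda>\<omega>. 2 * (cmod (E1 N0 n \<omega>))\<^sup>2 + 2 * (cmod (E2 N0 n \<omega>))\<^sup>2)" using e1 e2 by simp
    show "AE \<omega> in M. norm ((cmod (E n \<omega>))\<^sup>2) \<le> norm (2 * (cmod (E1 N0 n \<omega>))\<^sup>2 + 2 * (cmod (E2 N0 n \<omega>))\<^sup>2)"
      using le[OF order_refl] by (intro AE_I2) simp
    have [measurable]: "\<Theta> \<in> borel_measurable borel" by (rule borel_measurable_continuous_onI[OF \<Theta>c])
    have [measurable]: "a (fst k) (snd k) \<in> borel_measurable M" if "k \<in> K" for k using K that by (intro a_measurable) auto
    show "(\<lambda>\<omega>. (cmod (E n \<omega>))\<^sup>2) \<in> borel_measurable M" unfolding E_def by measurable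
  qed
  have bound: "expectation (\<lambda>\<omega>. (cmod (E n \<omega>))\<^sup>2) \<le> 64 * pi\<^sup>2 * B\<^sup>2 * tail N + 2 * (\<Sum>k\<in>L N. (cmod (q n k - zz k))\<^sup>2 * C (fst k))"
    if "N0 \<le> N" for N n
  proof -
    have "expectation (\<lambda>\<omega>. (cmod (E n \<omega>))\<^sup>2) \<le> expectation (\<lambda>\<omega>. 2 * (cmod (E1 N n \<omega>))\<^sup>2 + 2 * (cmod (E2 N n \<omega>))\<^sup>2)"
      using e1 e2 int le[OF that] by (intro integral_mono) auto
    also have "\<dots> = 2 * expectation (\<lambda>\<omega>. (cmod (E1 N n \<omega>))\<^sup>2) + 2 * (\<Sum>k\<in>L N. (cmod (q n k - zz k))\<^sup>2 * C (fst k))"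
      using e1 e2 by simp
    finally show ?thesis using e1b[of N n] by simp
  qed
  show "(\<lambda>n. expectation (\<lambda>\<omega>. (cmod (E n \<omega>))\<^sup>2)) \<longlonglongrightarrow> 0"
  proof (rule LIMSEQ_I)
    fix r :: real assume r: "r > 0"
    have "(\<lambda>N. 64 * pi\<^sup>2 * B\<^sup>2 * tail N) \<longlonglongrightarrow> 0" using tendsto_mult_right_zero[OF tail_tendsto] .
    then have "\<forall>\<^sub>F N in sequentially. 64 * pi\<^sup>2 * B\<^sup>2 * tail N < r / 2" by (rule order_tendstoD(2)) (use r in simp)
    then obtain N where N: "N0 \<le> N" "64 * pi\<^sup>2 * B\<^sup>2 * tail N < r / 2"
      unfolding eventually_sequentially by (metis nle_le)
    have "(\<lambda>n. 2 * (\<Sum>k\<in>L N. (cmod (q n k - zz k))\<^sup>2 * C (fst k))) \<longlonglongrightarrow> 2 * (\<Sum>k\<in>L N. (cmod (zz k - zz k))\<^sup>2 * C (fst k))"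
      using Lf by (intro tendsto_intros qlim) auto
    then have "\<forall>\<^sub>F n in sequentially. 2 * (\<Sum>k\<in>L N. (cmod (q n k - zz k))\<^sup>2 * C (fst k)) < r / 2"
      by (rule order_tendstoD(2)) (use r in simp)
    then obtain n0 where n0: "\<And>n. n0 \<le> n \<Longrightarrow> 2 * (\<Sum>k\<in>L N. (cmod (q n k - zz k))\<^sup>2 * C (fst k)) < r / 2"
      unfolding eventually_sequentially by blast
    show "\<exists>no. \<forall>n\<ge>no. norm (expectation (\<lambda>\<omega>. (cmod (E n \<omega>))\<^sup>2) - 0) < r"
    proof (intro exI allI impI)
      fix n assume "n0 \<le> n"
      then show "norm (expectation (\<lambda>\<omega>. (cmod (E n \<omega>))\<^sup>2) - 0) < r"
        using bound[OF N(1), of n] N(2) n0[of n] by simp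
    qed
  qed
qed

text \<open>The real part of a cubature sum is a real combination of values of \<open>T\<close>,
  hence Gaussian, and so is the mean-square limit. Complex \<open>z\<close> cover all real
  combinations of real and imaginary parts.\<close>

lemma coefficient_combination_gaussian:
  assumes K: "finite K" "K \<subseteq> harmonics UNIV"
  shows "centered_gaussian M (\<lambda>\<omega>. Re (\<Sum>k\<in>K. z k * a (fst k) (snd k) \<omega>))"
proof -
  obtain F :: "nat \<Rightarrow> (real ^ 3) set" and w :: "nat \<Rightarrow> real ^ 3 \<Rightarrow> real" where F: "\<And>n. finite (F n)" "\<And>n. F n \<subseteq> S2" "\<And>n x. w n x \<ge> 0" "\<And>n. (\<Sum>x\<in>F n. w n x) = 4 * pi"
      "\<And>f::real ^ 3 \<Rightarrow> complex. continuous_on UNIV f \<Longrightarrow>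
       (\<lambda>n. \<Sum>x\<in>F n. w n x *\<^sub>R f x) \<longlonglongrightarrow> (LINT x|surface_measure. f x)"
    by (rule cubature) blast
  define \<Theta> where "\<Theta> x = (\<Sum>k\<in>K. z k * cnj (sph_harm (fst k) (snd k) x))" for x
  define Y where "Y \<omega> = (\<Sum>k\<in>K. z k * a (fst k) (snd k) \<omega>)" for \<omega>
  define S where "S n \<omega> = (\<Sum>x\<in>F n. w n x *\<^sub>R (\<Theta> x * of_real (T x \<omega>)))" for n \<omega>
  note lim = projection_limit[OF K F, where z = z, folded \<Theta>_def, folded S_def Y_def]
  have [measurable]: "a (fst k) (snd k) \<in> borel_measurable M" if "k \<in> K" for k using K that by (intro a_measurable) auto
  have Ym [measurable]: "Y \<in> borel_measurable M" unfolding Y_def by measurable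
  have SR: "Re (S n \<omega>) = (\<Sum>x\<in>F n. (w n x * Re (\<Theta> x)) * T x \<omega>)" for n \<omega>
    by (simp add: S_def mult.assoc)
  have Sc: "centered_gaussian M (\<lambda>\<omega>. Re (S n \<omega>))" for n
    unfolding SR by (rule T_centered[OF F(1,2)])
  have le: "(Re u)\<^sup>2 \<le> (cmod u)\<^sup>2" for u
    by (simp add: cmod_power2)
  have Sm [measurable]: "(\<lambda>\<omega>. Re (S n \<omega>)) \<in> borel_measurable M" for n
    using Sc by (simp add: centered_gaussian_def)
  have iD: "integrable M (\<lambda>\<omega>. (Re (S n \<omega>) - Re (Y \<omega>))\<^sup>2)" for n
  proof (rule Bochner_Integration.integrable_bound[OF lim(1)[of n]])
    show "AE \<omega> in M. norm ((Re (S n \<omega>) - Re (Y \<omega>))\<^sup>2) \<le> norm ((cmod (S n \<omega> - Y \<omega>))\<^sup>2)"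
      using le[of "S n _ - Y _"] by (intro AE_I2) simp
  qed measurable
  show ?thesis
  proof (fold Y_def, rule centered_gaussian_limit[OF Sc])
    show "integrable M (\<lambda>\<omega>. (Re (Y \<omega>))\<^sup>2)"
    proof (rule Bochner_Integration.integrable_bound)
      show "integrable M (\<lambda>\<omega>. (cmod (Y \<omega>))\<^sup>2)" unfolding Y_def by (rule linear_square[OF K])
      show "AE \<omega> in M. norm ((Re (Y \<omega>))\<^sup>2) \<le> norm ((cmod (Y \<omega>))\<^sup>2)" using le by (intro AE_I2) simp
    qed measurable
    show "(\<lambda>n. expectation (\<lambda>\<omega>. (Re (S n \<omega>) - Re (Y \<omega>))\<^sup>2)) \<longlonglongrightarrow> 0"
    proof (rule tendsto_sandwich[OF _ _ tendsto_const lim(2)])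
      show "\<forall>\<^sub>F n in sequentially. 0 \<le> expectation (\<lambda>\<omega>. (Re (S n \<omega>) - Re (Y \<omega>))\<^sup>2)" by simp
      show "\<forall>\<^sub>F n in sequentially. expectation (\<lambda>\<omega>. (Re (S n \<omega>) - Re (Y \<omega>))\<^sup>2) \<le> expectation (\<lambda>\<omega>. (cmod (S n \<omega> - Y \<omega>))\<^sup>2)"
      proof (intro always_eventually allI integral_mono iD lim(1))
        show "(Re (S n \<omega>) - Re (Y \<omega>))\<^sup>2 \<le> (cmod (S n \<omega> - Y \<omega>))\<^sup>2" for n \<omega>
          using le[of "S n \<omega> - Y \<omega>"] by simp
      qed
    qed
  qed measurable
qed

text \<open>The cubature sums satisfy the relation exactly, because \<open>T\<close> is real and
  \<open>sph_harm_uminus\<close> holds pointwise; the limits inherit it almost surely.\<close>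

lemma coefficient_reality:
  assumes m: "m \<in> {- int l..int l}"
  shows "AE \<omega> in M. a l (- m) \<omega> = (- 1) ^ nat \<bar>m\<bar> * cnj (a l m \<omega>)"
proof -
  obtain F :: "nat \<Rightarrow> (real ^ 3) set" and w :: "nat \<Rightarrow> real ^ 3 \<Rightarrow> real" where F: "\<And>n. finite (F n)" "\<And>n. F n \<subseteq> S2" "\<And>n x. w n x \<ge> 0" "\<And>n. (\<Sum>x\<in>F n. w n x) = 4 * pi"
      "\<And>f::real ^ 3 \<Rightarrow> complex. continuous_on UNIV f \<Longrightarrow>
       (\<lambda>n. \<Sum>x\<in>F n. w n x *\<^sub>R f x) \<longlonglongrightarrow> (LINT x|surface_measure. f x)"
    by (rule cubature) blast
  define s :: complex where "s = (- 1) ^ nat \<bar>m\<bar>"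
  have s: "cmod s = 1" "cnj s = s" by (simp_all add: s_def norm_power)
  define S where "S i n \<omega> = (\<Sum>x\<in>F n. w n x *\<^sub>R (cnj (sph_harm l i x) * of_real (T x \<omega>)))" for i n \<omega>
  have lim: "integrable M (\<lambda>\<omega>. (cmod (S i n \<omega> - a l i \<omega>))\<^sup>2)"
      "(\<lambda>n. expectation (\<lambda>\<omega>. (cmod (S i n \<omega> - a l i \<omega>))\<^sup>2)) \<longlonglongrightarrow> 0" if "i \<in> {- int l..int l}" for i n
    using projection_limit[OF _ _ F, where K = "{(l, i)}" and z = "\<lambda>_. 1"] that by (simp_all add: S_def)
  have m': "- m \<in> {- int l..int l}" using m by auto
  have SS: "S (- m) n \<omega> = s * cnj (S m n \<omega>)" for n \<omega>
    by (simp add: S_def sph_harm_uminus s_def sum_distrib_left scaleR_conv_of_real mult_ac)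
  define D where "D \<omega> = a l (- m) \<omega> - s * cnj (a l m \<omega>)" for \<omega>
  have bound: "(cmod (D \<omega>))\<^sup>2 \<le> 2 * (cmod (S m n \<omega> - a l m \<omega>))\<^sup>2 + 2 * (cmod (S (- m) n \<omega> - a l (- m) \<omega>))\<^sup>2" for n \<omega>
  proof -
    have "D \<omega> = s * cnj (S m n \<omega> - a l m \<omega>) + - (S (- m) n \<omega> - a l (- m) \<omega>)"
      by (simp add: D_def SS algebra_simps)
    then show ?thesis
      using cmod_square_add[of "s * cnj (S m n \<omega> - a l m \<omega>)" "- (S (- m) n \<omega> - a l (- m) \<omega>)"] s
      by (simp add: norm_mult norm_minus_commute del: complex_cnj_diff)
  qed
  have cnjm [measurable]: "cnj \<in> borel_measurable borel" by (intro borel_measurable_continuous_onI continuous_intros)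
  have [measurable]: "a l m \<in> borel_measurable M" "a l (- m) \<in> borel_measurable M" using m m' a_measurable by blast+
  have Dm [measurable]: "D \<in> borel_measurable M" unfolding D_def by measurable
  have iD: "integrable M (\<lambda>\<omega>. (cmod (D \<omega>))\<^sup>2)"
  proof (rule Bochner_Integration.integrable_bound)
    show "integrable M (\<lambda>\<omega>. 2 * (cmod (S m 0 \<omega> - a l m \<omega>))\<^sup>2 + 2 * (cmod (S (- m) 0 \<omega> - a l (- m) \<omega>))\<^sup>2)"
      using lim(1)[OF m, of 0] lim(1)[OF m', of 0] by simp
    show "AE \<omega> in M. norm ((cmod (D \<omega>))\<^sup>2) \<le> norm (2 * (cmod (S m 0 \<omega> - a l m \<omega>))\<^sup>2 + 2 * (cmod (S (- m) 0 \<omega> - a l (- m) \<omega>))\<^sup>2)"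
      using bound[of _ 0] by (intro AE_I2) simp
  qed measurable
  have "expectation (\<lambda>\<omega>. (cmod (D \<omega>))\<^sup>2) \<le> 2 * 0 + 2 * 0"
  proof (rule LIMSEQ_le_const)
    show "(\<lambda>n. 2 * expectation (\<lambda>\<omega>. (cmod (S m n \<omega> - a l m \<omega>))\<^sup>2) + 2 * expectation (\<lambda>\<omega>. (cmod (S (- m) n \<omega> - a l (- m) \<omega>))\<^sup>2)) \<longlonglongrightarrow> 2 * 0 + 2 * 0"
      by (intro tendsto_intros lim(2) m m')
    have "expectation (\<lambda>\<omega>. (cmod (D \<omega>))\<^sup>2) \<le> expectation (\<lambda>\<omega>. 2 * (cmod (S m n \<omega> - a l m \<omega>))\<^sup>2 + 2 * (cmod (S (- m) n \<omega> - a l (- m) \<omega>))\<^sup>2)" for n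
      using lim(1)[OF m, of n] lim(1)[OF m', of n] by (intro integral_mono iD bound) simp
    then show "\<exists>N. \<forall>n\<ge>N. expectation (\<lambda>\<omega>. (cmod (D \<omega>))\<^sup>2) \<le> 2 * expectation (\<lambda>\<omega>. (cmod (S m n \<omega> - a l m \<omega>))\<^sup>2) + 2 * expectation (\<lambda>\<omega>. (cmod (S (- m) n \<omega> - a l (- m) \<omega>))\<^sup>2)"
      using lim(1)[OF m] lim(1)[OF m'] by simp
  qed
  then have "expectation (\<lambda>\<omega>. (cmod (D \<omega>))\<^sup>2) = 0" by (intro antisym) simp_all
  then have "AE \<omega> in M. (cmod (D \<omega>))\<^sup>2 = 0"
    by (subst (asm) integral_nonneg_eq_0_iff_AE[OF iD]) auto
  then show ?thesis by eventually_elim (simp add: D_def s_def)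
qed

text \<open>Countably many coefficient relations share one null set, whatever the point
  \<open>x\<close>; under them the exchange of \<open>m\<close> and \<open>- m\<close> conjugates
  the sum.\<close>

lemma harmonic_component_real:
  "AE \<omega> in M. \<forall>l x. Im (harmonic_component a l x \<omega>) = 0"
proof -
  have "AE \<omega> in M. \<forall>l. \<forall>m\<in>{- int l..int l}. a l (- m) \<omega> = (- 1) ^ nat \<bar>m\<bar> * cnj (a l m \<omega>)"
    unfolding AE_all_countable by (intro allI AE_finite_allI coefficient_reality) auto
  then show ?thesis
  proof (eventually_elim, intro allI)
    fix \<omega> l x
    assume r: "\<forall>l. \<forall>m\<in>{- int l..int l}. a l (- m) \<omega> = (- 1) ^ nat \<bar>m\<bar> * cnj (a l m \<omega>)"
    have "harmonic_component a l x \<omega> = (\<Sum>m\<in>{- int l..int l}. a l (- m) \<omega> * sph_harm l (- m) x)"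
      unfolding harmonic_component_def
      by (rule sum.reindex_bij_witness[of _ uminus uminus]) auto
    also have "\<dots> = (\<Sum>m\<in>{- int l..int l}. cnj (a l m \<omega> * sph_harm l m x))"
    proof (rule sum.cong[OF refl])
      fix m assume "m \<in> {- int l..int l}"
      with r have "a l (- m) \<omega> = (- 1) ^ nat \<bar>m\<bar> * cnj (a l m \<omega>)" by blast
      then show "a l (- m) \<omega> * sph_harm l (- m) x = cnj (a l m \<omega> * sph_harm l m x)"
        by (simp add: sph_harm_uminus)
    qed
    also have "\<dots> = cnj (harmonic_component a l x \<omega>)" by (simp add: harmonic_component_def)
    finally show "Im (harmonic_component a l x \<omega>) = 0" by (simp add: complex_eq_iff)
  qed
qed

end

section \<open>Band-limited fields as Gaussian expansions\<close>

lemma sum_times_bool: "(\<Sum>i\<in>K \<times> (UNIV :: bool set). g i) = (\<Sum>k\<in>K. g (k, True) + g (k, False))"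
  by (simp add: sum.cartesian_product' UNIV_bool add.commute)

text \<open>\<open>dominated\<close> says that the eigenvalues
  \<open>(w l)\<^sup>2 * C l / V\<close> of the covariance operator of the normalized field are at
  most \<open>d ^ 4\<close>.\<close>

locale band_limited_field = spectral_field M T a C
  for M :: "'w measure" and T a C +
  fixes A :: "nat set" and w :: "nat \<Rightarrow> real" and d :: real
  assumes finite_A: "finite A" and d: "d > 0"
    and variance_pos: "(\<Sum>l\<in>A. (w l)\<^sup>2 * C l * ((2 * real l + 1) / (4 * pi))) > 0"
    and dominated: "l \<in> A \<Longrightarrow> (w l)\<^sup>2 * C l \<le> d ^ 4 * (\<Sum>l\<in>A. (w l)\<^sup>2 * C l * ((2 * real l + 1) / (4 * pi)))"
begin

definition V where "V = (\<Sum>l\<in>A. (w l)\<^sup>2 * C l * ((2 * real l + 1) / (4 * pi)))"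
definition band where "band x \<omega> = (\<Sum>l\<in>A. w l * Re (harmonic_component a l x \<omega>))"
definition indices where "indices = harmonics A \<times> (UNIV :: bool set)"
definition \<xi> where "\<xi> i \<omega> = (if snd i then Re (a (fst (fst i)) (snd (fst i)) \<omega>) else Im (a (fst (fst i)) (snd (fst i)) \<omega>))"
text \<open>The minus sign is that of the real part of a product; \<open>True\<close> marks real and
  \<open>False\<close> imaginary parts.\<close>

definition e where "e x i = w (fst (fst i)) / sqrt V *
  (if snd i then Re (sph_harm (fst (fst i)) (snd (fst i)) x) else - Im (sph_harm (fst (fst i)) (snd (fst i)) x))"

lemma V: "V > 0" using variance_pos by (simp add: V_def)

lemma K: "finite (harmonics A)" "harmonics A \<subseteq> harmonics UNIV"
  using finite_A by auto

lemma combination: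
  "(\<Sum>i\<in>indices. c i * \<xi> i \<omega>) = Re (\<Sum>k\<in>harmonics A. Complex (c (k, True)) (- c (k, False)) * a (fst k) (snd k) \<omega>)"
  unfolding indices_def sum_times_bool by (simp add: \<xi>_def)

lemma expansion_complex:
  "(\<Sum>i\<in>indices. e x i * \<xi> i \<omega>) = Re (\<Sum>k\<in>harmonics A. (of_real (w (fst k) / sqrt V) * sph_harm (fst k) (snd k) x) * a (fst k) (snd k) \<omega>)"
  unfolding combination by (simp add: e_def algebra_simps diff_divide_distrib)

lemma expansion: "(\<Sum>i\<in>indices. e x i * \<xi> i \<omega>) = band x \<omega> / sqrt V"
proof -
  have "(\<Sum>k\<in>harmonics A. (of_real (w (fst k) / sqrt V) * sph_harm (fst k) (snd k) x) * a (fst k) (snd k) \<omega>)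
     = (\<Sum>l\<in>A. \<Sum>m\<in>{- int l..int l}. (of_real (w l / sqrt V) * sph_harm l m x) * a l m \<omega>)"
    using finite_A by (subst sum.Sigma) (auto intro!: sum.cong)
  also have "\<dots> = (\<Sum>l\<in>A. of_real (w l / sqrt V) * harmonic_component a l x \<omega>)"
    by (simp add: harmonic_component_def sum_distrib_left mult_ac)
  finally show ?thesis
    unfolding expansion_complex by (simp add: band_def sum_divide_distrib)
qed

text \<open>Almost surely the harmonic components are real, so the square of the real part may be
  replaced by the squared modulus of the complex sum; orthogonality and Unsoeld's theorem then
  remove the dependence on \<open>x\<close>.\<close>

lemma band_variance:
  assumes x: "x \<in> S2"
  shows "expectation (\<lambda>\<omega>. (band x \<omega>)\<^sup>2) = V"
proof -
  let ?z = "\<lambda>k. of_real (w (fst k)) * sph_harm (fst k) (snd k) x"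
  let ?S = "\<lambda>\<omega>. \<Sum>k\<in>harmonics A. ?z k * a (fst k) (snd k) \<omega>"
  have S: "?S \<omega> = (\<Sum>l\<in>A. of_real (w l) * harmonic_component a l x \<omega>)" for \<omega>
  proof -
    have "?S \<omega> = (\<Sum>l\<in>A. \<Sum>m\<in>{- int l..int l}. (of_real (w l) * sph_harm l m x) * a l m \<omega>)"
      using finite_A by (subst sum.Sigma) (auto intro!: sum.cong)
    also have "\<dots> = (\<Sum>l\<in>A. of_real (w l) * harmonic_component a l x \<omega>)"
      by (simp add: harmonic_component_def sum_distrib_left mult_ac)
    finally show ?thesis .
  qed
  have meas [measurable]: "a l m \<in> borel_measurable M" if "m \<in> {- int l..int l}" for l m
    using a_measurable that by blast
  have hm [measurable]: "(\<lambda>\<omega>. harmonic_component a l x \<omega>) \<in> borel_measurable M" for l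
    unfolding harmonic_component_def by measurable
  have bm [measurable]: "band x \<in> borel_measurable M" unfolding band_def by measurable
  have "expectation (\<lambda>\<omega>. (band x \<omega>)\<^sup>2) = expectation (\<lambda>\<omega>. (cmod (?S \<omega>))\<^sup>2)"
  proof (rule integral_cong_AE)
    show "(\<lambda>\<omega>. (cmod (?S \<omega>))\<^sup>2) \<in> borel_measurable M" unfolding S by measurable
    show "AE \<omega> in M. (band x \<omega>)\<^sup>2 = (cmod (?S \<omega>))\<^sup>2"
      using harmonic_component_real
    proof eventually_elim
      fix \<omega> assume i: "\<forall>l x. Im (harmonic_component a l x \<omega>) = 0"
      have "?S \<omega> = of_real (band x \<omega>)"
        unfolding S band_def of_real_sum of_real_mult
      proof (rule sum.cong[OF refl])
        fix l
        show "of_real (w l) * harmonic_component a l x \<omega> = of_real (w l) * complex_of_real (Re (harmonic_component a l x \<omega>))"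
          using i by (simp add: complex_eq_iff)
      qed
      then show "(band x \<omega>)\<^sup>2 = (cmod (?S \<omega>))\<^sup>2" by simp
    qed
  qed measurable
  also have "\<dots> = (\<Sum>k\<in>harmonics A. (cmod (?z k))\<^sup>2 * C (fst k))" by (rule linear_square[OF K])
  also have "\<dots> = (\<Sum>l\<in>A. \<Sum>m\<in>{- int l..int l}. (cmod (sph_harm l m x))\<^sup>2 * ((w l)\<^sup>2 * C l))"
    using finite_A by (subst sum.Sigma) (auto intro!: sum.cong simp: norm_mult power_mult_distrib)
  also have "\<dots> = V"
    unfolding sum_distrib_right[symmetric] sum_sph_harm_square[OF x] V_def by (simp add: mult_ac)
  finally show ?thesis .
qed

lemma e_continuous: "continuous_on UNIV (\<lambda>x. e x i)"
  unfolding e_def using V by (cases "snd i") (auto intro!: continuous_intros continuous_sph_harm)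

lemma gaussian_expansion: "gaussian_expansion M indices \<xi> surface_measure e"
proof
  show "finite indices" using K by (simp add: indices_def)
  show "centered_gaussian M (\<lambda>\<omega>. \<Sum>i\<in>indices. l i * \<xi> i \<omega>)" for l
    unfolding combination by (rule coefficient_combination_gaussian[OF K])
  show "bounded_measurable surface_measure (\<lambda>y. e y i)" for i
  proof -
    have "compact ((\<lambda>y. e y i) ` S2)"
      by (intro compact_continuous_image continuous_on_subset[OF e_continuous]) auto
    then obtain B where B: "\<And>y. y \<in> S2 \<Longrightarrow> \<bar>e y i\<bar> \<le> B"
      using compact_imp_bounded bounded_iff by (metis imageI real_norm_def)
    show ?thesis
    proof (rule bounded_measurableI)
      show "(\<lambda>y. e y i) \<in> borel_measurable surface_measure"
        by (intro continuous_surface_measurable e_continuous)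
      show "\<bar>e y i\<bar> \<le> B" if "y \<in> space surface_measure" for y
        using B that unfolding space_surface_measure by blast
    qed
  qed
  show "expectation (\<lambda>\<omega>. (\<Sum>i\<in>indices. e y i * \<xi> i \<omega>)\<^sup>2) = 1" if "y \<in> space surface_measure" for y
    using band_variance[of y] that V unfolding expansion space_surface_measure power_divide by simp
qed

interpretation G: gaussian_expansion M indices \<xi> surface_measure e
  by (rule gaussian_expansion)

text \<open>The integral is the real part of a combination of the random coefficients, weighted by
  the harmonic coefficients of \<open>f\<close> times \<open>w l / sqrt V\<close>. Orthogonality
  makes the second moment of the combination a single sum, \<open>dominated\<close> bounds its
  factors, and Bessel's inequality the rest.\<close>

lemma spectral:
  assumes f: "bounded_measurable surface_measure f"
  shows "expectation (\<lambda>\<omega>. (LINT y|surface_measure. f y * (\<Sum>i\<in>indices. e y i * \<xi> i \<omega>))\<^sup>2) \<le> d ^ 4 * (LINT y|surface_measure. (f y)\<^sup>2)"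
proof -
  define c where "c k = (LINT y|surface_measure. f y *\<^sub>R sph_harm (fst k) (snd k) y)" for k
  define z where "z k = of_real (w (fst k) / sqrt V) * c k" for k :: "nat \<times> int"
  let ?S = "\<lambda>\<omega>. \<Sum>k\<in>harmonics A. z k * a (fst k) (snd k) \<omega>"
  have fi: "integrable surface_measure (\<lambda>y. f y *\<^sub>R sph_harm (fst k) (snd k) y)" for k
  proof -
    obtain B where B: "\<And>y. y \<in> space surface_measure \<Longrightarrow> \<bar>f y\<bar> \<le> B"
      using f unfolding bounded_measurable_def by blast
    show ?thesis
    proof (rule Bochner_Integration.integrable_bound)
      show "integrable surface_measure (\<lambda>y. B * cmod (sph_harm (fst k) (snd k) y))"
        by (intro continuous_surface_integrable continuous_intros continuous_sph_harm)
      show "(\<lambda>y. f y *\<^sub>R sph_harm (fst k) (snd k) y) \<in> borel_measurable surface_measure"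
        by (intro borel_measurable_scaleR bounded_measurableD[OF f] continuous_surface_measurable continuous_sph_harm)
      show "AE y in surface_measure. norm (f y *\<^sub>R sph_harm (fst k) (snd k) y) \<le> norm (B * cmod (sph_harm (fst k) (snd k) y))"
      proof (rule AE_I2)
        fix y assume "y \<in> space surface_measure"
        from B[OF this] show "norm (f y *\<^sub>R sph_harm (fst k) (snd k) y) \<le> norm (B * cmod (sph_harm (fst k) (snd k) y))"
          by (auto simp: abs_mult intro!: mult_right_mono)
      qed
    qed
  qed
  have eq: "(LINT y|surface_measure. f y * (\<Sum>i\<in>indices. e y i * \<xi> i \<omega>)) = Re (?S \<omega>)" for \<omega>
  proof -
    have "(LINT y|surface_measure. f y * (\<Sum>i\<in>indices. e y i * \<xi> i \<omega>))
       = (LINT y|surface_measure. Re (\<Sum>k\<in>harmonics A. (of_real (w (fst k) / sqrt V) * a (fst k) (snd k) \<omega>) * (f y *\<^sub>R sph_harm (fst k) (snd k) y)))"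
      unfolding expansion_complex Re_complex_of_real[symmetric]
      by (simp add: scaleR_conv_of_real sum_distrib_left algebra_simps)
    also have "\<dots> = Re (LINT y|surface_measure. (\<Sum>k\<in>harmonics A. (of_real (w (fst k) / sqrt V) * a (fst k) (snd k) \<omega>) * (f y *\<^sub>R sph_harm (fst k) (snd k) y)))"
      by (rule integral_Re) (intro Bochner_Integration.integrable_sum integrable_mult_right fi)
    also have "(LINT y|surface_measure. (\<Sum>k\<in>harmonics A. (of_real (w (fst k) / sqrt V) * a (fst k) (snd k) \<omega>) * (f y *\<^sub>R sph_harm (fst k) (snd k) y))) = ?S \<omega>"
    proof -
      have "integrable surface_measure (\<lambda>y. (of_real (w (fst k) / sqrt V) * a (fst k) (snd k) \<omega>) * (f y *\<^sub>R sph_harm (fst k) (snd k) y))" for k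
        by (intro integrable_mult_right fi)
      then show ?thesis
        by (simp only: Bochner_Integration.integral_sum integral_mult_right_zero z_def c_def) (simp add: mult_ac)
    qed
    finally show ?thesis .
  qed
  have meas [measurable]: "a (fst k) (snd k) \<in> borel_measurable M" if "k \<in> harmonics A" for k
    using a_measurable that by force
  have "expectation (\<lambda>\<omega>. (Re (?S \<omega>))\<^sup>2) \<le> expectation (\<lambda>\<omega>. (cmod (?S \<omega>))\<^sup>2)"
  proof (rule integral_mono)
    show le: "(Re (?S \<omega>))\<^sup>2 \<le> (cmod (?S \<omega>))\<^sup>2" for \<omega> by (simp only: cmod_power2) simp
    show i: "integrable M (\<lambda>\<omega>. (cmod (?S \<omega>))\<^sup>2)" by (rule linear_square[OF K])
    show "integrable M (\<lambda>\<omega>. (Re (?S \<omega>))\<^sup>2)"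
      by (rule Bochner_Integration.integrable_bound[OF i]) (use le in \<open>auto simp del: Re_sum\<close>)
  qed
  also have "expectation (\<lambda>\<omega>. (cmod (?S \<omega>))\<^sup>2) = (\<Sum>k\<in>harmonics A. (cmod (z k))\<^sup>2 * C (fst k))" by (rule linear_square[OF K])
  also have "(\<Sum>k\<in>harmonics A. (cmod (z k))\<^sup>2 * C (fst k)) \<le> (\<Sum>k\<in>harmonics A. d ^ 4 * (cmod (c k))\<^sup>2)"
  proof (rule sum_mono)
    fix k assume k: "k \<in> harmonics A"
    have "(cmod (z k))\<^sup>2 * C (fst k) = ((w (fst k))\<^sup>2 * C (fst k)) / V * (cmod (c k))\<^sup>2"
      using V by (simp add: z_def norm_mult norm_divide power_mult_distrib power_divide)
    also have "\<dots> \<le> d ^ 4 * (cmod (c k))\<^sup>2"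
    proof (rule mult_right_mono)
      have "(w (fst k))\<^sup>2 * C (fst k) \<le> d ^ 4 * V" unfolding V_def by (rule dominated) (use k in auto)
      then show "((w (fst k))\<^sup>2 * C (fst k)) / V \<le> d ^ 4" using V by (simp only: pos_divide_le_eq)
    qed simp
    finally show "(cmod (z k))\<^sup>2 * C (fst k) \<le> d ^ 4 * (cmod (c k))\<^sup>2" .
  qed
  also have "\<dots> \<le> d ^ 4 * (LINT y|surface_measure. (f y)\<^sup>2)"
    unfolding sum_distrib_left[symmetric] c_def
  proof (intro mult_left_mono bessel_inequality[OF K(1)] continuous_sph_harm f)
    fix j k assume "j \<in> harmonics A" "k \<in> harmonics A"
    then show "(LINT x|surface_measure. sph_harm (fst j) (snd j) x * cnj (sph_harm (fst k) (snd k) x)) = (if j = k then 1 else 0)"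
      by (auto simp: sph_harm_orthonormal prod_eq_iff)
  qed (use d in simp)
  finally show ?thesis unfolding eq .
qed

lemma gaussian_functional:
  assumes "bounded_measurable surface_measure \<psi>" "\<And>y. y \<in> S2 \<Longrightarrow> \<bar>\<psi> y\<bar> \<le> \<Psi>" "\<Psi> \<ge> 0" "q \<ge> 1"
  shows "gaussian_functional M indices \<xi> surface_measure e d \<Psi> \<psi> q"
proof
  show "\<bar>\<psi> y\<bar> \<le> \<Psi>" if "y \<in> space surface_measure" for y
    using assms(2) that unfolding space_surface_measure by blast
qed (use d assms spectral in \<open>auto dest: bounded_measurableD\<close>)

end

section \<open>Needlet windows\<close>

lemma regular_spectrum_bounds:
  assumes "regular_spectrum C"
  obtains \<alpha> c\<^sub>0 d\<^sub>0 where "\<alpha> > 2" "0 < c\<^sub>0"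
    "\<And>l. l \<ge> 1 \<Longrightarrow> c\<^sub>0 * real l powr - \<alpha> \<le> C l" "\<And>l. l \<ge> 1 \<Longrightarrow> C l \<le> d\<^sub>0 * real l powr - \<alpha>"
proof -
  obtain \<alpha> G c\<^sub>0 d\<^sub>0 where *: "\<alpha> > 2" "\<And>l. l \<ge> 1 \<Longrightarrow> C l = G (real l) * real l powr - \<alpha>"
     "0 < c\<^sub>0" "\<And>u. u > 0 \<Longrightarrow> c\<^sub>0 \<le> G u \<and> G u \<le> d\<^sub>0"
    using assms unfolding regular_spectrum_def by metis
  show thesis
    by (rule that[of \<alpha> c\<^sub>0 d\<^sub>0]) (use * in \<open>auto intro!: mult_right_mono\<close>)
qed

lemma regular_spectrum_summable:
  assumes "regular_spectrum C" shows "summable (\<lambda>l. C l * (2 * real l + 1))"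
proof -
  obtain \<alpha> c\<^sub>0 d\<^sub>0 where *: "\<alpha> > 2" "0 < c\<^sub>0"
    "\<And>l. l \<ge> 1 \<Longrightarrow> c\<^sub>0 * real l powr - \<alpha> \<le> C l" "\<And>l. l \<ge> 1 \<Longrightarrow> C l \<le> d\<^sub>0 * real l powr - \<alpha>"
    by (rule regular_spectrum_bounds[OF assms]) blast
  show ?thesis
  proof (rule summable_comparison_test')
    show "summable (\<lambda>l. 3 * d\<^sub>0 * real l powr (1 - \<alpha>))"
      using *(1) by (intro summable_mult) (simp add: summable_real_powr_iff)
    fix l :: nat assume l: "1 \<le> l"
    have "0 \<le> c\<^sub>0 * real l powr - \<alpha>" using *(2) by simp
    then have "0 \<le> C l" using *(3)[OF l] by linarith
    then have "norm (C l * (2 * real l + 1)) = C l * (2 * real l + 1)" by simp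
    also have "\<dots> \<le> (d\<^sub>0 * real l powr - \<alpha>) * (3 * real l)"
      using *(4)[OF l] \<open>0 \<le> C l\<close> l by (intro mult_mono) auto
    also have "\<dots> = 3 * d\<^sub>0 * real l powr (1 - \<alpha>)" using l by (simp add: powr_diff powr_minus field_simps)
    finally show "norm (C l * (2 * real l + 1)) \<le> 3 * d\<^sub>0 * real l powr (1 - \<alpha>)" .
  qed
qed

lemma
  assumes "needlet_window B b"
  shows window_continuous: "continuous_on UNIV b"
    and window_support: "b u \<noteq> 0 \<Longrightarrow> inverse B \<le> u \<and> u \<le> B"
proof -
  have "b field_differentiable at u" for u
    using assms unfolding needlet_window_def smooth_on_def by (metis UNIV_I funpow_0)
  then show "continuous_on UNIV b"
    by (intro continuous_at_imp_continuous_on ballI field_differentiable_imp_continuous_at)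
  show "inverse B \<le> u \<and> u \<le> B" if "b u \<noteq> 0"
    using assms closure_subset[of "{x. b x \<noteq> 0}"] that unfolding needlet_window_def by auto
qed

lemma window_bounded:
  assumes "needlet_window B b"
  obtains H where "H > 0" "\<And>u. \<bar>b u\<bar> \<le> H"
proof -
  have "compact (b ` {inverse B..B})"
    by (intro compact_continuous_image continuous_on_subset[OF window_continuous[OF assms]]) auto
  then obtain H where H: "\<And>u. u \<in> {inverse B..B} \<Longrightarrow> \<bar>b u\<bar> \<le> H"
    using compact_imp_bounded bounded_iff by (metis imageI real_norm_def)
  show thesis
  proof (rule that[of "max H 1"])
    show "\<bar>b u\<bar> \<le> max H 1" for u
      using H[of u] window_support[OF assms, of u] by (cases "b u = 0") auto
  qed simp
qed

text \<open>Since the squares sum to 1, some \<open>b (l / B ^ j)\<close> is nonzero, and continuity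
  spreads this to an interval to the right of that point.\<close>

lemma window_lower_bound:
  assumes "needlet_window B b" "B > 1"
  obtains \<epsilon> u v where "\<epsilon> > 0" "0 < u" "u < v" "\<And>x. u \<le> x \<Longrightarrow> x \<le> v \<Longrightarrow> \<epsilon> \<le> (b x)\<^sup>2"
proof -
  obtain l :: nat where l: "real l > B" using reals_Archimedean2 by blast
  have s: "(\<lambda>j. (b (real l / B ^ j))\<^sup>2) sums 1" using assms l by (simp add: needlet_window_def)
  have "\<exists>j. b (real l / B ^ j) \<noteq> 0"
  proof (rule ccontr)
    assume "\<not> (\<exists>j. b (real l / B ^ j) \<noteq> 0)"
    then have "(\<lambda>j. 0::real) sums 1" using s by simp
    then show False using sums_unique2[OF sums_zero] by fastforce
  qed
  then obtain j where j: "b (real l / B ^ j) \<noteq> 0" by blast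
  define u where "u = real l / B ^ j"
  have u: "u > 0" "b u \<noteq> 0" using l assms(2) j by (simp_all add: u_def)
  have "continuous_on UNIV (\<lambda>x. (b x)\<^sup>2)" by (intro continuous_intros window_continuous[OF assms(1)])
  then have "isCont (\<lambda>x. (b x)\<^sup>2) u" by (simp add: continuous_on_eq_continuous_at)
  then have "\<forall>\<^sub>F x in at u. (b u)\<^sup>2 / 2 < (b x)\<^sup>2"
    unfolding isCont_def by (rule order_tendstoD(1)) (use u in simp)
  then obtain \<delta> where \<delta>: "\<delta> > 0" "\<And>x. x \<noteq> u \<Longrightarrow> dist x u < \<delta> \<Longrightarrow> (b u)\<^sup>2 / 2 < (b x)\<^sup>2"
    unfolding eventually_at by auto
  show thesis
  proof (rule that[of "(b u)\<^sup>2 / 2" u "u + \<delta> / 2"])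
    fix x assume "u \<le> x" "x \<le> u + \<delta> / 2"
    then show "(b u)\<^sup>2 / 2 \<le> (b x)\<^sup>2"
      using \<delta>(1) \<delta>(2)[of x] by (cases "x = u") (auto simp: dist_real_def)
  qed (use u \<delta> in auto)
qed

text \<open>Beyond these degrees the window at scale \<open>j\<close> vanishes, so the series of the
  needlet field is a finite sum.\<close>

definition degrees :: "real \<Rightarrow> nat \<Rightarrow> nat set" where "degrees B j = {l. real l \<le> B ^ Suc j}"

lemma finite_degrees: "finite (degrees B j)"
proof (rule finite_subset)
  show "degrees B j \<subseteq> {..nat \<lfloor>B ^ Suc j\<rfloor>}" by (auto simp: degrees_def le_nat_floor)
qed simp

lemma degrees_cover:
  assumes "needlet_window B b" "B > 1" "l \<notin> degrees B j" shows "b (real l / B ^ j) = 0"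
proof (rule ccontr)
  assume "b (real l / B ^ j) \<noteq> 0"
  then have "real l / B ^ j \<le> B" using window_support[OF assms(1)] by blast
  then show False using assms(2,3) by (simp add: degrees_def field_simps)
qed

definition band_variance_sum :: "real \<Rightarrow> (real \<Rightarrow> real) \<Rightarrow> (nat \<Rightarrow> real) \<Rightarrow> nat \<Rightarrow> real" where
  "band_variance_sum B b C j = (\<Sum>l\<in>degrees B j. (b (real l / B ^ j))\<^sup>2 * C l * ((2 * real l + 1) / (4 * pi)))"

lemma card_nat_interval:
  assumes "0 \<le> x" shows "y - x - 1 \<le> real (card {l::nat. x \<le> real l \<and> real l \<le> y})"
proof (cases "x \<le> y")
  case True
  have "{l::nat. x \<le> real l \<and> real l \<le> y} = {nat \<lceil>x\<rceil>..nat \<lfloor>y\<rfloor>}"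
    using assms True by (auto simp: le_nat_floor nat_le_iff ceiling_le_iff le_floor_iff le_nat_iff) 
  then show ?thesis using assms True by simp linarith
qed simp

text \<open>A number of degrees of order \<open>X = B ^ j\<close> lies where the window is bounded
  below, and each contributes at least the order \<open>X powr (1 - \<alpha>)\<close>.\<close>

lemma band_variance_lower:
  assumes b: "needlet_window B b" "B > 1" and C: "regular_spectrum C"
    and \<alpha>: "\<alpha> > 2" "0 < c\<^sub>0" "\<And>l. l \<ge> 1 \<Longrightarrow> c\<^sub>0 * real l powr - \<alpha> \<le> C l"
  obtains c where "c > 0" "\<forall>\<^sub>F j in sequentially. c * (B ^ (2 * j) * (B ^ j) powr - \<alpha>) \<le> band_variance_sum B b C j"
proof -
  obtain \<epsilon> u v where e: "\<epsilon> > 0" "0 < u" "u < v" "\<And>x. u \<le> x \<Longrightarrow> x \<le> v \<Longrightarrow> \<epsilon> \<le> (b x)\<^sup>2"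
    using window_lower_bound[OF b] by metis
  define c where "c = \<epsilon> * (c\<^sub>0 * v powr - \<alpha>) * (2 * u / (4 * pi)) * ((v - u) / 2)"
  have Bj: "B ^ j > 0" for j using b by simp
  have "filterlim (\<lambda>j. B ^ j) at_top sequentially"
    by (rule filterlim_at_infinity_imp_filterlim_at_top[OF filterlim_realpow_sequentially_gt1]) (use b in auto)
  \<comment> \<open>From here on the loss of 1 in \<open>card_nat_interval\<close> is at most half
    the length of the interval.\<close>
  then have "\<forall>\<^sub>F j in sequentially. 2 / (v - u) \<le> B ^ j" by (simp add: filterlim_at_top)
  then have ev: "\<forall>\<^sub>F j in sequentially. c * (B ^ (2 * j) * (B ^ j) powr - \<alpha>) \<le> band_variance_sum B b C j"
  proof eventually_elim
    fix j assume j: "2 / (v - u) \<le> B ^ j"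
    define X where "X = B ^ j"
    have X: "X > 0" "2 / (v - u) \<le> X" using Bj j by (simp_all add: X_def)
    define S where "S = {l::nat. u * X \<le> real l \<and> real l \<le> v * X}"
    define \<tau> where "\<tau> = \<epsilon> * (c\<^sub>0 * (v * X) powr - \<alpha>) * (2 * (u * X) / (4 * pi))"
    have \<tau>0: "\<tau> > 0" using e X \<alpha> by (simp add: \<tau>_def)
    let ?t = "\<lambda>l. (b (real l / B ^ j))\<^sup>2 * C l * ((2 * real l + 1) / (4 * pi))"
    have lo: "\<tau> \<le> ?t l" if "l \<in> S" for l
    proof -
      have l: "u * X \<le> real l" "real l \<le> v * X" using that by (auto simp: S_def)
      have "0 < u * X" using e X by simp
      then have l1: "l \<ge> 1" using l by (cases l) auto
      have "\<epsilon> \<le> (b (real l / B ^ j))\<^sup>2"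
        by (rule e(4)) (use l X in \<open>auto simp: X_def[symmetric] field_simps\<close>)
      moreover have "c\<^sub>0 * (v * X) powr - \<alpha> \<le> C l"
      proof -
        have "(v * X) powr - \<alpha> \<le> real l powr - \<alpha>" using l l1 \<alpha> by (intro powr_mono2') auto
        then show ?thesis using \<alpha>(2) \<alpha>(3)[OF l1] by (meson mult_left_mono less_imp_le order_trans)
      qed
      moreover have "2 * (u * X) / (4 * pi) \<le> (2 * real l + 1) / (4 * pi)"
        using l by (intro divide_right_mono) auto
      moreover from \<open>c\<^sub>0 * (v * X) powr - \<alpha> \<le> C l\<close> have "0 \<le> C l" using \<alpha>(2) by (auto intro: order_trans[rotated])
      ultimately show ?thesis
        unfolding \<tau>_def using e X \<alpha> by (intro mult_mono) (auto intro: order_trans[rotated])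
    qed
    have sub: "S \<subseteq> degrees B j"
    proof
      fix l assume "l \<in> S"
      from lo[OF this] \<tau>0 have "b (real l / B ^ j) \<noteq> 0" by auto
      then show "l \<in> degrees B j" using degrees_cover[OF b] by blast
    qed
    have nonneg: "0 \<le> ?t l" for l
    proof (cases "l \<ge> 1")
      case True
      have "0 \<le> c\<^sub>0 * real l powr - \<alpha>" using \<alpha> by simp
      with \<alpha>(3)[OF True] have "0 \<le> C l" by linarith
      then show ?thesis by simp
    next
      \<comment> \<open>Only \<open>l = 0\<close> remains. The lower bound on \<open>C\<close>
        starts at 1 and gives no sign for \<open>C 0\<close>, but the window vanishes there.\<close>
      case False
      then have "\<not> inverse B \<le> real l / B ^ j" using b by (simp add: not_less_eq_eq)
      then have "b (real l / B ^ j) = 0" using window_support[OF b(1)] by blast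
      then show ?thesis by simp
    qed
    have "real (card S) * \<tau> \<le> (\<Sum>l\<in>S. ?t l)"
      using lo by (simp add: sum_bounded_below)
    also have "\<dots> \<le> band_variance_sum B b C j"
      unfolding band_variance_sum_def by (rule sum_mono2[OF finite_degrees sub]) (rule nonneg)
    finally have le: "real (card S) * \<tau> \<le> band_variance_sum B b C j" .
    have "(v - u) / 2 * X \<le> v * X - u * X - 1" using X e by (simp add: field_simps)
    also have "\<dots> \<le> real (card S)" unfolding S_def using e X by (intro card_nat_interval) simp
    finally have "(v - u) / 2 * X * \<tau> \<le> real (card S) * \<tau>" using \<tau>0 by (intro mult_right_mono) auto
    moreover have "(v - u) / 2 * X * \<tau> = c * (B ^ (2 * j) * (B ^ j) powr - \<alpha>)"
      using X e by (simp add: \<tau>_def c_def X_def[symmetric] powr_mult power_mult power2_eq_square mult.commute[of 2 j] )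
    ultimately show "c * (B ^ (2 * j) * (B ^ j) powr - \<alpha>) \<le> band_variance_sum B b C j" using le by linarith
  qed
  show thesis by (rule that[of c]) (use e \<alpha> ev in \<open>auto simp: c_def\<close>)
qed

text \<open>On the support of the window \<open>l\<close> is at least \<open>B ^ j / B\<close>, so
  every term is at most of order \<open>(B ^ j) powr - \<alpha>\<close>; the variance is larger by
  the factor \<open>B ^ (2 * j)\<close>.\<close>

lemma window_domination:
  assumes b: "needlet_window B b" "B > 1" and C: "regular_spectrum C"
  obtains D where "D > 0" "\<forall>\<^sub>F j in sequentially. 0 < band_variance_sum B b C j \<and> (\<forall>l. (b (real l / B ^ j))\<^sup>2 * C l \<le> D / B ^ (2 * j) * band_variance_sum B b C j)"
proof -
  obtain \<alpha> c\<^sub>0 d\<^sub>0 where \<alpha>: "\<alpha> > 2" "0 < c\<^sub>0"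
    "\<And>l. l \<ge> 1 \<Longrightarrow> c\<^sub>0 * real l powr - \<alpha> \<le> C l" "\<And>l. l \<ge> 1 \<Longrightarrow> C l \<le> d\<^sub>0 * real l powr - \<alpha>"
    by (rule regular_spectrum_bounds[OF C]) blast
  obtain c where c: "c > 0" "\<forall>\<^sub>F j in sequentially. c * (B ^ (2 * j) * (B ^ j) powr - \<alpha>) \<le> band_variance_sum B b C j"
    by (rule band_variance_lower[OF b C \<alpha>(1-3)]) blast
  obtain H where H: "H > 0" "\<And>u. \<bar>b u\<bar> \<le> H" by (rule window_bounded[OF b(1)]) blast
  have d0: "d\<^sub>0 > 0"
    using \<alpha>(2) \<alpha>(3)[of 1] \<alpha>(4)[of 1] by simp
  define D where "D = H\<^sup>2 * d\<^sub>0 * B powr \<alpha> / c"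
  have D: "D > 0" using H d0 c b by (simp add: D_def)
  have "\<forall>\<^sub>F j in sequentially. 0 < band_variance_sum B b C j \<and> (\<forall>l. (b (real l / B ^ j))\<^sup>2 * C l \<le> D / B ^ (2 * j) * band_variance_sum B b C j)"
    using c(2)
  proof (eventually_elim, intro conjI allI)
    fix j l assume lower: "c * (B ^ (2 * j) * (B ^ j) powr - \<alpha>) \<le> band_variance_sum B b C j"
    define X where "X = B ^ j"
    have X: "X > 0" using b by (simp add: X_def)
    have "0 < c * (B ^ (2 * j) * (B ^ j) powr - \<alpha>)" using b c by simp
    with lower show "0 < band_variance_sum B b C j" by linarith
    have X2: "B ^ (2 * j) = X\<^sup>2" by (simp add: X_def power_mult[symmetric] mult.commute)
    have "H\<^sup>2 * d\<^sub>0 * B powr \<alpha> * X powr - \<alpha> = D / X\<^sup>2 * (c * (X\<^sup>2 * X powr - \<alpha>))"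
      using X c by (simp add: D_def field_simps)
    also have "\<dots> \<le> D / X\<^sup>2 * band_variance_sum B b C j"
      using lower X D by (intro mult_left_mono) (auto simp: X2 X_def[symmetric])
    finally have up: "H\<^sup>2 * d\<^sub>0 * B powr \<alpha> * X powr - \<alpha> \<le> D / B ^ (2 * j) * band_variance_sum B b C j" by (simp add: X2)
    have Hb: "0 \<le> H\<^sup>2 * d\<^sub>0 * B powr \<alpha> * X powr - \<alpha>" using d0 by simp
    show "(b (real l / B ^ j))\<^sup>2 * C l \<le> D / B ^ (2 * j) * band_variance_sum B b C j"
    proof (cases "b (real l / B ^ j) = 0")
      case True
      then show ?thesis using up Hb by simp
    next
      case False
      then have "inverse B \<le> real l / X" using window_support[OF b(1)] by (auto simp: X_def)
      then have l: "X / B \<le> real l" using X b by (simp add: field_simps)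
      moreover have "0 < X / B" using X b by simp
      ultimately have l1: "l \<ge> 1" by (cases l) auto
      have "0 \<le> c\<^sub>0 * real l powr - \<alpha>" using \<alpha> by simp
      with \<alpha>(3)[OF l1] have C0: "0 \<le> C l" by linarith
      have "real l powr - \<alpha> \<le> (X / B) powr - \<alpha>" using l \<open>0 < X / B\<close> \<alpha> by (intro powr_mono2') auto
      also have "\<dots> = B powr \<alpha> * X powr - \<alpha>" using X b by (simp add: powr_divide powr_minus field_simps)
      finally have "C l \<le> d\<^sub>0 * (B powr \<alpha> * X powr - \<alpha>)"
        using \<alpha>(4)[OF l1] d0 by (meson less_imp_le mult_left_mono order_trans)
      moreover have "(b (real l / B ^ j))\<^sup>2 \<le> H\<^sup>2" using H(2) by (simp add: abs_le_square_iff[symmetric] abs_le_iff H(1) order_less_imp_le)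
      ultimately have "(b (real l / B ^ j))\<^sup>2 * C l \<le> H\<^sup>2 * (d\<^sub>0 * (B powr \<alpha> * X powr - \<alpha>))"
        using C0 by (intro mult_mono) auto
      then show ?thesis using up by (simp add: mult_ac)
    qed
  qed
  with D show thesis by (rule that)
qed

section \<open>Interpolation and continuous functionals\<close>

text \<open>Such a kernel spans a finite-dimensional space of functions of \<open>x\<close>, which
  is the source of the interpolation nodes. Lists make sums of kernels a matter of
  appending.\<close>

definition separable_kernel :: "('x::topological_space \<Rightarrow> 'z \<Rightarrow> real) \<Rightarrow> bool" where
  "separable_kernel k \<longleftrightarrow> (\<exists>ps. (\<forall>(p, s)\<in>set ps. continuous_on UNIV p) \<and> (\<forall>x z. k x z = (\<Sum>(p, s)\<leftarrow>ps. p x * s z)))"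

lemma separable_kernel_single: "continuous_on UNIV p \<Longrightarrow> separable_kernel (\<lambda>x z. p x * s z)"
  unfolding separable_kernel_def by (rule exI[of _ "[(p, s)]"]) simp

lemma separable_kernel_add:
  assumes "separable_kernel k" "separable_kernel m"
  shows "separable_kernel (\<lambda>x z. k x z + m x z)"
proof -
  from assms(1) obtain ps where ps: "\<forall>(p, s)\<in>set ps. continuous_on UNIV p" "\<And>x z. k x z = (\<Sum>(p, s)\<leftarrow>ps. p x * s z)"
    unfolding separable_kernel_def by blast
  from assms(2) obtain qs where qs: "\<forall>(p, s)\<in>set qs. continuous_on UNIV p" "\<And>x z. m x z = (\<Sum>(p, s)\<leftarrow>qs. p x * s z)"
    unfolding separable_kernel_def by blast
  show ?thesis
    unfolding separable_kernel_def by (rule exI[of _ "ps @ qs"]) (use ps qs in auto)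
qed

lemma separable_kernel_mult:
  assumes "separable_kernel k" "continuous_on UNIV u"
  shows "separable_kernel (\<lambda>x z. k x z * (u x * v z))"
proof -
  from assms(1) obtain ps where ps: "\<forall>(p, s)\<in>set ps. continuous_on UNIV p" "\<And>x z. k x z = (\<Sum>(p, s)\<leftarrow>ps. p x * s z)"
    unfolding separable_kernel_def by blast
  define qs where "qs = map (\<lambda>(p, s). (\<lambda>x. p x * u x, \<lambda>z. s z * v z)) ps"
  have "(\<Sum>(p, s)\<leftarrow>ps. p x * s z) * (u x * v z) = (\<Sum>(p, s)\<leftarrow>qs. p x * s z)" for x z
    unfolding qs_def by (induction ps) (auto simp: algebra_simps)
  moreover have "\<forall>(p, s)\<in>set qs. continuous_on UNIV p"
    using ps(1) assms(2) by (auto simp: qs_def intro!: continuous_intros)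
  ultimately show ?thesis
    unfolding separable_kernel_def ps(2) by (intro exI[of _ qs]) auto
qed

lemma separable_kernel_sum:
  "finite A \<Longrightarrow> (\<And>i. i \<in> A \<Longrightarrow> separable_kernel (k i)) \<Longrightarrow> separable_kernel (\<lambda>x z. \<Sum>i\<in>A. k i x z)"
proof (induction A rule: finite_induct)
  case empty
  show ?case using separable_kernel_single[of "\<lambda>_. 0"] by simp
next
  case (insert i A)
  then show ?case by (simp add: separable_kernel_add)
qed

text \<open>Horner's scheme: one more factor \<open>x \<bullet> z\<close> is a finite sum of
  products of coordinates.\<close>

lemma separable_kernel_poly: "separable_kernel (\<lambda>x z :: real ^ 'n. poly p (x \<bullet> z))"
proof (induction p)
  case 0
  show ?case using separable_kernel_single[of "\<lambda>_. 0"] by simp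
next
  case (pCons c p)
  have "separable_kernel (\<lambda>x z :: real ^ 'n. c * 1 + (\<Sum>i\<in>UNIV. poly p (x \<bullet> z) * (x $ i * z $ i)))"
    by (intro separable_kernel_add separable_kernel_single separable_kernel_sum separable_kernel_mult pCons.IH continuous_intros) simp
  also have "(\<lambda>x z :: real ^ 'n. c * 1 + (\<Sum>i\<in>UNIV. poly p (x \<bullet> z) * (x $ i * z $ i))) = (\<lambda>x z. poly (pCons c p) (x \<bullet> z))"
    unfolding sum_distrib_left[symmetric] by (simp add: inner_vec_def mult.commute)
  finally show ?case .
qed

text \<open>Newton's scheme: if the present nodes do not reproduce the new function, its residual
  \<open>d\<close> is nonzero at some \<open>p\<close>, which becomes a node. The old functions have
  zero residual at \<open>p\<close>, so the correction by \<open>\<theta>\<close> leaves their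
  formulas intact.\<close>

lemma interpolation:
  fixes v :: "'r \<Rightarrow> 'x::topological_space \<Rightarrow> real"
  assumes "finite R" "\<And>r. r \<in> R \<Longrightarrow> continuous_on X (v r)"
  shows "\<exists>n::nat. \<exists>x \<phi>. (\<forall>i<n. x i \<in> X \<and> continuous_on X (\<phi> i)) \<and> (\<forall>r\<in>R. \<forall>y\<in>X. v r y = (\<Sum>i<n. v r (x i) * \<phi> i y))"
  using assms
proof (induction R rule: finite_induct)
  case empty
  show ?case by (intro exI[of _ 0]) simp
next
  case (insert s R)
  then obtain n :: nat and x \<phi> where IH: "\<And>i. i < n \<Longrightarrow> x i \<in> X" "\<And>i. i < n \<Longrightarrow> continuous_on X (\<phi> i)"
      "\<And>r y. r \<in> R \<Longrightarrow> y \<in> X \<Longrightarrow> v r y = (\<Sum>i<n. v r (x i) * \<phi> i y)"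
    by (metis insertI2)
  define d where "d y = v s y - (\<Sum>i<n. v s (x i) * \<phi> i y)" for y
  show ?case
  proof (cases "\<forall>y\<in>X. d y = 0")
    case True
    then show ?thesis using IH by (intro exI[of _ n] exI[of _ x] exI[of _ \<phi>]) (auto simp: d_def)
  next
    case False
    then obtain p where p: "p \<in> X" "d p \<noteq> 0" by blast
    define \<theta> where "\<theta> y = d y / d p" for y
    define x' where "x' = x(n := p)"
    define \<phi>' where "\<phi>' i y = (if i = n then \<theta> y else \<phi> i y - \<phi> i p * \<theta> y)" for i y
    have \<theta>c: "continuous_on X \<theta>"
      unfolding \<theta>_def d_def using p IH(2) insert.prems by (intro continuous_intros) (auto simp: d_def)
    have sum: "(\<Sum>i<Suc n. v r (x' i) * \<phi>' i y) = (\<Sum>i<n. v r (x i) * \<phi> i y) + (v r p - (\<Sum>i<n. v r (x i) * \<phi> i p)) * \<theta> y" for r y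
    proof -
      have "(\<Sum>i<n. v r (x' i) * \<phi>' i y) = (\<Sum>i<n. v r (x i) * \<phi> i y - v r (x i) * \<phi> i p * \<theta> y)"
        by (intro sum.cong) (auto simp: x'_def \<phi>'_def algebra_simps)
      also have "\<dots> = (\<Sum>i<n. v r (x i) * \<phi> i y) - (\<Sum>i<n. v r (x i) * \<phi> i p) * \<theta> y"
        by (simp add: sum_subtractf sum_distrib_right)
      finally show ?thesis by (simp add: x'_def \<phi>'_def left_diff_distrib)
    qed
    have "v r y = (\<Sum>i<Suc n. v r (x' i) * \<phi>' i y)" if "r \<in> insert s R" "y \<in> X" for r y
    proof (cases "r = s")
      case True
      have "(v s p - (\<Sum>i<n. v s (x i) * \<phi> i p)) * \<theta> y = d y" using p by (simp add: \<theta>_def d_def)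
      then show ?thesis unfolding True sum by (simp add: d_def)
    next
      case False
      with that have "r \<in> R" by simp
      then show ?thesis unfolding sum using IH(3)[OF _ that(2)] IH(3)[OF _ p(1)] by simp
    qed
    moreover have "x' i \<in> X \<and> continuous_on X (\<phi>' i)" if "i < Suc n" for i
      using that IH(1,2) p \<theta>c by (cases "i = n") (auto simp: x'_def \<phi>'_def intro!: continuous_intros)
    ultimately show ?thesis by blast
  qed
qed

lemma kernel_interpolation:
  assumes "separable_kernel k"
  obtains n :: nat and x \<phi> where "\<And>i. i < n \<Longrightarrow> x i \<in> X" "\<And>i. i < n \<Longrightarrow> continuous_on X (\<phi> i)"
    "\<And>y z. y \<in> X \<Longrightarrow> k y z = (\<Sum>i<n. \<phi> i y * k (x i) z)"
proof -
  from assms obtain ps where ps: "\<forall>(p, s)\<in>set ps. continuous_on UNIV p" "\<And>x z. k x z = (\<Sum>(p, s)\<leftarrow>ps. p x * s z)"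
    unfolding separable_kernel_def by blast
  have k: "k x z = (\<Sum>r<length ps. fst (ps ! r) x * snd (ps ! r) z)" for x z
    unfolding ps(2) by (simp add: sum_list_sum_nth split_beta atLeast0LessThan)
  have cont: "\<And>r. r \<in> {..<length ps} \<Longrightarrow> continuous_on X (fst (ps ! r))"
  proof -
    fix r assume "r \<in> {..<length ps}"
    then have "continuous_on UNIV (fst (ps ! r))" using ps(1) by (auto simp: split_beta)
    then show "continuous_on X (fst (ps ! r))" by (rule continuous_on_subset) simp
  qed
  have "\<exists>n::nat. \<exists>x \<phi>. (\<forall>i<n. x i \<in> X \<and> continuous_on X (\<phi> i)) \<and>
      (\<forall>r\<in>{..<length ps}. \<forall>y\<in>X. fst (ps ! r) y = (\<Sum>i<n. fst (ps ! r) (x i) * \<phi> i y))"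
    by (rule interpolation[OF finite_lessThan]) (rule cont)
  then obtain n :: nat and x \<phi> where *: "\<And>i. i < n \<Longrightarrow> x i \<in> X" "\<And>i. i < n \<Longrightarrow> continuous_on X (\<phi> i)"
      "\<And>r y. r < length ps \<Longrightarrow> y \<in> X \<Longrightarrow> fst (ps ! r) y = (\<Sum>i<n. fst (ps ! r) (x i) * \<phi> i y)"
    by (elim exE conjE) blast+
  show thesis
  proof (rule that[OF *(1,2)])
    fix y z assume y: "y \<in> X"
    have "k y z = (\<Sum>r<length ps. (\<Sum>i<n. fst (ps ! r) (x i) * \<phi> i y) * snd (ps ! r) z)"
      unfolding k using *(3)[OF _ y] by (intro sum.cong) auto
    also have "\<dots> = (\<Sum>i<n. \<phi> i y * k (x i) z)"
      unfolding k sum_distrib_right sum_distrib_left by (subst sum.swap) (simp add: mult_ac)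
    finally show "k y z = (\<Sum>i<n. \<phi> i y * k (x i) z)" .
  qed
qed

section \<open>Continuous functionals of random continuous functions\<close>

lemma mspace_C_S2: "u \<in> mspace C_S2 \<longleftrightarrow> u \<in> extensional S2 \<and> continuous_on S2 u"
  unfolding C_S2_def
  by (subst compactin_mspace_cfunspace) (auto simp: compactin_subtopology continuous_map_iff_continuous)

text \<open>Composed with this map, a continuous functional on \<open>C_S2\<close> becomes a
  continuous function of finitely many real variables, as
  \<open>asymptotically_proximal_vectors\<close> expects.\<close>

lemma continuous_linear_combination_C_S2:
  fixes \<phi> :: "nat \<Rightarrow> real ^ 3 \<Rightarrow> real"
  assumes \<phi>: "\<And>i. i < n \<Longrightarrow> continuous_on S2 (\<phi> i)"
  shows "continuous_map euclidean (mtopology_of C_S2) (\<lambda>v :: nat \<Rightarrow> real. \<lambda>y\<in>S2. \<Sum>i<n. v i * \<phi> i y)"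
proof -
  interpret Metric_space "mspace C_S2" "mdist C_S2" by (rule Metric_space_mspace_mdist)
  let ?\<Phi> = "\<lambda>v :: nat \<Rightarrow> real. \<lambda>y\<in>S2. \<Sum>i<n. v i * \<phi> i y"
  have ms: "?\<Phi> v \<in> mspace C_S2" for v
  proof -
    have "continuous_on S2 (?\<Phi> v) \<longleftrightarrow> continuous_on S2 (\<lambda>y. \<Sum>i<n. v i * \<phi> i y)"
      by (rule continuous_on_cong) auto
    then show ?thesis unfolding mspace_C_S2 using \<phi> by (auto intro!: continuous_intros)
  qed
  have "\<exists>B. \<forall>i<n. \<forall>y\<in>S2. \<bar>\<phi> i y\<bar> \<le> B"
  proof -
    have "\<forall>i<n. \<exists>B. \<forall>y\<in>S2. \<bar>\<phi> i y\<bar> \<le> B"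
    proof (intro allI impI)
      fix i assume "i < n"
      then have "bounded (\<phi> i ` S2)" by (intro compact_imp_bounded compact_continuous_image \<phi>) auto
      then show "\<exists>B. \<forall>y\<in>S2. \<bar>\<phi> i y\<bar> \<le> B" unfolding bounded_iff by (metis imageI real_norm_def)
    qed
    then obtain B where B: "\<And>i y. i < n \<Longrightarrow> y \<in> S2 \<Longrightarrow> \<bar>\<phi> i y\<bar> \<le> B i" by metis
    show ?thesis
    proof (intro exI[of _ "\<Sum>i<n. \<bar>B i\<bar>"] allI impI ballI)
      fix i y assume i: "i < n" and y: "y \<in> S2"
      have "\<bar>B i\<bar> \<le> (\<Sum>i<n. \<bar>B i\<bar>)" using i by (intro member_le_sum) auto
      then show "\<bar>\<phi> i y\<bar> \<le> (\<Sum>i<n. \<bar>B i\<bar>)" using B[OF i y] by linarith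
    qed
  qed
  then obtain B where B: "\<And>i y. i < n \<Longrightarrow> y \<in> S2 \<Longrightarrow> \<bar>\<phi> i y\<bar> \<le> B" by blast
  have "continuous_map euclidean mtopology ?\<Phi>"
    unfolding continuous_map_to_metric
  proof (intro ballI allI impI)
    fix v :: "nat \<Rightarrow> real" and \<epsilon> :: real assume \<epsilon>: "0 < \<epsilon>"
    let ?U = "{u. (\<Sum>i<n. \<bar>u i - v i\<bar> * \<bar>B\<bar>) < \<epsilon> / 2}"
    have U: "open ?U"
      by (intro open_Collect_less continuous_intros continuous_on_product_coordinates)
    show "\<exists>U. openin euclidean U \<and> v \<in> U \<and> (\<forall>u\<in>U. ?\<Phi> u \<in> mball (?\<Phi> v) \<epsilon>)"
    proof (intro exI[of _ ?U] conjI ballI)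
      show "openin euclidean ?U" using U by simp
      show "v \<in> ?U" using \<epsilon> by simp
      fix u assume u: "u \<in> ?U"
      have "mdist C_S2 (?\<Phi> v) (?\<Phi> u) \<le> \<epsilon> / 2"
        unfolding C_S2_def
      proof (rule mdist_cfunspace_le)
        fix y assume "y \<in> topspace (top_of_set S2)"
        then have y: "y \<in> S2" by simp
        have "\<bar>(\<Sum>i<n. v i * \<phi> i y) - (\<Sum>i<n. u i * \<phi> i y)\<bar> = \<bar>\<Sum>i<n. (u i - v i) * \<phi> i y\<bar>"
          by (simp add: left_diff_distrib sum_subtractf abs_minus_commute)
        also have "\<dots> \<le> (\<Sum>i<n. \<bar>u i - v i\<bar> * \<bar>B\<bar>)"
        proof (rule order_trans[OF sum_abs sum_mono])
          fix i assume "i \<in> {..<n}"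
          then have "\<bar>\<phi> i y\<bar> \<le> \<bar>B\<bar>" using B[OF _ y, of i] by simp
          then show "\<bar>(u i - v i) * \<phi> i y\<bar> \<le> \<bar>u i - v i\<bar> * \<bar>B\<bar>"
            unfolding abs_mult by (intro mult_left_mono) auto
        qed
        finally have "\<bar>(\<Sum>i<n. v i * \<phi> i y) - (\<Sum>i<n. u i * \<phi> i y)\<bar> \<le> \<epsilon> / 2" using u by simp
        then show "mdist euclidean_metric (?\<Phi> v y) (?\<Phi> u y) \<le> \<epsilon> / 2"
          using y by (simp add: dist_real_def del: mem_sphere mem_sphere_0)
      qed (use \<epsilon> in simp)
      then show "?\<Phi> u \<in> mball (?\<Phi> v) \<epsilon>" unfolding in_mball using ms \<epsilon> by auto
    qed
  qed
  then show ?thesis by (simp only: mtopology_of_def)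
qed

text \<open>Normalized tent functions over a finite cover by balls.\<close>

lemma sphere_partition_of_unity:
  fixes e :: real
  assumes e: "e > 0"
  shows "\<exists>n::nat. \<exists>p. \<exists>\<theta> :: nat \<Rightarrow> real ^ 3 \<Rightarrow> real. (\<forall>i<n. p i \<in> S2 \<and> continuous_on S2 (\<theta> i)) \<and>
    (\<forall>y\<in>S2. (\<Sum>i<n. \<theta> i y) = 1 \<and> (\<forall>i<n. 0 \<le> \<theta> i y \<and> (\<theta> i y \<noteq> 0 \<longrightarrow> dist (p i) y < e)))"
proof -
  obtain K where K: "finite K" "K \<subseteq> S2" "S2 \<subseteq> (\<Union>x\<in>K. ball x e)"
    using seq_compact_imp_totally_bounded[of S2] e by (auto simp: compact_eq_seq_compact_metric[symmetric])
  obtain n :: nat and p where p: "K = p ` {i. i < n}"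
    using finite_imp_nat_seg_image_inj_on[OF K(1)] by auto
  define s where "s i y = max 0 (e - dist (p i) y)" for i y
  define \<theta> where "\<theta> i y = s i y / (\<Sum>i<n. s i y)" for i y
  have s0: "0 \<le> s i y" for i y by (simp add: s_def)
  have pos: "0 < (\<Sum>i<n. s i y)" if y: "y \<in> S2" for y
  proof -
    from K(3) y p obtain i where i: "i < n" "dist (p i) y < e" by auto
    then have "0 < s i y" by (simp add: s_def)
    also have "s i y \<le> (\<Sum>i<n. s i y)" using i s0 by (intro member_le_sum) auto
    finally show ?thesis .
  qed
  show ?thesis
  proof (rule exI[of _ n], rule exI[of _ p], rule exI[of _ \<theta>], intro conjI allI impI ballI)
    show "p i \<in> S2" if "i < n" for i using that K(2) p by blast
    have c: "continuous_on S2 (s i)" for i unfolding s_def by (intro continuous_intros)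
    show "continuous_on S2 (\<theta> i)" for i
      unfolding \<theta>_def by (intro continuous_intros c ballI) (use pos in force)
    fix y assume y: "y \<in> S2"
    show "(\<Sum>i<n. \<theta> i y) = 1"
      using pos[OF y] unfolding \<theta>_def sum_divide_distrib[symmetric] by simp
    show "0 \<le> \<theta> i y" for i unfolding \<theta>_def using s0 by (intro divide_nonneg_nonneg sum_nonneg) auto
    show "dist (p i) y < e" if "\<theta> i y \<noteq> 0" for i
      using that by (auto simp: \<theta>_def s_def max_def split: if_splits)
  qed
qed

lemma borel_measurable_continuous_linear_combination:
  fixes \<phi> :: "nat \<Rightarrow> real ^ 3 \<Rightarrow> real"
  assumes h: "continuous_map (mtopology_of C_S2) euclideanreal h"
    and \<phi>: "\<And>i. i < n \<Longrightarrow> continuous_on S2 (\<phi> i)"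
  shows "continuous_on UNIV (\<lambda>v :: nat \<Rightarrow> real. h (\<lambda>y\<in>S2. \<Sum>i<n. v i * \<phi> i y))"
    and "(\<And>i. i < n \<Longrightarrow> X i \<in> borel_measurable N) \<Longrightarrow> (\<lambda>\<omega>. h (\<lambda>y\<in>S2. \<Sum>i<n. X i \<omega> * \<phi> i y)) \<in> borel_measurable N"
proof -
  show c: "continuous_on UNIV (\<lambda>v :: nat \<Rightarrow> real. h (\<lambda>y\<in>S2. \<Sum>i<n. v i * \<phi> i y))"
    using continuous_map_compose[OF continuous_linear_combination_C_S2[OF \<phi>] h] by (simp add: o_def)
  assume X: "\<And>i. i < n \<Longrightarrow> X i \<in> borel_measurable N"
  have "(\<lambda>\<omega> i. if i < n then X i \<omega> else 0) \<in> borel_measurable N"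
  proof (rule measurable_coordinatewise_then_product)
    show "(\<lambda>\<omega>. if i < n then X i \<omega> else 0) \<in> borel_measurable N" for i using X by (cases "i < n") auto
  qed
  from measurable_compose[OF this borel_measurable_continuous_onI[OF c]]
  show "(\<lambda>\<omega>. h (\<lambda>y\<in>S2. \<Sum>i<n. X i \<omega> * \<phi> i y)) \<in> borel_measurable N"
    by (simp cong: sum.cong_simp)
qed

text \<open>Measurability of the field is known only point by point. Averaging finitely many values
  with a partition of unity gives measurable approximations; they converge uniformly for continuous
  paths, and \<open>h\<close> respects that limit.\<close>

lemma borel_measurable_continuous_functional:
  assumes h: "continuous_map (mtopology_of C_S2) euclideanreal h"
    and f: "\<And>x. x \<in> S2 \<Longrightarrow> f x \<in> borel_measurable N"
    and paths: "\<And>\<omega>. \<omega> \<in> space N \<Longrightarrow> continuous_on S2 (\<lambda>x. f x \<omega>)"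
  shows "(\<lambda>\<omega>. h (\<lambda>x\<in>S2. f x \<omega>)) \<in> borel_measurable N"
proof -
  have "\<forall>k. \<exists>n::nat. \<exists>p. \<exists>\<theta> :: nat \<Rightarrow> real ^ 3 \<Rightarrow> real. (\<forall>i<n. p i \<in> S2 \<and> continuous_on S2 (\<theta> i)) \<and>
    (\<forall>y\<in>S2. (\<Sum>i<n. \<theta> i y) = 1 \<and> (\<forall>i<n. 0 \<le> \<theta> i y \<and> (\<theta> i y \<noteq> 0 \<longrightarrow> dist (p i) y < 1 / real (Suc k))))"
    by (intro allI sphere_partition_of_unity) simp
  then obtain n :: "nat \<Rightarrow> nat" and p and \<theta> :: "nat \<Rightarrow> nat \<Rightarrow> real ^ 3 \<Rightarrow> real" where *: "\<forall>k. (\<forall>i<n k. p k i \<in> S2 \<and> continuous_on S2 (\<theta> k i)) \<and>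
    (\<forall>y\<in>S2. (\<Sum>i<n k. \<theta> k i y) = 1 \<and> (\<forall>i<n k. 0 \<le> \<theta> k i y \<and> (\<theta> k i y \<noteq> 0 \<longrightarrow> dist (p k i) y < 1 / real (Suc k))))"
    unfolding choice_iff by (elim exE) (rule that)
  have p: "p k i \<in> S2" "continuous_on S2 (\<theta> k i)" if "i < n k" for k i using spec[OF *, of k] that by blast+
  have \<theta>: "(\<Sum>i<n k. \<theta> k i y) = 1" "\<And>i. i < n k \<Longrightarrow> 0 \<le> \<theta> k i y"
      "\<And>i. i < n k \<Longrightarrow> \<theta> k i y \<noteq> 0 \<Longrightarrow> dist (p k i) y < 1 / real (Suc k)" if "y \<in> S2" for k y
    using spec[OF *, of k] that by blast+
  let ?\<Pi> = "\<lambda>k \<omega>. \<lambda>y\<in>S2. \<Sum>i<n k. f (p k i) \<omega> * \<theta> k i y"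
  interpret Metric_space "mspace C_S2" "mdist C_S2" by (rule Metric_space_mspace_mdist)
  show ?thesis
  proof (rule borel_measurable_LIMSEQ_real)
    show "(\<lambda>\<omega>. h (?\<Pi> k \<omega>)) \<in> borel_measurable N" for k
      by (intro borel_measurable_continuous_linear_combination(2)[OF h] p f)
    fix \<omega> assume \<omega>: "\<omega> \<in> space N"
    let ?u = "\<lambda>x\<in>S2. f x \<omega>"
    have "limitin mtopology (\<lambda>k. ?\<Pi> k \<omega>) ?u sequentially"
      unfolding limitin_metric
    proof (intro conjI allI impI)
      have "continuous_on S2 ?u \<longleftrightarrow> continuous_on S2 (\<lambda>x. f x \<omega>)" by (rule continuous_on_cong) auto
      then show "?u \<in> mspace C_S2" using paths[OF \<omega>] by (simp add: mspace_C_S2)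
      fix \<epsilon> :: real assume \<epsilon>: "0 < \<epsilon>"
      have "uniformly_continuous_on S2 (\<lambda>x. f x \<omega>)" by (intro compact_uniformly_continuous paths \<omega>) simp
      then obtain \<delta> where \<delta>: "\<delta> > 0" "\<And>x y. x \<in> S2 \<Longrightarrow> y \<in> S2 \<Longrightarrow> dist x y < \<delta> \<Longrightarrow> \<bar>f x \<omega> - f y \<omega>\<bar> < \<epsilon> / 2"
        unfolding uniformly_continuous_on_def using \<epsilon> by (metis dist_real_def half_gt_zero)
      have "\<forall>\<^sub>F k in sequentially. 1 / real (Suc k) < \<delta>"
        by (rule order_tendstoD(2)[OF LIMSEQ_Suc[OF lim_1_over_n]]) (rule \<delta>(1))
      then show "\<forall>\<^sub>F k in sequentially. ?\<Pi> k \<omega> \<in> mspace C_S2 \<and> mdist C_S2 (?\<Pi> k \<omega>) ?u < \<epsilon>"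
      proof eventually_elim
        fix k assume k: "1 / real (Suc k) < \<delta>"
        have "continuous_on S2 (?\<Pi> k \<omega>) \<longleftrightarrow> continuous_on S2 (\<lambda>y. \<Sum>i<n k. f (p k i) \<omega> * \<theta> k i y)"
          by (rule continuous_on_cong) auto
        then have ms: "?\<Pi> k \<omega> \<in> mspace C_S2"
          unfolding mspace_C_S2 using p(2) by (auto intro!: continuous_intros)
        have "mdist C_S2 (?\<Pi> k \<omega>) ?u \<le> \<epsilon> / 2"
          unfolding C_S2_def
        proof (rule mdist_cfunspace_le)
          fix y assume "y \<in> topspace (top_of_set S2)"
          then have y: "y \<in> S2" by simp
          have "(\<Sum>i<n k. f (p k i) \<omega> * \<theta> k i y) - f y \<omega> = (\<Sum>i<n k. (f (p k i) \<omega> - f y \<omega>) * \<theta> k i y)"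
            using \<theta>(1)[OF y, of k] by (simp add: left_diff_distrib sum_subtractf sum_distrib_left[symmetric])
          also have "\<bar>\<dots>\<bar> \<le> (\<Sum>i<n k. \<epsilon> / 2 * \<theta> k i y)"
          proof (rule order_trans[OF sum_abs sum_mono])
            fix i assume "i \<in> {..<n k}"
            then have i: "i < n k" by simp
            show "\<bar>(f (p k i) \<omega> - f y \<omega>) * \<theta> k i y\<bar> \<le> \<epsilon> / 2 * \<theta> k i y"
            proof (cases "\<theta> k i y = 0")
              case False
              then have "dist (p k i) y < \<delta>" using \<theta>(3)[OF y i] k by linarith
              then have "\<bar>f (p k i) \<omega> - f y \<omega>\<bar> \<le> \<epsilon> / 2" using \<delta>(2)[OF p(1)[OF i] y] by linarith
              then show ?thesis
                unfolding abs_mult abs_of_nonneg[OF \<theta>(2)[OF y i]] by (rule mult_right_mono[OF _ \<theta>(2)[OF y i]])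
            qed simp
          qed
          also have "\<dots> = \<epsilon> / 2" unfolding sum_distrib_left[symmetric] \<theta>(1)[OF y] by simp
          finally show "mdist euclidean_metric (?\<Pi> k \<omega> y) (?u y) \<le> \<epsilon> / 2"
            using y by (simp add: dist_real_def del: mem_sphere mem_sphere_0)
        qed (use \<epsilon> in simp)
        then show "?\<Pi> k \<omega> \<in> mspace C_S2 \<and> mdist C_S2 (?\<Pi> k \<omega>) ?u < \<epsilon>" using ms \<epsilon> by auto
      qed
    qed
    then have "limitin (mtopology_of C_S2) (\<lambda>k. ?\<Pi> k \<omega>) ?u sequentially" by (simp only: mtopology_of_def)
    from continuous_map_limit[OF h this] show "(\<lambda>k. h (?\<Pi> k \<omega>)) \<longlonglongrightarrow> h ?u" by (simp add: o_def)
  qed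
qed

lemma (in prob_space) combination_square:
  fixes X :: "'i \<Rightarrow> 'a \<Rightarrow> real"
  assumes A: "finite A" and X: "\<And>i. i \<in> A \<Longrightarrow> X i \<in> borel_measurable M" "\<And>i. i \<in> A \<Longrightarrow> integrable M (\<lambda>\<omega>. (X i \<omega>)\<^sup>2)"
  shows "integrable M (\<lambda>\<omega>. (\<Sum>i\<in>A. t i * X i \<omega>)\<^sup>2)"
    and "expectation (\<lambda>\<omega>. (\<Sum>i\<in>A. t i * X i \<omega>)\<^sup>2) = (\<Sum>i\<in>A. \<Sum>k\<in>A. t i * t k * expectation (\<lambda>\<omega>. X i \<omega> * X k \<omega>))"
proof -
  have prod: "integrable M (\<lambda>\<omega>. X i \<omega> * X k \<omega>)" if "i \<in> A" "k \<in> A" for i k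
  proof (rule Bochner_Integration.integrable_bound)
    show "integrable M (\<lambda>\<omega>. ((X i \<omega>)\<^sup>2 + (X k \<omega>)\<^sup>2) / 2)" using X that by simp
    have "\<bar>x * y\<bar> \<le> (x\<^sup>2 + y\<^sup>2) / 2" for x y :: real
      using zero_le_power2[of "\<bar>x\<bar> - \<bar>y\<bar>"] by (simp add: power2_eq_square abs_mult algebra_simps)
    then show "AE \<omega> in M. norm (X i \<omega> * X k \<omega>) \<le> norm (((X i \<omega>)\<^sup>2 + (X k \<omega>)\<^sup>2) / 2)"
      by (intro AE_I2) (simp only: real_norm_def, simp)
    show "(\<lambda>\<omega>. X i \<omega> * X k \<omega>) \<in> borel_measurable M" using X that by simp
  qed
  have sq: "(\<Sum>i\<in>A. t i * X i \<omega>)\<^sup>2 = (\<Sum>i\<in>A. \<Sum>k\<in>A. t i * t k * (X i \<omega> * X k \<omega>))" for \<omega>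
    by (simp add: power2_eq_square sum_product mult_ac)
  have i: "integrable M (\<lambda>\<omega>. t i * t k * (X i \<omega> * X k \<omega>))" if "i \<in> A" "k \<in> A" for i k
    by (rule integrable_mult_right) (rule prod[OF that])
  show "integrable M (\<lambda>\<omega>. (\<Sum>i\<in>A. t i * X i \<omega>)\<^sup>2)"
    unfolding sq by (intro Bochner_Integration.integrable_sum i)
  show "expectation (\<lambda>\<omega>. (\<Sum>i\<in>A. t i * X i \<omega>)\<^sup>2) = (\<Sum>i\<in>A. \<Sum>k\<in>A. t i * t k * expectation (\<lambda>\<omega>. X i \<omega> * X k \<omega>))"
    unfolding sq using i by (simp add: Bochner_Integration.integral_sum Bochner_Integration.integrable_sum)
qed

section \<open>Transfer between fields with equal covariances\<close>

locale equal_covariances = M: prob_space M + N: prob_space N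
  for M :: "'w measure" and N :: "'v measure" +
  fixes S :: "'x set" and g :: "'x \<Rightarrow> 'w \<Rightarrow> real" and f :: "'x \<Rightarrow> 'v \<Rightarrow> real"
  assumes g: "\<And>x. x \<in> S \<Longrightarrow> g x \<in> borel_measurable M" "\<And>x. x \<in> S \<Longrightarrow> integrable M (\<lambda>\<omega>. (g x \<omega>)\<^sup>2)"
    and f: "\<And>x. x \<in> S \<Longrightarrow> f x \<in> borel_measurable N" "\<And>x. x \<in> S \<Longrightarrow> integrable N (\<lambda>\<omega>. (f x \<omega>)\<^sup>2)"
    and eq: "\<And>x y. x \<in> S \<Longrightarrow> y \<in> S \<Longrightarrow> N.expectation (\<lambda>\<omega>. f x \<omega> * f y \<omega>) = M.expectation (\<lambda>\<omega>. g x \<omega> * g y \<omega>)"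
begin

lemma second_moment_eq:
  assumes "finite A" "\<And>i. i \<in> A \<Longrightarrow> x i \<in> S"
  shows "N.expectation (\<lambda>\<omega>. (\<Sum>i\<in>A. t i * f (x i) \<omega>)\<^sup>2) = M.expectation (\<lambda>\<omega>. (\<Sum>i\<in>A. t i * g (x i) \<omega>)\<^sup>2)"
proof -
  have "N.expectation (\<lambda>\<omega>. (\<Sum>i\<in>A. t i * f (x i) \<omega>)\<^sup>2) = (\<Sum>i\<in>A. \<Sum>k\<in>A. t i * t k * N.expectation (\<lambda>\<omega>. f (x i) \<omega> * f (x k) \<omega>))"
    by (rule N.combination_square(2)[of A "\<lambda>i. f (x i)" t, OF assms(1)]) (use f assms(2) in auto)
  also have "\<dots> = (\<Sum>i\<in>A. \<Sum>k\<in>A. t i * t k * M.expectation (\<lambda>\<omega>. g (x i) \<omega> * g (x k) \<omega>))"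
    using eq assms(2) by (intro sum.cong refl) auto
  also have "\<dots> = M.expectation (\<lambda>\<omega>. (\<Sum>i\<in>A. t i * g (x i) \<omega>)\<^sup>2)"
    by (rule M.combination_square(2)[of A "\<lambda>i. g (x i)" t, OF assms(1), symmetric]) (use g assms(2) in auto)
  finally show ?thesis .
qed

text \<open>The difference of the two sides has second moment zero for \<open>g\<close>, and this
  moment is a function of the covariances.\<close>

lemma linear_relation_transfer:
  fixes x :: "nat \<Rightarrow> 'x"
  assumes x: "\<And>i. i < n \<Longrightarrow> x i \<in> S" and y: "y \<in> S"
    and rel: "\<And>\<omega>. \<omega> \<in> space M \<Longrightarrow> g y \<omega> = (\<Sum>i<n. c i * g (x i) \<omega>)"
  shows "AE \<omega> in N. f y \<omega> = (\<Sum>i<n. c i * f (x i) \<omega>)"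
proof -
  define x' where "x' = x(n := y)"
  define t where "t i = (if i = n then 1 else - c i)" for i
  have x': "x' i \<in> S" if "i \<in> {..<Suc n}" for i using that x y by (auto simp: x'_def less_Suc_eq)
  have comb: "(\<Sum>i<Suc n. t i * u (x' i)) = u y - (\<Sum>i<n. c i * u (x i))" for u :: "'x \<Rightarrow> real"
  proof -
    have "(\<Sum>i<n. t i * u (x' i)) = (\<Sum>i<n. - (c i * u (x i)))"
      by (intro sum.cong) (auto simp: t_def x'_def)
    then show ?thesis by (simp add: t_def x'_def sum_negf)
  qed
  have "N.expectation (\<lambda>\<omega>. (\<Sum>i<Suc n. t i * f (x' i) \<omega>)\<^sup>2) = M.expectation (\<lambda>\<omega>. (\<Sum>i<Suc n. t i * g (x' i) \<omega>)\<^sup>2)"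
    by (rule second_moment_eq[OF finite_lessThan x'])
  also have "\<dots> = M.expectation (\<lambda>\<omega>. 0)"
    unfolding comb[of "\<lambda>z. g z _"] by (rule Bochner_Integration.integral_cong) (use rel in auto)
  finally have "N.expectation (\<lambda>\<omega>. (\<Sum>i<Suc n. t i * f (x' i) \<omega>)\<^sup>2) = 0" by simp
  moreover have "integrable N (\<lambda>\<omega>. (\<Sum>i<Suc n. t i * f (x' i) \<omega>)\<^sup>2)"
    by (rule N.combination_square(1)[of "{..<Suc n}" "\<lambda>i. f (x' i)" t]) (use f x' in auto)
  ultimately have "AE \<omega> in N. (\<Sum>i<Suc n. t i * f (x' i) \<omega>)\<^sup>2 = 0"
    by (subst (asm) integral_nonneg_eq_0_iff_AE) auto
  then show ?thesis unfolding comb[of "\<lambda>z. f z _"] by eventually_elim simp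
qed

end

section \<open>Smoothed needlet fields\<close>

text \<open>The part of the bound in \<open>cos_approximation\<close> that does not depend on the
  field; \<open>4 * pi\<close> is the mass of the sphere.\<close>

definition proximity_constant :: "nat \<Rightarrow> real" where
  "proximity_constant q = (real q)\<^sup>2 * recursion_error (q - 1) * ((4 * pi + (4 * pi) ^ 3) * moment_sum q)"

context band_limited_field
begin

definition hermite_functional where
  "hermite_functional q \<psi> \<omega> = (LINT z|surface_measure. \<psi> z * poly (hermite q) (band z \<omega> / sqrt V))"

lemma band_continuous: "continuous_on UNIV (\<lambda>z. band z \<omega>)"
  unfolding band_def harmonic_component_def by (intro continuous_intros continuous_sph_harm)

lemma hermite_functional_integrand:
  assumes "continuous_on UNIV \<psi>"
  shows "integrable surface_measure (\<lambda>z. \<psi> z * poly (hermite q) (band z \<omega> / sqrt V))"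
  using V by (intro continuous_surface_integrable continuous_intros assms band_continuous) simp

lemma hermite_functional_combination:
  assumes "\<And>i. i \<in> J \<Longrightarrow> continuous_on UNIV (\<psi> i)"
  shows "hermite_functional q (\<lambda>z. \<Sum>i\<in>J. c i * \<psi> i z) \<omega> = (\<Sum>i\<in>J. c i * hermite_functional q (\<psi> i) \<omega>)"
proof -
  have i: "integrable surface_measure (\<lambda>z. c i * (\<psi> i z * poly (hermite q) (band z \<omega> / sqrt V)))" if "i \<in> J" for i
    using assms that by (intro integrable_mult_right hermite_functional_integrand)
  have "hermite_functional q (\<lambda>z. \<Sum>i\<in>J. c i * \<psi> i z) \<omega>
     = (LINT z|surface_measure. (\<Sum>i\<in>J. c i * (\<psi> i z * poly (hermite q) (band z \<omega> / sqrt V))))"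
    by (simp add: hermite_functional_def sum_distrib_right mult.assoc)
  also have "\<dots> = (\<Sum>i\<in>J. (LINT z|surface_measure. c i * (\<psi> i z * poly (hermite q) (band z \<omega> / sqrt V))))"
    by (rule Bochner_Integration.integral_sum) (rule i)
  finally show ?thesis by (simp add: hermite_functional_def)
qed

lemma hermite_functional:
  assumes \<psi>: "continuous_on UNIV \<psi>" "\<And>y. y \<in> S2 \<Longrightarrow> \<bar>\<psi> y\<bar> \<le> \<Psi>" "\<Psi> \<ge> 0" and q: "q \<ge> 1"
  shows "integrable M (hermite_functional q \<psi>)" "integrable M (\<lambda>\<omega>. (hermite_functional q \<psi> \<omega>)\<^sup>2)"
    "expectation (hermite_functional q \<psi>) = 0"
    "\<bar>expectation (\<lambda>\<omega>. cos (hermite_functional q \<psi> \<omega> + \<theta>))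
        - cos \<theta> * exp (- expectation (\<lambda>\<omega>. (hermite_functional q \<psi> \<omega>)\<^sup>2) / 2)\<bar>
     \<le> proximity_constant q * (\<Psi> ^ 3 * d ^ 7)"
proof -
  have bm: "bounded_measurable surface_measure \<psi>"
  proof (rule bounded_measurableI)
    show "\<psi> \<in> borel_measurable surface_measure" by (rule continuous_surface_measurable[OF \<psi>(1)])
    show "\<bar>\<psi> y\<bar> \<le> \<Psi>" if "y \<in> space surface_measure" for y
      using \<psi>(2) that unfolding space_surface_measure by blast
  qed
  interpret F: gaussian_functional M indices \<xi> surface_measure e d \<Psi> \<psi> q
    by (rule gaussian_functional[OF bm \<psi>(2,3) q])
  have eq: "hermite_functional q \<psi> = F.F"
    by (rule ext) (simp add: hermite_functional_def F.F_def F.\<beta>_def expansion)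
  show "integrable M (hermite_functional q \<psi>)" "integrable M (\<lambda>\<omega>. (hermite_functional q \<psi> \<omega>)\<^sup>2)"
    "expectation (hermite_functional q \<psi>) = 0"
    unfolding eq using F.F_integrable F.F_mean by auto
  have "(real q)\<^sup>2 * recursion_error (q - 1) * F.error_bound = proximity_constant q * (\<Psi> ^ 3 * d ^ 7)"
    by (simp add: proximity_constant_def F.error_bound_def F.mass_def surface_mass mult_ac)
  then show "\<bar>expectation (\<lambda>\<omega>. cos (hermite_functional q \<psi> \<omega> + \<theta>))
        - cos \<theta> * exp (- expectation (\<lambda>\<omega>. (hermite_functional q \<psi> \<omega>)\<^sup>2) / 2)\<bar>
     \<le> proximity_constant q * (\<Psi> ^ 3 * d ^ 7)"
    unfolding eq using F.cos_approximation[of \<theta>] by simp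
qed

end

text \<open>Nodes may coincide, while \<open>gaussian_field\<close> is stated for sets of points, so
  the coefficients of equal nodes are collected first.\<close>

lemma (in prob_space) gaussian_field_centered:
  fixes x :: "nat \<Rightarrow> real ^ 3"
  assumes "gaussian_field M f" "zero_mean_field M f" and x: "\<And>i. i < n \<Longrightarrow> x i \<in> S2"
  shows "centered_gaussian M (\<lambda>\<omega>. \<Sum>i<n. t i * f (x i) \<omega>)"
proof -
  let ?F = "x ` {..<n}"
  define c where "c y = (\<Sum>i\<in>{i. i \<in> {..<n} \<and> x i = y}. t i)" for y
  have F: "finite ?F" "?F \<subseteq> S2" using x by blast+
  have eq: "(\<Sum>i<n. t i * f (x i) \<omega>) = (\<Sum>y\<in>?F. c y * f y \<omega>)" for \<omega>
    by (subst sum.image_gen[OF finite_lessThan, of _ n x]) (auto simp: c_def sum_distrib_right intro!: sum.cong)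
  show ?thesis unfolding eq by (rule gaussian_field_centered_set[OF assms(1,2) F])
qed

text \<open>The exceptional null set depends on \<open>y\<close>; a countable dense set yields a
  single one, and continuity of the paths extends the identity to the whole sphere.\<close>

lemma continuous_paths_interpolation:
  fixes x :: "nat \<Rightarrow> real ^ 3" and f :: "real ^ 3 \<Rightarrow> 'v \<Rightarrow> real" and \<phi> :: "nat \<Rightarrow> real ^ 3 \<Rightarrow> real"
  assumes paths: "\<And>\<omega>. \<omega> \<in> space N \<Longrightarrow> continuous_on S2 (\<lambda>x. f x \<omega>)"
    and \<phi>: "\<And>i. i < n \<Longrightarrow> continuous_on S2 (\<phi> i)"
    and ae: "\<And>y. y \<in> S2 \<Longrightarrow> AE \<omega> in N. f y \<omega> = (\<Sum>i<n. \<phi> i y * f (x i) \<omega>)"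
  shows "AE \<omega> in N. \<forall>y\<in>S2. f y \<omega> = (\<Sum>i<n. \<phi> i y * f (x i) \<omega>)"
proof -
  obtain D where D: "countable D" "D \<subseteq> S2" "S2 \<subseteq> closure D" using separable[of S2] by blast
  have "AE \<omega> in N. \<forall>y\<in>D. f y \<omega> = (\<Sum>i<n. \<phi> i y * f (x i) \<omega>)"
    using D(1,2) ae by (intro AE_ball_countable[THEN iffD2] ballI) auto
  then show ?thesis
    using AE_space
  proof eventually_elim
    fix \<omega> assume a: "\<forall>y\<in>D. f y \<omega> = (\<Sum>i<n. \<phi> i y * f (x i) \<omega>)" and \<omega>: "\<omega> \<in> space N"
    let ?E = "{y \<in> S2. f y \<omega> - (\<Sum>i<n. \<phi> i y * f (x i) \<omega>) = 0}"
    have "closed ?E"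
      by (intro continuous_closed_preimage_constant continuous_intros paths \<omega> \<phi>) auto
    moreover have "D \<subseteq> ?E" using a D(2) by auto
    ultimately have "closure D \<subseteq> ?E" by (rule closure_minimal[rotated])
    then show "\<forall>y\<in>S2. f y \<omega> = (\<Sum>i<n. \<phi> i y * f (x i) \<omega>)" using D(3) by auto
  qed
qed

lemma (in band_limited_field) needlet_field_eq_band:
  assumes "\<And>l. l \<notin> A \<Longrightarrow> w l = 0"
  shows "(\<Sum>l. w l * Re (harmonic_component a l x \<omega>)) = band x \<omega>"
  unfolding band_def by (rule suminf_finite[OF finite_A]) (simp add: assms)

text \<open>The variance of \<open>band\<close> is the same at all points of the sphere, so the
  pointwise normalization divides by a constant.\<close>

lemma (in band_limited_field) smoothed_hermite_band:
  "smoothed_hermite L \<kappa> q (normalized_field M band) x = hermite_functional q (\<lambda>z. smoothing_kernel L \<kappa> (x \<bullet> z))"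
proof (rule ext)
  fix \<omega>
  have "normalized_field M band z \<omega> = band z \<omega> / sqrt V" if "z \<in> space surface_measure" for z
    using that band_variance[of z] unfolding space_surface_measure normalized_field_def by simp
  then show "smoothed_hermite L \<kappa> q (normalized_field M band) x \<omega> = hermite_functional q (\<lambda>z. smoothing_kernel L \<kappa> (x \<bullet> z)) \<omega>"
    unfolding smoothed_hermite_def hermite_functional_def by (intro Bochner_Integration.integral_cong refl) (simp only:)
qed

locale smoothed_band = band_limited_field M T a C A w d
  for M :: "'w measure" and T a C A w d +
  fixes k :: "real ^ 3 \<Rightarrow> real ^ 3 \<Rightarrow> real" and q :: nat and S P :: real
  assumes q: "q \<ge> 1" and k_continuous: "\<And>x. continuous_on UNIV (k x)"
    and k_bound: "\<And>x z. x \<in> S2 \<Longrightarrow> z \<in> S2 \<Longrightarrow> \<bar>k x z\<bar> \<le> P" and P: "P \<ge> 0"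
    and S: "S > 0" and variance: "\<And>x. x \<in> S2 \<Longrightarrow> expectation (\<lambda>\<omega>. (hermite_functional q (k x) \<omega>)\<^sup>2) = S"
begin

abbreviation G where "G \<equiv> normalized_field M (\<lambda>x. hermite_functional q (k x))"

lemma G_eq: "x \<in> S2 \<Longrightarrow> G x \<omega> = hermite_functional q (k x) \<omega> / sqrt S"
  by (simp only: normalized_field_def variance)

lemma
  assumes x: "x \<in> S2"
  shows G_integrable: "integrable M (G x)" "integrable M (\<lambda>\<omega>. (G x \<omega>)\<^sup>2)"
    and G_mean: "expectation (G x) = 0" and G_variance: "expectation (\<lambda>\<omega>. (G x \<omega>)\<^sup>2) = 1"
proof -
  note H = hermite_functional[OF k_continuous k_bound[OF x] P q]
  have eq: "G x = (\<lambda>\<omega>. hermite_functional q (k x) \<omega> / sqrt S)" using G_eq[OF x] by blast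
  show "integrable M (G x)" "integrable M (\<lambda>\<omega>. (G x \<omega>)\<^sup>2)" "expectation (G x) = 0"
    unfolding eq power_divide using H by simp_all
  show "expectation (\<lambda>\<omega>. (G x \<omega>)\<^sup>2) = 1"
    unfolding eq power_divide using variance[OF x] S by simp
qed

lemma G_interpolation:
  assumes x: "\<And>i. i < n \<Longrightarrow> x i \<in> S2" and y: "y \<in> S2" and "\<And>z. k y z = (\<Sum>i<n. c i * k (x i) z)"
  shows "G y \<omega> = (\<Sum>i<n. c i * G (x i) \<omega>)"
proof -
  have "hermite_functional q (k y) \<omega> = (\<Sum>i<n. c i * hermite_functional q (k (x i)) \<omega>)"
    unfolding assms(3) by (rule hermite_functional_combination) (rule k_continuous)
  then show ?thesis using G_eq[OF y] G_eq[OF x] by (simp add: sum_divide_distrib)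
qed

text \<open>A combination of values of \<open>G\<close> is again a single Hermite functional with a
  combined kernel, so the one-dimensional estimate covers all finite-dimensional laws.\<close>

lemma G_cos_approximation:
  assumes x: "\<And>i. i < n \<Longrightarrow> x i \<in> S2"
  shows "\<bar>expectation (\<lambda>\<omega>. cos ((\<Sum>i<n. t i * G (x i) \<omega>) + \<theta>))
      - cos \<theta> * exp (- expectation (\<lambda>\<omega>. (\<Sum>i<n. t i * G (x i) \<omega>)\<^sup>2) / 2)\<bar>
    \<le> proximity_constant q * (((\<Sum>i<n. \<bar>t i\<bar>) * P / sqrt S) ^ 3 * d ^ 7)"
proof -
  define \<psi> where "\<psi> z = (\<Sum>i<n. t i / sqrt S * k (x i) z)" for z
  have eq: "(\<Sum>i<n. t i * G (x i) \<omega>) = hermite_functional q \<psi> \<omega>" for \<omega>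
  proof -
    have "hermite_functional q \<psi> \<omega> = (\<Sum>i<n. t i / sqrt S * hermite_functional q (k (x i)) \<omega>)"
      unfolding \<psi>_def by (rule hermite_functional_combination) (rule k_continuous)
    then show ?thesis using G_eq[OF x] by simp
  qed
  show ?thesis
    unfolding eq
  proof (rule hermite_functional(4))
    show "continuous_on UNIV \<psi>" unfolding \<psi>_def by (intro continuous_intros k_continuous) (use S in simp)
    show "\<bar>\<psi> y\<bar> \<le> (\<Sum>i<n. \<bar>t i\<bar>) * P / sqrt S" if y: "y \<in> S2" for y
    proof -
      have "\<bar>\<psi> y\<bar> \<le> (\<Sum>i<n. \<bar>t i\<bar> / sqrt S * P)"
        unfolding \<psi>_def
      proof (rule order_trans[OF sum_abs sum_mono])
        fix i assume "i \<in> {..<n}"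
        then have "\<bar>k (x i) y\<bar> \<le> P" using k_bound x y by simp
        then show "\<bar>t i / sqrt S * k (x i) y\<bar> \<le> \<bar>t i\<bar> / sqrt S * P"
          unfolding abs_mult using S by (simp add: mult_left_mono divide_right_mono)
      qed
      then show ?thesis by (simp add: sum_distrib_right sum_divide_distrib)
    qed
    show "(\<Sum>i<n. \<bar>t i\<bar>) * P / sqrt S \<ge> 0" using P S by (simp add: sum_nonneg)
  qed (rule q)
qed

end

section \<open>Asymptotic proximity of the smoothed needlet fields\<close>

theorem theorem18:
  fixes M :: "'w measure" and T :: "'w field"
    and a :: "nat \<Rightarrow> int \<Rightarrow> 'w \<Rightarrow> complex" and C :: "nat \<Rightarrow> real"
    and B :: real and b :: "real \<Rightarrow> real"
    and L :: nat and \<kappa> :: "nat \<Rightarrow> real" and q :: nat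
    and N :: "nat \<Rightarrow> 'v measure" and f :: "nat \<Rightarrow> 'v field"
    and h :: "((real^3) \<Rightarrow> real) \<Rightarrow> real"
    and \<beta> \<beta>t g gt :: "nat \<Rightarrow> 'w field"
  defines "\<beta> \<equiv> needlet_field b B a"
    and "\<beta>t \<equiv> \<lambda>j. normalized_field M (\<beta> j)"
    and "g \<equiv> \<lambda>j. smoothed_hermite L \<kappa> q (\<beta>t j)"
    and "gt \<equiv> \<lambda>j. normalized_field M (g j)"
  assumes "prob_space M"
    and "gaussian_field M T" and "zero_mean_field M T" and "isotropic_field M T"
    and "spectral_representation M T a C"
    and "regular_spectrum C"
    and "B > 1" and "needlet_window B b"
    and "q \<ge> 1"
    and "\<forall>j\<ge>1. \<forall>x\<in>S2. prob_space.expectation M (\<lambda>\<omega>. (\<beta> j x \<omega>)\<^sup>2) > 0"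
    and "\<exists>c\<^sub>1>0. \<exists>c\<^sub>2>0. \<forall>j\<ge>1. \<exists>s. c\<^sub>1 \<le> s \<and> s \<le> c\<^sub>2 \<and>
           (\<forall>x\<in>S2. prob_space.variance M (g j x) = s * B powr (- 2 * real j))"
    and "\<forall>j\<ge>1. prob_space (N j)"
    and "\<forall>j\<ge>1. gaussian_field (N j) (f j) \<and> zero_mean_field (N j) (f j) \<and>
           isotropic_field (N j) (f j)"
    and "\<forall>j\<ge>1. \<forall>\<omega>\<in>space (N j). continuous_on S2 (\<lambda>x. f j x \<omega>)"
    and "\<forall>j\<ge>1. \<forall>x\<in>S2. \<forall>y\<in>S2.
           covariance (N j) (f j x) (f j y) = covariance M (gt j x) (gt j y)"
    and "continuous_map (mtopology_of C_S2) euclideanreal h"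
    and "bounded (h ` mspace C_S2)"
  shows "(\<lambda>j. \<bar>prob_space.expectation M (\<lambda>\<omega>. h (\<lambda>x\<in>S2. gt j x \<omega>))
             - prob_space.expectation (N j) (\<lambda>\<omega>. h (\<lambda>x\<in>S2. f j x \<omega>))\<bar>) \<longlonglongrightarrow> 0"
proof -
  interpret prob_space M by (rule assms(5))
  interpret spectral_field M T a C
    using assms(6,7,9) regular_spectrum_summable[OF assms(10)] by unfold_locales
  define k where "k x z = smoothing_kernel L \<kappa> (x \<bullet> z)" for x z :: "real ^ 3"
  define p where "p = (\<Sum>l=1..L. smult ((2 * real l + 1) / (4 * pi) * \<kappa> l) (legendre l))"
  have k_poly: "k = (\<lambda>x z. poly p (x \<bullet> z))"
    by (rule ext, rule ext) (simp add: k_def p_def smoothing_kernel_def poly_sum)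
  have k_continuous: "continuous_on UNIV (k x)" for x unfolding k_poly by (intro continuous_intros)
  have "\<exists>P\<ge>0. \<forall>x\<in>S2. \<forall>z\<in>S2. \<bar>k x z\<bar> \<le> P"
  proof -
    have "compact (poly p ` {-1..1})" by (intro compact_continuous_image continuous_intros) auto
    then obtain P where P: "\<And>u. u \<in> {-1..1} \<Longrightarrow> \<bar>poly p u\<bar> \<le> P"
      using compact_imp_bounded bounded_iff by (metis imageI real_norm_def)
    have "x \<bullet> z \<in> {-1..1}" if "x \<in> S2" "z \<in> S2" for x z :: "real ^ 3"
      using Cauchy_Schwarz_ineq2[of x z] that by (simp add: abs_le_iff)
    moreover have "0 \<le> P" using P[of 0] by simp
    ultimately show ?thesis using P unfolding k_poly by blast
  qed
  then obtain P where P: "P \<ge> 0" "\<And>x z. x \<in> S2 \<Longrightarrow> z \<in> S2 \<Longrightarrow> \<bar>k x z\<bar> \<le> P" by blast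
  have "separable_kernel k" unfolding k_poly by (rule separable_kernel_poly)
  then obtain n :: nat and x \<phi> where x: "\<And>i. i < n \<Longrightarrow> x i \<in> S2" and \<phi>: "\<And>i. i < n \<Longrightarrow> continuous_on S2 (\<phi> i)"
    and k_interpolation: "\<And>y z. y \<in> S2 \<Longrightarrow> k y z = (\<Sum>i<n. \<phi> i y * k (x i) z)"
    by (rule kernel_interpolation[where X = S2]) blast
  obtain D where D: "D > 0" and ev: "\<forall>\<^sub>F j in sequentially. 0 < band_variance_sum B b C j \<and>
      (\<forall>l. (b (real l / B ^ j))\<^sup>2 * C l \<le> D / B ^ (2 * j) * band_variance_sum B b C j)"
    by (rule window_domination[OF assms(12,11,10)]) blast
  \<comment> \<open>The fourth root of the eigenvalue bound \<open>D / B ^ (2 * j)\<close>.\<close>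
  define d where "d j = root 4 D * (1 / sqrt B) ^ j" for j
  have d_pos: "d j > 0" for j using D assms(11) by (simp add: d_def)
  have d_4: "d j ^ 4 = D / B ^ (2 * j)" for j
  proof -
    have "d j ^ 4 = D * ((1 / sqrt B) ^ j) ^ 4" using D by (simp add: d_def power_mult_distrib)
    also have "((1 / sqrt B) ^ j) ^ 4 = ((1 / sqrt B)\<^sup>2) ^ (2 * j)" by (simp add: mult.commute flip: power_mult)
    finally show ?thesis using assms(11) by (simp add: power_divide)
  qed
  obtain c\<^sub>1 c\<^sub>2 where c1: "c\<^sub>1 > 0" and "\<forall>j\<ge>1. \<exists>s. c\<^sub>1 \<le> s \<and> s \<le> c\<^sub>2 \<and>
           (\<forall>x\<in>S2. variance (g j x) = s * B powr (- 2 * real j))"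
    using assms(15) by blast
  then have "\<forall>j. \<exists>s. 1 \<le> j \<longrightarrow> c\<^sub>1 \<le> s \<and> (\<forall>x\<in>S2. variance (g j x) = s * B powr (- 2 * real j))" by blast
  then obtain s where s: "\<And>j. 1 \<le> j \<Longrightarrow> c\<^sub>1 \<le> s j"
    and var: "\<And>j x. 1 \<le> j \<Longrightarrow> x \<in> S2 \<Longrightarrow> variance (g j x) = s j * B powr (- 2 * real j)" by metis
  define S where "S j = s j * B powr (- 2 * real j)" for j
  have S_pos: "S j > 0" if "1 \<le> j" for j using s[OF that] c1 assms(11) by (simp add: S_def)
  \<comment> \<open>From \<open>J\<close> on the window estimates hold; it is at least 1 because the
    assumptions on the fields start at \<open>j = 1\<close>.\<close>
  obtain J where J: "J \<ge> 1" "\<And>j. j \<ge> J \<Longrightarrow> 0 < band_variance_sum B b C j"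
      "\<And>j l. j \<ge> J \<Longrightarrow> (b (real l / B ^ j))\<^sup>2 * C l \<le> D / B ^ (2 * j) * band_variance_sum B b C j"
  proof -
    obtain J where "\<forall>j\<ge>J. 0 < band_variance_sum B b C j \<and>
      (\<forall>l. (b (real l / B ^ j))\<^sup>2 * C l \<le> D / B ^ (2 * j) * band_variance_sum B b C j)"
      using ev unfolding eventually_sequentially by blast
    then show thesis by (intro that[of "max J 1"]) auto
  qed
  have gt_props: "\<And>y. y \<in> S2 \<Longrightarrow> integrable M (gt j y)" "\<And>y. y \<in> S2 \<Longrightarrow> integrable M (\<lambda>\<omega>. (gt j y \<omega>)\<^sup>2)"
      "\<And>y. y \<in> S2 \<Longrightarrow> expectation (gt j y) = 0" "\<And>y. y \<in> S2 \<Longrightarrow> expectation (\<lambda>\<omega>. (gt j y \<omega>)\<^sup>2) = 1"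
      "\<And>y \<omega>. y \<in> S2 \<Longrightarrow> gt j y \<omega> = (\<Sum>i<n. \<phi> i y * gt j (x i) \<omega>)"
      "\<And>t \<theta>. \<bar>expectation (\<lambda>\<omega>. cos ((\<Sum>i<n. t i * gt j (x i) \<omega>) + \<theta>))
        - cos \<theta> * exp (- expectation (\<lambda>\<omega>. (\<Sum>i<n. t i * gt j (x i) \<omega>)\<^sup>2) / 2)\<bar>
        \<le> proximity_constant q * (((\<Sum>i<n. \<bar>t i\<bar>) * P / sqrt (S j)) ^ 3 * d j ^ 7)" if j: "j \<ge> J" for j
  proof -
    have j1: "1 \<le> j" using j J(1) by linarith
    let ?w = "\<lambda>l. b (real l / B ^ j)"
    interpret bl: band_limited_field M T a C "degrees B j" ?w "d j"
      using finite_degrees d_pos J(2,3)[OF j] by unfold_locales (simp_all add: d_4 band_variance_sum_def)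
    have "\<beta> j x \<omega> = bl.band x \<omega>" for x \<omega>
      unfolding assms(1) needlet_field_def by (rule bl.needlet_field_eq_band) (rule degrees_cover[OF assms(12,11)])
    then have \<beta>: "\<beta> j = bl.band" by blast
    have "g j x = bl.hermite_functional q (k x)" for x
      unfolding assms(2,3) \<beta> bl.smoothed_hermite_band k_def[abs_def] ..
    then have g_eq: "g j = (\<lambda>x. bl.hermite_functional q (k x))" by blast
    interpret sb: smoothed_band M T a C "degrees B j" ?w "d j" k q "S j" P
    proof
      fix x :: "real ^ 3" assume x: "x \<in> S2"
      \<comment> \<open>The variance condition concerns centred moments and the normalization raw
        ones; they agree because the mean is zero.\<close>
      have "expectation (bl.hermite_functional q (k x)) = 0"
        by (rule bl.hermite_functional(3)[OF k_continuous P(2)[OF x] P(1) assms(13)])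
      then show "expectation (\<lambda>\<omega>. (bl.hermite_functional q (k x) \<omega>)\<^sup>2) = S j"
        using var[OF j1 x] unfolding g_eq S_def by simp
    qed (use assms(13) k_continuous P S_pos[OF j1] in auto)
    have gt_eq: "gt j = sb.G" unfolding assms(4) g_eq ..
    show "integrable M (gt j y)" "integrable M (\<lambda>\<omega>. (gt j y \<omega>)\<^sup>2)"
      "expectation (gt j y) = 0" "expectation (\<lambda>\<omega>. (gt j y \<omega>)\<^sup>2) = 1" if "y \<in> S2" for y
      unfolding gt_eq using sb.G_integrable sb.G_mean sb.G_variance that by blast+
    show "gt j y \<omega> = (\<Sum>i<n. \<phi> i y * gt j (x i) \<omega>)" if "y \<in> S2" for y \<omega>
      unfolding gt_eq by (rule sb.G_interpolation[OF x that k_interpolation[OF that]])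
    show "\<bar>expectation (\<lambda>\<omega>. cos ((\<Sum>i<n. t i * gt j (x i) \<omega>) + \<theta>))
        - cos \<theta> * exp (- expectation (\<lambda>\<omega>. (\<Sum>i<n. t i * gt j (x i) \<omega>)\<^sup>2) / 2)\<bar>
        \<le> proximity_constant q * (((\<Sum>i<n. \<bar>t i\<bar>) * P / sqrt (S j)) ^ 3 * d j ^ 7)" for t \<theta>
      unfolding gt_eq by (rule sb.G_cos_approximation[OF x])
  qed
  have error_limit: "(\<lambda>j. proximity_constant q * ((c * P / sqrt (S j)) ^ 3 * d j ^ 7)) \<longlonglongrightarrow> 0" if c: "c \<ge> 0" for c
  proof -
    \<comment> \<open>In powers of \<open>r\<close>, \<open>sqrt (S j)\<close> is at least of order
      \<open>r ^ (2 * j)\<close> and \<open>d j\<close> is of order \<open>r ^ j\<close>, so the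
      error is at most of order \<open>r ^ (7 * j) / r ^ (6 * j)\<close>.\<close>
    define r where "r = 1 / sqrt B"
    have r: "0 < r" "r < 1" "r\<^sup>2 = 1 / B" using assms(11) by (simp_all add: r_def power_divide)
    define Q where "Q = (c * P / sqrt c\<^sub>1) ^ 3 * root 4 D ^ 7"
    have bound: "0 \<le> (c * P / sqrt (S j)) ^ 3 * d j ^ 7" "(c * P / sqrt (S j)) ^ 3 * d j ^ 7 \<le> Q * r ^ j" if j: "1 \<le> j" for j
    proof -
      have rj: "r ^ (2 * j) > 0" using r by simp
      have "B powr (- 2 * real j) = (r ^ (2 * j))\<^sup>2"
      proof -
        have "B powr (- 2 * real j) = inverse (B powr real (2 * j))" by (simp add: powr_minus)
        also have "\<dots> = inverse (B ^ (2 * j))" using assms(11) by (subst powr_realpow) auto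
        also have "\<dots> = (1 / B) ^ (2 * j)" by (simp add: power_one_over inverse_eq_divide)
        also have "\<dots> = (r ^ (2 * j))\<^sup>2" unfolding r(3)[symmetric] by (simp flip: power_mult add: mult.commute)
        finally show ?thesis .
      qed
      then have Sj: "sqrt (S j) = sqrt (s j) * r ^ (2 * j)" using rj by (simp add: S_def real_sqrt_mult)
      have "sqrt c\<^sub>1 * r ^ (2 * j) \<le> sqrt (S j)" unfolding Sj using s[OF j] rj by (intro mult_right_mono) auto
      moreover have "0 < sqrt c\<^sub>1 * r ^ (2 * j)" using c1 rj by simp
      ultimately have "c * P / sqrt (S j) \<le> c * P / (sqrt c\<^sub>1 * r ^ (2 * j))"
        using c P(1) c1 rj S_pos[OF j] by (intro divide_left_mono mult_pos_pos) simp_all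
      then have "(c * P / sqrt (S j)) ^ 3 * d j ^ 7 \<le> (c * P / (sqrt c\<^sub>1 * r ^ (2 * j))) ^ 3 * d j ^ 7"
        using c P(1) S_pos[OF j] d_pos[of j] by (intro mult_right_mono power_mono) auto
      also have "\<dots> = Q * (r ^ (7 * j) / r ^ (6 * j))"
        by (simp add: Q_def d_def r_def[symmetric] power_mult_distrib power_divide mult.commute flip: power_mult)
      also have "r ^ (7 * j) / r ^ (6 * j) = r ^ j" using r by (simp add: power_diff[symmetric])
      finally show "(c * P / sqrt (S j)) ^ 3 * d j ^ 7 \<le> Q * r ^ j" .
      show "0 \<le> (c * P / sqrt (S j)) ^ 3 * d j ^ 7" using c P(1) S_pos[OF j] d_pos[of j] by simp
    qed
    have "(\<lambda>j. Q * r ^ j) \<longlonglongrightarrow> Q * 0" using r by (intro tendsto_intros LIMSEQ_power_zero) simp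
    then have "(\<lambda>j. Q * r ^ j) \<longlonglongrightarrow> 0" by simp
    then have "(\<lambda>j. (c * P / sqrt (S j)) ^ 3 * d j ^ 7) \<longlonglongrightarrow> 0"
      by (rule tendsto_sandwich[OF _ _ tendsto_const, rotated 2])
        (auto simp: eventually_sequentially intro!: exI[of _ 1] bound)
    then show ?thesis by (rule tendsto_mult_right_zero)
  qed
  have f_props: "centered_gaussian (N j) (\<lambda>\<omega>. \<Sum>i<m. t i * f j (y i) \<omega>)"
    if "j \<ge> J" "\<And>i. i < m \<Longrightarrow> y i \<in> S2" for j m and t :: "nat \<Rightarrow> real" and y
  proof -
    have "1 \<le> j" using that(1) J(1) by linarith
    then interpret Nj: prob_space "N j" using assms(16) by blast
    show ?thesis using assms(17) \<open>1 \<le> j\<close> that(2) by (intro Nj.gaussian_field_centered) auto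
  qed
  have ec: "equal_covariances M (N j) S2 (gt j) (f j)" if j: "j \<ge> J" for j
  proof -
    have j1: "1 \<le> j" using j J(1) by linarith
    then interpret Nj: prob_space "N j" using assms(16) by blast
    have cg: "centered_gaussian (N j) (f j y)" if "y \<in> S2" for y
      using f_props[OF j, of 1 "\<lambda>_. y" "\<lambda>_. 1"] that by simp
    have f0: "Nj.expectation (f j y) = 0" if "y \<in> S2" for y
      using assms(17) j1 that by (auto simp: zero_mean_field_def)
    show ?thesis
    proof
      fix y z :: "real ^ 3" assume yz: "y \<in> S2" "z \<in> S2"
      have "covariance (N j) (f j y) (f j z) = covariance M (gt j y) (gt j z)"
        using assms(19) j1 yz by blast
      then show "Nj.expectation (\<lambda>\<omega>. f j y \<omega> * f j z \<omega>) = expectation (\<lambda>\<omega>. gt j y \<omega> * gt j z \<omega>)"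
        using f0 gt_props(3)[OF j] yz by (simp only: covariance_def diff_zero)
    next
      fix y :: "real ^ 3" assume y: "y \<in> S2"
      show "gt j y \<in> borel_measurable M" "integrable M (\<lambda>\<omega>. (gt j y \<omega>)\<^sup>2)"
        using gt_props(1,2)[OF j y] by auto
      show "f j y \<in> borel_measurable (N j)" "integrable (N j) (\<lambda>\<omega>. (f j y \<omega>)\<^sup>2)"
        using cg[OF y] by (auto simp: centered_gaussian_def)
    qed
  qed
  \<comment> \<open>\<open>h\<close> on the interpolation space, as a function of the values at the
    nodes.\<close>
  define h' where "h' v = h (\<lambda>y\<in>S2. \<Sum>i<n. v i * \<phi> i y)" for v :: "nat \<Rightarrow> real"
  have h'c: "continuous_on UNIV h'"
    unfolding h'_def[abs_def] by (rule borel_measurable_continuous_linear_combination(1)[OF assms(20) \<phi>])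
  obtain H where H: "\<And>u. u \<in> mspace C_S2 \<Longrightarrow> \<bar>h u\<bar> \<le> H"
    using assms(21) unfolding bounded_iff by (metis imageI real_norm_def)
  have h'_bound: "\<bar>h' v\<bar> \<le> H" for v
  proof -
    have "continuous_map euclidean (mtopology_of C_S2) (\<lambda>v :: nat \<Rightarrow> real. \<lambda>y\<in>S2. \<Sum>i<n. v i * \<phi> i y)"
      by (rule continuous_linear_combination_C_S2[OF \<phi>])
    from continuous_map_image_subset_topspace[OF this]
    have "(\<lambda>y\<in>S2. \<Sum>i<n. v i * \<phi> i y) \<in> mspace C_S2" by auto
    then show ?thesis unfolding h'_def by (rule H)
  qed
  have gt_h: "h (\<lambda>y\<in>S2. gt j y \<omega>) = h' (\<lambda>i. gt j (x i) \<omega>)" if j: "j \<ge> J" for j \<omega>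
  proof -
    have "(\<lambda>y\<in>S2. gt j y \<omega>) = (\<lambda>y\<in>S2. \<Sum>i<n. gt j (x i) \<omega> * \<phi> i y)"
      using gt_props(5)[OF j] by (intro restrict_ext) (metis (no_types, lifting) mult.commute sum.cong)
    then show ?thesis by (simp only: h'_def)
  qed
  have f_h: "integral\<^sup>L (N j) (\<lambda>\<omega>. h (\<lambda>y\<in>S2. f j y \<omega>)) = integral\<^sup>L (N j) (\<lambda>\<omega>. h' (\<lambda>i. f j (x i) \<omega>))" if j: "j \<ge> J" for j
  proof -
    have j1: "1 \<le> j" using j J(1) by linarith
    interpret ec: equal_covariances M "N j" S2 "gt j" "f j" by (rule ec[OF j])
    have paths: "continuous_on S2 (\<lambda>x. f j x \<omega>)" if "\<omega> \<in> space (N j)" for \<omega>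
      using assms(18) j1 that by blast
    have "AE \<omega> in N j. \<forall>y\<in>S2. f j y \<omega> = (\<Sum>i<n. \<phi> i y * f j (x i) \<omega>)"
      by (intro continuous_paths_interpolation paths \<phi> ec.linear_relation_transfer x gt_props(5)[OF j])
    then have ae: "AE \<omega> in N j. h (\<lambda>y\<in>S2. f j y \<omega>) = h' (\<lambda>i. f j (x i) \<omega>)"
    proof eventually_elim
      fix \<omega> assume "\<forall>y\<in>S2. f j y \<omega> = (\<Sum>i<n. \<phi> i y * f j (x i) \<omega>)"
      then have "(\<lambda>y\<in>S2. f j y \<omega>) = (\<lambda>y\<in>S2. \<Sum>i<n. f j (x i) \<omega> * \<phi> i y)"
        by (intro restrict_ext) (metis (no_types, lifting) mult.commute sum.cong)
      then show "h (\<lambda>y\<in>S2. f j y \<omega>) = h' (\<lambda>i. f j (x i) \<omega>)" by (simp only: h'_def)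
    qed
    show ?thesis
    proof (rule integral_cong_AE[OF _ _ ae])
      show "(\<lambda>\<omega>. h (\<lambda>y\<in>S2. f j y \<omega>)) \<in> borel_measurable (N j)"
        by (rule borel_measurable_continuous_functional[OF assms(20) ec.f(1) paths])
      show "(\<lambda>\<omega>. h' (\<lambda>i. f j (x i) \<omega>)) \<in> borel_measurable (N j)"
        unfolding h'_def by (rule borel_measurable_continuous_linear_combination(2)[OF assms(20) \<phi> ec.f(1)[OF x]])
    qed
  qed
  \<comment> \<open>The sequences are shifted by \<open>J\<close>, from where the estimates hold;
    the moment bound below is 1 because the fields are normalized.\<close>
  have "(\<lambda>j. expectation (\<lambda>\<omega>. h' (\<lambda>i. gt (j + J) (x i) \<omega>))
      - integral\<^sup>L (N (j + J)) (\<lambda>\<omega>. h' (\<lambda>i. f (j + J) (x i) \<omega>))) \<longlonglongrightarrow> 0"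
  proof (rule asymptotically_proximal_vectors[where I = "{..<n}" and c = 1 and H = H and h = h'])
    show "h' u = h' v" if "\<And>i. i \<in> {..<n} \<Longrightarrow> u i = v i" for u v
      unfolding h'_def using that by (intro arg_cong[of _ _ h] restrict_ext sum.cong) auto
    fix j
    have j: "j + J \<ge> J" by simp
    interpret ec: equal_covariances M "N (j + J)" S2 "gt (j + J)" "f (j + J)" by (rule ec[OF j])
    show "prob_space (N (j + J))" by (rule ec.N.prob_space_axioms)
    fix i assume "i \<in> {..<n}"
    then have xi: "x i \<in> S2" using x by blast
    show "gt (j + J) (x i) \<in> borel_measurable M" "integrable M (\<lambda>\<omega>. (gt (j + J) (x i) \<omega>)\<^sup>2)"
      "f (j + J) (x i) \<in> borel_measurable (N (j + J))" "integrable (N (j + J)) (\<lambda>\<omega>. (f (j + J) (x i) \<omega>)\<^sup>2)"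
      using ec.g ec.f xi by blast+
    show "expectation (\<lambda>\<omega>. (gt (j + J) (x i) \<omega>)\<^sup>2) \<le> 1" using gt_props(4)[OF j xi] by simp
    show "ec.N.expectation (\<lambda>\<omega>. (f (j + J) (x i) \<omega>)\<^sup>2) \<le> 1"
      using ec.eq[OF xi xi] gt_props(4)[OF j xi] by (simp add: power2_eq_square)
  next
    fix t \<theta>
    show "(\<lambda>j. expectation (\<lambda>\<omega>. cos ((\<Sum>i<n. t i * gt (j + J) (x i) \<omega>) + \<theta>))
       - integral\<^sup>L (N (j + J)) (\<lambda>\<omega>. cos ((\<Sum>i<n. t i * f (j + J) (x i) \<omega>) + \<theta>))) \<longlonglongrightarrow> 0"
    proof (rule Lim_null_comparison)
      show "(\<lambda>j. proximity_constant q * (((\<Sum>i<n. \<bar>t i\<bar>) * P / sqrt (S (j + J))) ^ 3 * d (j + J) ^ 7)) \<longlonglongrightarrow> 0"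
        by (rule LIMSEQ_ignore_initial_segment[OF error_limit]) (simp add: sum_nonneg)
      show "\<forall>\<^sub>F j in sequentially. norm (expectation (\<lambda>\<omega>. cos ((\<Sum>i<n. t i * gt (j + J) (x i) \<omega>) + \<theta>))
         - integral\<^sup>L (N (j + J)) (\<lambda>\<omega>. cos ((\<Sum>i<n. t i * f (j + J) (x i) \<omega>) + \<theta>)))
         \<le> proximity_constant q * (((\<Sum>i<n. \<bar>t i\<bar>) * P / sqrt (S (j + J))) ^ 3 * d (j + J) ^ 7)"
      proof (intro always_eventually allI)
        fix j
        have j: "j + J \<ge> J" by simp
        interpret ec: equal_covariances M "N (j + J)" S2 "gt (j + J)" "f (j + J)" by (rule ec[OF j])
        have "centered_gaussian (N (j + J)) (\<lambda>\<omega>. \<Sum>i<n. t i * f (j + J) (x i) \<omega>)"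
          by (rule f_props[OF j x])
        then have "ec.N.expectation (\<lambda>\<omega>. cos (1 * (\<Sum>i<n. t i * f (j + J) (x i) \<omega>) + \<theta>))
           = cos \<theta> * exp (- (1\<^sup>2 * ec.N.expectation (\<lambda>\<omega>. (\<Sum>i<n. t i * f (j + J) (x i) \<omega>)\<^sup>2)) / 2)"
          unfolding centered_gaussian_def by blast
        then have "ec.N.expectation (\<lambda>\<omega>. cos ((\<Sum>i<n. t i * f (j + J) (x i) \<omega>) + \<theta>))
           = cos \<theta> * exp (- expectation (\<lambda>\<omega>. (\<Sum>i<n. t i * gt (j + J) (x i) \<omega>)\<^sup>2) / 2)"
          using ec.second_moment_eq[of "{..<n}" x t] x by simp
        then show "norm (expectation (\<lambda>\<omega>. cos ((\<Sum>i<n. t i * gt (j + J) (x i) \<omega>) + \<theta>))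
         - integral\<^sup>L (N (j + J)) (\<lambda>\<omega>. cos ((\<Sum>i<n. t i * f (j + J) (x i) \<omega>) + \<theta>)))
         \<le> proximity_constant q * (((\<Sum>i<n. \<bar>t i\<bar>) * P / sqrt (S (j + J))) ^ 3 * d (j + J) ^ 7)"
          using gt_props(6)[OF j] by (simp only: real_norm_def)
      qed
    qed
  qed (use h'c h'_bound prob_space_axioms in auto)
  then have "(\<lambda>j. expectation (\<lambda>\<omega>. h (\<lambda>x\<in>S2. gt (j + J) x \<omega>))
      - integral\<^sup>L (N (j + J)) (\<lambda>\<omega>. h (\<lambda>x\<in>S2. f (j + J) x \<omega>))) \<longlonglongrightarrow> 0"
    by (simp only: gt_h f_h le_add2)
  then have "(\<lambda>j. expectation (\<lambda>\<omega>. h (\<lambda>x\<in>S2. gt j x \<omega>))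
      - integral\<^sup>L (N j) (\<lambda>\<omega>. h (\<lambda>x\<in>S2. f j x \<omega>))) \<longlonglongrightarrow> 0"
    by (rule LIMSEQ_offset)
  then show ?thesis by (rule tendsto_rabs_zero)
qed

end
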